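(* If the order $N$ of a renormalized wavelet system $\{\psi_{\omega,n^*}\}_{\omega\in\Omega}$ satisfies $N>n+1$, $\upsilon\in A_1$, and $\beta\in(-\infty,1-\frac1n)\cup(1,\infty)$, then, for any $f\in W^{1,1}_\upsilon$, $$f=\sum_{\omega\in\Omega}\langle f,\psi_{\omega,n}\rangle\,\psi_{\omega,n^*}$$ holds in $\mathcal{S}'$ and $$\left\|\left\{\frac{\langle f,\psi_{\omega,n}\rangle}{|I_\omega|^\beta}\right\}_{\omega\in\Omega}\right\|_{w\ell^1_{\beta,\upsilon}}\lesssim[\upsilon]_{A_1}\|f\|_{W^{1,1}_\upsilon}\lesssim[\upsilon]_{A_1}^2\left\|\left\{\frac{\langle f,\psi_{\omega,n}\rangle}{|I_\omega|^\beta}\right\}_{\omega\in\Omega}\right\|_{\ell^1_{\beta,\upsilon}},$$ where, for any $\omega\in\Omega$, $\langle f,\psi_{\omega,n}\rangle:=\int_{\mathbb{R}^n}f(x)\psi_{\omega,n}(x)\,dx$ (Lebesgue integral) and the implicit positive constants are independent of both $[\upsilon]_{A_1}$ and $f$.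
   Context: Everything is on $\mathbb{R}^n$. $\mathcal{S}'$ is the space of tempered distributions, $\mathbb{Z}_+:=\{0,1,2,\dots\}$, $A\lesssim B$ means $A\le CB$ with a positive constant $C$, $n^*:=\frac n{n-1}$ ($n^*:=\infty$ if $n=1$). Wavelets. $C^N_{\rm c}$ denotes $N$-times (continuously) differentiable compactly supported functions. Let $\varphi\in C^N_{\rm c}(\mathbb{R})$ be a univariate scaling function and $\psi\in C^N_{\rm c}(\mathbb{R})$ an associated univariate wavelet for some $N\in\mathbb{N}$; put $\psi^0:=\varphi$, $\psi^1:=\psi$, and $\psi^e(x):=\prod_{i=1}^n\psi^{e_i}(x_i)$ for $e\in\{0,1\}^n$. Let $E:=\{0,1\}^n\setminus\{\mathbf{0}\}$ and assume $\int_{\mathbb{R}^n}x^\alpha\psi^e(x)\,dx=0$ for all $e\in E$ and all multi-indices $\alpha$ with $|\alpha|\le N$. For $I=2^{-j}[k+[0,1)^n]$ with $j\in\mathbb{Z}$, $k\in\mathbb{Z}^n$, $p\in[1,\infty]$, and a function $g$, let $g_{I,p}(\cdot):=2^{\frac{jn}p}g(2^j\cdot-k)$. Let $\mathcal{D}_+$ be the set of all $I=2^{-j}[k+[0,1)^n]$ with $j\in\mathbb{Z}_+$, $k\in\mathbb{Z}^n$, and $\mathcal{D}_0$ the subset of those with $j=0$. The system $\{\psi^e_{I,2}\}_{e\in E,I\in\mathcal{D}_+}\cup\{\psi^{\mathbf{0}}_{I,2}\}_{I\in\mathcal{D}_0}$ is a complete orthonormal basis of $L^2$, and $N$ is called its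 order. Let $\Omega:=(\{\mathbf{0}\}\times\mathcal{D}_0)\cup(E\times\mathcal{D}_+)$ and, for $\omega=(e,I)\in\Omega$ and $p\in[1,\infty]$, $I_\omega:=I$ and $\psi_{\omega,p}:=\psi^e_{I,p}$. The renormalized wavelet system is $\{\psi_{\omega,n^*}\}_{\omega\in\Omega}$, with dual system $\{\psi_{\omega,n}\}_{\omega\in\Omega}$. Weights. A nonnegative locally integrable $\upsilon$ (not a.e. zero) is in $A_1$ if $[\upsilon]_{A_1}:=\sup_Q\big[\frac1{|Q|}\int_Q\upsilon\big]\|\upsilon^{-1}\|_{L^\infty(Q)}<\infty$ (supremum over all cubes); $\upsilon(Q):=\int_Q\upsilon$; $\|g\|_{L^1_\upsilon}:=\int|g|\upsilon$. $W^{1,1}_\upsilon$ is the set of all tempered distributions $f\in L^1_\upsilon$ whose weak gradient exists with $|\nabla f|\in L^1_\upsilon$; $\|f\|_{W^{1,1}_\upsilon}:=\|f\|_{L^1_\upsilon}+\|\,|\nabla f|\,\|_{L^1_\upsilon}$. Sequence norms, for $a=\{a_\omega\}_{\omega\in\Omega}\subset\mathbb{C}$: $\|a\|_{\ell^1_{\beta,\upsilon}}:=\sum_{\omega\in\Omega}|I_\omega|^{\beta-1}\upsilon(I_\omega)|a_\omega|$ and $\|a\|_{w\ell^1_{\beta,\upsilon}}:=\sup_{\lambda\in(0,\infty)}\lambda\sum_{\{\omega\in\Omega:|a_\omega|>\lambda\}}|I_\omega|^{\beta-1}\upsilon(I_\omega)$ (values in $[0,\infty]$). *)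

theory Defs
  imports "HOL-Analysis.Analysis" "HOL-Probability.Essential_Supremum"
begin

section \<open>Tempered distributions\<close>

definition partial_deriv :: "'n \<Rightarrow> (real ^ 'n \<Rightarrow> complex) \<Rightarrow> real ^ 'n::finite \<Rightarrow> complex" where
  "partial_deriv i g x = frechet_derivative g (at x) (axis i 1)"

primrec iter_partial :: "'n list \<Rightarrow> (real ^ 'n \<Rightarrow> complex) \<Rightarrow> real ^ 'n::finite \<Rightarrow> complex" where
  "iter_partial [] g = g"
| "iter_partial (i # js) g = partial_deriv i (iter_partial js g)"

definition smooth :: "(real ^ 'n::finite \<Rightarrow> complex) \<Rightarrow> bool" where
  "smooth g \<longleftrightarrow> (\<forall>js x. iter_partial js g differentiable (at x))"

definition schwartz :: "(real ^ 'n::finite \<Rightarrow> complex) set" where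
  "schwartz = {g. smooth g \<and>
     (\<forall>js m. bounded (range (\<lambda>x. (1 + norm x) ^ m *\<^sub>R iter_partial js g x)))}"

definition schwartz_seminorm :: "nat \<Rightarrow> (real ^ 'n::finite \<Rightarrow> complex) \<Rightarrow> real" where
  "schwartz_seminorm m g =
     (SUP (js, x) \<in> {js. length js \<le> m} \<times> UNIV. (1 + norm x) ^ m * norm (iter_partial js g x))"

text \<open>The Schwartz topology is metrizable, so sequential continuity is continuity.\<close>

definition tempered_distribution :: "((real ^ 'n::finite \<Rightarrow> complex) \<Rightarrow> complex) \<Rightarrow> bool" where
  "tempered_distribution u \<longleftrightarrow>
     (\<forall>g\<in>schwartz. \<forall>h\<in>schwartz. \<forall>a b.
        u (\<lambda>x. a * g x + b * h x) = a * u g + b * u h) \<and>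
     (\<forall>G g. (\<forall>k. G k \<in> schwartz) \<longrightarrow> g \<in> schwartz \<longrightarrow>
        (\<forall>m. (\<lambda>k::nat. schwartz_seminorm m (\<lambda>x. G k x - g x)) \<longlonglongrightarrow> 0) \<longrightarrow>
        (\<lambda>k. u (G k)) \<longlonglongrightarrow> u g)"

definition pairing :: "(real ^ 'n::finite \<Rightarrow> complex) \<Rightarrow> (real ^ 'n \<Rightarrow> complex) \<Rightarrow> complex" where
  "pairing f g = (LINT x|lebesgue. f x * g x)"

definition is_tempered :: "(real ^ 'n::finite \<Rightarrow> complex) \<Rightarrow> bool" where
  "is_tempered f \<longleftrightarrow>
     (\<forall>g\<in>schwartz. integrable lebesgue (\<lambda>x. f x * g x)) \<and> tempered_distribution (pairing f)"


section \<open>Weak gradients, weights and the weighted Sobolev space\<close>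

definition locally_integrable ::
    "('a::euclidean_space \<Rightarrow> 'b::{banach, second_countable_topology}) \<Rightarrow> bool" where
  "locally_integrable f \<longleftrightarrow> (\<forall>K. compact K \<longrightarrow> set_integrable lebesgue K f)"

definition test_function :: "(real ^ 'n::finite \<Rightarrow> complex) \<Rightarrow> bool" where
  "test_function g \<longleftrightarrow> smooth g \<and> compact (closure {x. g x \<noteq> 0})"

definition has_weak_gradient ::
    "(real ^ 'n::finite \<Rightarrow> complex) \<Rightarrow> (real ^ 'n \<Rightarrow> complex ^ 'n) \<Rightarrow> bool" where
  "has_weak_gradient f G \<longleftrightarrow> locally_integrable f \<and> locally_integrable G \<and>
     (\<forall>i g. test_function g \<longrightarrow>
        (LINT x|lebesgue. f x * partial_deriv i g x) = - (LINT x|lebesgue. G x $ i * g x))"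

text \<open>A weak gradient is determined only up to a null set; the choice does not affect the norms.\<close>

definition weak_gradient :: "(real ^ 'n::finite \<Rightarrow> complex) \<Rightarrow> real ^ 'n \<Rightarrow> complex ^ 'n" where
  "weak_gradient f = (SOME G. has_weak_gradient f G)"

definition L1_norm ::
    "(real ^ 'n::finite \<Rightarrow> real) \<Rightarrow> (real ^ 'n \<Rightarrow> 'b::real_normed_vector) \<Rightarrow> ennreal" where
  "L1_norm \<upsilon> g = (\<integral>\<^sup>+x. ennreal (norm (g x) * \<upsilon> x) \<partial>lebesgue)"

definition L1_space :: "(real ^ 'n::finite \<Rightarrow> real) \<Rightarrow>
    (real ^ 'n \<Rightarrow> 'b::{real_normed_vector, second_countable_topology}) set" where
  "L1_space \<upsilon> = {g \<in> borel_measurable lebesgue. L1_norm \<upsilon> g < \<infinity>}"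

definition W11_space :: "(real ^ 'n::finite \<Rightarrow> real) \<Rightarrow> (real ^ 'n \<Rightarrow> complex) set" where
  "W11_space \<upsilon> = {f. is_tempered f \<and> f \<in> L1_space \<upsilon> \<and>
     (\<exists>G. has_weak_gradient f G) \<and> weak_gradient f \<in> L1_space \<upsilon>}"

definition W11_norm :: "(real ^ 'n::finite \<Rightarrow> real) \<Rightarrow> (real ^ 'n \<Rightarrow> complex) \<Rightarrow> ennreal" where
  "W11_norm \<upsilon> f = L1_norm \<upsilon> f + L1_norm \<upsilon> (weak_gradient f)"

definition weight_measure :: "(real ^ 'n::finite \<Rightarrow> real) \<Rightarrow> (real ^ 'n) set \<Rightarrow> ennreal" where
  "weight_measure \<upsilon> Q = (\<integral>\<^sup>+x\<in>Q. ennreal (\<upsilon> x) \<partial>lebesgue)"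

definition cubes :: "(real ^ 'n::finite) set set" where
  "cubes = {cbox a (a + r *\<^sub>R (\<chi> i. 1)) | a r. r > 0}"

text \<open>In \<^typ>\<open>ennreal\<close> the inverse of \<open>0\<close> is \<open>\<infinity>\<close>, so
  points where the weight vanishes are not ignored by the essential supremum.\<close>

definition A1_const :: "(real ^ 'n::finite \<Rightarrow> real) \<Rightarrow> ennreal" where
  "A1_const \<upsilon> = (SUP Q\<in>cubes. weight_measure \<upsilon> Q / emeasure lebesgue Q
     * esssup (restrict_space lebesgue Q) (\<lambda>x. inverse (ennreal (\<upsilon> x))))"

definition A1_weight :: "(real ^ 'n::finite \<Rightarrow> real) \<Rightarrow> bool" where
  "A1_weight \<upsilon> \<longleftrightarrow> (\<forall>x. 0 \<le> \<upsilon> x) \<and> locally_integrable \<upsilon> \<and>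
     \<not> (AE x in lebesgue. \<upsilon> x = 0) \<and> A1_const \<upsilon> < \<infinity>"


section \<open>Orthonormal systems in \<open>L\<^sup>2\<close>\<close>

definition L2_space :: "('a::euclidean_space \<Rightarrow> complex) set" where
  "L2_space = {f \<in> borel_measurable lebesgue. (\<integral>\<^sup>+x. ennreal ((norm (f x))\<^sup>2) \<partial>lebesgue) < \<infinity>}"

definition L2_approx :: "('a::euclidean_space \<Rightarrow> complex) \<Rightarrow> real \<Rightarrow> ('a \<Rightarrow> complex) \<Rightarrow> bool" where
  "L2_approx f \<epsilon> g \<longleftrightarrow> (\<integral>\<^sup>+x. ennreal ((norm (f x - g x))\<^sup>2) \<partial>lebesgue) < ennreal (\<epsilon>\<^sup>2)"

definition L2_closed_span ::
    "'i set \<Rightarrow> ('i \<Rightarrow> 'a::euclidean_space \<Rightarrow> real) \<Rightarrow> ('a \<Rightarrow> complex) set" where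
  "L2_closed_span A g = {f \<in> L2_space. \<forall>\<epsilon>>0. \<exists>F c. finite F \<and> F \<subseteq> A \<and>
     L2_approx f \<epsilon> (\<lambda>x. \<Sum>i\<in>F. c i * of_real (g i x))}"

definition L2_orthonormal :: "'i set \<Rightarrow> ('i \<Rightarrow> 'a::euclidean_space \<Rightarrow> real) \<Rightarrow> bool" where
  "L2_orthonormal A g \<longleftrightarrow> (\<forall>i\<in>A. (\<lambda>x. of_real (g i x)) \<in> L2_space) \<and>
     (\<forall>i\<in>A. \<forall>j\<in>A. (LINT x|lebesgue. g i x * g j x) = (if i = j then 1 else 0))"

definition L2_orthonormal_basis :: "'i set \<Rightarrow> ('i \<Rightarrow> 'a::euclidean_space \<Rightarrow> real) \<Rightarrow> bool" where
  "L2_orthonormal_basis A g \<longleftrightarrow> L2_orthonormal A g \<and> L2_closed_span A g = L2_space"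


section \<open>Univariate scaling functions and wavelets\<close>

definition CcN :: "nat \<Rightarrow> (real \<Rightarrow> real) set" where
  "CcN N = {g. (\<forall>k<N. \<forall>x. (deriv ^^ k) g field_differentiable (at x)) \<and>
     continuous_on UNIV ((deriv ^^ N) g) \<and> compact (closure {x. g x \<noteq> 0})}"

definition dilate :: "(real \<Rightarrow> real) \<Rightarrow> int \<Rightarrow> int \<Rightarrow> real \<Rightarrow> real" where
  "dilate g j k x = 2 powr (of_int j / 2) * g (2 powi j * x - of_int k)"

definition MRA_space :: "(real \<Rightarrow> real) \<Rightarrow> int \<Rightarrow> (real \<Rightarrow> complex) set" where
  "MRA_space \<phi> j = L2_closed_span UNIV (dilate \<phi> j)"

text \<open>The spaces \<^term>\<open>MRA_space \<phi> j\<close> form an orthonormal multiresolution analysis. The scaling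
  relation between consecutive spaces holds by construction.\<close>

definition scaling_function :: "(real \<Rightarrow> real) \<Rightarrow> bool" where
  "scaling_function \<phi> \<longleftrightarrow> L2_orthonormal UNIV (dilate \<phi> 0) \<and>
     (\<forall>j. MRA_space \<phi> j \<subseteq> MRA_space \<phi> (j + 1)) \<and>
     (\<Inter>j. MRA_space \<phi> j) = {f \<in> L2_space. AE x in lebesgue. f x = 0} \<and>
     (\<forall>f\<in>L2_space. \<forall>\<epsilon>>0. \<exists>j. \<exists>g\<in>MRA_space \<phi> j. L2_approx f \<epsilon> g)"

definition associated_wavelet :: "(real \<Rightarrow> real) \<Rightarrow> (real \<Rightarrow> real) \<Rightarrow> bool" where
  "associated_wavelet \<phi> \<psi> \<longleftrightarrow> L2_orthonormal UNIV (dilate \<psi> 0) \<and>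
     L2_closed_span UNIV (dilate \<psi> 0) =
       {f \<in> MRA_space \<phi> 1. \<forall>g\<in>MRA_space \<phi> 0. (LINT x|lebesgue. f x * cnj (g x)) = 0}"


section \<open>Wavelet systems on \<open>\<real>\<^sup>n\<close>\<close>

text \<open>A dyadic cube is represented by its parameters \<open>(j, k)\<close>, which it determines uniquely, and an
  element of \<open>{0,1}\<^sup>n\<close> by a vector of truth values.\<close>

type_synonym 'n dyadic = "int \<times> (int ^ 'n)"
type_synonym 'n windex = "(bool ^ 'n) \<times> 'n dyadic"

definition dyadic_cube :: "'n::finite dyadic \<Rightarrow> (real ^ 'n) set" where
  "dyadic_cube = (\<lambda>(j, k).
     {x. \<forall>i. 2 powi (- j) * of_int (k $ i) \<le> x $ i \<and> x $ i < 2 powi (- j) * (of_int (k $ i) + 1)})"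

definition zero_type :: "bool ^ 'n::finite" where
  "zero_type = (\<chi> i. False)"

definition dyadic_plus :: "'n::finite dyadic set" where
  "dyadic_plus = {(j, k). 0 \<le> j}"

definition dyadic_zero :: "'n::finite dyadic set" where
  "dyadic_zero = {(j, k). j = 0}"

definition Omega :: "'n::finite windex set" where
  "Omega = {zero_type} \<times> dyadic_zero \<union> (UNIV - {zero_type}) \<times> dyadic_plus"

definition cube_of :: "'n::finite windex \<Rightarrow> (real ^ 'n) set" where
  "cube_of \<omega> = dyadic_cube (snd \<omega>)"

definition cube_vol :: "'n::finite windex \<Rightarrow> real" where
  "cube_vol \<omega> = measure lebesgue (cube_of \<omega>)"

definition tensor_wavelet ::
    "(real \<Rightarrow> real) \<Rightarrow> (real \<Rightarrow> real) \<Rightarrow> bool ^ 'n::finite \<Rightarrow> real ^ 'n \<Rightarrow> real" where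
  "tensor_wavelet \<phi> \<psi> e x = (\<Prod>i\<in>UNIV. (if e $ i then \<psi> else \<phi>) (x $ i))"

text \<open>For \<open>p = \<infinity>\<close> the exponent below is \<open>0\<close>.\<close>

definition rescale :: "ereal \<Rightarrow> 'n::finite dyadic \<Rightarrow> (real ^ 'n \<Rightarrow> real) \<Rightarrow> real ^ 'n \<Rightarrow> real" where
  "rescale p = (\<lambda>(j, k) g x.
     2 powr (of_int j * real CARD('n) * real_of_ereal (inverse p)) *
     g (2 powi j *\<^sub>R x - (\<chi> i. of_int (k $ i))))"

definition wavelet ::
    "(real \<Rightarrow> real) \<Rightarrow> (real \<Rightarrow> real) \<Rightarrow> ereal \<Rightarrow> 'n::finite windex \<Rightarrow> real ^ 'n \<Rightarrow> real" where
  "wavelet \<phi> \<psi> p \<omega> = rescale p (snd \<omega>) (tensor_wavelet \<phi> \<psi> (fst \<omega>))"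

text \<open>The functions are real-valued, as is implicit in the bilinear (conjugation-free) coefficients
  \<open>\<integral> f \<psi>\<close>. The type argument supplies the dimension \<open>n\<close>, and \<open>N\<close> is the order.
  The basis property is part of the setting; it also follows from the two univariate conditions.\<close>

definition wavelet_system :: "'n::finite itself \<Rightarrow> nat \<Rightarrow> (real \<Rightarrow> real) \<Rightarrow> (real \<Rightarrow> real) \<Rightarrow> bool" where
  "wavelet_system _ N \<phi> \<psi> \<longleftrightarrow> \<phi> \<in> CcN N \<and> \<psi> \<in> CcN N \<and>
     scaling_function \<phi> \<and> associated_wavelet \<phi> \<psi> \<and>
     (\<forall>(e :: bool ^ 'n) (\<alpha> :: nat ^ 'n). e \<noteq> zero_type \<longrightarrow> (\<Sum>i\<in>UNIV. \<alpha> $ i) \<le> N \<longrightarrow>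
        (LINT x|lebesgue. (\<Prod>i\<in>UNIV. (x $ i) ^ (\<alpha> $ i)) * tensor_wavelet \<phi> \<psi> e x) = 0) \<and>
     L2_orthonormal_basis (Omega :: 'n windex set) (wavelet \<phi> \<psi> 2)"

definition sobolev_exp :: "'n::finite itself \<Rightarrow> ereal" where
  "sobolev_exp _ = (if CARD('n) = 1 then \<infinity> else ereal (real CARD('n) / (real CARD('n) - 1)))"

definition wcoeff :: "(real \<Rightarrow> real) \<Rightarrow> (real \<Rightarrow> real) \<Rightarrow>
    (real ^ 'n::finite \<Rightarrow> complex) \<Rightarrow> 'n windex \<Rightarrow> complex" where
  "wcoeff \<phi> \<psi> f \<omega> =
     (LINT x|lebesgue. f x * of_real (wavelet \<phi> \<psi> (ereal (real CARD('n))) \<omega> x))"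

definition sums_in_tempered ::
    "'i set \<Rightarrow> ('i \<Rightarrow> real ^ 'n::finite \<Rightarrow> complex) \<Rightarrow> (real ^ 'n \<Rightarrow> complex) \<Rightarrow> bool" where
  "sums_in_tempered A F f \<longleftrightarrow>
     (\<forall>g\<in>schwartz. ((\<lambda>i. pairing (F i) g) has_sum pairing f g) A)"


section \<open>Sequence norms\<close>

definition seq_weight :: "real \<Rightarrow> (real ^ 'n::finite \<Rightarrow> real) \<Rightarrow> 'n windex \<Rightarrow> ennreal" where
  "seq_weight \<beta> \<upsilon> \<omega> = ennreal (cube_vol \<omega> powr (\<beta> - 1)) * weight_measure \<upsilon> (cube_of \<omega>)"

definition l1_norm ::
    "real \<Rightarrow> (real ^ 'n::finite \<Rightarrow> real) \<Rightarrow> ('n windex \<Rightarrow> complex) \<Rightarrow> ennreal" where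
  "l1_norm \<beta> \<upsilon> a = (\<Sum>\<^sub>\<infinity>\<omega>\<in>Omega. seq_weight \<beta> \<upsilon> \<omega> * ennreal (norm (a \<omega>)))"

definition wl1_norm ::
    "real \<Rightarrow> (real ^ 'n::finite \<Rightarrow> real) \<Rightarrow> ('n windex \<Rightarrow> complex) \<Rightarrow> ennreal" where
  "wl1_norm \<beta> \<upsilon> a =
     (SUP t\<in>{0<..}. ennreal t * (\<Sum>\<^sub>\<infinity>\<omega>\<in>{\<omega>\<in>Omega. norm (a \<omega>) > t}. seq_weight \<beta> \<upsilon> \<omega>))"

end

theory Submission
  imports Defs
begin

text \<open>
  Functions in the weighted space satisfy, for almost every point and every coordinate direction, the
  bound of their increments by line integrals of the gradient. Along paths that move one
  coordinate at a time this controls the difference of the medians of \<open>f\<close> on a dyadic cube and on one of its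
  children, even if the paths have to avoid smaller cubes of small total codimension one size.
  In the range \<open>\<beta> < 1 - 1/n\<close> an absorption argument then bounds the total cost of all
  large jumps by the integral of the gradient over the union of the cubes, and the mean oscillation
  on a cube is recovered from the jumps on its descendants; for \<open>\<beta> > 1\<close> the Poincare inequality
  on maximal cubes suffices. Since wavelets have mean zero, their coefficients are dominated by mean
  oscillations on cubes of side \<open>(2R + 1) 2\<^sup>-\<^sup>j\<close>. The weight enters only through
  \<open>\<upsilon>(Q) \<le> [\<upsilon>] |Q| \<upsilon>(x)\<close> for almost every \<open>x\<close> in \<open>Q\<close>, by layer-cake integration.

  The expansion follows from that of Schwartz functions, whose partial sums are dominated by
  \<open>(1 + |x|)\<^sup>-\<^sup>n\<close>, while every \<open>A\<^sub>1\<close> weight is at least a multiple of \<open>(1 + |x|)\<^sup>-\<^sup>n\<close>. Testing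
  the expansion of \<open>f\<close> and its derivatives against bump functions gives pointwise bounds
  by the series of absolute values of the wavelets and of their derivatives, hence the last inequality.\<close>

section \<open>Smooth bump functions and domination by test integrals\<close>

text \<open>Medians are used because a jump t between the medians of a cube and of a child yields
  two sets, each a fixed fraction of its cube, on whose points the values differ by at least t. This
  survives when smaller cubes are cut out of the paths, so different scales can be charged to
  different parts of the gradient. A hole of side r is dangerous only for paths whose line meets its
  shadow, a set of measure of order r^(n-1). The cost of a cube is this number times the jump
  required of it, and the required jump grows by \<open>\<sigma> = 2^(n-1) * \<tau>\<close> per
  generation. Absorption rests on \<open>\<sigma> > 1\<close>, which is the condition \<beta> < 1 -
  1/n. The weight can be added last because the unweighted bound integrates the gradient only over
  the union of the cubes of the family at hand. It therefore applies to each superlevel family of a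
  weight and can be integrated over the levels, with linear dependence on the \<open>A1\<close>
  constant. The functions f have no square integrability, so orthonormality cannot be applied to
  them. The test function is expanded instead, with an absolutely convergent and dominated series
  that can be integrated against f.\<close>

lemma smooth_if_closed:
  assumes "g \<in> S" and "\<And>h x. h \<in> S \<Longrightarrow> h differentiable (at x)"
    and "\<And>h i. h \<in> S \<Longrightarrow> partial_deriv i h \<in> S"
  shows "smooth g"
proof -
  have "iter_partial js g \<in> S" for js by (induction js) (use assms in auto)
  thus ?thesis unfolding smooth_def using assms(2) by blast
qed

text \<open>Differentiating exp(-c/t) produces the negative powers of t. The parameter
  \<open>c\<close> is there to be sent to 0, where \<open>cusp c 0\<close> tends to the indicator of
  the positive half line.\<close>

definition cusp :: "real \<Rightarrow> nat \<Rightarrow> real \<Rightarrow> real" where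
  "cusp c m t = (if 0 < t then inverse t ^ m * exp (- c / t) else 0)"

lemma cusp_tendsto_0:
  assumes "c > 0" shows "(cusp c k \<longlongrightarrow> 0) (at 0)"
proof -
  have inv: "filterlim (\<lambda>t. c * inverse t) at_top (at_right (0::real))"
    using filterlim_tendsto_pos_mult_at_top[OF tendsto_const assms filterlim_inverse_at_top_right] .
  have "((\<lambda>t. (c * inverse t) ^ k / exp (c * inverse t)) \<longlongrightarrow> 0) (at_right 0)"
    using filterlim_compose[OF tendsto_power_div_exp_0 inv] .
  from tendsto_mult_right_zero[OF this, of "inverse (c ^ k)"]
  have "((\<lambda>t. inverse t ^ k * exp (- c / t)) \<longlongrightarrow> 0) (at_right 0)"
    using assms by (simp add: power_mult_distrib exp_minus field_simps power_inverse)
  hence R: "(cusp c k \<longlongrightarrow> 0) (at_right 0)"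
    by (rule Lim_transform_eventually) (auto simp: cusp_def eventually_at_filter)
  have "((\<lambda>_. 0) \<longlongrightarrow> (0::real)) (at_left (0::real))" by simp
  hence L: "(cusp c k \<longlongrightarrow> 0) (at_left 0)"
    by (rule Lim_transform_eventually) (auto simp: cusp_def eventually_at_filter)
  show ?thesis using L R filterlim_split_at by blast
qed

lemma DERIV_transform_nhds:
  "(f has_field_derivative u) (at x) \<Longrightarrow> \<forall>\<^sub>F y in nhds x. f y = g y \<Longrightarrow> (g has_field_derivative u) (at x)"
  using DERIV_cong_ev[of x x f g u u] by simp

lemma cusp_has_derivative:
  assumes "c > 0"
  shows "(cusp c m has_real_derivative c * cusp c (m+2) t - m * cusp c (m+1) t) (at t)"
proof (cases t "0::real" rule: linorder_cases)
  case greater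
  have "((\<lambda>t. inverse t ^ m * exp (- c / t)) has_real_derivative
      c * (inverse t ^ (m+2) * exp (- c / t)) - m * (inverse t ^ (m+1) * exp (- c / t))) (at t)"
    using greater
    by (auto intro!: derivative_eq_intros simp: field_simps power2_eq_square)
       (cases m; simp add: field_simps)
  hence "((\<lambda>t. inverse t ^ m * exp (- c / t)) has_real_derivative
      c * cusp c (m+2) t - m * cusp c (m+1) t) (at t)" using greater by (simp add: cusp_def)
  moreover have "\<forall>\<^sub>F x in nhds t. inverse x ^ m * exp (- c / x) = cusp c m x"
    using eventually_nhds_in_open[of "{0<..}" t] greater
    by (auto simp: cusp_def elim!: eventually_mono)
  ultimately show ?thesis by (rule DERIV_transform_nhds)
next
  case less
  have "((\<lambda>t::real. 0::real) has_real_derivative 0) (at t)" by simp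
  moreover have "\<forall>\<^sub>F x in nhds t. 0 = cusp c m x"
    using eventually_nhds_in_open[of "{..<0}" t] less
    by (auto simp: cusp_def elim!: eventually_mono)
  ultimately have "(cusp c m has_real_derivative 0) (at t)" by (rule DERIV_transform_nhds)
  thus ?thesis using less by (simp add: cusp_def)
next
  case equal
  \<comment> \<open>At 0 the difference quotient of \<open>cusp c m\<close> is
    \<open>cusp c (m+1)\<close> itself, which tends to 0.\<close>
  have "((\<lambda>h. (cusp c m (0 + h) - cusp c m 0) / h) \<longlongrightarrow> 0) (at 0)"
    using cusp_tendsto_0[OF assms, of "m+1"]
    by (rule Lim_transform_eventually) (auto simp: cusp_def eventually_at_filter field_simps)
  thus ?thesis using equal by (simp add: DERIV_def cusp_def)
qed

text \<open>Contains the two one-sided factors of a bump on [a, b] and is stable under the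
  operations of the product rule, hence under differentiation. This avoids any formula for higher
  derivatives.\<close>

inductive_set cusp_algebra :: "real \<Rightarrow> real \<Rightarrow> real \<Rightarrow> (real \<Rightarrow> real) set" for c a b where
  left: "(\<lambda>x. cusp c m (x - a)) \<in> cusp_algebra c a b"
| right: "(\<lambda>x. cusp c m (b - x)) \<in> cusp_algebra c a b"
| scale: "p \<in> cusp_algebra c a b \<Longrightarrow> (\<lambda>x. r * p x) \<in> cusp_algebra c a b"
| add: "p \<in> cusp_algebra c a b \<Longrightarrow> q \<in> cusp_algebra c a b \<Longrightarrow> (\<lambda>x. p x + q x) \<in> cusp_algebra c a b"
| mult: "p \<in> cusp_algebra c a b \<Longrightarrow> q \<in> cusp_algebra c a b \<Longrightarrow> (\<lambda>x. p x * q x) \<in> cusp_algebra c a b"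

lemma cusp_algebra_deriv:
  assumes "c > 0" "p \<in> cusp_algebra c a b"
  shows "\<exists>q\<in>cusp_algebra c a b. \<forall>x. (p has_real_derivative q x) (at x)"
  using assms(2)
proof induction
  case (left m)
  show ?case
  proof (intro bexI allI)
    show "((\<lambda>x. cusp c m (x - a)) has_real_derivative
        c * cusp c (m+2) (x - a) + (- real m) * cusp c (m+1) (x - a)) (at x)" for x
      by (rule DERIV_cong, rule DERIV_chain2[where g="\<lambda>x. x - a", OF cusp_has_derivative[OF assms(1)]])
         (auto intro!: derivative_eq_intros)
  qed (intro cusp_algebra.intros)
next
  case (right m)
  show ?case
  proof (intro bexI allI)
    show "((\<lambda>x. cusp c m (b - x)) has_real_derivative
        (- c) * cusp c (m+2) (b - x) + real m * cusp c (m+1) (b - x)) (at x)" for x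
      by (rule DERIV_cong, rule DERIV_chain2[where g="\<lambda>x. b - x", OF cusp_has_derivative[OF assms(1)]])
         (auto intro!: derivative_eq_intros)
  qed (intro cusp_algebra.intros)
next
  case (scale p r)
  then obtain q where q: "q \<in> cusp_algebra c a b" "\<And>x. (p has_real_derivative q x) (at x)" by blast
  show ?case
    by (rule bexI[of _ "\<lambda>x. r * q x"]) (auto intro!: DERIV_cmult cusp_algebra.scale q)
next
  case (add p q)
  then obtain p' q' where q: "p' \<in> cusp_algebra c a b" "\<And>x. (p has_real_derivative p' x) (at x)"
    "q' \<in> cusp_algebra c a b" "\<And>x. (q has_real_derivative q' x) (at x)" by metis
  show ?case
    by (rule bexI[of _ "\<lambda>x. p' x + q' x"]) (auto intro!: DERIV_add cusp_algebra.add q)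
next
  case (mult p q)
  then obtain p' q' where q: "p' \<in> cusp_algebra c a b" "\<And>x. (p has_real_derivative p' x) (at x)"
    "q' \<in> cusp_algebra c a b" "\<And>x. (q has_real_derivative q' x) (at x)" by metis
  show ?case
    by (rule bexI[of _ "\<lambda>x. p' x * q x + q' x * p x"])
       (auto intro!: DERIV_mult cusp_algebra.add cusp_algebra.mult q mult)
qed

lemma has_derivative_coordinate_prod:
  fixes p :: "'n::finite \<Rightarrow> real \<Rightarrow> real" and q :: "'n \<Rightarrow> real"
  assumes "\<And>i. (p i has_real_derivative q i) (at (x $ i))"
  shows "((\<lambda>x. complex_of_real (\<Prod>i\<in>UNIV. p i (x $ i))) has_derivative
     (\<lambda>h. complex_of_real (\<Sum>i\<in>UNIV. q i * h $ i * (\<Prod>j\<in>UNIV - {i}. p j (x $ j))))) (at x)"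
proof -
  have 1: "((\<lambda>x. p i (x $ i)) has_derivative (\<lambda>h. q i * h $ i)) (at x)" for i
    using assms[of i] unfolding has_field_derivative_def
    by (rule has_derivative_compose[rotated])
       (auto intro!: bounded_linear_imp_has_derivative bounded_linear_vec_nth)
  show ?thesis
    by (intro has_derivative_of_real has_derivative_prod 1)
qed

lemma partial_deriv_eqI:
  assumes "(g has_derivative g') (at x)"
  shows "partial_deriv i g x = g' (axis i 1)"
  unfolding partial_deriv_def using frechet_derivative_at[OF assms] by simp

text \<open>A partial derivative changes only one factor of such a product and keeps it in its
  algebra. The products thus form a class to which \<open>smooth_if_closed\<close> applies.\<close>

lemma smooth_cusp_prod:
  fixes p :: "'n::finite \<Rightarrow> real \<Rightarrow> real"
  assumes "c > 0" "\<And>i. p i \<in> cusp_algebra c (a i) (b i)"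
  shows "smooth (\<lambda>x. complex_of_real (\<Prod>i\<in>UNIV. p i (x $ i)))"
proof (rule smooth_if_closed)
  let ?S = "{\<lambda>x::real^'n. complex_of_real (\<Prod>i\<in>UNIV. p i (x $ i)) |p. \<forall>i. p i \<in> cusp_algebra c (a i) (b i)}"
  show "(\<lambda>x. complex_of_real (\<Prod>i\<in>UNIV. p i (x $ i))) \<in> ?S" using assms(2) by blast
  fix h assume "h \<in> ?S"
  then obtain p where h: "h = (\<lambda>x. complex_of_real (\<Prod>i\<in>UNIV. p i (x $ i)))"
    and p: "\<And>i. p i \<in> cusp_algebra c (a i) (b i)" by blast
  from cusp_algebra_deriv[OF assms(1) p] obtain q where
    q: "\<And>i. q i \<in> cusp_algebra c (a i) (b i)" "\<And>i x. (p i has_real_derivative q i x) (at x)" by metis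
  note D = has_derivative_coordinate_prod[of p "\<lambda>i. q i (x $ i)" x for x, OF q(2)]
  show "h differentiable (at x)" for x unfolding h using D[of x] by (rule differentiableI)
  show "partial_deriv i h \<in> ?S" for i
  proof -
    have "partial_deriv i h x = complex_of_real (\<Prod>j\<in>UNIV. (p(i := q i)) j (x $ j))" for x
    proof -
      have "(\<Sum>k\<in>UNIV. q k (x $ k) * axis i 1 $ k * (\<Prod>j\<in>UNIV - {k}. p j (x $ j)))
          = (\<Sum>k\<in>UNIV. if k = i then q k (x $ k) * (\<Prod>j\<in>UNIV - {k}. p j (x $ j)) else 0)"
        by (intro sum.cong) (auto simp: axis_def)
      also have "\<dots> = q i (x $ i) * (\<Prod>j\<in>UNIV - {i}. p j (x $ j))" by simp
      also have "(\<Prod>j\<in>UNIV - {i}. p j (x $ j)) = (\<Prod>j\<in>UNIV - {i}. (p(i := q i)) j (x $ j))"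
        by (intro prod.cong) auto
      also have "q i (x $ i) * \<dots> = (\<Prod>j\<in>UNIV. (p(i := q i)) j (x $ j))"
        by (subst prod.remove[of UNIV i]) auto
      finally show ?thesis unfolding h using partial_deriv_eqI[OF D[of x], of i] by simp
    qed
    thus ?thesis using p q(1) by (intro CollectI exI[of _ "p(i := q i)"]) auto
  qed
qed

text \<open>A smooth stand-in for the indicator of the open box: it lives on the box, has values in
  [0, 1], and converges to the indicator as c tends to 0. Translates of bumps are bumps, which
  \<open>upper_gradient_of_weak\<close> exploits.\<close>

definition bump :: "real \<Rightarrow> real^'n \<Rightarrow> real^'n \<Rightarrow> real^'n::finite \<Rightarrow> real" where
  "bump c a b x = (\<Prod>i\<in>UNIV. cusp c 0 (x $ i - a $ i) * cusp c 0 (b $ i - x $ i))"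

lemma cusp_0_bounds: "c > 0 \<Longrightarrow> 0 \<le> cusp c 0 t \<and> cusp c 0 t \<le> 1"
  by (auto simp: cusp_def)

lemma bump_bounds:
  assumes "c > 0" shows "0 \<le> bump c a b x" "bump c a b x \<le> 1"
  using cusp_0_bounds[OF assms]
  by (auto simp: bump_def intro!: prod_nonneg prod_le_1 mult_le_one)

lemma bump_eq_0:
  assumes "x \<notin> cbox a b" shows "bump c a b x = 0"
proof -
  obtain i where "x $ i < a $ i \<or> b $ i < x $ i" using assms by (auto simp: mem_box_cart not_le)
  hence "cusp c 0 (x $ i - a $ i) * cusp c 0 (b $ i - x $ i) = 0" by (auto simp: cusp_def)
  thus ?thesis unfolding bump_def by (subst prod_zero_iff) auto
qed

lemma test_function_bump:
  assumes "c > 0" shows "test_function (\<lambda>x. complex_of_real (bump c a b x))"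
proof -
  have "smooth (\<lambda>x. complex_of_real (bump c a b x))"
    unfolding bump_def using assms
    by (intro smooth_cusp_prod[where c=c and a="\<lambda>i. a $ i" and b="\<lambda>i. b $ i"]
          cusp_algebra.intros) auto
  moreover have "closure {x. complex_of_real (bump c a b x) \<noteq> 0} \<subseteq> cbox a b"
    using bump_eq_0[of _ a b c] by (intro closure_minimal) auto
  hence "compact (closure {x. complex_of_real (bump c a b x) \<noteq> 0})"
    using compact_Int_closed[OF compact_cbox closed_closure] by (metis inf.absorb_iff2)
  ultimately show ?thesis unfolding test_function_def by blast
qed

lemma bump_translate: "bump c a b (x + y) = bump c (a - y) (b - y) x"
  by (auto simp: bump_def algebra_simps)

lemma cusp_tendsto_indicator: "(\<lambda>k. cusp (1 / Suc k) 0 t) \<longlonglongrightarrow> indicator {0<..} t"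
proof (cases "t > 0")
  case True
  have "(\<lambda>k. - (1 / real (Suc k)) / t) \<longlonglongrightarrow> - 0 / t"
    using LIMSEQ_inverse_real_of_nat True by (intro tendsto_intros) (auto simp: inverse_eq_divide)
  hence "(\<lambda>k. exp (- (1 / real (Suc k)) / t)) \<longlonglongrightarrow> exp (- 0 / t)" by (rule tendsto_exp)
  thus ?thesis using True by (simp add: cusp_def)
qed (simp add: cusp_def)

lemma bump_tendsto: "(\<lambda>k. bump (1 / Suc k) a b x) \<longlonglongrightarrow> indicator (box a b) x"
proof -
  have "(\<lambda>k. bump (1 / Suc k) a b x) \<longlonglongrightarrow>
     (\<Prod>i\<in>UNIV. indicator {0<..} (x $ i - a $ i) * indicator {0<..} (b $ i - x $ i))"
    unfolding bump_def by (intro tendsto_intros cusp_tendsto_indicator)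
  also have "(\<Prod>i\<in>UNIV. indicator {0<..} (x $ i - a $ i) * indicator {0<..} (b $ i - x $ i)) = (indicator (box a b) x :: real)"
    by (auto simp: indicator_def mem_box_cart split: if_splits)
  finally show ?thesis .
qed

lemma borel_measurable_cusp [measurable]: "cusp c m \<in> borel_measurable borel"
  unfolding cusp_def by measurable

lemma borel_measurable_bump [measurable]: "bump c a b \<in> borel_measurable borel"
  unfolding bump_def by measurable

section \<open>From integrals against bumps to almost everywhere bounds\<close>

lemma locally_integrable_mult_bounded:
  fixes f :: "'a::euclidean_space \<Rightarrow> 'b::{banach, second_countable_topology, real_normed_algebra}"
  assumes "locally_integrable f" "compact K" "\<And>x. x \<notin> K \<Longrightarrow> h x = 0"
    "h \<in> borel_measurable lebesgue" "\<And>x. norm (h x) \<le> B"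
  shows "integrable lebesgue (\<lambda>x. f x * h x)"
proof -
  have f: "integrable lebesgue (\<lambda>x. indicator K x *\<^sub>R f x)"
    using assms(1,2) unfolding locally_integrable_def set_integrable_def by blast
  have eq: "f x * h x = (indicator K x *\<^sub>R f x) * h x" for x
    using assms(3)[of x] by (cases "x \<in> K") auto
  have B: "0 \<le> B" using assms(5)[of undefined] norm_ge_zero order_trans by blast
  show ?thesis
  proof (rule Bochner_Integration.integrable_bound[OF integrable_mult_right[OF integrable_norm[OF f], of B]])
    show "(\<lambda>x. f x * h x) \<in> borel_measurable lebesgue"
      unfolding eq using f assms(4) by measurable
    show "AE x in lebesgue. norm (f x * h x) \<le> norm (B * norm (indicator K x *\<^sub>R f x))"
    proof (intro AE_I2)
      fix x
      have "norm (f x * h x) \<le> norm (indicator K x *\<^sub>R f x) * norm (h x)"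
        unfolding eq by (rule norm_mult_ineq)
      also have "\<dots> \<le> norm (indicator K x *\<^sub>R f x) * B"
        using assms(5) by (intro mult_left_mono) auto
      finally show "norm (f x * h x) \<le> norm (B * norm (indicator K x *\<^sub>R f x))"
        using B by (simp add: mult.commute)
    qed
  qed
qed

lemma LINT_bump_tendsto:
  fixes f :: "real^'n::finite \<Rightarrow> 'b::euclidean_space"
  assumes "locally_integrable f"
  shows "(\<lambda>k. LINT x|lebesgue. bump (1 / Suc k) a b x *\<^sub>R f x) \<longlonglongrightarrow> integral (cbox a b) f"
proof -
  have si: "set_integrable lebesgue (cbox a b) f"
    using assms compact_cbox unfolding locally_integrable_def by blast
  have f: "integrable lebesgue (\<lambda>x. indicator (cbox a b) x *\<^sub>R f x)"
    using si unfolding set_integrable_def .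
  have sb: "set_integrable lebesgue (box a b) f"
    by (rule set_integrable_subset[OF si]) (auto simp: box_subset_cbox)
  have m: "(\<lambda>x. bump (1 / Suc k) a b x *\<^sub>R f x) \<in> borel_measurable lebesgue" for k
  proof -
    have "bump (1 / Suc k) a b x *\<^sub>R f x = bump (1 / Suc k) a b x *\<^sub>R (indicator (cbox a b) x *\<^sub>R f x)" for x
      using bump_eq_0[of x a b "1 / Suc k"] by (cases "x \<in> cbox a b") auto
    moreover have "(\<lambda>x. bump (1 / Suc k) a b x *\<^sub>R (indicator (cbox a b) x *\<^sub>R f x)) \<in> borel_measurable lebesgue"
      by (rule borel_measurable_scaleR[OF _ borel_measurable_integrable[OF f]])
         (rule measurable_completion, simp)
    ultimately show ?thesis by presburger
  qed
  have mb: "(\<lambda>x. indicator (box a b) x *\<^sub>R f x) \<in> borel_measurable lebesgue"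
    using sb unfolding set_integrable_def by auto
  have "(\<lambda>k. LINT x|lebesgue. bump (1 / Suc k) a b x *\<^sub>R f x) \<longlonglongrightarrow> (LINT x|lebesgue. indicator (box a b) x *\<^sub>R f x)"
  proof (rule integral_dominated_convergence[OF mb m integrable_norm[OF f]])
    show "AE x in lebesgue. (\<lambda>k. bump (1 / Suc k) a b x *\<^sub>R f x) \<longlonglongrightarrow> indicator (box a b) x *\<^sub>R f x"
      by (intro AE_I2 tendsto_scaleR bump_tendsto tendsto_const)
    show "AE x in lebesgue. norm (bump (1 / Suc k) a b x *\<^sub>R f x) \<le> norm (indicator (cbox a b) x *\<^sub>R f x)" for k
    proof (intro AE_I2)
      fix x
      show "norm (bump (1 / Suc k) a b x *\<^sub>R f x) \<le> norm (indicator (cbox a b) x *\<^sub>R f x)"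
        using bump_eq_0[of x a b "1 / Suc k"] bump_bounds[of "1 / Suc k" a b x]
        by (cases "x \<in> cbox a b") (auto intro!: mult_left_le_one_le)
    qed
  qed
  also have "(LINT x|lebesgue. indicator (box a b) x *\<^sub>R f x) = integral (box a b) f"
    using set_lebesgue_integral_eq_integral(2)[OF sb] by (simp add: set_lebesgue_integral_def)
  finally show ?thesis by (simp add: integral_open_interval)
qed

text \<open>Letting c tend to 0 replaces bumps by boxes. Lebesgue differentiation along the cubes
  with lower corner x then gives the bound at almost every x. This is how integral inequalities
  become pointwise, both for increments along lines and for wavelet series.\<close>

lemma domination:
  fixes f :: "real^'n::finite \<Rightarrow> complex" and g :: "real^'n \<Rightarrow> real"
  assumes f: "locally_integrable f" and g: "locally_integrable g"
    and le: "\<And>a b c. c > 0 \<Longrightarrow> norm (LINT x|lebesgue. f x * of_real (bump c a b x)) \<le> (LINT x|lebesgue. g x * bump c a b x)"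
  shows "AE x in lebesgue. norm (f x) \<le> g x"
proof -
  have int: "norm (integral (cbox a b) f) \<le> integral (cbox a b) g" for a b
  proof (rule LIMSEQ_le)
    show "(\<lambda>k. norm (LINT x|lebesgue. bump (1 / Suc k) a b x *\<^sub>R f x)) \<longlonglongrightarrow> norm (integral (cbox a b) f)"
      by (intro tendsto_norm LINT_bump_tendsto f)
    show "(\<lambda>k. LINT x|lebesgue. bump (1 / Suc k) a b x *\<^sub>R g x) \<longlonglongrightarrow> integral (cbox a b) g"
      by (intro LINT_bump_tendsto g)
    show "\<exists>N. \<forall>k\<ge>N. norm (LINT x|lebesgue. bump (1 / Suc k) a b x *\<^sub>R f x)
        \<le> (LINT x|lebesgue. bump (1 / Suc k) a b x *\<^sub>R g x)"
      using le[of "1 / Suc k" for k] by (auto simp: scaleR_conv_of_real mult.commute)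
  qed
  have iof: "f integrable_on cbox a b" and iog: "g integrable_on cbox a b" for a b
    using f g unfolding locally_integrable_def
    by (meson compact_cbox set_lebesgue_integral_eq_integral(1))+
  obtain N1 where N1: "negligible N1" "\<And>x e. \<lbrakk>x \<notin> N1; 0 < e\<rbrakk> \<Longrightarrow> \<exists>d>0. \<forall>h. 0 < h \<and> h < d \<longrightarrow>
      norm (integral (cbox x (x + h *\<^sub>R One)) f /\<^sub>R h ^ DIM(real^'n) - f x) < e"
    using integrable_ccontinuous_explicit[OF iof] by blast
  obtain N2 where N2: "negligible N2" "\<And>x e. \<lbrakk>x \<notin> N2; 0 < e\<rbrakk> \<Longrightarrow> \<exists>d>0. \<forall>h. 0 < h \<and> h < d \<longrightarrow>
      norm (integral (cbox x (x + h *\<^sub>R One)) g /\<^sub>R h ^ DIM(real^'n) - g x) < e"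
    using integrable_ccontinuous_explicit[OF iog] by blast
  have "norm (f x) \<le> g x" if x: "x \<notin> N1" "x \<notin> N2" for x
  proof (rule field_le_epsilon)
    fix e :: real assume "e > 0"
    then obtain d1 d2 where d: "d1 > 0" "d2 > 0"
      "\<And>h. 0 < h \<Longrightarrow> h < d1 \<Longrightarrow> norm (integral (cbox x (x + h *\<^sub>R One)) f /\<^sub>R h ^ DIM(real^'n) - f x) < e/2"
      "\<And>h. 0 < h \<Longrightarrow> h < d2 \<Longrightarrow> norm (integral (cbox x (x + h *\<^sub>R One)) g /\<^sub>R h ^ DIM(real^'n) - g x) < e/2"
      using N1(2)[OF x(1), of "e/2"] N2(2)[OF x(2), of "e/2"] by (metis half_gt_zero)
    define h where "h = min d1 d2 / 2"
    have h: "0 < h" "h < d1" "h < d2" using d unfolding h_def by auto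
    let ?I = "integral (cbox x (x + h *\<^sub>R One)) f /\<^sub>R h ^ DIM(real^'n)"
    let ?J = "integral (cbox x (x + h *\<^sub>R One)) g /\<^sub>R h ^ DIM(real^'n)"
    have "norm ?I \<le> ?J" using int h by (auto simp: divide_simps intro!: mult_left_mono)
    moreover have "norm (f x) \<le> norm ?I + norm (?I - f x)" by (metis norm_triangle_sub norm_minus_commute)
    moreover have "?J \<le> g x + norm (?J - g x)" by (simp add: abs_le_iff)
    ultimately show "norm (f x) \<le> g x + e" using d(3)[OF h(1,2)] d(4)[OF h(1,3)] by linarith
  qed
  hence "{x \<in> space lebesgue. \<not> norm (f x) \<le> g x} \<subseteq> N1 \<union> N2" by blast
  moreover have "N1 \<union> N2 \<in> null_sets lebesgue"
    using N1(1) N2(1) by (simp add: negligible_iff_null_sets null_sets.Un)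
  ultimately show ?thesis by (intro AE_I') 
qed

section \<open>Upper gradients\<close>

lemma nn_integral_lborel_shift:
  fixes a :: "'a::euclidean_space"
  assumes [measurable]: "F \<in> borel_measurable borel"
  shows "(\<integral>\<^sup>+x. F (x + a) \<partial>lborel) = (\<integral>\<^sup>+x. F x \<partial>lborel)"
proof -
  have "(\<integral>\<^sup>+x. F x \<partial>lborel) = (\<integral>\<^sup>+x. F x \<partial>distr lborel borel ((+) a))"
    by (simp add: lborel_distr_plus)
  also have "\<dots> = (\<integral>\<^sup>+x. F (a + x) \<partial>lborel)"
    by (subst nn_integral_distr) auto
  finally show ?thesis by (simp add: add.commute)
qed

lemma AE_lborel_shift:
  fixes a :: "'a::euclidean_space"
  assumes "AE x in lborel. P x"
  shows "AE x in lborel. P (x + a)"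
proof -
  from assms obtain N where N: "{x \<in> space lborel. \<not> P x} \<subseteq> N" "emeasure lborel N = 0" "N \<in> sets lborel"
    by (rule AE_E)
  have [measurable]: "N \<in> sets borel" using N(3) by simp
  have V: "(\<lambda>x. x + a) -` N \<in> sets borel"
    by (rule measurable_sets_borel[where M=borel]) measurable
  have "emeasure lborel ((\<lambda>x. x + a) -` N) = (\<integral>\<^sup>+x. indicator N (x + a) \<partial>lborel)"
  proof -
    have "indicator N (x + a) = (indicator ((\<lambda>x. x + a) -` N) x :: ennreal)" for x
      by (simp add: indicator_def)
    thus ?thesis using V by simp
  qed
  also have "\<dots> = 0" using nn_integral_lborel_shift[of "indicator N" a] N(2,3) by simp
  finally have "(\<lambda>x. x + a) -` N \<in> null_sets lborel"
    by (intro null_setsI) (auto simp: V)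
  moreover have "{x \<in> space lborel. \<not> P (x + a)} \<subseteq> (\<lambda>x. x + a) -` N" using N(1) by auto
  ultimately show ?thesis by (rule AE_I')
qed

lemma integral_lborel_shift:
  fixes f :: "'a::euclidean_space \<Rightarrow> 'b::{banach, second_countable_topology}"
  assumes [measurable]: "f \<in> borel_measurable borel"
  shows "(LINT x|lborel. f (x + a)) = (LINT x|lborel. f x)"
proof -
  have "(LINT x|lborel. f x) = (LINT x|distr lborel borel ((+) a). f x)"
    by (simp add: lborel_distr_plus)
  also have "\<dots> = (LINT x|lborel. f (a + x))" by (subst integral_distr) auto
  finally show ?thesis by (simp add: add.commute)
qed

lemma integrable_lborel_shift:
  fixes f :: "'a::euclidean_space \<Rightarrow> 'b::{banach, second_countable_topology}"
  assumes "integrable lborel f"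
  shows "integrable lborel (\<lambda>x. f (x + a))"
proof -
  have "integrable (distr lborel borel ((+) a)) f" using assms by (simp add: lborel_distr_plus)
  hence "integrable lborel (\<lambda>x. f (a + x))" using assms by (subst (asm) integrable_distr_eq) auto
  thus ?thesis by (simp add: add.commute)
qed

definition upper_gradient :: "(real^'n::finite \<Rightarrow> 'b::{real_normed_vector,second_countable_topology}) \<Rightarrow> (real^'n \<Rightarrow> ennreal) \<Rightarrow> bool" where
  "upper_gradient u F \<longleftrightarrow> u \<in> borel_measurable borel \<and> F \<in> borel_measurable borel \<and>
    (\<forall>i t. AE x in lborel. ennreal (norm (u (x + t *\<^sub>R axis i 1) - u x))
        \<le> (\<integral>\<^sup>+s. indicator (closed_segment 0 t) s * F (x + s *\<^sub>R axis i 1) \<partial>lborel))"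

lemma locally_integrable_nn_integral_finite:
  fixes f :: "'a::euclidean_space \<Rightarrow> 'b::{banach, second_countable_topology}"
  assumes "locally_integrable f" "f0 \<in> borel_measurable borel" "AE x in lebesgue. f x = f0 x" "compact K"
  shows "(\<integral>\<^sup>+x. indicator K x * ennreal (norm (f0 x)) \<partial>lborel) < \<infinity>"
proof -
  have "integrable lebesgue (\<lambda>x. indicator K x *\<^sub>R f x)"
    using assms unfolding locally_integrable_def set_integrable_def by blast
  hence "(\<integral>\<^sup>+x. ennreal (norm (indicator K x *\<^sub>R f x)) \<partial>lebesgue) < \<infinity>"
    by (simp add: integrable_iff_bounded)
  also have "(\<integral>\<^sup>+x. ennreal (norm (indicator K x *\<^sub>R f x)) \<partial>lebesgue)
      = (\<integral>\<^sup>+x. ennreal (norm (indicator K x *\<^sub>R f0 x)) \<partial>lebesgue)"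
    by (intro nn_integral_cong_AE) (use assms(3) in \<open>auto elim!: eventually_mono\<close>)
  also have "\<dots> = (\<integral>\<^sup>+x. ennreal (norm (indicator K x *\<^sub>R f0 x)) \<partial>lborel)"
    by (simp add: nn_integral_completion)
  also have "\<dots> = (\<integral>\<^sup>+x. indicator K x * ennreal (norm (f0 x)) \<partial>lborel)"
    by (intro nn_integral_cong) (auto simp: indicator_def)
  finally show ?thesis .
qed

lemma locally_integrable_borelI:
  fixes f :: "'a::euclidean_space \<Rightarrow> 'b::{banach, second_countable_topology}"
  assumes [measurable]: "f \<in> borel_measurable borel"
    and fin: "\<And>K. compact K \<Longrightarrow> (\<integral>\<^sup>+x. indicator K x * ennreal (norm (f x)) \<partial>lborel) < \<infinity>"
  shows "locally_integrable f"
  unfolding locally_integrable_def set_integrable_def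
proof (intro allI impI)
  fix K :: "'a set" assume K: "compact K"
  hence [measurable]: "K \<in> sets borel" by (simp add: borel_compact)
  have "integrable lborel (\<lambda>x. indicator K x *\<^sub>R f x)"
    unfolding integrable_iff_bounded
  proof
    have "(\<integral>\<^sup>+x. ennreal (norm (indicator K x *\<^sub>R f x)) \<partial>lborel) = (\<integral>\<^sup>+x. indicator K x * ennreal (norm (f x)) \<partial>lborel)"
      by (intro nn_integral_cong) (auto simp: indicator_def)
    thus "(\<integral>\<^sup>+x. ennreal (norm (indicator K x *\<^sub>R f x)) \<partial>lborel) < \<infinity>" using fin[OF K] by simp
  qed auto
  thus "integrable lebesgue (\<lambda>x. indicator K x *\<^sub>R f x)" by (simp add: integrable_completion)
qed

lemma compact_shift_cover:
  fixes K :: "'a::euclidean_space set"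
  assumes "compact K"
  obtains r where "r > 0" "\<And>x y. x \<in> K \<Longrightarrow> norm y \<le> t \<Longrightarrow> x + y \<in> cball 0 r"
proof -
  from compact_imp_bounded[OF assms] obtain b where b: "b > 0" "\<And>x. x \<in> K \<Longrightarrow> norm x \<le> b"
    using bounded_pos by blast
  show thesis
  proof (rule that[of "b + \<bar>t\<bar>"])
    show "x + y \<in> cball 0 (b + \<bar>t\<bar>)" if "x \<in> K" "norm y \<le> t" for x y
      using norm_triangle_ineq[of x y] b(2)[OF that(1)] that(2) by (simp)
  qed (use b in auto)
qed

lemma continuous_on_partial_bump:
  assumes "c > 0" shows "continuous_on UNIV (partial_deriv i (\<lambda>x. complex_of_real (bump c a b x)))"
proof -
  have "smooth (\<lambda>x. complex_of_real (bump c a b x))"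
    using test_function_bump[OF assms] unfolding test_function_def by blast
  hence "iter_partial [i] (\<lambda>x. complex_of_real (bump c a b x)) differentiable (at x)" for x
    unfolding smooth_def by blast
  thus ?thesis by (auto intro!: continuous_at_imp_continuous_on differentiable_imp_continuous_within)
qed

lemma differentiable_bump:
  assumes "c > 0" shows "(\<lambda>x. complex_of_real (bump c a b x)) differentiable (at x)"
proof -
  have "smooth (\<lambda>x. complex_of_real (bump c a b x))"
    using test_function_bump[OF assms] unfolding test_function_def by blast
  hence "iter_partial [] (\<lambda>x. complex_of_real (bump c a b x)) differentiable (at x)"
    unfolding smooth_def by blast
  thus ?thesis by simp
qed

lemma partial_deriv_line:
  assumes "g differentiable (at (x + s *\<^sub>R axis i 1))"
  shows "((\<lambda>s. g (x + s *\<^sub>R axis i 1)) has_vector_derivative partial_deriv i g (x + s *\<^sub>R axis i 1)) (at s)"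
proof -
  have g: "(g has_derivative frechet_derivative g (at (x + s *\<^sub>R axis i 1))) (at (x + s *\<^sub>R axis i 1))"
    using assms frechet_derivative_works by blast
  have "((\<lambda>s. x + s *\<^sub>R axis i 1) has_derivative (\<lambda>s. s *\<^sub>R axis i (1::real))) (at s)"
    by (auto intro!: derivative_eq_intros)
  from has_derivative_compose[OF this g]
  have "((\<lambda>s. g (x + s *\<^sub>R axis i 1)) has_derivative
      (\<lambda>s'. frechet_derivative g (at (x + s *\<^sub>R axis i 1)) (s' *\<^sub>R axis i 1))) (at s)" .
  moreover have "linear (frechet_derivative g (at (x + s *\<^sub>R axis i 1)))"
    using assms by (rule linear_frechet_derivative)
  ultimately show ?thesis
    unfolding has_vector_derivative_def partial_deriv_def by (simp add: linear_cmul)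
qed

lemma partial_bump_eq_0:
  assumes "c > 0" "x \<notin> cbox a b" shows "partial_deriv i (\<lambda>x. complex_of_real (bump c a b x)) x = 0"
proof -
  have "open (- cbox a b)" by (simp add: closed_cbox open_Compl)
  have "((\<lambda>x. 0::complex) has_derivative (\<lambda>_. 0)) (at x)" by simp
  hence "((\<lambda>x. complex_of_real (bump c a b x)) has_derivative (\<lambda>_. 0)) (at x)"
    by (rule has_derivative_transform_within_open[of _ _ _ _ "- cbox a b"])
       (use assms(2) \<open>open (- cbox a b)\<close> in \<open>auto simp: bump_eq_0\<close>)
  from partial_deriv_eqI[OF this] show ?thesis by simp
qed

lemma bounded_partial_bump:
  assumes "c > 0"
  obtains B where "B \<ge> 0" "\<And>x. norm (partial_deriv i (\<lambda>x. complex_of_real (bump c a b x)) x) \<le> B"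
proof -
  let ?D = "partial_deriv i (\<lambda>x. complex_of_real (bump c a b x))"
  have "compact (?D ` cbox a b)"
    using continuous_on_subset[OF continuous_on_partial_bump[OF assms]] by (intro compact_continuous_image) auto
  then obtain B where B: "B > 0" "\<And>x. x \<in> cbox a b \<Longrightarrow> norm (?D x) \<le> B"
    using compact_imp_bounded bounded_pos by (metis imageI)
  show thesis
  proof (rule that[of B])
    show "norm (?D x) \<le> B" for x
      using B partial_bump_eq_0[OF assms, of x a b i] by (cases "x \<in> cbox a b") auto
  qed (use B in auto)
qed

text \<open>Test the increment against a bump and move the translation to the bump. The difference
  of the two bumps is the integral of a partial derivative over translates, and each translate is
  again a bump, so \<open>weak\<close> applies to it. Fubini gives the integral of the claimed bound
  against the original bump, and \<open>domination\<close> concludes.\<close>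

lemma upper_gradient_of_weak:
  fixes f0 :: "real^'n::finite \<Rightarrow> complex" and F0 :: "real^'n \<Rightarrow> real"
  assumes f0 [measurable]: "f0 \<in> borel_measurable borel"
    and F0 [measurable]: "F0 \<in> borel_measurable borel" and F0_nonneg: "\<And>x. 0 \<le> F0 x"
    and lf: "\<And>K. compact K \<Longrightarrow> (\<integral>\<^sup>+x. indicator K x * ennreal (norm (f0 x)) \<partial>lborel) < \<infinity>"
    and lF: "\<And>K. compact K \<Longrightarrow> (\<integral>\<^sup>+x. indicator K x * ennreal (F0 x) \<partial>lborel) < \<infinity>"
    and weak: "\<And>i a b c. c > 0 \<Longrightarrow>
      ennreal (norm (LINT x|lborel. f0 x * partial_deriv i (\<lambda>x. complex_of_real (bump c a b x)) x))
        \<le> (\<integral>\<^sup>+x. ennreal (F0 x * bump c a b x) \<partial>lborel)"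
  shows "upper_gradient f0 (\<lambda>x. ennreal (F0 x))"
proof -
  have pos: "AE x in lborel. ennreal (norm (f0 (x + t *\<^sub>R axis i 1) - f0 x))
        \<le> (\<integral>\<^sup>+s. indicator {0..t} s * ennreal (F0 (x + s *\<^sub>R axis i 1)) \<partial>lborel)"
    if t: "t \<ge> 0" for i and t :: real
  proof -
    define e :: "real^'n" where "e = axis i 1"
    have ne: "norm e = 1" by (simp add: e_def)
    \<comment> \<open>The claimed bound, which has to be finite almost everywhere and locally
      integrable before \<open>domination\<close> can be used.\<close>
    define g where "g x = (\<integral>\<^sup>+s. indicator {0..t} s * ennreal (F0 (x + s *\<^sub>R e)) \<partial>lborel)" for x
    have g_meas [measurable]: "g \<in> borel_measurable borel" unfolding g_def by measurable
    have g_fin: "(\<integral>\<^sup>+x. indicator K x * g x \<partial>lborel) < \<infinity>" if K: "compact K" for K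
    proof -
      have [measurable]: "K \<in> sets borel" using K by (simp add: borel_compact)
      obtain r where r: "r > 0" "\<And>x y. x \<in> K \<Longrightarrow> norm y \<le> t \<Longrightarrow> x + y \<in> cball 0 r"
        using compact_shift_cover[OF K] by blast
      have [measurable]: "cball (0::real^'n) r \<in> sets borel" by simp
      have "(\<integral>\<^sup>+x. indicator K x * g x \<partial>lborel)
         = (\<integral>\<^sup>+x. \<integral>\<^sup>+s. indicator K x * (indicator {0..t} s * ennreal (F0 (x + s *\<^sub>R e))) \<partial>lborel \<partial>lborel)"
        unfolding g_def by (subst nn_integral_cmult) auto
      also have "\<dots> = (\<integral>\<^sup>+s. \<integral>\<^sup>+x. indicator K x * (indicator {0..t} s * ennreal (F0 (x + s *\<^sub>R e))) \<partial>lborel \<partial>lborel)"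
        by (rule lborel_pair.Fubini') measurable
      also have "\<dots> \<le> (\<integral>\<^sup>+s. indicator {0..t} s * (\<integral>\<^sup>+x. indicator (cball 0 r) (x + s *\<^sub>R e) * ennreal (F0 (x + s *\<^sub>R e)) \<partial>lborel) \<partial>lborel)"
      proof (intro nn_integral_mono)
        fix s
        have "(\<integral>\<^sup>+x. indicator K x * (indicator {0..t} s * ennreal (F0 (x + s *\<^sub>R e))) \<partial>lborel)
          \<le> (\<integral>\<^sup>+x. indicator {0..t} s * (indicator (cball 0 r) (x + s *\<^sub>R e) * ennreal (F0 (x + s *\<^sub>R e))) \<partial>lborel)"
          by (intro nn_integral_mono, use r ne in \<open>auto simp: indicator_def\<close>)
        also have "\<dots> = indicator {0..t} s * (\<integral>\<^sup>+x. indicator (cball 0 r) (x + s *\<^sub>R e) * ennreal (F0 (x + s *\<^sub>R e)) \<partial>lborel)"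
          by (rule nn_integral_cmult, rule measurable_compose[where N=borel and f="\<lambda>x. x + s *\<^sub>R e" and g="\<lambda>x. indicator (cball 0 r) x * ennreal (F0 x)"]) measurable
        finally show "(\<integral>\<^sup>+x. indicator K x * (indicator {0..t} s * ennreal (F0 (x + s *\<^sub>R e))) \<partial>lborel)
          \<le> indicator {0..t} s * (\<integral>\<^sup>+x. indicator (cball 0 r) (x + s *\<^sub>R e) * ennreal (F0 (x + s *\<^sub>R e)) \<partial>lborel)" .
      qed
      also have "\<dots> = (\<integral>\<^sup>+s. indicator {0..t} s * (\<integral>\<^sup>+x. indicator (cball 0 r) x * ennreal (F0 x) \<partial>lborel) \<partial>lborel)"
        by (subst nn_integral_lborel_shift[where F="\<lambda>x. indicator (cball 0 r) x * ennreal (F0 x)"]) simp_all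
      also have "\<dots> = ennreal t * (\<integral>\<^sup>+x. indicator (cball 0 r) x * ennreal (F0 x) \<partial>lborel)"
        using t by (subst nn_integral_multc) auto
      also have "\<dots> < \<infinity>" using lF[of "cball 0 r"] by (simp add: ennreal_mult_less_top)
      finally show ?thesis .
    qed
    have g_AE: "AE x in lborel. g x < \<infinity>"
    proof -
      have [measurable]: "cball (0::real^'n) (real k) \<in> sets borel" for k by simp
      have "AE x in lborel. \<forall>k::nat. indicator (cball 0 (real k)) x * g x \<noteq> \<infinity>"
        unfolding AE_all_countable
        using g_fin by (intro allI nn_integral_noteq_infinite) (auto simp: less_top)
      thus ?thesis
      proof (rule eventually_mono)
        fix x assume *: "\<forall>k::nat. indicator (cball 0 (real k)) x * g x \<noteq> \<infinity>"
        obtain k :: nat where "norm x \<le> real k" using real_arch_simple by blast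
        thus "g x < \<infinity>" using *[rule_format, of k] by (auto simp: less_top)
      qed
    qed
    let ?g = "\<lambda>x. enn2real (g x)"
    let ?f = "\<lambda>x. f0 (x + t *\<^sub>R e) - f0 x"
    have lg: "locally_integrable ?g"
    proof (rule locally_integrable_borelI)
      fix K :: "(real^'n) set" assume K: "compact K"
      have "(\<integral>\<^sup>+x. indicator K x * ennreal (norm (?g x)) \<partial>lborel) \<le> (\<integral>\<^sup>+x. indicator K x * g x \<partial>lborel)"
        by (intro nn_integral_mono mult_left_mono) (auto simp: ennreal_enn2real_if)
      thus "(\<integral>\<^sup>+x. indicator K x * ennreal (norm (?g x)) \<partial>lborel) < \<infinity>" using g_fin[OF K] by (rule le_less_trans)
    qed measurable
    have lf': "locally_integrable ?f"
    proof (rule locally_integrable_borelI)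
      fix K :: "(real^'n) set" assume K: "compact K"
      hence [measurable]: "K \<in> sets borel" by (simp add: borel_compact)
      obtain r where r: "r > 0" "\<And>x y. x \<in> K \<Longrightarrow> norm y \<le> t \<Longrightarrow> x + y \<in> cball 0 r"
        using compact_shift_cover[OF K] by blast
      have [measurable]: "cball (0::real^'n) r \<in> sets borel" by simp
      have "(\<integral>\<^sup>+x. indicator K x * ennreal (norm (?f x)) \<partial>lborel)
         \<le> (\<integral>\<^sup>+x. indicator (cball 0 r) (x + t *\<^sub>R e) * ennreal (norm (f0 (x + t *\<^sub>R e))) + indicator K x * ennreal (norm (f0 x)) \<partial>lborel)"
      proof (intro nn_integral_mono)
        fix x
        have "ennreal (norm (?f x)) \<le> ennreal (norm (f0 (x + t *\<^sub>R e))) + ennreal (norm (f0 x))"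
          by (simp add: ennreal_leI norm_triangle_ineq4 ennreal_plus[symmetric] del: ennreal_plus)
        thus "indicator K x * ennreal (norm (?f x)) \<le> indicator (cball 0 r) (x + t *\<^sub>R e) * ennreal (norm (f0 (x + t *\<^sub>R e))) + indicator K x * ennreal (norm (f0 x))"
          using r(2)[of x "t *\<^sub>R e"] ne t by (auto simp: indicator_def)
      qed
      also have "\<dots> = (\<integral>\<^sup>+x. indicator (cball 0 r) x * ennreal (norm (f0 x)) \<partial>lborel) + (\<integral>\<^sup>+x. indicator K x * ennreal (norm (f0 x)) \<partial>lborel)"
        by (subst nn_integral_add, measurable)
           (subst nn_integral_lborel_shift[where F="\<lambda>x. indicator (cball 0 r) x * ennreal (norm (f0 x))"], simp_all)
      also have "\<dots> < \<infinity>" using lf[OF K] lf[of "cball 0 r"] by simp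
      finally show "(\<integral>\<^sup>+x. indicator K x * ennreal (norm (?f x)) \<partial>lborel) < \<infinity>" .
    qed measurable
    have "AE x in lebesgue. norm (?f x) \<le> ?g x"
    proof (rule domination[OF lf' lg])
      fix a b :: "real^'n" and c :: real assume c: "c > 0"
      define \<theta> where "\<theta> = (\<lambda>x. complex_of_real (bump c a b x))"
      define D where "D = partial_deriv i \<theta>"
      have [measurable]: "\<theta> \<in> borel_measurable borel" unfolding \<theta>_def by measurable
      have Dc: "continuous_on UNIV D" unfolding D_def \<theta>_def by (rule continuous_on_partial_bump[OF c])
      hence [measurable]: "D \<in> borel_measurable borel" by (rule borel_measurable_continuous_onI)
      obtain B where B: "B \<ge> 0" "\<And>x. norm (D x) \<le> B"
        unfolding D_def \<theta>_def using bounded_partial_bump[OF c] by blast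
      have D0: "D x = 0" if "x \<notin> cbox a b" for x
        unfolding D_def \<theta>_def using partial_bump_eq_0[OF c that] .
      obtain r where r: "r > 0" "\<And>x y. x \<in> cbox a b \<Longrightarrow> norm y \<le> t \<Longrightarrow> x + y \<in> cball 0 r"
        using compact_shift_cover[OF compact_cbox] by blast
      have [measurable]: "cball (0::real^'n) r \<in> sets borel" by simp
      \<comment> \<open>Integrating \<open>h x\<close> in s gives the difference of the bump at x
        and at x - t e, while integrating in x at fixed s gives a pairing with the derivative of a
        translated bump.\<close>
      define h where "h x s = f0 x * (indicator {0..t} s *\<^sub>R D (x + (- s) *\<^sub>R e))" for x s
      have h_meas [measurable]: "case_prod h \<in> borel_measurable (lborel \<Otimes>\<^sub>M lborel)"
        unfolding h_def by measurable
      have h_int: "integrable (lborel \<Otimes>\<^sub>M lborel) (case_prod h)"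
        unfolding integrable_iff_bounded
      proof
        have "(\<integral>\<^sup>+z. ennreal (norm (case_prod h z)) \<partial>(lborel \<Otimes>\<^sub>M lborel))
          = (\<integral>\<^sup>+x. \<integral>\<^sup>+s. ennreal (norm (h x s)) \<partial>lborel \<partial>lborel)"
          by (subst lborel.nn_integral_fst[symmetric]) auto
        also have "\<dots> \<le> (\<integral>\<^sup>+x. \<integral>\<^sup>+s. (indicator (cball 0 r) x * ennreal (norm (f0 x)) * ennreal B) * indicator {0..t} s \<partial>lborel \<partial>lborel)"
        proof (intro nn_integral_mono)
          fix x :: "real^'n" and s :: real
          show "ennreal (norm (h x s)) \<le> (indicator (cball 0 r) x * ennreal (norm (f0 x)) * ennreal B) * indicator {0..t} s"
          proof (cases "s \<in> {0..t} \<and> x + (- s) *\<^sub>R e \<in> cbox a b")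
            case True
            hence "x \<in> cball 0 r" using r(2)[of "x + (- s) *\<^sub>R e" "s *\<^sub>R e"] ne by auto
            moreover have "norm (h x s) \<le> norm (f0 x) * B" unfolding h_def using True B
              by (auto simp: norm_mult intro!: mult_left_mono)
            ultimately show ?thesis using True B(1) by (simp add: ennreal_mult[symmetric] ennreal_leI)
          next
            case False
            hence "h x s = 0" unfolding h_def using D0 by (auto simp: indicator_def)
            thus ?thesis by simp
          qed
        qed
        also have "\<dots> = (\<integral>\<^sup>+x. indicator (cball 0 r) x * ennreal (norm (f0 x)) * (ennreal B * ennreal t) \<partial>lborel)"
          using t by (intro nn_integral_cong) (simp add: nn_integral_cmult mult.assoc)
        also have "\<dots> = (\<integral>\<^sup>+x. indicator (cball 0 r) x * ennreal (norm (f0 x)) \<partial>lborel) * (ennreal B * ennreal t)"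
          by (subst nn_integral_multc) auto
        also have "\<dots> < \<infinity>" using lf[of "cball 0 r"] by (simp add: ennreal_mult_less_top)
        finally show "(\<integral>\<^sup>+z. ennreal (norm (case_prod h z)) \<partial>(lborel \<Otimes>\<^sub>M lborel)) < \<infinity>" .
      qed simp
      have ftc: "(LINT s|lborel. h x s) = f0 x * (\<theta> x - \<theta> (x + (- t) *\<^sub>R e))" for x
      proof -
        have "(LINT s|lborel. indicator {0..t} s *\<^sub>R D (x + (- s) *\<^sub>R e)) = - \<theta> (x + (- t) *\<^sub>R e) - (- \<theta> (x + (- 0) *\<^sub>R e))"
        proof (rule integral_FTC_Icc[OF t])
          fix s
          have "((\<lambda>s. \<theta> (x + s *\<^sub>R e)) has_vector_derivative D (x + (- s) *\<^sub>R e)) (at (- s))"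
            unfolding e_def D_def by (rule partial_deriv_line) (simp add: \<theta>_def differentiable_bump[OF c])
          moreover have "(uminus has_vector_derivative (- 1 :: real)) (at s)"
            by (auto intro!: derivative_eq_intros)
          ultimately have "((\<lambda>s. \<theta> (x + (- s) *\<^sub>R e)) has_vector_derivative - D (x + (- s) *\<^sub>R e)) (at s)"
            using vector_diff_chain_at[of uminus "- 1" s "\<lambda>s. \<theta> (x + s *\<^sub>R e)"] by (simp add: o_def)
          from has_vector_derivative_minus[OF this]
          show "((\<lambda>s. - \<theta> (x + (- s) *\<^sub>R e)) has_vector_derivative D (x + (- s) *\<^sub>R e)) (at s within {0..t})"
            by (auto intro: has_vector_derivative_at_within)
        next
          show "continuous_on {0..t} (\<lambda>s. D (x + (- s) *\<^sub>R e))"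
            by (intro continuous_on_compose2[OF Dc] continuous_intros) auto
        qed
        thus ?thesis unfolding h_def integral_mult_right_zero by simp
      qed
      have int1: "integrable lborel (\<lambda>x. f0 x * \<theta> (x + y))" for y
      proof -
        have "locally_integrable f0" by (rule locally_integrable_borelI) (use lf in auto)
        hence "integrable lebesgue (\<lambda>x. f0 x * complex_of_real (bump c (a - y) (b - y) x))"
          by (rule locally_integrable_mult_bounded[OF _ compact_cbox[of "a-y" "b-y"], where B=1])
             (auto intro!: measurable_completion simp: bump_bounds[OF c] bump_eq_0 abs_of_nonneg)
        hence "integrable lborel (\<lambda>x. f0 x * complex_of_real (bump c (a - y) (b - y) x))"
          by (subst (asm) integrable_completion) auto
        thus ?thesis unfolding \<theta>_def bump_translate .
      qed
      have "(LINT x|lborel. ?f x * \<theta> x) = (LINT x|lborel. f0 (x + t *\<^sub>R e) * \<theta> x - f0 x * \<theta> x)"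
        by (simp add: algebra_simps)
      also have "\<dots> = (LINT x|lborel. f0 (x + t *\<^sub>R e) * \<theta> x) - (LINT x|lborel. f0 x * \<theta> x)"
        using integrable_lborel_shift[OF int1[of "- t *\<^sub>R e"], of "t *\<^sub>R e"] int1[of 0]
        by (subst Bochner_Integration.integral_diff) auto
      also have "(LINT x|lborel. f0 (x + t *\<^sub>R e) * \<theta> x) = (LINT x|lborel. f0 x * \<theta> (x + (- t) *\<^sub>R e))"
        using integral_lborel_shift[of "\<lambda>x. f0 x * \<theta> (x + (- t) *\<^sub>R e)" "t *\<^sub>R e"] by simp
      also have "\<dots> - (LINT x|lborel. f0 x * \<theta> x) = (LINT x|lborel. f0 x * \<theta> (x + (- t) *\<^sub>R e) - f0 x * \<theta> x)"
        using int1[of "(- t) *\<^sub>R e"] int1[of 0] by (subst Bochner_Integration.integral_diff) auto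
      also have "\<dots> = - (LINT x|lborel. LINT s|lborel. h x s)"
        unfolding ftc by (subst Bochner_Integration.integral_minus[symmetric]) (simp add: algebra_simps)
      also have "(LINT x|lborel. LINT s|lborel. h x s) = (LINT s|lborel. LINT x|lborel. h x s)"
        by (rule lborel_pair.Fubini_integral[OF h_int, symmetric])
      finally have eq: "(LINT x|lborel. ?f x * \<theta> x) = - (LINT s|lborel. LINT x|lborel. h x s)" .
      have "ennreal (norm (LINT x|lborel. ?f x * \<theta> x)) \<le> (\<integral>\<^sup>+s. ennreal (norm (LINT x|lborel. h x s)) \<partial>lborel)"
        unfolding eq norm_minus_cancel by (rule integral_norm_bound_ennreal[OF lborel_pair.integrable_snd[OF h_int]])
      also have "\<dots> \<le> (\<integral>\<^sup>+s. indicator {0..t} s * (\<integral>\<^sup>+x. ennreal (F0 (x + s *\<^sub>R e) * bump c a b x) \<partial>lborel) \<partial>lborel)"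
      proof (intro nn_integral_mono)
        fix s :: real
        show "ennreal (norm (LINT x|lborel. h x s)) \<le> indicator {0..t} s * (\<integral>\<^sup>+x. ennreal (F0 (x + s *\<^sub>R e) * bump c a b x) \<partial>lborel)"
        proof (cases "s \<in> {0..t}")
          case True
          \<comment> \<open>A translate of the derivative is the derivative of the bump on the
            translated box, so that \<open>weak\<close> can be used for every s.\<close>
          have Dshift: "D (x + (- s) *\<^sub>R e) = partial_deriv i (\<lambda>x. complex_of_real (bump c (a + s *\<^sub>R e) (b + s *\<^sub>R e) x)) x" for x
          proof -
            have "(\<theta> has_derivative frechet_derivative \<theta> (at (x + (- s) *\<^sub>R e))) (at (x + (- s) *\<^sub>R e))"
              using differentiable_bump[OF c] frechet_derivative_works unfolding \<theta>_def by blast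
            moreover have "((\<lambda>x. x + (- s) *\<^sub>R e) has_derivative (\<lambda>x. x)) (at x)"
              by (auto intro!: derivative_eq_intros)
            ultimately have "((\<lambda>x. \<theta> (x + (- s) *\<^sub>R e)) has_derivative frechet_derivative \<theta> (at (x + (- s) *\<^sub>R e))) (at x)"
              by (rule has_derivative_compose[rotated])
            from partial_deriv_eqI[OF this, of i] show ?thesis
              unfolding \<theta>_def bump_translate D_def partial_deriv_def by simp
          qed
          have "(LINT x|lborel. h x s) = (LINT x|lborel. f0 x * partial_deriv i (\<lambda>x. complex_of_real (bump c (a + s *\<^sub>R e) (b + s *\<^sub>R e) x)) x)"
            using True unfolding h_def Dshift by simp
          hence "ennreal (norm (LINT x|lborel. h x s)) \<le> (\<integral>\<^sup>+x. ennreal (F0 x * bump c (a + s *\<^sub>R e) (b + s *\<^sub>R e) x) \<partial>lborel)"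
            using weak[OF c] by simp
          also have "\<dots> = (\<integral>\<^sup>+x. ennreal (F0 (x + s *\<^sub>R e) * bump c (a + s *\<^sub>R e) (b + s *\<^sub>R e) (x + s *\<^sub>R e)) \<partial>lborel)"
            by (subst nn_integral_lborel_shift[where F="\<lambda>x. ennreal (F0 x * bump c (a + s *\<^sub>R e) (b + s *\<^sub>R e) x)"]) auto
          finally show ?thesis using True by (simp add: bump_translate)
        qed (simp add: h_def)
      qed
      also have "\<dots> = (\<integral>\<^sup>+s. \<integral>\<^sup>+x. indicator {0..t} s * ennreal (F0 (x + s *\<^sub>R e) * bump c a b x) \<partial>lborel \<partial>lborel)"
        by (subst nn_integral_cmult) auto
      also have "\<dots> = (\<integral>\<^sup>+x. \<integral>\<^sup>+s. indicator {0..t} s * ennreal (F0 (x + s *\<^sub>R e) * bump c a b x) \<partial>lborel \<partial>lborel)"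
        by (rule lborel_pair.Fubini'[symmetric]) measurable
      also have "\<dots> = (\<integral>\<^sup>+x. g x * ennreal (bump c a b x) \<partial>lborel)"
        unfolding g_def
        by (subst nn_integral_multc[symmetric])
           (auto simp: ennreal_mult mult.assoc F0_nonneg bump_bounds[OF c] intro!: nn_integral_cong)
      also have "\<dots> = (\<integral>\<^sup>+x. ennreal (?g x * bump c a b x) \<partial>lborel)"
        by (rule nn_integral_cong_AE, use g_AE in eventually_elim)
           (simp add: ennreal_mult bump_bounds[OF c])
      also have "\<dots> = ennreal (LINT x|lborel. ?g x * bump c a b x)"
      proof (rule nn_integral_eq_integral)
        have "integrable lebesgue (\<lambda>x. ?g x * bump c a b x)"
          by (rule locally_integrable_mult_bounded[OF lg compact_cbox[of a b], where B=1])
             (auto intro!: measurable_completion simp: bump_bounds[OF c] bump_eq_0 abs_of_nonneg)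
        thus "integrable lborel (\<lambda>x. ?g x * bump c a b x)" by (subst (asm) integrable_completion) auto
      qed (simp add: bump_bounds[OF c])
      finally have "norm (LINT x|lborel. ?f x * \<theta> x) \<le> (LINT x|lborel. ?g x * bump c a b x)"
        by (subst (asm) ennreal_le_iff) (auto intro!: integral_nonneg_AE simp: bump_bounds[OF c])
      thus "norm (LINT x|lebesgue. ?f x * of_real (bump c a b x)) \<le> (LINT x|lebesgue. ?g x * bump c a b x)"
        unfolding \<theta>_def by (simp add: integral_completion)
    qed
    hence "AE x in lborel. norm (?f x) \<le> ?g x"
      by (simp add: AE_completion_iff)
    thus ?thesis using g_AE
    proof eventually_elim
      case (elim x)
      hence "ennreal (norm (?f x)) \<le> g x" by (metis ennreal_enn2real ennreal_leI infinity_ennreal_def)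
      thus ?case unfolding g_def e_def .
    qed
  qed
  show ?thesis unfolding upper_gradient_def
  proof (intro conjI allI)
    fix i and t :: real
    let ?e = "axis i 1 :: real^'n"
    show "AE x in lborel. ennreal (norm (f0 (x + t *\<^sub>R ?e) - f0 x))
        \<le> (\<integral>\<^sup>+s. indicator (closed_segment 0 t) s * ennreal (F0 (x + s *\<^sub>R ?e)) \<partial>lborel)"
    proof (cases "t \<ge> 0")
      case True
      thus ?thesis using pos[OF True, of i] by (simp add: closed_segment_eq_real_ivl)
    next
      case False
      hence "- t \<ge> 0" by simp
      \<comment> \<open>For negative t start from the other endpoint and run the segment
        backwards.\<close>
      from AE_lborel_shift[OF pos[OF this, of i], of "t *\<^sub>R ?e"]
      show ?thesis
      proof (rule eventually_mono)
        fix x assume *: "ennreal (norm (f0 (x + t *\<^sub>R ?e + (- t) *\<^sub>R ?e) - f0 (x + t *\<^sub>R ?e)))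
          \<le> (\<integral>\<^sup>+s. indicator {0..- t} s * ennreal (F0 (x + t *\<^sub>R ?e + s *\<^sub>R ?e)) \<partial>lborel)"
        have "(\<integral>\<^sup>+s. indicator {t..0} s * ennreal (F0 (x + s *\<^sub>R ?e)) \<partial>lborel)
          = (\<integral>\<^sup>+s. indicator {t..0} (s + t) * ennreal (F0 (x + (s + t) *\<^sub>R ?e)) \<partial>lborel)"
          by (subst nn_integral_lborel_shift[where F="\<lambda>s. indicator {t..0} s * ennreal (F0 (x + s *\<^sub>R ?e))"]) auto
        also have "\<dots> = (\<integral>\<^sup>+s. indicator {0..- t} s * ennreal (F0 (x + t *\<^sub>R ?e + s *\<^sub>R ?e)) \<partial>lborel)"
          by (intro nn_integral_cong) (auto simp: indicator_def algebra_simps)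
        finally show "ennreal (norm (f0 (x + t *\<^sub>R ?e) - f0 x))
            \<le> (\<integral>\<^sup>+s. indicator (closed_segment 0 t) s * ennreal (F0 (x + s *\<^sub>R ?e)) \<partial>lborel)"
          using * False by (simp add: closed_segment_eq_real_ivl norm_minus_commute)
      qed
    qed
  qed measurable
qed

section \<open>Jumps along coordinate paths in a cube\<close>

text \<open>Half-open, so that the dyadic cubes of one generation partition the space.\<close>

definition hbox :: "real^'n \<Rightarrow> real^'n \<Rightarrow> (real^'n::finite) set" where
  "hbox a b = {x. \<forall>i. a $ i \<le> x $ i \<and> x $ i < b $ i}"

lemma sets_closed_segment [measurable]: "closed_segment a (b::real) \<in> sets borel"
  by (simp add: closed_segment_eq_real_ivl)

lemma sets_hbox [measurable, simp]: "hbox a b \<in> sets borel"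
  unfolding hbox_def by measurable

lemma emeasure_hbox:
  fixes a b :: "real^'n::finite"
  assumes "\<And>i. a $ i \<le> b $ i"
  shows "emeasure lborel (hbox a b) = ennreal (\<Prod>i\<in>UNIV. b $ i - a $ i)"
proof -
  have ne: "cbox a b \<noteq> {}" using assms by (auto simp: interval_ne_empty_cart)
  have "emeasure lborel (box a b) = emeasure lborel (cbox a b)"
    by (metis emeasure_lborel_box_eq emeasure_lborel_cbox_eq)
  moreover have "emeasure lborel (cbox a b) = ennreal (\<Prod>i\<in>UNIV. b $ i - a $ i)"
    using content_cbox_cart[OF ne] emeasure_eq_ennreal_measure[of lborel "cbox a b"]
      emeasure_lborel_cbox_finite[of a b] by simp
  moreover have "emeasure lborel (box a b) \<le> emeasure lborel (hbox a b)"
    by (intro emeasure_mono) (auto simp: hbox_def mem_box_cart less_imp_le)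
  moreover have "emeasure lborel (hbox a b) \<le> emeasure lborel (cbox a b)"
    by (intro emeasure_mono) (auto simp: hbox_def mem_box_cart less_imp_le)
  ultimately show ?thesis by simp
qed

abbreviation hcube :: "real^'n \<Rightarrow> real \<Rightarrow> (real^'n::finite) set" where
  "hcube a r \<equiv> hbox a (\<chi> i. a $ i + r)"

lemma emeasure_hcube: "r \<ge> 0 \<Longrightarrow> emeasure lborel (hcube (a::real^'n::finite) r) = ennreal (r ^ CARD('n))"
  by (subst emeasure_hbox) auto

text \<open>The corners of the path from x to x + h, relative to x: step k starts after the
  coordinates in \<open>take k is\<close> have been moved and moves coordinate
  \<open>is ! k\<close>.\<close>

definition partial_shift :: "'n list \<Rightarrow> real^'n \<Rightarrow> nat \<Rightarrow> real^'n::finite" where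
  "partial_shift is h k = (\<chi> i. if i \<in> set (take k is) then h $ i else 0)"

abbreviation step_integral :: "(real^'n \<Rightarrow> ennreal) \<Rightarrow> 'n list \<Rightarrow> real^'n \<Rightarrow> real^'n::finite \<Rightarrow> nat \<Rightarrow> ennreal" where
  "step_integral F is h x k \<equiv> (\<integral>\<^sup>+s. indicator (closed_segment 0 (h $ (is ! k))) s
     * F (x + partial_shift is h k + s *\<^sub>R axis (is ! k) 1) \<partial>lborel)"

lemma partial_shift_0 [simp]: "partial_shift is h 0 = 0"
  by (simp add: partial_shift_def vec_eq_iff)

lemma partial_shift_Suc:
  assumes "distinct is" "k < length is"
  shows "partial_shift is h (Suc k) = partial_shift is h k + (h $ (is ! k)) *\<^sub>R axis (is ! k) 1"
proof -
  have "is ! k \<notin> set (take k is)"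
    using assms by (auto simp: in_set_conv_nth nth_eq_iff_index_eq)
  thus ?thesis using assms(2)
    by (auto simp: partial_shift_def vec_eq_iff axis_def take_Suc_conv_app_nth)
qed

lemma partial_shift_full: "set is = UNIV \<Longrightarrow> partial_shift is h (length is) = h"
  by (simp add: partial_shift_def vec_eq_iff)

text \<open>For fixed h all corners are fixed translates of x, so the exceptional sets are finitely
  many translated null sets.\<close>

lemma partial_shift_AE:
  fixes u :: "real^'n::finite \<Rightarrow> real"
  assumes "upper_gradient u F" "distinct is"
  shows "AE x in lborel. \<forall>k<length is. ennreal (norm (u (x + partial_shift is h (Suc k)) - u (x + partial_shift is h k)))
     \<le> step_integral F is h x k"
proof -
  have "AE x in lborel. k < length is \<longrightarrow> ennreal (norm (u (x + partial_shift is h (Suc k)) - u (x + partial_shift is h k)))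
     \<le> step_integral F is h x k" for k
  proof (cases "k < length is")
    case True
    from assms(1) have "AE x in lborel. ennreal (norm (u (x + (h $ (is ! k)) *\<^sub>R axis (is ! k) 1) - u x))
        \<le> (\<integral>\<^sup>+s. indicator (closed_segment 0 (h $ (is ! k))) s * F (x + s *\<^sub>R axis (is ! k) 1) \<partial>lborel)"
      unfolding upper_gradient_def by blast
    from AE_lborel_shift[OF this, of "partial_shift is h k"] show ?thesis
      using True assms(2) by (simp add: partial_shift_Suc add.assoc)
  qed simp
  thus ?thesis by (simp add: AE_all_countable)
qed

lemma path_in_hcube:
  fixes x h :: "real^'n::finite"
  assumes "x \<in> hbox a b" "x + h \<in> hbox a b" "distinct is" "k < length is" "s \<in> closed_segment 0 (h $ (is ! k))"
  shows "x + partial_shift is h k + s *\<^sub>R axis (is ! k) 1 \<in> hbox a b"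
proof -
  have nk: "is ! k \<notin> set (take k is)"
    using assms(3,4) by (auto simp: in_set_conv_nth nth_eq_iff_index_eq)
  have "a $ i \<le> (x + partial_shift is h k + s *\<^sub>R axis (is ! k) 1) $ i \<and>
     (x + partial_shift is h k + s *\<^sub>R axis (is ! k) 1) $ i < b $ i" for i
  proof -
    have "a $ i \<le> x $ i" "x $ i < b $ i" "a $ i \<le> x $ i + h $ i" "x $ i + h $ i < b $ i"
      using assms(1,2) by (auto simp: hbox_def)
    moreover have "min 0 (h $ (is ! k)) \<le> s" "s \<le> max 0 (h $ (is ! k))"
      using assms(5) by (auto simp: closed_segment_eq_real_ivl split: if_splits)
    ultimately show ?thesis using nk by (auto simp: partial_shift_def axis_def min_def max_def split: if_splits)
  qed
  thus ?thesis by (simp add: hbox_def)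
qed

lemma norm_sum_steps:
  fixes g :: "nat \<Rightarrow> real"
  shows "ennreal (norm (g m - g 0)) \<le> (\<Sum>k<m. ennreal (norm (g (Suc k) - g k)))"
proof -
  have "norm (g m - g 0) \<le> (\<Sum>k<m. norm (g (Suc k) - g k))"
    using norm_sum[of "\<lambda>k. g (Suc k) - g k" "{..<m}"] by (simp add: sum_lessThan_telescope)
  thus ?thesis by (subst sum_ennreal) (auto intro: ennreal_leI)
qed

text \<open>Pairs of points of a cube are joined by moving one coordinate at a time, so that only
  translations are needed to integrate over all pairs.\<close>

lemma pairs_integral_le:
  fixes q :: "real^'n::finite" and \<Phi> :: "real^'n \<Rightarrow> real^'n \<Rightarrow> ennreal"
  assumes l: "l > 0" and isd: "distinct is" "set is = UNIV"
    and \<Phi> [measurable]: "case_prod \<Phi> \<in> borel_measurable (lborel \<Otimes>\<^sub>M lborel)"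
    and supp: "\<And>x y. \<Phi> x y \<noteq> 0 \<Longrightarrow> x \<in> hcube q l \<and> y \<in> hcube q l"
    and W [measurable]: "\<And>i. W i \<in> borel_measurable borel" and G [measurable]: "G \<in> borel_measurable borel"
    and le: "\<And>h. AE x in lborel. \<Phi> x (x + h) \<le> (\<Sum>k<length is. W (is ! k) (x + partial_shift is h k) + step_integral G is h x k)"
  shows "(\<integral>\<^sup>+x. \<integral>\<^sup>+y. \<Phi> x y \<partial>lborel \<partial>lborel)
     \<le> ennreal ((2 * l) ^ CARD('n)) * (\<Sum>i\<in>UNIV. (\<integral>\<^sup>+x. W i x \<partial>lborel) + ennreal l * (\<integral>\<^sup>+x. G x \<partial>lborel))"
proof -
  define S where "S = (\<Sum>i\<in>UNIV. (\<integral>\<^sup>+x. W i x \<partial>lborel) + ennreal l * (\<integral>\<^sup>+x. G x \<partial>lborel))"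
  \<comment> \<open>Differences of two points of the cube lie in this cube of side 2l. Its volume is
    the factor in the bound.\<close>
  define C :: "(real^'n) set" where "C = cbox (\<chi> i. - l) (\<chi> i. l)"
  have C: "emeasure lborel C = ennreal ((2 * l) ^ CARD('n))"
  proof -
    have "C \<noteq> {}" unfolding C_def using l by (auto simp: interval_ne_empty_cart)
    hence "measure lborel C = (2 * l) ^ CARD('n)" unfolding C_def
      by (subst content_cbox_cart) auto
    thus ?thesis using emeasure_eq_ennreal_measure[of lborel C]
      emeasure_lborel_cbox_finite[of "\<chi> i. - l" "(\<chi> i. l) :: real^'n"] by (simp add: C_def)
  qed
  \<comment> \<open>Substitute y = x + h and exchange the integrals, so that h is fixed while x runs
    through the space. Then \<open>le\<close> applies and every corner is a translate of x.\<close>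
  have "(\<integral>\<^sup>+x. \<integral>\<^sup>+y. \<Phi> x y \<partial>lborel \<partial>lborel) = (\<integral>\<^sup>+x. \<integral>\<^sup>+h. \<Phi> x (h + x) \<partial>lborel \<partial>lborel)"
    by (rule nn_integral_cong, rule nn_integral_lborel_shift[symmetric]) measurable
  also have "\<dots> = (\<integral>\<^sup>+h. \<integral>\<^sup>+x. \<Phi> x (h + x) \<partial>lborel \<partial>lborel)"
    by (rule lborel_pair.Fubini'[symmetric]) measurable
  also have "\<dots> \<le> (\<integral>\<^sup>+h. S * indicator C h \<partial>lborel)"
  proof (intro nn_integral_mono)
    fix h :: "real^'n"
    show "(\<integral>\<^sup>+x. \<Phi> x (h + x) \<partial>lborel) \<le> S * indicator C h"
    proof (cases "h \<in> C")
      case False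
      have "\<Phi> x (h + x) = 0" for x
      proof (rule ccontr)
        assume "\<Phi> x (h + x) \<noteq> 0"
        from supp[OF this] have "\<bar>h $ i\<bar> \<le> l" for i
          by (auto simp: hbox_def abs_le_iff dest!: spec[of _ i])
        thus False using False by (auto simp: C_def mem_box_cart abs_le_iff)
           (metis abs_le_iff minus_le_iff)
      qed
      thus ?thesis by simp
    next
      case True
      have hb: "\<bar>h $ i\<bar> \<le> l" for i using True by (auto simp: C_def mem_box_cart abs_le_iff) (metis minus_le_iff)
      have "(\<integral>\<^sup>+x. \<Phi> x (h + x) \<partial>lborel) \<le> (\<integral>\<^sup>+x. (\<Sum>k<length is. W (is ! k) (x + partial_shift is h k) + step_integral G is h x k) \<partial>lborel)"
        using le[of h] by (intro nn_integral_mono_AE) (simp add: add.commute)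
      also have "\<dots> = (\<Sum>k<length is. (\<integral>\<^sup>+x. W (is ! k) (x + partial_shift is h k) \<partial>lborel)
       + (\<integral>\<^sup>+x. \<integral>\<^sup>+s. indicator (closed_segment 0 (h $ (is ! k))) s * G (x + partial_shift is h k + s *\<^sub>R axis (is ! k) 1) \<partial>lborel \<partial>lborel))"
      proof -
        have m1: "(\<lambda>x. W (is ! k) (x + partial_shift is h k)) \<in> borel_measurable lborel" for k by measurable
        have m2: "(\<lambda>x. \<integral>\<^sup>+s. indicator (closed_segment 0 (h $ (is ! k))) s * G (x + partial_shift is h k + s *\<^sub>R axis (is ! k) 1) \<partial>lborel)
          \<in> borel_measurable lborel" for k by measurable
        show ?thesis using m1 m2 by (simp add: nn_integral_sum nn_integral_add)
      qed
      also have "\<dots> \<le> (\<Sum>k<length is. (\<integral>\<^sup>+x. W (is ! k) x \<partial>lborel) + ennreal l * (\<integral>\<^sup>+x. G x \<partial>lborel))"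
      proof (intro sum_mono add_mono)
        fix k
        show "(\<integral>\<^sup>+x. W (is ! k) (x + partial_shift is h k) \<partial>lborel) \<le> (\<integral>\<^sup>+x. W (is ! k) x \<partial>lborel)"
          by (subst nn_integral_lborel_shift) auto
        let ?h = "h $ (is ! k)"
        have "(\<integral>\<^sup>+x. \<integral>\<^sup>+s. indicator (closed_segment 0 ?h) s * G (x + partial_shift is h k + s *\<^sub>R axis (is ! k) 1) \<partial>lborel \<partial>lborel)
          = (\<integral>\<^sup>+s. \<integral>\<^sup>+x. indicator (closed_segment 0 ?h) s * G (x + partial_shift is h k + s *\<^sub>R axis (is ! k) 1) \<partial>lborel \<partial>lborel)"
          by (rule lborel_pair.Fubini') measurable
        also have "\<dots> = (\<integral>\<^sup>+s. indicator (closed_segment 0 ?h) s * (\<integral>\<^sup>+x. G x \<partial>lborel) \<partial>lborel)"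
        proof (intro nn_integral_cong)
          fix s :: real
          have "(\<integral>\<^sup>+x. G (x + partial_shift is h k + s *\<^sub>R axis (is ! k) 1) \<partial>lborel) = (\<integral>\<^sup>+x. G x \<partial>lborel)"
            using nn_integral_lborel_shift[OF G, of "partial_shift is h k + s *\<^sub>R axis (is ! k) 1"] by (simp add: add.assoc)
          thus "(\<integral>\<^sup>+x. indicator (closed_segment 0 ?h) s * G (x + partial_shift is h k + s *\<^sub>R axis (is ! k) 1) \<partial>lborel)
            = indicator (closed_segment 0 ?h) s * (\<integral>\<^sup>+x. G x \<partial>lborel)"
            by (subst nn_integral_cmult) auto
        qed
        also have "\<dots> = emeasure lborel (closed_segment 0 ?h) * (\<integral>\<^sup>+x. G x \<partial>lborel)"
          by (subst nn_integral_multc) (auto simp: closed_segment_eq_real_ivl)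
        also have "\<dots> \<le> ennreal l * (\<integral>\<^sup>+x. G x \<partial>lborel)"
          using hb[of "is ! k"] by (intro mult_right_mono) (auto simp: closed_segment_eq_real_ivl intro!: ennreal_leI)
        finally show "(\<integral>\<^sup>+x. \<integral>\<^sup>+s. indicator (closed_segment 0 ?h) s * G (x + partial_shift is h k + s *\<^sub>R axis (is ! k) 1) \<partial>lborel \<partial>lborel)
          \<le> ennreal l * (\<integral>\<^sup>+x. G x \<partial>lborel)" .
      qed
      also have "\<dots> = (\<Sum>i\<leftarrow>is. (\<integral>\<^sup>+x. W i x \<partial>lborel) + ennreal l * (\<integral>\<^sup>+x. G x \<partial>lborel))"
        by (simp add: sum_list_sum_nth atLeast0LessThan)
      also have "\<dots> = S" unfolding S_def
        using isd by (simp add: sum_list_distinct_conv_sum_set)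
      finally show ?thesis using True by simp
    qed
  qed
  also have "\<dots> = S * ennreal ((2 * l) ^ CARD('n))"
    using C by (subst nn_integral_cmult_indicator) (auto simp: C_def)
  finally show ?thesis unfolding S_def by (simp add: mult.commute)
qed

lemma pairs_poincare:
  fixes q :: "real^'n::finite" and u :: "real^'n \<Rightarrow> real"
  assumes l: "l > 0" and ug: "upper_gradient u F"
  shows "(\<integral>\<^sup>+x\<in>hcube q l. \<integral>\<^sup>+y\<in>hcube q l. ennreal \<bar>u x - u y\<bar> \<partial>lborel \<partial>lborel)
     \<le> ennreal ((2 * l) ^ CARD('n) * (real CARD('n) * l)) * (\<integral>\<^sup>+x\<in>hcube q l. F x \<partial>lborel)"
proof -
  have [measurable]: "u \<in> borel_measurable borel" "F \<in> borel_measurable borel"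
    using ug unfolding upper_gradient_def by auto
  obtain "is" :: "'n list" where isd: "distinct is" "set is = UNIV"
    using finite_distinct_list[OF finite_class.finite_UNIV] by blast
  let ?Q = "hcube q l"
  let ?\<Phi> = "\<lambda>x y. ennreal \<bar>u x - u y\<bar> * indicator ?Q y * indicator ?Q x"
  let ?G = "\<lambda>x. F x * indicator ?Q x"
  have "(\<integral>\<^sup>+x. \<integral>\<^sup>+y. ?\<Phi> x y \<partial>lborel \<partial>lborel) \<le> ennreal ((2 * l) ^ CARD('n)) *
      (\<Sum>i\<in>(UNIV::'n set). (\<integral>\<^sup>+x. 0 \<partial>(lborel::(real^'n) measure)) + ennreal l * (\<integral>\<^sup>+x. ?G x \<partial>lborel))"
  proof (rule pairs_integral_le[OF l isd])
    fix h :: "real^'n"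
    show "AE x in lborel. ?\<Phi> x (x + h) \<le> (\<Sum>k<length is. 0 + step_integral ?G is h x k)"
      using partial_shift_AE[OF ug isd(1), of h]
    proof eventually_elim
      case (elim x)
      show ?case
      proof (cases "x \<in> ?Q \<and> x + h \<in> ?Q")
        case True
        have "?\<Phi> x (x + h) = ennreal (norm (u (x + partial_shift is h (length is)) - u (x + partial_shift is h 0)))"
          using True isd by (simp add: partial_shift_full abs_minus_commute)
        also have "\<dots> \<le> (\<Sum>k<length is. ennreal (norm (u (x + partial_shift is h (Suc k)) - u (x + partial_shift is h k))))"
          by (rule norm_sum_steps)
        also have "\<dots> \<le> (\<Sum>k<length is. 0 + step_integral ?G is h x k)"
        proof (rule sum_mono)
          fix k assume k: "k \<in> {..<length is}"
          have "step_integral F is h x k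
            = step_integral ?G is h x k"
            using path_in_hcube[of x q _ h "is" k] True isd(1) k
            by (intro nn_integral_cong) (auto simp: indicator_def)
          thus "ennreal (norm (u (x + partial_shift is h (Suc k)) - u (x + partial_shift is h k))) \<le> 0 + step_integral ?G is h x k"
            using elim[rule_format, of k] k by simp
        qed
        finally show ?thesis .
      qed auto
    qed
  qed (auto simp: indicator_def split: if_splits)
  also have "\<dots> = ennreal ((2 * l) ^ CARD('n) * (real CARD('n) * l)) * (\<integral>\<^sup>+x. ?G x \<partial>lborel)"
    using l by (simp add: ennreal_mult ennreal_of_nat_eq_real_of_nat mult.assoc)
  finally show ?thesis by (simp add: nn_integral_multc)
qed

text \<open>These are the points of the cube whose line in direction i runs through the shadow of a
  cube of side r at p. The exponent n - 1 is why holes are measured by the (n-1)-st power of their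
  side throughout.\<close>

lemma emeasure_line_hits:
  fixes q p :: "real^'n::finite"
  assumes "l \<ge> 0" "r \<ge> 0"
  shows "emeasure lborel {z \<in> hcube q l. \<forall>j. j \<noteq> i \<longrightarrow> p $ j \<le> z $ j \<and> z $ j < p $ j + r}
     \<le> ennreal (l * r ^ (CARD('n) - 1))"
proof -
  let ?a = "\<chi> j. if j = i then q $ j else p $ j" and ?b = "\<chi> j. if j = i then q $ j + l else p $ j + r"
  have "emeasure lborel {z \<in> hcube q l. \<forall>j. j \<noteq> i \<longrightarrow> p $ j \<le> z $ j \<and> z $ j < p $ j + r}
     \<le> emeasure lborel (hbox ?a ?b)"
    by (rule emeasure_mono) (auto simp: hbox_def)
  also have "\<dots> = ennreal (\<Prod>j\<in>UNIV. ?b $ j - ?a $ j)"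
    using assms by (subst emeasure_hbox) auto
  also have "(\<Prod>j\<in>UNIV. ?b $ j - ?a $ j) = (\<Prod>j\<in>UNIV. if j = i then l else r)"
    by (intro prod.cong) auto
  also have "\<dots> = l * r ^ (CARD('n) - 1)"
    by (subst prod.remove[of _ i]) (auto simp: card_Diff_singleton)
  finally show ?thesis .
qed

text \<open>For x in A and y in B the path either meets a hole or avoids all of them. In the first
  case the value t is charged to a corner whose line meets the shadow of the hole, in the second to
  the line integrals of F outside the holes. \<open>pairs_integral_le\<close> integrates both
  charges.\<close>

lemma jump_with_holes:
  fixes q :: "real^'n::finite" and u :: "real^'n \<Rightarrow> real" and p :: "'k \<Rightarrow> real^'n"
  assumes l: "l > 0" and ug: "upper_gradient u F" and I: "finite I" and r: "\<And>k. k \<in> I \<Longrightarrow> r k \<ge> 0"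
    and A [measurable]: "A \<in> sets borel" and B [measurable]: "B \<in> sets borel" and AB: "A \<subseteq> hcube q l" "B \<subseteq> hcube q l"
    and t: "t \<ge> 0" and jump: "\<And>x y. x \<in> A \<Longrightarrow> y \<in> B \<Longrightarrow> t \<le> \<bar>u x - u y\<bar>"
  shows "ennreal t * (emeasure lborel A * emeasure lborel B) \<le> ennreal ((2 * l) ^ CARD('n) * (real CARD('n) * l)) *
     (ennreal (t * (\<Sum>k\<in>I. r k ^ (CARD('n) - 1))) + (\<integral>\<^sup>+x\<in>hcube q l - (\<Union>k\<in>I. hcube (p k) (r k)). F x \<partial>lborel))"
proof -
  have [measurable]: "u \<in> borel_measurable borel" "F \<in> borel_measurable borel"
    using ug unfolding upper_gradient_def by auto
  obtain "is" :: "'n list" where isd: "distinct is" "set is = UNIV"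
    using finite_distinct_list[OF finite_class.finite_UNIV] by blast
  let ?Q = "hcube q l"
  define H where "H = (\<Union>k\<in>I. hcube (p k) (r k))"
  have [measurable]: "H \<in> sets borel" unfolding H_def using I by (intro sets.finite_UN) auto
  let ?\<Phi> = "\<lambda>x y. ennreal t * indicator B y * indicator A x"
  let ?G = "\<lambda>x. F x * indicator (?Q - H) x"
  define T where "T k i = {z \<in> ?Q. \<forall>j. j \<noteq> i \<longrightarrow> p k $ j \<le> z $ j \<and> z $ j < p k $ j + r k}" for k i
  have T [measurable]: "T k i \<in> sets borel" for k i unfolding T_def hbox_def by measurable
  let ?W = "\<lambda>i x. \<Sum>k\<in>I. ennreal t * indicator (T k i) x"
  have "ennreal t * (emeasure lborel A * emeasure lborel B) = (\<integral>\<^sup>+x. \<integral>\<^sup>+y. ?\<Phi> x y \<partial>lborel \<partial>lborel)"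
    by (simp add: nn_integral_cmult nn_integral_multc mult_ac)
  also have "\<dots> \<le> ennreal ((2 * l) ^ CARD('n)) *
      (\<Sum>i\<in>(UNIV::'n set). (\<integral>\<^sup>+x. ?W i x \<partial>lborel) + ennreal l * (\<integral>\<^sup>+x. ?G x \<partial>lborel))"
  proof (rule pairs_integral_le[OF l isd])
    fix h :: "real^'n"
    show "AE x in lborel. ?\<Phi> x (x + h) \<le> (\<Sum>k<length is. ?W (is ! k) (x + partial_shift is h k) + step_integral ?G is h x k)"
      using partial_shift_AE[OF ug isd(1), of h]
    proof eventually_elim
      case (elim x)
      show ?case
      proof (cases "x \<in> A \<and> x + h \<in> B")
        case True
        hence xQ: "x \<in> ?Q" "x + h \<in> ?Q" using AB by auto
        show ?thesis
        proof (cases "\<exists>j<length is. \<exists>s\<in>closed_segment 0 (h $ (is ! j)). x + partial_shift is h j + s *\<^sub>R axis (is ! j) 1 \<in> H")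
          case hit: True
          then obtain j s k where j: "j < length is" "k \<in> I"
            "x + partial_shift is h j + s *\<^sub>R axis (is ! j) 1 \<in> hcube (p k) (r k)"
            unfolding H_def by blast
          have "x + partial_shift is h j + 0 *\<^sub>R axis (is ! j) 1 \<in> ?Q"
            by (rule path_in_hcube[OF xQ isd(1) j(1)]) simp
          \<comment> \<open>The corner and the point where the hole is hit differ only in the
            coordinate moved by this step, and membership in \<open>T\<close> does not constrain
            that coordinate beyond the cube.\<close>
          hence "x + partial_shift is h j \<in> T k (is ! j)"
            using j(3) unfolding T_def by (auto simp: hbox_def axis_def split: if_splits)
          hence "ennreal t \<le> ennreal t * indicator (T k (is ! j)) (x + partial_shift is h j)" by simp
          also have "\<dots> \<le> ?W (is ! j) (x + partial_shift is h j)"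
            by (rule member_le_sum[of k I "\<lambda>k. ennreal t * indicator (T k (is ! j)) (x + partial_shift is h j)"]) (use I j in auto)
          also have "\<dots> \<le> ?W (is ! j) (x + partial_shift is h j)
       + (\<integral>\<^sup>+s. indicator (closed_segment 0 (h $ (is ! j))) s * ?G (x + partial_shift is h j + s *\<^sub>R axis (is ! j) 1) \<partial>lborel)"
            by simp
          also have "\<dots> \<le> (\<Sum>k<length is. ?W (is ! k) (x + partial_shift is h k) + step_integral ?G is h x k)"
            by (rule member_le_sum[where f="\<lambda>k. ?W (is ! k) (x + partial_shift is h k) + step_integral ?G is h x k"])
               (use j in auto)
          finally show ?thesis using True by simp
        next
          case nohit: False
          have "?\<Phi> x (x + h) \<le> ennreal (norm (u (x + partial_shift is h (length is)) - u (x + partial_shift is h 0)))"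
            using True isd jump[of x "x + h"] by (simp add: partial_shift_full abs_minus_commute ennreal_leI)
          also have "\<dots> \<le> (\<Sum>k<length is. ennreal (norm (u (x + partial_shift is h (Suc k)) - u (x + partial_shift is h k))))"
            by (rule norm_sum_steps)
          also have "\<dots> \<le> (\<Sum>k<length is. ?W (is ! k) (x + partial_shift is h k) + step_integral ?G is h x k)"
          proof (rule sum_mono)
            fix k assume k: "k \<in> {..<length is}"
            have "step_integral F is h x k
              = step_integral ?G is h x k"
              using path_in_hcube[OF xQ isd(1), of k] nohit k
              by (intro nn_integral_cong) (auto simp: indicator_def)
            thus "ennreal (norm (u (x + partial_shift is h (Suc k)) - u (x + partial_shift is h k))) \<le> ?W (is ! k) (x + partial_shift is h k)
         + step_integral ?G is h x k"
              using elim[rule_format, of k] k by (simp add: add_increasing)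
          qed
          finally show ?thesis .
        qed
      qed (auto simp: indicator_def)
    qed
  qed (use AB in \<open>auto simp: indicator_def split: if_splits\<close>)
  also have "\<dots> \<le> ennreal ((2 * l) ^ CARD('n)) *
      (\<Sum>i\<in>(UNIV::'n set). ennreal l * (ennreal (t * (\<Sum>k\<in>I. r k ^ (CARD('n) - 1))) + (\<integral>\<^sup>+x. ?G x \<partial>lborel)))"
  proof (intro mult_left_mono sum_mono)
    fix i :: 'n
    have "(\<integral>\<^sup>+x. ?W i x \<partial>lborel) = (\<Sum>k\<in>I. ennreal t * emeasure lborel (T k i))"
      by (subst nn_integral_sum) (auto simp: nn_integral_cmult)
    also have "\<dots> \<le> (\<Sum>k\<in>I. ennreal t * ennreal (l * r k ^ (CARD('n) - 1)))"
      using l r unfolding T_def by (intro sum_mono mult_left_mono emeasure_line_hits) auto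
    also have "\<dots> = (\<Sum>k\<in>I. ennreal (l * (t * r k ^ (CARD('n) - 1))))"
      using l t r by (intro sum.cong) (auto simp: ennreal_mult[symmetric] mult_ac)
    also have "\<dots> = ennreal (\<Sum>k\<in>I. l * (t * r k ^ (CARD('n) - 1)))"
      using l t r by (intro sum_ennreal) auto
    also have "\<dots> = ennreal l * ennreal (t * (\<Sum>k\<in>I. r k ^ (CARD('n) - 1)))"
      using l t r by (subst ennreal_mult[symmetric]) (auto intro!: sum_nonneg mult_nonneg_nonneg simp: sum_distrib_left)
    finally show "(\<integral>\<^sup>+x. ?W i x \<partial>lborel) + ennreal l * (\<integral>\<^sup>+x. ?G x \<partial>lborel)
       \<le> ennreal l * (ennreal (t * (\<Sum>k\<in>I. r k ^ (CARD('n) - 1))) + (\<integral>\<^sup>+x. ?G x \<partial>lborel))"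
      by (simp add: distrib_left add_right_mono)
  qed simp
  also have "\<dots> = ennreal ((2 * l) ^ CARD('n) * (real CARD('n) * l)) *
     (ennreal (t * (\<Sum>k\<in>I. r k ^ (CARD('n) - 1))) + (\<integral>\<^sup>+x. ?G x \<partial>lborel))"
    using l by (simp add: ennreal_mult ennreal_of_nat_eq_real_of_nat mult.assoc)
  finally show ?thesis unfolding H_def by simp
qed

section \<open>Dyadic cubes and medians\<close>

text \<open>The cube 2^(-j) (k + [0,1)^n) for the pair (j, k). With floors, uniqueness within a
  generation is immediate and nesting becomes integer division.\<close>

definition dy :: "nat \<times> (int^'n) \<Rightarrow> (real^'n::finite) set" where
  "dy P = {x. \<forall>i. \<lfloor>2 ^ fst P * x $ i\<rfloor> = snd P $ i}"

abbreviation side :: "nat \<times> (int^'n) \<Rightarrow> real" where "side P \<equiv> (1/2) ^ fst P"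

text \<open>Subtraction of naturals truncates, so this is the cube m generations up only if
  \<open>m \<le> fst P\<close>.\<close>

definition ancestor :: "nat \<Rightarrow> nat \<times> (int^'n) \<Rightarrow> nat \<times> (int^'n::finite)" where
  "ancestor m P = (fst P - m, \<chi> i. snd P $ i div 2 ^ m)"

definition descendants :: "nat \<Rightarrow> nat \<times> (int^'n) \<Rightarrow> (nat \<times> (int^'n::finite)) set" where
  "descendants m Q = {P. fst P = fst Q + m \<and> ancestor m P = Q}"

lemma fst_ancestor [simp]: "fst (ancestor m P) = fst P - m"
  by (simp add: ancestor_def)

lemma dy_eq_hcube: "dy P = hcube (\<chi> i. real_of_int (snd P $ i) / 2 ^ fst P) (side P)"
  by (auto simp: dy_def hbox_def floor_eq_iff field_simps power_divide)

lemma sets_dy [measurable, simp]: "dy P \<in> sets borel"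
  unfolding dy_eq_hcube by measurable

lemma emeasure_dy: "emeasure lborel (dy (P :: nat \<times> (int^'n::finite))) = ennreal (side P ^ CARD('n))"
  unfolding dy_eq_hcube by (rule emeasure_hcube) simp

lemma dy_nonempty: "dy P \<noteq> {}"
proof -
  have "(\<chi> i. real_of_int (snd P $ i) / 2 ^ fst P) \<in> dy P" by (simp add: dy_def)
  thus ?thesis by blast
qed

lemma dy_ancestor:
  assumes "m \<le> fst P" shows "dy P \<subseteq> dy (ancestor m P)"
proof
  fix x assume x: "x \<in> dy P"
  have "\<lfloor>2 ^ (fst P - m) * x $ i\<rfloor> = snd P $ i div 2 ^ m" for i
  proof -
    have "2 ^ (fst P - m) * x $ i = (2 ^ fst P * x $ i) / real_of_int (2 ^ m)"
      using assms by (simp add: power_diff)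
    also have "\<lfloor>\<dots>\<rfloor> = \<lfloor>2 ^ fst P * x $ i\<rfloor> div 2 ^ m" by (rule floor_divide_real_eq_div) simp
    finally show ?thesis using x by (simp add: dy_def)
  qed
  thus "x \<in> dy (ancestor m P)" by (simp add: dy_def ancestor_def)
qed

lemma dy_unique: "x \<in> dy P \<Longrightarrow> x \<in> dy Q \<Longrightarrow> fst P = fst Q \<Longrightarrow> P = Q"
  by (simp add: dy_def prod_eq_iff vec_eq_iff)

lemma dy_meet:
  assumes "x \<in> dy P" "x \<in> dy Q" "fst Q \<le> fst P"
  shows "Q = ancestor (fst P - fst Q) P" "dy P \<subseteq> dy Q"
proof -
  have "x \<in> dy (ancestor (fst P - fst Q) P)" using dy_ancestor[of "fst P - fst Q" P] assms by auto
  thus *: "Q = ancestor (fst P - fst Q) P" using dy_unique[OF assms(2)] assms(3) by simp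
  show "dy P \<subseteq> dy Q" using dy_ancestor[of "fst P - fst Q" P] * by simp
qed

lemma dy_subset_imp: "dy P \<subseteq> dy Q \<Longrightarrow> fst Q \<le> fst P \<Longrightarrow> Q = ancestor (fst P - fst Q) P"
  using dy_meet(1) dy_nonempty by blast

lemma descendants_subset: "P \<in> descendants m Q \<Longrightarrow> dy P \<subseteq> dy Q"
  using dy_ancestor[of m P] by (auto simp: descendants_def)

lemma dy_descendants: "dy Q = (\<Union>P\<in>descendants m Q. dy P)"
proof
  show "dy Q \<subseteq> (\<Union>P\<in>descendants m Q. dy P)"
  proof
    fix x assume x: "x \<in> dy Q"
    let ?P = "(fst Q + m, \<chi> i. \<lfloor>2 ^ (fst Q + m) * x $ i\<rfloor>)"
    have P: "x \<in> dy ?P" by (simp add: dy_def)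
    from dy_meet(1)[OF P x] have "?P \<in> descendants m Q" by (simp add: descendants_def)
    thus "x \<in> (\<Union>P\<in>descendants m Q. dy P)" using P by blast
  qed
qed (use descendants_subset in blast)

lemma disjoint_descendants: "disjoint_family_on dy (descendants m Q)"
  unfolding disjoint_family_on_def descendants_def by (auto dest: dy_unique)

text \<open>Volume comparison: the descendants are disjoint subcubes of \<open>dy Q\<close>, each
  with the fraction 2^(-mn) of its volume. Bounding finite subfamilies first gives finiteness as
  well.\<close>

lemma card_descendants:
  fixes Q :: "nat \<times> (int^'n::finite)"
  shows "finite (descendants m Q) \<and> card (descendants m Q) \<le> 2 ^ (m * CARD('n))"
proof (rule finite_if_finite_subsets_card_bdd)
  fix G assume G: "G \<subseteq> descendants m Q" "finite G"
  have "disjoint_family_on dy G" using disjoint_descendants G(1) by (rule disjoint_family_on_mono[rotated])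
  hence "(\<Sum>P\<in>G. emeasure lborel (dy P)) = emeasure lborel (\<Union>P\<in>G. dy P)"
    by (intro sum_emeasure) (use G in auto)
  also have "\<dots> \<le> emeasure lborel (dy Q)"
    using G descendants_subset by (intro emeasure_mono UN_least) (blast, simp)
  also have "\<dots> = ennreal ((1/2) ^ (fst Q * CARD('n)))" by (simp only: emeasure_dy power_mult)
  also have "(\<Sum>P\<in>G. emeasure lborel (dy P)) = (\<Sum>P\<in>G. ennreal ((1/2) ^ ((fst Q + m) * CARD('n))))"
  proof (rule sum.cong[OF refl])
    fix P assume "P \<in> G"
    hence "fst P = fst Q + m" using G(1) unfolding descendants_def by blast
    thus "emeasure lborel (dy P) = ennreal ((1/2) ^ ((fst Q + m) * CARD('n)))"
      by (simp only: emeasure_dy power_mult)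
  qed
  also have "\<dots> = ennreal (\<Sum>P\<in>G. (1/2) ^ ((fst Q + m) * CARD('n)))" by (rule sum_ennreal) simp
  finally have "(\<Sum>P\<in>G. (1/2) ^ ((fst Q + m) * CARD('n))) \<le> ((1/2) ^ (fst Q * CARD('n)) :: real)"
    by (subst (asm) ennreal_le_iff) auto
  hence "real (card G) * ((1/2) ^ (fst Q * CARD('n)) * (1/2) ^ (m * CARD('n))) \<le> (1/2) ^ (fst Q * CARD('n))"
    by (simp only: sum_constant add_mult_distrib power_add)
  hence "(1/2) ^ (fst Q * CARD('n)) * (real (card G) * (1/2) ^ (m * CARD('n))) \<le> (1/2) ^ (fst Q * CARD('n)) * 1"
    by (simp only: mult.left_commute mult_1_right)
  hence "real (card G) * (1/2) ^ (m * CARD('n)) \<le> 1"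
    by (subst (asm) mult_le_cancel_left_pos) auto
  hence "real (card G) \<le> 2 ^ (m * CARD('n))" by (simp add: power_one_over divide_simps)
  thus "card G \<le> 2 ^ (m * CARD('n))" by (metis of_nat_le_iff of_nat_numeral of_nat_power)
qed

lemma nn_integral_descendants:
  assumes [measurable]: "g \<in> borel_measurable borel"
  shows "(\<integral>\<^sup>+x\<in>dy Q. g x \<partial>lborel) = (\<Sum>P\<in>descendants m Q. \<integral>\<^sup>+x\<in>dy P. g x \<partial>lborel)"
proof -
  have "indicator (dy Q) x = (\<Sum>P\<in>descendants m Q. indicator (dy P) x :: ennreal)" for x
    using card_descendants[of m Q] disjoint_descendants[of m Q]
    by (subst dy_descendants[of Q m]) (intro indicator_UN_disjoint, auto)
  hence "(\<integral>\<^sup>+x\<in>dy Q. g x \<partial>lborel) = (\<integral>\<^sup>+x. (\<Sum>P\<in>descendants m Q. g x * indicator (dy P) x) \<partial>lborel)"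
    by (simp add: sum_distrib_left)
  also have "\<dots> = (\<Sum>P\<in>descendants m Q. \<integral>\<^sup>+x\<in>dy P. g x \<partial>lborel)"
    by (rule nn_integral_sum) auto
  finally show ?thesis .
qed

section \<open>Medians and the Poincare inequality relative to a median\<close>

definition is_median :: "('a::euclidean_space \<Rightarrow> real) \<Rightarrow> 'a set \<Rightarrow> real \<Rightarrow> bool" where
  "is_median u Q m \<longleftrightarrow> emeasure lborel Q \<le> 2 * emeasure lborel (Q \<inter> {x. u x \<le> m}) \<and>
     emeasure lborel Q \<le> 2 * emeasure lborel (Q \<inter> {x. m \<le> u x})"

text \<open>Take the infimum of the levels a for which {u <= a} has at least half the measure. Right
  continuity of the distribution function gives one of the two inequalities, its left limit the
  other.\<close>

lemma median_exists:
  fixes u :: "'a::euclidean_space \<Rightarrow> real"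
  assumes u [measurable]: "u \<in> borel_measurable borel" and Q [measurable]: "Q \<in> sets borel"
    and fin: "emeasure lborel Q < \<infinity>"
  shows "\<exists>m. is_median u Q m"
proof (cases "emeasure lborel Q = 0")
  case True thus ?thesis by (simp add: is_median_def)
next
  case False
  define \<mu> where "\<mu> a = measure lborel (Q \<inter> {x. u x \<le> a})" for a
  define M where "M = measure lborel Q"
  have fin': "emeasure lborel (Q \<inter> X) \<noteq> \<infinity>" for X
    using fin emeasure_mono[of "Q \<inter> X" Q lborel] Q by (metis inf.cobounded1 infinity_ennreal_def leD sets_lborel top.not_eq_extremum)
  have em: "emeasure lborel (Q \<inter> X) = ennreal (measure lborel (Q \<inter> X))" for X
    using fin'[of X] by (simp add: emeasure_eq_ennreal_measure)
  have emQ: "emeasure lborel Q = ennreal M" using em[of UNIV] by (simp add: M_def)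
  have Mpos: "M > 0" using False emQ by (metis ennreal_eq_0_iff not_le)
  have mono: "\<mu> a \<le> \<mu> b" if "a \<le> b" for a b
    unfolding \<mu>_def using that fin'
    by (intro measure_mono_fmeasurable) (auto simp: fmeasurable_def less_top)
  have lim_top: "(\<lambda>k. \<mu> (real k)) \<longlonglongrightarrow> M"
  proof -
    have U: "(\<Union>k. Q \<inter> {x. u x \<le> real k}) = Q" using real_arch_simple by blast
    have "(\<lambda>k. measure lborel (Q \<inter> {x. u x \<le> real k})) \<longlonglongrightarrow> measure lborel (\<Union>k. Q \<inter> {x. u x \<le> real k})"
    proof (intro Lim_measure_incseq)
      show "emeasure lborel (\<Union>k. Q \<inter> {x. u x \<le> real k}) \<noteq> \<infinity>" unfolding U using fin by auto
    qed (auto simp: incseq_def)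
    thus ?thesis unfolding \<mu>_def M_def U .
  qed
  have lim_bot: "(\<lambda>k. \<mu> (- real k)) \<longlonglongrightarrow> 0"
  proof -
    have U: "(\<Inter>k. Q \<inter> {x. u x \<le> - real k}) = {}"
    proof -
      have "\<exists>k. \<not> u x \<le> - real k" for x
      proof -
        obtain k where "- u x < real k" using reals_Archimedean2[of "- u x"] by blast
        thus ?thesis by (intro exI[of _ k]) linarith
      qed
      thus ?thesis by blast
    qed
    have "(\<lambda>k. measure lborel (Q \<inter> {x. u x \<le> - real k})) \<longlonglongrightarrow> measure lborel (\<Inter>k. Q \<inter> {x. u x \<le> - real k})"
      by (intro Lim_measure_decseq) (use fin' in \<open>auto simp: decseq_def\<close>)
    thus ?thesis unfolding \<mu>_def U by simp
  qed
  define S where "S = {a. M \<le> 2 * \<mu> a}"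
  obtain k1 where "\<mu> (real k1) > M / 2"
    using order_tendstoD(1)[OF lim_top, of "M/2"] Mpos by (auto simp: eventually_sequentially)
  hence "real k1 \<in> S" unfolding S_def by simp
  hence Sne: "S \<noteq> {}" by blast
  obtain k2 where k2: "\<mu> (- real k2) < M / 2"
    using order_tendstoD(2)[OF lim_bot, of "M/2"] Mpos by (auto simp: eventually_sequentially)
  have Sb: "bdd_below S"
  proof (rule bdd_belowI[of _ "- real k2"])
    fix a assume "a \<in> S"
    thus "- real k2 \<le> a" using mono[of a "- real k2"] k2 unfolding S_def by force
  qed
  define m where "m = Inf S"
  have above: "M \<le> 2 * \<mu> a" if am: "a > m" for a
  proof -
    from cInf_lessD[OF Sne] am obtain s where "s \<in> S" "s < a" unfolding m_def by blast
    thus ?thesis using mono[of s a] unfolding S_def by force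
  qed
  have below: "\<mu> a \<le> M / 2" if am: "a < m" for a
    using cInf_lower[OF _ Sb, of a] am unfolding m_def S_def by force
  have "(\<lambda>k. \<mu> (m + inverse (real (Suc k)))) \<longlonglongrightarrow> \<mu> m"
  proof -
    have U: "(\<Inter>k. Q \<inter> {x. u x \<le> m + inverse (real (Suc k))}) = Q \<inter> {x. u x \<le> m}"
    proof -
      have "u x \<le> m" if "\<forall>k. u x \<le> m + inverse (real (Suc k))" for x
        using that LIMSEQ_le_const[OF LIMSEQ_inverse_real_of_nat_add[of m], of "u x"] by auto
      moreover have "u x \<le> m + inverse (real (Suc k))" if "u x \<le> m" for x k
        using that by (smt (verit) inverse_nonnegative_iff_nonnegative of_nat_0_le_iff)
      ultimately show ?thesis by blast
    qed
    have "(\<lambda>k. measure lborel (Q \<inter> {x. u x \<le> m + inverse (real (Suc k))}))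
       \<longlonglongrightarrow> measure lborel (\<Inter>k. Q \<inter> {x. u x \<le> m + inverse (real (Suc k))})"
    proof (intro Lim_measure_decseq)
      show "decseq (\<lambda>k. Q \<inter> {x. u x \<le> m + inverse (real (Suc k))})"
        unfolding decseq_def by (force intro: order_trans le_imp_inverse_le)
    qed (use fin' in auto)
    thus ?thesis unfolding \<mu>_def U .
  qed
  hence 1: "M \<le> 2 * \<mu> m"
    using LIMSEQ_le_const[of "\<lambda>k. 2 * \<mu> (m + inverse (real (Suc k)))" "2 * \<mu> m" M] above
    by (auto intro: tendsto_mult_left)
  have "(\<lambda>k. \<mu> (m + - inverse (real (Suc k)))) \<longlonglongrightarrow> measure lborel (Q \<inter> {x. u x < m})"
  proof -
    have U: "(\<Union>k. Q \<inter> {x. u x \<le> m + - inverse (real (Suc k))}) = Q \<inter> {x. u x < m}"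
    proof -
      have "\<exists>k. u x \<le> m + - inverse (real (Suc k))" if "u x < m" for x
      proof -
        from that obtain k where "inverse (real (Suc k)) < m - u x" using reals_Archimedean[of "m - u x"] by auto
        thus ?thesis by (intro exI[of _ k]) linarith
      qed
      moreover have "u x < m" if "u x \<le> m + - inverse (real (Suc k))" for x k
        using that by (smt (verit) inverse_positive_iff_positive of_nat_0_less_iff zero_less_Suc)
      ultimately show ?thesis by blast
    qed
    have "(\<lambda>k. measure lborel (Q \<inter> {x. u x \<le> m + - inverse (real (Suc k))}))
       \<longlonglongrightarrow> measure lborel (\<Union>k. Q \<inter> {x. u x \<le> m + - inverse (real (Suc k))})"
    proof (intro Lim_measure_incseq)
      show "incseq (\<lambda>k. Q \<inter> {x. u x \<le> m + - inverse (real (Suc k))})"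
        unfolding incseq_def by (force intro: order_trans le_imp_inverse_le)
      show "emeasure lborel (\<Union>k. Q \<inter> {x. u x \<le> m + - inverse (real (Suc k))}) \<noteq> \<infinity>"
        unfolding U by (rule fin')
    qed auto
    thus ?thesis unfolding \<mu>_def U .
  qed
  hence 2: "measure lborel (Q \<inter> {x. u x < m}) \<le> M / 2"
    by (rule LIMSEQ_le_const2) (use below in auto)
  have "M = measure lborel (Q \<inter> {x. u x < m}) + measure lborel (Q \<inter> {x. m \<le> u x})"
  proof -
    have "emeasure lborel ((Q \<inter> {x. u x < m}) \<union> (Q \<inter> {x. m \<le> u x}))
      = emeasure lborel (Q \<inter> {x. u x < m}) + emeasure lborel (Q \<inter> {x. m \<le> u x})"
      by (intro plus_emeasure[symmetric]) auto
    moreover have "(Q \<inter> {x. u x < m}) \<union> (Q \<inter> {x. m \<le> u x}) = Q" by auto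
    ultimately have "ennreal M = ennreal (measure lborel (Q \<inter> {x. u x < m}) + measure lborel (Q \<inter> {x. m \<le> u x}))"
      by (simp add: em emQ)
    thus ?thesis using Mpos by (subst (asm) ennreal_inj) auto
  qed
  hence 3: "M \<le> 2 * measure lborel (Q \<inter> {x. m \<le> u x})" using 2 by simp
  have two: "ennreal M \<le> 2 * ennreal y" if "M \<le> 2 * y" for y
  proof -
    have "ennreal M \<le> ennreal (2 * y)" using that by (rule ennreal_leI)
    thus ?thesis by (simp add: ennreal_mult')
  qed
  show ?thesis unfolding is_median_def emQ em
    using two[OF 1] two[OF 3] unfolding \<mu>_def by blast
qed

definition med :: "('a::euclidean_space \<Rightarrow> real) \<Rightarrow> 'a set \<Rightarrow> real" where
  "med u Q = (SOME m. is_median u Q m)"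

lemma is_median_med_dy:
  "u \<in> borel_measurable borel \<Longrightarrow> is_median u (dy P) (med u (dy P))"
  unfolding med_def by (rule someI_ex, rule median_exists) (auto simp: emeasure_dy)

text \<open>For every x at least half of the cube lies on the other side of the median from u(x).
  There |u(x) - m| is at most |u(x) - u(y)|, so averaging over y reduces the claim to
  \<open>pairs_poincare\<close> with a factor 2.\<close>

lemma poincare_median:
  fixes q :: "real^'n::finite" and u :: "real^'n \<Rightarrow> real"
  assumes l: "l > 0" and ug: "upper_gradient u F" and m: "is_median u (hcube q l) m"
  shows "(\<integral>\<^sup>+x\<in>hcube q l. ennreal \<bar>u x - m\<bar> \<partial>lborel)
     \<le> ennreal (2 ^ (CARD('n) + 1) * real CARD('n) * l) * (\<integral>\<^sup>+x\<in>hcube q l. F x \<partial>lborel)"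
proof -
  have [measurable]: "u \<in> borel_measurable borel" using ug unfolding upper_gradient_def by auto
  let ?Q = "hcube q l" and ?n = "CARD('n)"
  have Q: "emeasure lborel ?Q = ennreal (l ^ ?n)" using l by (simp add: emeasure_hcube)
  have pw: "ennreal (l ^ ?n) * ennreal \<bar>u x - m\<bar> \<le> 2 * (\<integral>\<^sup>+y\<in>?Q. ennreal \<bar>u x - u y\<bar> \<partial>lborel)" for x
  proof -
    define X where "X = ?Q \<inter> (if m \<le> u x then {y. u y \<le> m} else {y. m \<le> u y})"
    have X [measurable]: "X \<in> sets borel" unfolding X_def by auto
    have "ennreal (l ^ ?n) \<le> 2 * emeasure lborel X"
      using m unfolding is_median_def Q X_def by auto
    hence "ennreal (l ^ ?n) * ennreal \<bar>u x - m\<bar> \<le> 2 * emeasure lborel X * ennreal \<bar>u x - m\<bar>"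
      by (rule mult_right_mono) simp
    also have "\<dots> = 2 * (\<integral>\<^sup>+y. ennreal \<bar>u x - m\<bar> * indicator X y \<partial>lborel)"
      by (subst nn_integral_cmult_indicator) (auto simp: mult_ac)
    also have "\<dots> \<le> 2 * (\<integral>\<^sup>+y\<in>?Q. ennreal \<bar>u x - u y\<bar> \<partial>lborel)"
      by (intro mult_left_mono nn_integral_mono)
         (auto simp: X_def indicator_def intro!: ennreal_leI split: if_splits)
    finally show ?thesis .
  qed
  define g where "g x = (\<integral>\<^sup>+y\<in>?Q. ennreal \<bar>u x - u y\<bar> \<partial>lborel)" for x
  have [measurable]: "g \<in> borel_measurable borel" unfolding g_def by measurable
  have "ennreal (l ^ ?n) * (\<integral>\<^sup>+x\<in>?Q. ennreal \<bar>u x - m\<bar> \<partial>lborel)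
     = (\<integral>\<^sup>+x. ennreal (l ^ ?n) * (ennreal \<bar>u x - m\<bar> * indicator ?Q x) \<partial>lborel)"
    by (rule nn_integral_cmult[symmetric]) measurable
  also have "\<dots> \<le> (\<integral>\<^sup>+x. 2 * (g x * indicator ?Q x) \<partial>lborel)"
    using pw unfolding g_def mult.assoc[symmetric] by (intro nn_integral_mono mult_right_mono) auto
  also have "\<dots> = 2 * (\<integral>\<^sup>+x\<in>?Q. g x \<partial>lborel)"
    by (rule nn_integral_cmult) measurable
  also have "\<dots> = 2 * (\<integral>\<^sup>+x\<in>?Q. \<integral>\<^sup>+y\<in>?Q. ennreal \<bar>u x - u y\<bar> \<partial>lborel \<partial>lborel)"
    unfolding g_def ..
  also have "\<dots> \<le> 2 * (ennreal ((2 * l) ^ ?n * (real ?n * l)) * (\<integral>\<^sup>+x\<in>?Q. F x \<partial>lborel))"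
    by (intro mult_left_mono pairs_poincare l ug) simp
  also have "\<dots> = ennreal (l ^ ?n) * (ennreal (2 ^ (?n + 1) * real ?n * l) * (\<integral>\<^sup>+x\<in>?Q. F x \<partial>lborel))"
  proof -
    have "2 * ennreal ((2 * l) ^ ?n * (real ?n * l)) = ennreal (2 * ((2 * l) ^ ?n * (real ?n * l)))"
      by (simp add: ennreal_mult')
    also have "2 * ((2 * l) ^ ?n * (real ?n * l)) = l ^ ?n * (2 ^ (?n + 1) * real ?n * l)"
      by (simp add: power_mult_distrib)
    also have "ennreal \<dots> = ennreal (l ^ ?n) * ennreal (2 ^ (?n + 1) * real ?n * l)"
      using l by (subst ennreal_mult) auto
    finally show ?thesis unfolding mult.assoc[symmetric] by (rule arg_cong)
  qed
  finally show ?thesis using l by (subst (asm) ennreal_mult_le_mult_iff) auto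
qed

text \<open>The product of 4 for the two half-measure sets, 2^n for the volume of a child against
  its parent, 2^n and n from the path estimate, and a final 2 that pays for absorbing the
  holes.\<close>

definition jump_const :: "'n::finite itself \<Rightarrow> real" where
  "jump_const _ = real CARD('n) * 2 ^ (2 * CARD('n) + 3)"

lemma jump_const_pos: "jump_const TYPE('n::finite) > 0"
  by (simp add: jump_const_def)

text \<open>Feed \<open>jump_with_holes\<close> with the halves of child and parent that lie on
  opposite sides of the gap between the medians. The assumption on \<open>I\<close> makes the
  contribution of the holes at most half of the left side.\<close>

lemma median_jump_cost:
  fixes u :: "real^'n::finite \<Rightarrow> real" and Q :: "nat \<times> (int^'n)"
  assumes ug: "upper_gradient u F" and P: "P \<in> descendants 1 Q"
    and t: "0 \<le> t" "t \<le> \<bar>med u (dy P) - med u (dy Q)\<bar>"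
    and I: "finite I" "jump_const TYPE('n) * (\<Sum>R\<in>I. side R ^ (CARD('n) - 1)) \<le> side Q ^ (CARD('n) - 1)"
  shows "ennreal (t * side Q ^ (CARD('n) - 1)) \<le> ennreal (jump_const TYPE('n)) * (\<integral>\<^sup>+x\<in>dy Q - (\<Union>R\<in>I. dy R). F x \<partial>lborel)"
proof (cases "(\<integral>\<^sup>+x\<in>dy Q - (\<Union>R\<in>I. dy R). F x \<partial>lborel) = \<infinity>")
  case True thus ?thesis by (simp add: ennreal_mult_top jump_const_def)
next
  case False
  then obtain w where w: "w \<ge> 0" "(\<integral>\<^sup>+x\<in>dy Q - (\<Union>R\<in>I. dy R). F x \<partial>lborel) = ennreal w"
    by (cases "(\<integral>\<^sup>+x\<in>dy Q - (\<Union>R\<in>I. dy R). F x \<partial>lborel)") auto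
  have [measurable]: "u \<in> borel_measurable borel" using ug unfolding upper_gradient_def by auto
  let ?n = "CARD('n)"
  define l where "l = side Q"
  define L where "L = l ^ (?n - 1)"
  have L: "l ^ ?n = l * L" unfolding L_def by (metis power_minus_mult zero_less_card_finite mult.commute)
  have l: "l > 0" "L > 0" unfolding L_def l_def by simp_all
  have mP: "is_median u (dy P) (med u (dy P))" and mQ: "is_median u (dy Q) (med u (dy Q))"
    by (rule is_median_med_dy, measurable)+
  have PQ: "dy P \<subseteq> dy Q" using descendants_subset[OF P] .
  have eP: "emeasure lborel (dy P) = ennreal ((l / 2) ^ ?n)" and eQ: "emeasure lborel (dy Q) = ennreal (l ^ ?n)"
    using P by (auto simp: emeasure_dy descendants_def l_def)
  \<comment> \<open>The half of the child beyond its own median and the half of the parent on the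
    near side of the parent's median.\<close>
  obtain A B where AB: "A \<in> sets borel" "B \<in> sets borel" "A \<subseteq> dy Q" "B \<subseteq> dy Q"
    "\<And>x y. x \<in> A \<Longrightarrow> y \<in> B \<Longrightarrow> t \<le> \<bar>u x - u y\<bar>"
    "ennreal ((l / 2) ^ ?n) \<le> 2 * emeasure lborel A" "ennreal (l ^ ?n) \<le> 2 * emeasure lborel B"
  proof (cases "med u (dy P) \<ge> med u (dy Q)")
    case True
    show thesis
    proof (rule that[of "dy P \<inter> {x. med u (dy P) \<le> u x}" "dy Q \<inter> {x. u x \<le> med u (dy Q)}"])
      show "t \<le> \<bar>u x - u y\<bar>" if "x \<in> dy P \<inter> {x. med u (dy P) \<le> u x}" "y \<in> dy Q \<inter> {x. u x \<le> med u (dy Q)}" for x y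
        using that t True by auto
    qed (use PQ mP mQ in \<open>auto simp: is_median_def eP eQ\<close>)
  next
    case False
    show thesis
    proof (rule that[of "dy P \<inter> {x. u x \<le> med u (dy P)}" "dy Q \<inter> {x. med u (dy Q) \<le> u x}"])
      show "t \<le> \<bar>u x - u y\<bar>" if "x \<in> dy P \<inter> {x. u x \<le> med u (dy P)}" "y \<in> dy Q \<inter> {x. med u (dy Q) \<le> u x}" for x y
        using that t False by auto
    qed (use PQ mP mQ in \<open>auto simp: is_median_def eP eQ\<close>)
  qed
  define s where "s = (\<Sum>R\<in>I. side R ^ (?n - 1))"
  have s0: "s \<ge> 0" unfolding s_def by (intro sum_nonneg) simp
  have J: "ennreal t * (emeasure lborel A * emeasure lborel B) \<le> ennreal ((2 * l) ^ ?n * (real ?n * l)) * (ennreal (t * s) + ennreal w)"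
    using jump_with_holes[OF l(1)[unfolded l_def] ug I(1), of side A B "\<chi> i. real_of_int (snd Q $ i) / 2 ^ fst Q" t "\<lambda>R. \<chi> i. real_of_int (snd R $ i) / 2 ^ fst R",
        unfolded dy_eq_hcube[symmetric]] AB(1-5) t(1)
    unfolding l_def s_def w(2)[symmetric] by auto
  have "ennreal (t * ((l / 2) ^ ?n * l ^ ?n)) = ennreal t * (ennreal ((l / 2) ^ ?n) * ennreal (l ^ ?n))"
    using t l(1) by (simp add: ennreal_mult del: ennreal_power)
  also have "\<dots> \<le> ennreal t * ((2 * emeasure lborel A) * (2 * emeasure lborel B))"
    by (intro mult_left_mono mult_mono AB) auto
  also have "\<dots> = 4 * (ennreal t * (emeasure lborel A * emeasure lborel B))" by (simp add: mult_ac)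
  also have "\<dots> \<le> 4 * (ennreal ((2 * l) ^ ?n * (real ?n * l)) * (ennreal (t * s) + ennreal w))"
    by (intro mult_left_mono J) simp
  also have "\<dots> = ennreal (4 * ((2 * l) ^ ?n * (real ?n * l) * (t * s + w)))"
  proof -
    have e1: "ennreal (t * s) + ennreal w = ennreal (t * s + w)"
      using t w s0 by (subst ennreal_plus) auto
    have e2: "4 * (ennreal a * ennreal b) = ennreal (4 * (a * b))" if "a \<ge> 0" "b \<ge> 0" for a b
      using that by (simp add: ennreal_mult)
    show ?thesis unfolding e1 by (rule e2) (use t w s0 l(1) in auto)
  qed
  finally have "t * ((l / 2) ^ ?n * l ^ ?n) \<le> 4 * ((2 * l) ^ ?n * (real ?n * l) * (t * s + w))"
    using t w s0 l(1) by (subst (asm) ennreal_le_iff) auto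
  hence "t * (l * L / 2 ^ ?n * (l * L)) \<le> 4 * (2 ^ ?n * (l * L) * (real ?n * l) * (t * s + w))"
    by (simp only: power_mult_distrib power_divide L)
  hence "(l * l * L) * (t * L) \<le> (l * l * L) * (4 * 2 ^ ?n * 2 ^ ?n * real ?n * (t * s + w))"
    by (simp add: field_simps)
  hence "t * L \<le> 4 * 2 ^ ?n * 2 ^ ?n * real ?n * (t * s + w)"
    using l by (subst (asm) mult_le_cancel_left_pos) auto
  also have "4 * 2 ^ ?n * 2 ^ ?n * real ?n = jump_const TYPE('n) / 2"
    unfolding jump_const_def by (simp add: power_add power_mult power2_eq_square power_mult_distrib[symmetric])
  \<comment> \<open>The factor 2 gained from \<open>jump_const\<close> lets one copy of
    \<open>t * L\<close> swallow the hole term.\<close>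
  finally have "2 * (t * L) \<le> t * (jump_const TYPE('n) * s) + jump_const TYPE('n) * w" by (simp add: algebra_simps)
  also have "t * (jump_const TYPE('n) * s) \<le> t * L"
    using I(2) t(1) unfolding s_def L_def l_def by (rule mult_left_mono)
  finally have "t * L \<le> jump_const TYPE('n) * w" by linarith
  thus ?thesis unfolding w(2) l_def[symmetric] L_def[symmetric] using w jump_const_pos[where 'n='n]
    by (simp add: ennreal_mult[symmetric] ennreal_leI)
qed

section \<open>Large jumps of medians\<close>

definition below :: "nat \<Rightarrow> (nat \<times> (int^'n)) set \<Rightarrow> nat \<times> (int^'n) \<Rightarrow> (nat \<times> (int^'n::finite)) set" where
  "below K R Q = {P \<in> R. dy P \<subseteq> dy Q \<and> fst Q + K \<le> fst P}"

text \<open>Maximality is stated through generations: nested dyadic cubes of the same generation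
  coincide, so no member of \<open>below\<close> properly contains such a cube.\<close>

definition top_below :: "nat \<Rightarrow> (nat \<times> (int^'n)) set \<Rightarrow> nat \<times> (int^'n) \<Rightarrow> (nat \<times> (int^'n::finite)) set" where
  "top_below K R Q = {P \<in> below K R Q. \<forall>P'\<in>below K R Q. dy P \<subseteq> dy P' \<longrightarrow> fst P \<le> fst P'}"

lemma below_in_top_below:
  assumes "P \<in> below K R Q"
  shows "\<exists>P'\<in>top_below K R Q. dy P \<subseteq> dy P'"
proof -
  from ex_has_least_nat[of "\<lambda>P'. P' \<in> below K R Q \<and> dy P \<subseteq> dy P'" P fst] assms
  obtain P' where "P' \<in> below K R Q" "dy P \<subseteq> dy P'"
    "\<And>P''. P'' \<in> below K R Q \<Longrightarrow> dy P \<subseteq> dy P'' \<Longrightarrow> fst P' \<le> fst P''" by blast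
  thus ?thesis unfolding top_below_def by blast
qed

text \<open>Dyadic cubes through a common point are determined by their generations, which is how
  \<open>inj_on\<close> is supplied in both uses.\<close>

lemma card_le_if_levels:
  assumes "inj_on fst (T :: (nat \<times> 'b) set)" and "\<And>Q Q'. Q \<in> T \<Longrightarrow> Q' \<in> T \<Longrightarrow> fst Q' < fst Q + K"
  shows "card T \<le> K"
proof (cases "T = {}")
  case False
  then obtain Q0 where Q0: "Q0 \<in> T" "\<And>Q. Q \<in> T \<Longrightarrow> fst Q0 \<le> fst Q"
    using ex_has_least_nat[of "\<lambda>Q. Q \<in> T" _ fst] by blast
  have "fst ` T \<subseteq> {fst Q0..<fst Q0 + K}"
  proof (rule image_subsetI)
    fix Q assume "Q \<in> T"
    thus "fst Q \<in> {fst Q0..<fst Q0 + K}" using Q0(2)[of Q] assms(2)[OF Q0(1), of Q] by simp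
  qed
  hence "card (fst ` T) \<le> K" using card_mono[of "{fst Q0..<fst Q0 + K}"] by fastforce
  thus ?thesis by (simp add: card_image assms(1))
qed simp

text \<open>The cubes that have P as a hole all contain P. If two of them were K or more generations
  apart, the smaller one would itself be a candidate hole of the larger and properly contain P,
  against maximality.\<close>

lemma card_top_below:
  assumes "K \<ge> 1" shows "card {Q \<in> R. P \<in> top_below K R Q} \<le> K"
proof (rule card_le_if_levels)
  obtain x where x: "x \<in> dy P" using dy_nonempty by blast
  have *: "x \<in> dy Q" if "P \<in> top_below K R Q" for Q
    using that x by (auto simp: top_below_def below_def)
  show "inj_on fst {Q \<in> R. P \<in> top_below K R Q}"
    by (rule inj_onI) (use * dy_unique in blast)
  fix Q Q' assume Q: "Q \<in> {Q \<in> R. P \<in> top_below K R Q}" "Q' \<in> {Q \<in> R. P \<in> top_below K R Q}"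
  show "fst Q' < fst Q + K"
  proof (rule ccontr)
    assume "\<not> fst Q' < fst Q + K"
    hence "Q' \<in> below K R Q" using Q * dy_meet(2)[of x Q' Q] by (auto simp: below_def)
    moreover have "dy P \<subseteq> dy Q'" using Q(2) by (simp add: top_below_def below_def)
    moreover have "\<forall>P'\<in>below K R Q. dy P \<subseteq> dy P' \<longrightarrow> fst P \<le> fst P'"
      using Q(1) unfolding top_below_def by blast
    ultimately have "fst P \<le> fst Q'" by blast
    thus False using Q assms by (auto simp: top_below_def below_def)
  qed
qed

text \<open>Let two cubes of the family contain x. If the smaller is K or more generations below the
  larger, it lies in a hole of the larger, so x is not exposed there.\<close>

lemma card_exposed:
  "card {Q \<in> R. x \<in> dy Q - (\<Union>P\<in>top_below K R Q. dy P)} \<le> K"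
proof (rule card_le_if_levels)
  show "inj_on fst {Q \<in> R. x \<in> dy Q - (\<Union>P\<in>top_below K R Q. dy P)}"
    by (rule inj_onI) (use dy_unique in blast)
  fix Q Q' assume Q: "Q \<in> {Q \<in> R. x \<in> dy Q - (\<Union>P\<in>top_below K R Q. dy P)}"
    "Q' \<in> {Q \<in> R. x \<in> dy Q - (\<Union>P\<in>top_below K R Q. dy P)}"
  show "fst Q' < fst Q + K"
  proof (rule ccontr)
    assume "\<not> fst Q' < fst Q + K"
    hence "Q' \<in> below K R Q" using Q dy_meet(2)[of x Q' Q] by (auto simp: below_def)
    thus False using below_in_top_below[of Q' K R Q] Q by blast
  qed
qed

text \<open>The maximal cubes of the family at least \<open>K\<close> generations below \<open>Q\<close> serve as the holes of
  \<open>median_jump_cost\<close>. If they are cheap, the cost of \<open>Q\<close> is paid by the integral over the complement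
  of the holes, and these complements overlap at most \<open>K\<close> times. Otherwise the cost of \<open>Q\<close> is at most
  a constant times \<open>\<sigma>\<^sup>-\<^sup>K\<close> times the cost of the holes, which is absorbed when \<open>K\<close> is large.\<close>

lemma jump_family_bound:
  fixes \<sigma> :: real
  assumes \<sigma>: "\<sigma> > 1"
  shows "\<exists>C>0. \<forall>(u :: real^'n::finite \<Rightarrow> real) F (lam::real) R. upper_gradient u F \<longrightarrow> lam > 0 \<longrightarrow> finite R \<longrightarrow>
    (\<forall>Q\<in>R. \<exists>P\<in>descendants 1 Q. lam * \<sigma> ^ fst Q \<le> \<bar>med u (dy P) - med u (dy Q)\<bar>) \<longrightarrow>
    ennreal (\<Sum>Q\<in>R. lam * \<sigma> ^ fst Q * side Q ^ (CARD('n) - 1)) \<le> ennreal C * (\<integral>\<^sup>+x\<in>(\<Union>Q\<in>R. dy Q). F x \<partial>lborel)"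
proof -
  define K0 where "K0 = jump_const TYPE('n)"
  have K0: "K0 > 0" unfolding K0_def by (rule jump_const_pos)
  \<comment> \<open>A cube is a hole of at most K others, and each time its cost is discounted by
    \<open>\<sigma>\<close> to the power -K. The exponential beats the linear overlap, so K can be
    chosen to make the total discount less than 1/2.\<close>
  have "(\<lambda>K. real K * (1/\<sigma>) ^ K) \<longlonglongrightarrow> 0"
    using \<sigma> by (intro powser_times_n_limit_0) auto
  hence "(\<lambda>K. K0 * (real K * (1/\<sigma>) ^ K)) \<longlonglongrightarrow> 0" by (rule tendsto_mult_right_zero)
  from order_tendstoD(2)[OF this, of "1/2"]
  obtain K' where K': "\<And>K. K \<ge> K' \<Longrightarrow> K0 * (real K * (1/\<sigma>) ^ K) < 1/2"
    by (auto simp: eventually_sequentially)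
  define K where "K = max K' 1"
  have K: "K \<ge> 1" "K0 * (real K * (1/\<sigma>) ^ K) < 1/2" using K'[of K] unfolding K_def by auto
  have "ennreal (\<Sum>Q\<in>R. lam * \<sigma> ^ fst Q * side Q ^ (CARD('n) - 1)) \<le> ennreal (2 * K0 * real K) * (\<integral>\<^sup>+x\<in>(\<Union>Q\<in>R. dy Q). F x \<partial>lborel)"
    if ug: "upper_gradient u F" and lam: "lam > 0" and R: "finite R"
      and J: "\<And>Q. Q\<in>R \<Longrightarrow> \<exists>P\<in>descendants 1 Q. lam * \<sigma> ^ fst Q \<le> \<bar>med u (dy P) - med u (dy Q)\<bar>"
    for u :: "real^'n \<Rightarrow> real" and F lam R
  proof -
    have [measurable]: "F \<in> borel_measurable borel" using ug unfolding upper_gradient_def by auto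
    define c where "c Q = lam * \<sigma> ^ fst Q * side Q ^ (CARD('n) - 1)" for Q :: "nat \<times> (int^'n)"
    define M where "M = top_below K R"
    define E where "E Q = dy Q - (\<Union>P\<in>M Q. dy P)" for Q
    have c0: "c Q \<ge> 0" for Q unfolding c_def using lam \<sigma> by simp
    have Mfin: "finite (M Q)" "M Q \<subseteq> R" for Q
      unfolding M_def top_below_def below_def using R by auto
    have [measurable]: "E Q \<in> sets borel" for Q
      unfolding E_def using Mfin by (intro sets.Diff sets.finite_UN) auto
    have each: "ennreal (c Q) \<le> ennreal (K0 * (1/\<sigma>) ^ K * (\<Sum>P\<in>M Q. c P)) + ennreal K0 * (\<integral>\<^sup>+x\<in>E Q. F x \<partial>lborel)"
      if Q: "Q \<in> R" for Q
    proof (cases "K0 * (\<Sum>P\<in>M Q. side P ^ (CARD('n) - 1)) \<le> side Q ^ (CARD('n) - 1)")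
      case True
      from J[OF Q] obtain P where P: "P \<in> descendants 1 Q" "lam * \<sigma> ^ fst Q \<le> \<bar>med u (dy P) - med u (dy Q)\<bar>" by blast
      have "ennreal (c Q) \<le> ennreal K0 * (\<integral>\<^sup>+x\<in>E Q. F x \<partial>lborel)"
        using median_jump_cost[OF ug P(1) _ P(2) Mfin(1), of Q] True lam \<sigma>
        unfolding c_def E_def K0_def by simp
      thus ?thesis by (rule order_trans) simp
    next
      case False
      \<comment> \<open>The holes are expensive: replace the side of Q by theirs. They are at least
        K generations deeper, so the factor \<open>\<sigma> ^ fst Q\<close> is at most
        \<open>(1/\<sigma>) ^ K\<close> times their own.\<close>
      have "c Q \<le> lam * \<sigma> ^ fst Q * (K0 * (\<Sum>P\<in>M Q. side P ^ (CARD('n) - 1)))"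
        unfolding c_def using False lam \<sigma> by (intro mult_left_mono) auto
      also have "\<dots> = K0 * (\<Sum>P\<in>M Q. lam * \<sigma> ^ fst Q * side P ^ (CARD('n) - 1))"
        by (simp add: sum_distrib_left mult_ac)
      also have "\<dots> \<le> K0 * (\<Sum>P\<in>M Q. (1/\<sigma>) ^ K * c P)"
      proof (intro mult_left_mono sum_mono)
        fix P assume "P \<in> M Q"
        hence "fst Q + K \<le> fst P" unfolding M_def top_below_def below_def by auto
        hence "\<sigma> ^ (fst Q + K) \<le> \<sigma> ^ fst P" using \<sigma> by (intro power_increasing) auto
        hence "\<sigma> ^ fst Q \<le> (1/\<sigma>) ^ K * \<sigma> ^ fst P" using \<sigma> by (simp add: power_add power_divide field_simps)
        hence "\<sigma> ^ fst Q * (lam * side P ^ (CARD('n) - 1)) \<le> ((1/\<sigma>) ^ K * \<sigma> ^ fst P) * (lam * side P ^ (CARD('n) - 1))"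
          using lam by (intro mult_right_mono) auto
        thus "lam * \<sigma> ^ fst Q * side P ^ (CARD('n) - 1) \<le> (1/\<sigma>) ^ K * c P"
          unfolding c_def by (simp add: mult_ac)
      qed (use K0 in auto)
      also have "\<dots> = K0 * (1/\<sigma>) ^ K * (\<Sum>P\<in>M Q. c P)" by (simp only: sum_distrib_left[symmetric] mult.assoc)
      finally have "ennreal (c Q) \<le> ennreal (K0 * (1/\<sigma>) ^ K * (\<Sum>P\<in>M Q. c P))" by (rule ennreal_leI)
      thus ?thesis by (rule order_trans) simp
    qed
    have s1: "(\<Sum>Q\<in>R. \<Sum>P\<in>M Q. c P) \<le> real K * (\<Sum>P\<in>R. c P)"
    proof -
      have "(\<Sum>Q\<in>R. \<Sum>P\<in>M Q. c P) = (\<Sum>Q\<in>R. \<Sum>P\<in>{P \<in> R. P \<in> M Q}. c P)"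
        using Mfin(2) by (intro sum.cong) auto
      also have "\<dots> = (\<Sum>P\<in>R. \<Sum>Q\<in>{Q \<in> R. P \<in> M Q}. c P)" by (rule sum.swap_restrict[OF R R])
      also have "\<dots> = (\<Sum>P\<in>R. real (card {Q \<in> R. P \<in> M Q}) * c P)" by simp
      also have "\<dots> \<le> (\<Sum>P\<in>R. real K * c P)"
        unfolding M_def using c0 card_top_below[OF K(1), of R] by (intro sum_mono mult_right_mono) auto
      finally show ?thesis by (simp add: sum_distrib_left)
    qed
    have s2: "(\<Sum>Q\<in>R. \<integral>\<^sup>+x\<in>E Q. F x \<partial>lborel) \<le> ennreal (real K) * (\<integral>\<^sup>+x\<in>(\<Union>Q\<in>R. dy Q). F x \<partial>lborel)"
    proof -
      have "(\<Sum>Q\<in>R. \<integral>\<^sup>+x\<in>E Q. F x \<partial>lborel) = (\<integral>\<^sup>+x. (\<Sum>Q\<in>R. F x * indicator (E Q) x) \<partial>lborel)"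
        by (rule nn_integral_sum[symmetric]) auto
      also have "\<dots> \<le> (\<integral>\<^sup>+x. ennreal (real K) * (F x * indicator (\<Union>Q\<in>R. dy Q) x) \<partial>lborel)"
      proof (intro nn_integral_mono)
        fix x
        have i: "(\<Sum>Q\<in>R. indicator (E Q) x :: ennreal) = of_nat (card {Q \<in> R. x \<in> E Q})"
          using R by (simp add: indicator_def sum.If_cases Int_def)
        have "card {Q \<in> R. x \<in> E Q} \<le> K" unfolding E_def M_def by (rule card_exposed)
        hence "(of_nat (card {Q \<in> R. x \<in> E Q}) :: ennreal) \<le> of_nat K * indicator (\<Union>Q\<in>R. dy Q) x"
        proof (cases "{Q \<in> R. x \<in> E Q} = {}")
          case False
          hence "x \<in> (\<Union>Q\<in>R. dy Q)" unfolding E_def by blast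
          thus ?thesis using \<open>card {Q \<in> R. x \<in> E Q} \<le> K\<close> by simp
        next
          case True thus ?thesis by (simp only: card.empty of_nat_0 zero_le)
        qed
        hence "F x * (\<Sum>Q\<in>R. indicator (E Q) x) \<le> F x * (of_nat K * indicator (\<Union>Q\<in>R. dy Q) x)"
          unfolding i by (rule mult_left_mono) simp
        thus "(\<Sum>Q\<in>R. F x * indicator (E Q) x) \<le> ennreal (real K) * (F x * indicator (\<Union>Q\<in>R. dy Q) x)"
          by (simp add: sum_distrib_left ennreal_of_nat_eq_real_of_nat mult_ac)
      qed
      also have "\<dots> = ennreal (real K) * (\<integral>\<^sup>+x\<in>(\<Union>Q\<in>R. dy Q). F x \<partial>lborel)"
        using R by (intro nn_integral_cmult) (auto intro!: borel_measurable_times_ennreal borel_measurable_indicator sets.finite_UN)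
      finally show ?thesis .
    qed
    show ?thesis
    proof (cases "(\<integral>\<^sup>+x\<in>(\<Union>Q\<in>R. dy Q). F x \<partial>lborel) = \<infinity>")
      case True thus ?thesis using K0 K by (simp add: ennreal_mult_top)
    next
      case False
      then obtain w where w: "w \<ge> 0" "(\<integral>\<^sup>+x\<in>(\<Union>Q\<in>R. dy Q). F x \<partial>lborel) = ennreal w"
        by (cases "(\<integral>\<^sup>+x\<in>(\<Union>Q\<in>R. dy Q). F x \<partial>lborel)") auto
      \<comment> \<open>A real number, because the family is finite; hence half of it may be
        subtracted at the end.\<close>
      define X where "X = (\<Sum>Q\<in>R. c Q)"
      have X0: "X \<ge> 0" unfolding X_def using c0 by (intro sum_nonneg) auto
      have "ennreal X = (\<Sum>Q\<in>R. ennreal (c Q))" unfolding X_def using c0 by (intro sum_ennreal[symmetric]) auto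
      also have "\<dots> \<le> (\<Sum>Q\<in>R. ennreal (K0 * (1/\<sigma>) ^ K * (\<Sum>P\<in>M Q. c P)) + ennreal K0 * (\<integral>\<^sup>+x\<in>E Q. F x \<partial>lborel))"
        by (intro sum_mono each)
      also have "\<dots> = (\<Sum>Q\<in>R. ennreal (K0 * (1/\<sigma>) ^ K * (\<Sum>P\<in>M Q. c P))) + ennreal K0 * (\<Sum>Q\<in>R. \<integral>\<^sup>+x\<in>E Q. F x \<partial>lborel)"
        by (simp add: sum.distrib sum_distrib_left)
      also have "(\<Sum>Q\<in>R. ennreal (K0 * (1/\<sigma>) ^ K * (\<Sum>P\<in>M Q. c P))) = ennreal (K0 * (1/\<sigma>) ^ K * (\<Sum>Q\<in>R. \<Sum>P\<in>M Q. c P))"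
        using K0 \<sigma> c0 by (subst sum_ennreal) (auto simp: sum_distrib_left intro!: mult_nonneg_nonneg sum_nonneg)
      also have "\<dots> \<le> ennreal (X / 2)"
      proof (rule ennreal_leI)
        have "K0 * (1/\<sigma>) ^ K * (\<Sum>Q\<in>R. \<Sum>P\<in>M Q. c P) \<le> K0 * (1/\<sigma>) ^ K * (real K * X)"
          unfolding X_def using s1 K0 \<sigma> by (intro mult_left_mono) auto
        also have "\<dots> = (K0 * (real K * (1/\<sigma>) ^ K)) * X" by simp
        also have "\<dots> \<le> 1/2 * X" using K(2) X0 by (intro mult_right_mono) auto
        finally show "K0 * (1/\<sigma>) ^ K * (\<Sum>Q\<in>R. \<Sum>P\<in>M Q. c P) \<le> X / 2" by simp
      qed
      also have "ennreal K0 * (\<Sum>Q\<in>R. \<integral>\<^sup>+x\<in>E Q. F x \<partial>lborel) \<le> ennreal K0 * (ennreal (real K) * ennreal w)"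
        using s2 unfolding w(2) by (rule mult_left_mono) simp
      finally have "ennreal X \<le> ennreal (X / 2) + ennreal K0 * (ennreal (real K) * ennreal w)" by (simp add: add_mono)
      also have "\<dots> = ennreal (X / 2 + K0 * (real K * w))"
        using X0 K0 w by (simp add: ennreal_mult ennreal_plus)
      finally have "X \<le> X / 2 + K0 * (real K * w)" using X0 K0 w by (subst (asm) ennreal_le_iff) auto
      hence "X \<le> 2 * K0 * real K * w" by simp
      hence "ennreal X \<le> ennreal (2 * K0 * real K * w)" by (rule ennreal_leI)
      also have "\<dots> = ennreal (2 * K0 * real K) * ennreal w" using K0 w by (intro ennreal_mult) auto
      finally show ?thesis unfolding w(2) X_def c_def .
    qed
  qed
  thus ?thesis using K0 K(1) by (intro exI[of _ "2 * K0 * real K"]) auto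
qed

section \<open>Generations of descendants, and jumps indexed by the child\<close>

lemma ancestor_ancestor: "ancestor m (ancestor k P) = ancestor (k + m) P"
  by (simp add: ancestor_def power_add vec_eq_iff div_mult2_eq zdiv_zmult2_eq)

lemma descendants_Suc: "descendants (Suc m) Q = (\<Union>P\<in>descendants m Q. descendants 1 P)"
proof (intro equalityI subsetI)
  fix P assume P: "P \<in> descendants (Suc m) Q"
  hence "ancestor 1 P \<in> descendants m Q" "P \<in> descendants 1 (ancestor 1 P)"
    by (auto simp: descendants_def ancestor_ancestor)
  thus "P \<in> (\<Union>P\<in>descendants m Q. descendants 1 P)" by blast
next
  fix P assume "P \<in> (\<Union>P\<in>descendants m Q. descendants 1 P)"
  then obtain P1 where "P1 \<in> descendants m Q" "P \<in> descendants 1 P1" by blast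
  hence "ancestor m P1 = Q" "fst P1 = fst Q + m" "ancestor 1 P = P1" "fst P = fst P1 + 1"
    by (simp_all add: descendants_def)
  moreover from this have "ancestor (Suc m) P = Q" using ancestor_ancestor[of m 1 P] by (metis plus_1_eq_Suc)
  ultimately show "P \<in> descendants (Suc m) Q" by (simp add: descendants_def)
qed

lemma descendants_0: "descendants 0 Q = {Q}"
  by (auto simp: descendants_def ancestor_def)

abbreviation mdiff :: "(real^'n \<Rightarrow> real) \<Rightarrow> nat \<times> (int^'n::finite) \<Rightarrow> real" where
  "mdiff u P \<equiv> \<bar>med u (dy P) - med u (dy (ancestor 1 P))\<bar>"

text \<open>\<open>jump_family_bound\<close> counted by children. A jump normalized by
  \<open>side P ^ (n-1)\<close> exceeds \<open>lam * \<tau> ^ j\<close> exactly if the jump itself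
  exceeds \<open>lam * \<sigma> ^ j\<close> with \<open>\<sigma> = \<tau> * 2^(n-1)\<close>. At most
  2^n children share a parent.\<close>

lemma median_family_bound:
  fixes \<tau> :: real
  assumes \<tau>: "\<tau> > 0" "\<tau> * 2 ^ (CARD('n::finite) - 1) > 1"
  shows "\<exists>C>0. \<forall>(u :: real^'n \<Rightarrow> real) F (lam::real) T. upper_gradient u F \<longrightarrow> lam > 0 \<longrightarrow> finite T \<longrightarrow>
    (\<forall>P\<in>T. 1 \<le> fst P \<and> lam * \<tau> ^ fst P \<le> mdiff u P * side P ^ (CARD('n) - 1)) \<longrightarrow>
    ennreal (\<Sum>P\<in>T. lam * \<tau> ^ fst P) \<le> ennreal C * (\<integral>\<^sup>+x\<in>(\<Union>P\<in>T. dy (ancestor 1 P)). F x \<partial>lborel)"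
proof -
  define \<sigma> where "\<sigma> = \<tau> * 2 ^ (CARD('n) - 1)"
  have \<sigma>: "\<sigma> > 1" using \<tau> unfolding \<sigma>_def by simp
  have \<sigma>\<tau>: "\<sigma> ^ k * ((1/2) ^ k) ^ (CARD('n) - 1) = \<tau> ^ k" for k
    unfolding \<sigma>_def by (simp add: power_mult_distrib power_mult[symmetric] power_divide mult.commute)
  obtain C where C: "C > 0" "\<forall>(u :: real^'n \<Rightarrow> real) F (lam::real) R. upper_gradient u F \<longrightarrow> lam > 0 \<longrightarrow> finite R \<longrightarrow>
    (\<forall>Q\<in>R. \<exists>P\<in>descendants 1 Q. lam * \<sigma> ^ fst Q \<le> \<bar>med u (dy P) - med u (dy Q)\<bar>) \<longrightarrow>
    ennreal (\<Sum>Q\<in>R. lam * \<sigma> ^ fst Q * side Q ^ (CARD('n) - 1)) \<le> ennreal C * (\<integral>\<^sup>+x\<in>(\<Union>Q\<in>R. dy Q). F x \<partial>lborel)"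
    using jump_family_bound[OF \<sigma>, where 'n='n] by (elim exE conjE) (rule that)
  have "ennreal (\<Sum>P\<in>T. lam * \<tau> ^ fst P) \<le> ennreal (2 ^ CARD('n) * \<tau> * C) * (\<integral>\<^sup>+x\<in>(\<Union>P\<in>T. dy (ancestor 1 P)). F x \<partial>lborel)"
    if ug: "upper_gradient u F" and lam: "lam > 0" and T: "finite T"
      and J: "\<And>P. P\<in>T \<Longrightarrow> 1 \<le> fst P \<and> lam * \<tau> ^ fst P \<le> mdiff u P * side P ^ (CARD('n) - 1)"
    for u :: "real^'n \<Rightarrow> real" and F lam T
  proof -
    define R where "R = ancestor 1 ` T"
    have R: "finite R" unfolding R_def using T by simp
    have J': "\<exists>P\<in>descendants 1 Q. lam * \<sigma> ^ fst Q \<le> \<bar>med u (dy P) - med u (dy Q)\<bar>" if Q: "Q \<in> R" for Q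
    proof -
      from Q obtain P where P: "P \<in> T" "Q = ancestor 1 P" unfolding R_def by blast
      hence PQ: "P \<in> descendants 1 Q" using J[OF P(1)] by (auto simp: descendants_def)
      have "lam * \<sigma> ^ fst P * side P ^ (CARD('n) - 1) \<le> mdiff u P * side P ^ (CARD('n) - 1)"
        using J[OF P(1)] \<sigma>\<tau>[of "fst P"] by (simp add: mult.assoc)
      hence "lam * \<sigma> ^ fst P \<le> mdiff u P" by (subst (asm) mult_le_cancel_right_pos) auto
      moreover have "lam * \<sigma> ^ fst Q \<le> lam * \<sigma> ^ fst P"
        using P \<sigma> lam by (intro mult_left_mono power_increasing) auto
      ultimately show ?thesis using P(2) by (intro bexI[OF _ PQ]) simp
    qed
    have "(\<Sum>P\<in>T. lam * \<tau> ^ fst P) = (\<Sum>Q\<in>R. \<Sum>P\<in>{P \<in> T. ancestor 1 P = Q}. lam * \<tau> ^ fst P)"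
      unfolding R_def using T by (intro sum.image_gen)
    also have "\<dots> \<le> (\<Sum>Q\<in>R. 2 ^ CARD('n) * \<tau> * (lam * \<tau> ^ fst Q))"
    proof (intro sum_mono)
      fix Q
      have sub: "{P \<in> T. ancestor 1 P = Q} \<subseteq> descendants 1 Q"
      proof
        fix P assume "P \<in> {P \<in> T. ancestor 1 P = Q}"
        thus "P \<in> descendants 1 Q" using J[of P] by (auto simp: descendants_def)
      qed
      have "(\<Sum>P\<in>{P \<in> T. ancestor 1 P = Q}. lam * \<tau> ^ fst P) \<le> (\<Sum>P\<in>descendants 1 Q. lam * \<tau> ^ fst P)"
        using card_descendants[of 1 Q] sub lam \<tau> by (intro sum_mono2) auto
      also have "\<dots> = real (card (descendants 1 Q)) * (lam * \<tau> ^ (fst Q + 1))"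
        by (simp add: descendants_def)
      also have "\<dots> \<le> real (2 ^ (1 * CARD('n))) * (lam * \<tau> ^ (fst Q + 1))"
        using card_descendants[of 1 Q] lam \<tau> by (intro mult_right_mono of_nat_mono) auto
      finally show "(\<Sum>P\<in>{P \<in> T. ancestor 1 P = Q}. lam * \<tau> ^ fst P) \<le> 2 ^ CARD('n) * \<tau> * (lam * \<tau> ^ fst Q)"
        by (simp add: mult_ac)
    qed
    also have "\<dots> = 2 ^ CARD('n) * \<tau> * (\<Sum>Q\<in>R. lam * \<sigma> ^ fst Q * side Q ^ (CARD('n) - 1))"
      by (simp only: sum_distrib_left mult.assoc \<sigma>\<tau>)
    finally have "ennreal (\<Sum>P\<in>T. lam * \<tau> ^ fst P) \<le> ennreal (2 ^ CARD('n) * \<tau> * (\<Sum>Q\<in>R. lam * \<sigma> ^ fst Q * side Q ^ (CARD('n) - 1)))"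
      by (rule ennreal_leI)
    also have "\<dots> = ennreal (2 ^ CARD('n) * \<tau>) * ennreal (\<Sum>Q\<in>R. lam * \<sigma> ^ fst Q * side Q ^ (CARD('n) - 1))"
      using \<tau> lam \<sigma> by (intro ennreal_mult) (auto intro!: sum_nonneg)
    also have "\<dots> \<le> ennreal (2 ^ CARD('n) * \<tau>) * (ennreal C * (\<integral>\<^sup>+x\<in>(\<Union>Q\<in>R. dy Q). F x \<partial>lborel))"
      by (intro mult_left_mono C(2)[rule_format, OF ug lam R J']) auto
    also have "\<dots> = ennreal (2 ^ CARD('n) * \<tau> * C) * (\<integral>\<^sup>+x\<in>(\<Union>Q\<in>R. dy Q). F x \<partial>lborel)"
      using \<tau> C(1) by (subst ennreal_mult[of "2 ^ CARD('n) * \<tau>" C]) (auto simp: mult.assoc)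
    finally show ?thesis unfolding R_def by simp
  qed
  thus ?thesis using \<tau>(1) C(1) by (intro exI[of _ "2 ^ CARD('n) * \<tau> * C"]) auto
qed

section \<open>Large mean oscillations\<close>

text \<open>A discrete layer cake. Up to the truncation, d is less than twice the largest layer
  \<open>2 ^ i * a\<close> not exceeding it. Sums of jumps thereby become sums over level sets, the
  only sets for which bounds are available.\<close>

lemma dyadic_layers:
  fixes a d :: real
  assumes "0 \<le> a" "a \<le> d"
  shows "min d (2 ^ m * a) \<le> (\<Sum>i\<le>m. if 2 ^ i * a \<le> d then 2 * (2 ^ i * a) else 0)"
proof (induction m)
  case 0 thus ?case using assms by simp
next
  case (Suc m)
  show ?case
  proof (cases "2 ^ Suc m * a \<le> d")
    case True
    have "0 \<le> (\<Sum>i\<le>m. if 2 ^ i * a \<le> d then 2 * (2 ^ i * a) else 0)"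
      using assms by (intro sum_nonneg) auto
    moreover have "0 \<le> 2 ^ Suc m * a" using assms by simp
    ultimately show ?thesis using True by simp
  next
    case f: False
    show ?thesis
    proof (cases "d \<le> 2 ^ m * a")
      case True thus ?thesis using Suc f by simp
    next
      case False
      have "(if 2 ^ m * a \<le> d then 2 * (2 ^ m * a) else 0) \<le> (\<Sum>i\<le>m. if 2 ^ i * a \<le> d then 2 * (2 ^ i * a) else 0)"
        by (rule member_le_sum[of m "{..m}" "\<lambda>i. if 2 ^ i * a \<le> d then 2 * (2 ^ i * a) else 0"]) (use assms in auto)
      thus ?thesis using False f by simp
    qed
  qed
qed

lemma disjoint_descendants_of:
  assumes "Q \<noteq> Q'" shows "descendants k Q \<inter> descendants k Q' = {}"
  using assms by (auto simp: descendants_def)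

lemma finite_descendants [simp]: "finite (descendants m Q)"
  using card_descendants[of m Q] by simp

text \<open>Converts the weak-type bound \<open>W\<close> into a bound for cubes whose k-th
  generation carries many jumps in total. Very small jumps contribute at most half of the total, and
  jumps may be truncated at half of the required total. Between these thresholds there are only N +
  1 dyadic layers, and \<open>W\<close> is applied to each, so the loss is polynomial in k.\<close>

lemma level_bound:
  fixes \<tau> C :: real and u :: "real^'n::finite \<Rightarrow> real"
  assumes \<tau>: "\<tau> > 0" and C: "C > 0"
    and W: "\<And>(lam::real) T. lam > 0 \<Longrightarrow> finite T \<Longrightarrow>
    (\<And>P. P\<in>T \<Longrightarrow> 1 \<le> fst P \<and> lam * \<tau> ^ fst P \<le> mdiff u P * side P ^ (CARD('n) - 1)) \<Longrightarrow>
    ennreal (\<Sum>P\<in>T. lam * \<tau> ^ fst P) \<le> ennreal C * (\<integral>\<^sup>+x\<in>(\<Union>P\<in>T. dy (ancestor 1 P)). F x \<partial>lborel)"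
    and F [measurable]: "F \<in> borel_measurable borel" and lam: "lam > 0" and S: "finite S" and k: "k \<ge> 1" and V: "V > 0"
    and big: "\<And>Q. Q \<in> S \<Longrightarrow> V * (lam * \<tau> ^ fst Q) \<le> (\<Sum>P\<in>descendants k Q. mdiff u P * side P ^ (CARD('n) - 1))"
  shows "ennreal (\<Sum>Q\<in>S. lam * \<tau> ^ fst Q) \<le> ennreal (4 * (real (k * CARD('n)) + 1) / V * C) * (\<integral>\<^sup>+x\<in>(\<Union>Q\<in>S. dy Q). F x \<partial>lborel)"
proof -
  define N where "N = k * CARD('n)"
  \<comment> \<open>Chosen so that \<open>2 ^ N * a P\<close> is half of the required total
    \<open>V * (lam * \<tau> ^ fst Q)\<close>. The at most 2^N descendants with jump below
    \<open>a P\<close> then contribute at most that half.\<close>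
  define \<theta> where "\<theta> = V / (2 * 2 ^ N * \<tau> ^ k)"
  have \<theta>: "\<theta> > 0" unfolding \<theta>_def using V \<tau> by simp
  have \<theta>V: "2 ^ N * (\<theta> * \<tau> ^ k) = V / 2" unfolding \<theta>_def using \<tau> by simp
  define \<delta> where "\<delta> P = mdiff u P * side P ^ (CARD('n) - 1)" for P :: "nat \<times> (int^'n)"
  have \<delta>0: "\<delta> P \<ge> 0" for P unfolding \<delta>_def by simp
  define a where "a P = \<theta> * (lam * \<tau> ^ fst P)" for P :: "nat \<times> (int^'n)"
  have a0: "a P > 0" for P unfolding a_def using \<theta> lam \<tau> by simp
  define D where "D = (\<Union>Q\<in>S. descendants k Q)"
  have D: "finite D" unfolding D_def using S by simp
  have each: "V / 2 * (lam * \<tau> ^ fst Q) \<le> (\<Sum>P\<in>descendants k Q. \<Sum>i\<le>N. if 2 ^ i * a P \<le> \<delta> P then 2 * (2 ^ i * a P) else 0)"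
    if Q: "Q \<in> S" for Q
  proof -
    let ?G = "descendants k Q" and ?c = "V / 2 * (lam * \<tau> ^ fst Q)"
    have G: "finite ?G" "card ?G \<le> 2 ^ N" using card_descendants[of k Q] unfolding N_def by auto
    have c0: "?c \<ge> 0" using V lam \<tau> by simp
    have ac: "2 ^ N * a P = ?c" if "P \<in> ?G" for P
    proof -
      have "2 ^ N * a P = (2 ^ N * (\<theta> * \<tau> ^ k)) * (lam * \<tau> ^ fst Q)"
        using that by (simp add: a_def descendants_def power_add mult_ac)
      thus ?thesis unfolding \<theta>V .
    qed
    have "(\<Sum>P\<in>{P\<in>?G. \<delta> P < a P}. \<delta> P) \<le> (\<Sum>P\<in>{P\<in>?G. \<delta> P < a P}. ?c / 2 ^ N)"
    proof (intro sum_mono)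
      fix P assume P: "P \<in> {P\<in>?G. \<delta> P < a P}"
      hence "a P = ?c / 2 ^ N" using ac[of P] by (simp add: field_simps)
      thus "\<delta> P \<le> ?c / 2 ^ N" using P by simp
    qed
    also have "\<dots> = real (card {P\<in>?G. \<delta> P < a P}) * (?c / 2 ^ N)" by simp
    also have "\<dots> \<le> real (2 ^ N) * (?c / 2 ^ N)"
    proof (intro mult_right_mono of_nat_mono)
      have "card {P\<in>?G. \<delta> P < a P} \<le> card ?G" using G by (intro card_mono) auto
      thus "card {P\<in>?G. \<delta> P < a P} \<le> 2 ^ N" using G by linarith
    qed (use c0 in simp)
    finally have small: "(\<Sum>P\<in>{P\<in>?G. \<delta> P < a P}. \<delta> P) \<le> ?c" by simp
    have "2 * ?c \<le> (\<Sum>P\<in>?G. \<delta> P)" using big[OF Q] unfolding \<delta>_def by simp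
    also have "\<dots> = (\<Sum>P\<in>{P\<in>?G. a P \<le> \<delta> P} \<union> {P\<in>?G. \<delta> P < a P}. \<delta> P)"
      by (intro sum.cong) auto
    also have "\<dots> = (\<Sum>P\<in>{P\<in>?G. a P \<le> \<delta> P}. \<delta> P) + (\<Sum>P\<in>{P\<in>?G. \<delta> P < a P}. \<delta> P)"
      using G by (intro sum.union_disjoint) auto
    finally have l: "?c \<le> (\<Sum>P\<in>{P\<in>?G. a P \<le> \<delta> P}. \<delta> P)" using small by linarith
    \<comment> \<open>Truncation is harmless: a single jump of size \<open>?c\<close> already
      suffices, and if there is none, nothing is cut off.\<close>
    have "?c \<le> (\<Sum>P\<in>{P\<in>?G. a P \<le> \<delta> P}. min (\<delta> P) ?c)"
    proof (cases "\<exists>P0\<in>{P\<in>?G. a P \<le> \<delta> P}. ?c \<le> \<delta> P0")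
      case True
      then obtain P0 where P0: "P0 \<in> {P\<in>?G. a P \<le> \<delta> P}" "?c \<le> \<delta> P0" by blast
      have "min (\<delta> P0) ?c \<le> (\<Sum>P\<in>{P\<in>?G. a P \<le> \<delta> P}. min (\<delta> P) ?c)"
        by (rule member_le_sum[OF P0(1)]) (use G \<delta>0 c0 in auto)
      thus ?thesis using P0(2) by simp
    next
      case False
      have "(\<Sum>P\<in>{P\<in>?G. a P \<le> \<delta> P}. \<delta> P) = (\<Sum>P\<in>{P\<in>?G. a P \<le> \<delta> P}. min (\<delta> P) ?c)"
      proof (rule sum.cong[OF refl])
        fix P assume "P \<in> {P\<in>?G. a P \<le> \<delta> P}"
        hence "\<not> ?c \<le> \<delta> P" using False by blast
        thus "\<delta> P = min (\<delta> P) ?c" by simp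
      qed
      thus ?thesis using l by simp
    qed
    also have "\<dots> \<le> (\<Sum>P\<in>{P\<in>?G. a P \<le> \<delta> P}. \<Sum>i\<le>N. if 2 ^ i * a P \<le> \<delta> P then 2 * (2 ^ i * a P) else 0)"
    proof (intro sum_mono)
      fix P assume P: "P \<in> {P\<in>?G. a P \<le> \<delta> P}"
      show "min (\<delta> P) ?c \<le> (\<Sum>i\<le>N. if 2 ^ i * a P \<le> \<delta> P then 2 * (2 ^ i * a P) else 0)"
        using dyadic_layers[of "a P" "\<delta> P" N] P a0[of P] ac[of P] by simp
    qed
    also have "\<dots> \<le> (\<Sum>P\<in>?G. \<Sum>i\<le>N. if 2 ^ i * a P \<le> \<delta> P then 2 * (2 ^ i * a P) else 0)"
      using G a0 by (intro sum_mono2) (auto intro!: sum_nonneg simp: less_imp_le)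
    finally show ?thesis .
  qed
  have "V / 2 * (\<Sum>Q\<in>S. lam * \<tau> ^ fst Q) \<le> (\<Sum>Q\<in>S. \<Sum>P\<in>descendants k Q. \<Sum>i\<le>N. if 2 ^ i * a P \<le> \<delta> P then 2 * (2 ^ i * a P) else 0)"
    unfolding sum_distrib_left by (intro sum_mono each)
  also have "\<dots> = (\<Sum>P\<in>D. \<Sum>i\<le>N. if 2 ^ i * a P \<le> \<delta> P then 2 * (2 ^ i * a P) else 0)"
    unfolding D_def
    by (intro sum.UNION_disjoint[symmetric] ballI impI disjoint_descendants_of) (simp_all add: S)
  also have "\<dots> = (\<Sum>i\<le>N. \<Sum>P\<in>D. if 2 ^ i * a P \<le> \<delta> P then 2 * (2 ^ i * a P) else 0)"
    by (rule sum.swap)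
  also have "\<dots> = (\<Sum>i\<le>N. 2 * (\<Sum>P\<in>{P\<in>D. 2 ^ i * a P \<le> \<delta> P}. 2 ^ i * a P))"
    using D by (simp add: sum.If_cases sum_distrib_left Int_def)
  finally have main: "V / 2 * (\<Sum>Q\<in>S. lam * \<tau> ^ fst Q) \<le> (\<Sum>i\<le>N. 2 * (\<Sum>P\<in>{P\<in>D. 2 ^ i * a P \<le> \<delta> P}. 2 ^ i * a P))" .
  define w where "w = (\<integral>\<^sup>+x\<in>(\<Union>Q\<in>S. dy Q). F x \<partial>lborel)"
  have layer: "ennreal (\<Sum>P\<in>{P\<in>D. 2 ^ i * a P \<le> \<delta> P}. 2 ^ i * a P) \<le> ennreal C * w" for i :: nat
  proof -
    let ?T = "{P\<in>D. 2 ^ i * a P \<le> \<delta> P}"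
    have "ennreal (\<Sum>P\<in>?T. (2 ^ i * \<theta> * lam) * \<tau> ^ fst P) \<le> ennreal C * (\<integral>\<^sup>+x\<in>(\<Union>P\<in>?T. dy (ancestor 1 P)). F x \<partial>lborel)"
    proof (rule W)
      fix P assume P: "P \<in> ?T"
      show "1 \<le> fst P \<and> 2 ^ i * \<theta> * lam * \<tau> ^ fst P \<le> mdiff u P * side P ^ (CARD('n) - 1)"
        using P k by (auto simp: D_def descendants_def a_def \<delta>_def mult_ac)
    qed (use \<theta> lam D in auto)
    also have "\<dots> \<le> ennreal C * w"
      unfolding w_def
    proof (rule mult_left_mono, rule nn_integral_mono)
      have "dy (ancestor 1 P) \<subseteq> (\<Union>Q\<in>S. dy Q)" if "P \<in> ?T" for P
      proof -
        from that obtain Q where Q: "Q \<in> S" "P \<in> descendants k Q" unfolding D_def by blast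
        have "Q = ancestor (k - 1) (ancestor 1 P)" "k - 1 \<le> fst (ancestor 1 P)"
          using Q(2) k by (auto simp: descendants_def ancestor_ancestor)
        thus ?thesis using dy_ancestor[of "k - 1" "ancestor 1 P"] Q(1) by blast
      qed
      hence "(\<Union>P\<in>?T. dy (ancestor 1 P)) \<subseteq> (\<Union>Q\<in>S. dy Q)" by blast
      thus "F x * indicator (\<Union>P\<in>?T. dy (ancestor 1 P)) x \<le> F x * indicator (\<Union>Q\<in>S. dy Q) x" for x
        by (intro mult_left_mono indicator_leI) (blast, simp)
    qed simp
    finally show ?thesis by (simp add: a_def mult_ac)
  qed
  have "ennreal (V / 2) * ennreal (\<Sum>Q\<in>S. lam * \<tau> ^ fst Q) = ennreal (V / 2 * (\<Sum>Q\<in>S. lam * \<tau> ^ fst Q))"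
    using V lam \<tau> by (intro ennreal_mult[symmetric]) (auto intro!: sum_nonneg)
  also have "\<dots> \<le> ennreal (\<Sum>i\<le>N. 2 * (\<Sum>P\<in>{P\<in>D. 2 ^ i * a P \<le> \<delta> P}. 2 ^ i * a P))"
    using main by (rule ennreal_leI)
  also have "\<dots> = (\<Sum>i\<le>N. ennreal (2 * (\<Sum>P\<in>{P\<in>D. 2 ^ i * a P \<le> \<delta> P}. 2 ^ i * a P)))"
    using a0 by (intro sum_ennreal[symmetric]) (auto intro!: sum_nonneg simp: less_imp_le)
  also have "\<dots> \<le> (\<Sum>i\<le>N. 2 * (ennreal C * w))"
  proof (intro sum_mono)
    fix i assume "i \<in> {..N}"
    show "ennreal (2 * (\<Sum>P\<in>{P\<in>D. 2 ^ i * a P \<le> \<delta> P}. 2 ^ i * a P)) \<le> 2 * (ennreal C * w)"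
      using mult_left_mono[OF layer[of i], of 2] by (simp add: ennreal_mult')
  qed
  also have "\<dots> = ennreal (V / 2) * (ennreal (4 * (real N + 1) / V * C) * w)"
  proof -
    have "ennreal (V / 2) * ennreal (4 * (real N + 1) / V * C) = ennreal (V / 2 * (4 * (real N + 1) / V * C))"
      using V C by (intro ennreal_mult[symmetric]) auto
    also have "V / 2 * (4 * (real N + 1) / V * C) = real (Suc N) * (2 * C)" using V by (simp add: field_simps)
    also have "ennreal \<dots> = of_nat (Suc N) * (2 * ennreal C)"
      using C by (simp add: ennreal_mult ennreal_of_nat_eq_real_of_nat del: of_nat_Suc)
    finally show ?thesis by (simp add: mult_ac)
  qed
  finally show ?thesis using V unfolding w_def[symmetric] N_def
    by (subst (asm) ennreal_mult_le_mult_iff) auto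
qed

text \<open>Replace the median of a cube by those of its children, generation by generation. The
  errors are the jumps weighted by volume, and the remainder is the oscillation on the cubes of
  generation m.\<close>

lemma telescope_medians:
  fixes u :: "real^'n::finite \<Rightarrow> real"
  assumes [measurable]: "u \<in> borel_measurable borel"
  shows "(\<integral>\<^sup>+x\<in>dy Q. ennreal \<bar>u x - med u (dy Q)\<bar> \<partial>lborel)
    \<le> ennreal (\<Sum>k<m. \<Sum>P\<in>descendants (Suc k) Q. side P ^ CARD('n) * mdiff u P)
      + (\<Sum>P\<in>descendants m Q. \<integral>\<^sup>+x\<in>dy P. ennreal \<bar>u x - med u (dy P)\<bar> \<partial>lborel)"
proof (induction m)
  case 0 thus ?case by (simp add: descendants_0)
next
  case (Suc m)
  have "(\<Sum>P\<in>descendants m Q. \<integral>\<^sup>+x\<in>dy P. ennreal \<bar>u x - med u (dy P)\<bar> \<partial>lborel)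
    \<le> (\<Sum>P\<in>descendants m Q. \<Sum>P'\<in>descendants 1 P. ennreal (side P' ^ CARD('n) * mdiff u P')
       + (\<integral>\<^sup>+x\<in>dy P'. ennreal \<bar>u x - med u (dy P')\<bar> \<partial>lborel))"
  proof (intro sum_mono)
    fix P
    have "(\<integral>\<^sup>+x\<in>dy P. ennreal \<bar>u x - med u (dy P)\<bar> \<partial>lborel)
      = (\<Sum>P'\<in>descendants 1 P. \<integral>\<^sup>+x\<in>dy P'. ennreal \<bar>u x - med u (dy P)\<bar> \<partial>lborel)"
      by (rule nn_integral_descendants) measurable
    also have "\<dots> \<le> (\<Sum>P'\<in>descendants 1 P. ennreal (side P' ^ CARD('n) * mdiff u P')
       + (\<integral>\<^sup>+x\<in>dy P'. ennreal \<bar>u x - med u (dy P')\<bar> \<partial>lborel))"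
    proof (intro sum_mono)
      fix P' assume "P' \<in> descendants 1 P"
      hence P: "P = ancestor 1 P'" by (auto simp: descendants_def)
      have "(\<integral>\<^sup>+x\<in>dy P'. ennreal \<bar>u x - med u (dy P)\<bar> \<partial>lborel)
        \<le> (\<integral>\<^sup>+x. ennreal (mdiff u P') * indicator (dy P') x + ennreal \<bar>u x - med u (dy P')\<bar> * indicator (dy P') x \<partial>lborel)"
      proof (intro nn_integral_mono)
        fix x
        have "ennreal \<bar>u x - med u (dy P)\<bar> \<le> ennreal (mdiff u P' + \<bar>u x - med u (dy P')\<bar>)"
          unfolding P by (rule ennreal_leI) linarith
        also have "\<dots> = ennreal (mdiff u P') + ennreal \<bar>u x - med u (dy P')\<bar>" by (rule ennreal_plus) auto
        finally show "ennreal \<bar>u x - med u (dy P)\<bar> * indicator (dy P') x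
          \<le> ennreal (mdiff u P') * indicator (dy P') x + ennreal \<bar>u x - med u (dy P')\<bar> * indicator (dy P') x"
          by (simp add: distrib_right[symmetric] mult_right_mono)
      qed
      also have "\<dots> = ennreal (mdiff u P') * emeasure lborel (dy P') + (\<integral>\<^sup>+x\<in>dy P'. ennreal \<bar>u x - med u (dy P')\<bar> \<partial>lborel)"
        by (subst nn_integral_add) (auto simp: nn_integral_cmult_indicator)
      also have "ennreal (mdiff u P') * emeasure lborel (dy P') = ennreal (side P' ^ CARD('n) * mdiff u P')"
        by (simp add: emeasure_dy ennreal_mult'' mult.commute)
      finally show "(\<integral>\<^sup>+x\<in>dy P'. ennreal \<bar>u x - med u (dy P)\<bar> \<partial>lborel) \<le> ennreal (side P' ^ CARD('n) * mdiff u P')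
       + (\<integral>\<^sup>+x\<in>dy P'. ennreal \<bar>u x - med u (dy P')\<bar> \<partial>lborel)" .
    qed
    finally show "(\<integral>\<^sup>+x\<in>dy P. ennreal \<bar>u x - med u (dy P)\<bar> \<partial>lborel) \<le> (\<Sum>P'\<in>descendants 1 P. ennreal (side P' ^ CARD('n) * mdiff u P')
       + (\<integral>\<^sup>+x\<in>dy P'. ennreal \<bar>u x - med u (dy P')\<bar> \<partial>lborel))" .
  qed
  also have "\<dots> = (\<Sum>P'\<in>descendants (Suc m) Q. ennreal (side P' ^ CARD('n) * mdiff u P')
       + (\<integral>\<^sup>+x\<in>dy P'. ennreal \<bar>u x - med u (dy P')\<bar> \<partial>lborel))"
    unfolding descendants_Suc
    by (intro sum.UNION_disjoint[symmetric] ballI impI disjoint_descendants_of) simp_all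
  also have "\<dots> = ennreal (\<Sum>P\<in>descendants (Suc m) Q. side P ^ CARD('n) * mdiff u P)
       + (\<Sum>P'\<in>descendants (Suc m) Q. \<integral>\<^sup>+x\<in>dy P'. ennreal \<bar>u x - med u (dy P')\<bar> \<partial>lborel)"
    by (subst sum.distrib, subst sum_ennreal) auto
  finally have step: "(\<Sum>P\<in>descendants m Q. \<integral>\<^sup>+x\<in>dy P. ennreal \<bar>u x - med u (dy P)\<bar> \<partial>lborel)
    \<le> ennreal (\<Sum>P\<in>descendants (Suc m) Q. side P ^ CARD('n) * mdiff u P)
       + (\<Sum>P'\<in>descendants (Suc m) Q. \<integral>\<^sup>+x\<in>dy P'. ennreal \<bar>u x - med u (dy P')\<bar> \<partial>lborel)" .
  have p: "ennreal ((\<Sum>k<m. \<Sum>P\<in>descendants (Suc k) Q. side P ^ CARD('n) * mdiff u P) + (\<Sum>P\<in>descendants (Suc m) Q. side P ^ CARD('n) * mdiff u P))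
    = ennreal (\<Sum>k<m. \<Sum>P\<in>descendants (Suc k) Q. side P ^ CARD('n) * mdiff u P) + ennreal (\<Sum>P\<in>descendants (Suc m) Q. side P ^ CARD('n) * mdiff u P)"
    by (intro ennreal_plus sum_nonneg) auto
  show ?case
    unfolding sum.lessThan_Suc p add.assoc by (rule order_trans[OF Suc add_left_mono[OF step]])
qed

lemma poincare_dy:
  fixes u :: "real^'n::finite \<Rightarrow> real"
  assumes ug: "upper_gradient u F"
  shows "(\<integral>\<^sup>+x\<in>dy P. ennreal \<bar>u x - med u (dy P)\<bar> \<partial>lborel)
     \<le> ennreal (2 ^ (CARD('n) + 1) * real CARD('n) * side P) * (\<integral>\<^sup>+x\<in>dy P. F x \<partial>lborel)"
proof -
  have "u \<in> borel_measurable borel" using ug unfolding upper_gradient_def by auto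
  hence "is_median u (dy P) (med u (dy P))" by (rule is_median_med_dy)
  from poincare_median[OF _ ug this[unfolded dy_eq_hcube]] show ?thesis
    unfolding dy_eq_hcube[symmetric] by simp
qed

text \<open>The geometric weights \<open>(3/2)\<^sup>k\<close> beat the polynomial loss of \<open>level_bound\<close> in the sum over \<open>k\<close>.\<close>

lemma oscillation_level:
  fixes u :: "real^'n::finite \<Rightarrow> real"
  assumes ug: "upper_gradient u F" and c: "c > 0" and fin: "(\<integral>\<^sup>+x\<in>dy Q. F x \<partial>lborel) < \<infinity>"
    and osc: "ennreal (c * side Q) \<le> (\<integral>\<^sup>+x\<in>dy Q. ennreal \<bar>u x - med u (dy Q)\<bar> \<partial>lborel)"
  shows "\<exists>k\<ge>1. (1/6) * (3/2) ^ k * c \<le> (\<Sum>P\<in>descendants k Q. mdiff u P * side P ^ (CARD('n) - 1))"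
proof (rule ccontr)
  assume neg: "\<not> ?thesis"
  have [measurable]: "u \<in> borel_measurable borel" "F \<in> borel_measurable borel" using ug unfolding upper_gradient_def by auto
  define \<delta> where "\<delta> P = mdiff u P * side P ^ (CARD('n) - 1)" for P :: "nat \<times> (int^'n)"
  have small: "(\<Sum>P\<in>descendants (Suc k) Q. \<delta> P) \<le> (1/6) * (3/2) ^ Suc k * c" for k
  proof -
    have "1 \<le> Suc k" by simp
    with neg have "\<not> (1/6) * (3/2) ^ Suc k * c \<le> (\<Sum>P\<in>descendants (Suc k) Q. \<delta> P)"
      unfolding \<delta>_def by blast
    thus ?thesis by linarith
  qed
  obtain w where w: "w \<ge> 0" "(\<integral>\<^sup>+x\<in>dy Q. F x \<partial>lborel) = ennreal w"
    using fin by (cases "(\<integral>\<^sup>+x\<in>dy Q. F x \<partial>lborel)") auto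
  define B where "B = 2 ^ (CARD('n) + 1) * real CARD('n)"
  have B0: "B \<ge> 0" unfolding B_def by simp
  \<comment> \<open>By the Poincare inequality the remainder in generation m has a factor 2^(-m). As
    \<open>w\<close> is finite, it drops below half of the assumed oscillation.\<close>
  have "(\<lambda>m. B * side Q * w * (1/2) ^ m) \<longlonglongrightarrow> 0"
    by (intro tendsto_mult_right_zero LIMSEQ_realpow_zero) auto
  from order_tendstoD(2)[OF this, of "c * side Q / 2"]
  obtain m where m: "B * side Q * w * (1/2) ^ m < c * side Q / 2"
    using c by (auto simp: eventually_sequentially)
  have "(\<Sum>k<m. \<Sum>P\<in>descendants (Suc k) Q. side P ^ CARD('n) * mdiff u P) \<le> (\<Sum>k<m. c * side Q / 6 * ((3/4) ^ Suc k))"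
  proof (intro sum_mono)
    fix k
    have "(\<Sum>P\<in>descendants (Suc k) Q. side P ^ CARD('n) * mdiff u P) = (\<Sum>P\<in>descendants (Suc k) Q. (side Q * (1/2) ^ Suc k) * \<delta> P)"
    proof (intro sum.cong refl)
      fix P assume "P \<in> descendants (Suc k) Q"
      hence sP: "side P = side Q * (1/2) ^ Suc k" by (simp add: descendants_def power_add)
      have "side P ^ CARD('n) = side P * side P ^ (CARD('n) - 1)" 
        by (metis power_minus_mult zero_less_card_finite mult.commute)
      thus "side P ^ CARD('n) * mdiff u P = (side Q * (1/2) ^ Suc k) * \<delta> P"
        unfolding \<delta>_def sP[symmetric] by simp
    qed
    also have "\<dots> = (side Q * (1/2) ^ Suc k) * (\<Sum>P\<in>descendants (Suc k) Q. \<delta> P)" by (simp add: sum_distrib_left)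
    also have "\<dots> \<le> (side Q * (1/2) ^ Suc k) * ((1/6) * (3/2) ^ Suc k * c)"
      by (intro mult_left_mono small) simp
    also have "\<dots> = c * side Q / 6 * ((1/2) ^ Suc k * (3/2) ^ Suc k)" by (simp add: mult_ac)
    also have "(1/2) ^ Suc k * (3/2) ^ Suc k = ((3/4) ^ Suc k :: real)" by (simp add: power_mult_distrib[symmetric])
    finally show "(\<Sum>P\<in>descendants (Suc k) Q. side P ^ CARD('n) * mdiff u P) \<le> c * side Q / 6 * ((3/4) ^ Suc k)" .
  qed
  also have "\<dots> = c * side Q / 6 * (\<Sum>k<m. (3/4) ^ Suc k)" by (simp only: sum_distrib_left)
  \<comment> \<open>The powers of 3/4 from the first on sum to at most 3, so with the factor 1/6 the
    jumps account for at most half of the oscillation. This fixes 1/6.\<close>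
  also have "(\<Sum>k<m. (3/4) ^ Suc k) = 3/4 * (\<Sum>k<m. (3/4::real) ^ k)" by (simp add: sum_distrib_left)
  also have "(\<Sum>k<m. (3/4::real) ^ k) = (1 - (3/4) ^ m) * 4" by (subst sum_gp_strict) auto
  also have "c * side Q / 6 * (3/4 * ((1 - (3/4) ^ m) * 4)) \<le> c * side Q / 6 * (3/4 * (1 * 4))"
    using c by (intro mult_left_mono mult_right_mono) auto
  finally have s1: "(\<Sum>k<m. \<Sum>P\<in>descendants (Suc k) Q. side P ^ CARD('n) * mdiff u P) \<le> c * side Q / 2" by simp
  have "(\<Sum>P\<in>descendants m Q. \<integral>\<^sup>+x\<in>dy P. ennreal \<bar>u x - med u (dy P)\<bar> \<partial>lborel)
     \<le> (\<Sum>P\<in>descendants m Q. ennreal (B * (side Q * (1/2) ^ m)) * (\<integral>\<^sup>+x\<in>dy P. F x \<partial>lborel))"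
  proof (intro sum_mono)
    fix P assume "P \<in> descendants m Q"
    hence sP: "side P = side Q * (1/2) ^ m" by (simp add: descendants_def power_add)
    show "(\<integral>\<^sup>+x\<in>dy P. ennreal \<bar>u x - med u (dy P)\<bar> \<partial>lborel) \<le> ennreal (B * (side Q * (1/2) ^ m)) * (\<integral>\<^sup>+x\<in>dy P. F x \<partial>lborel)"
      using poincare_dy[OF ug, of P] unfolding B_def sP .
  qed
  also have "\<dots> = ennreal (B * (side Q * (1/2) ^ m)) * ennreal w"
    unfolding w(2)[symmetric] by (subst nn_integral_descendants[of F Q m]) (auto simp: sum_distrib_left)
  also have "\<dots> = ennreal (B * (side Q * (1/2) ^ m) * w)" using B0 w by (intro ennreal_mult[symmetric]) auto
  finally have s2: "(\<Sum>P\<in>descendants m Q. \<integral>\<^sup>+x\<in>dy P. ennreal \<bar>u x - med u (dy P)\<bar> \<partial>lborel) \<le> ennreal (B * (side Q * (1/2) ^ m) * w)" .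
  have "ennreal (c * side Q) \<le> ennreal (c * side Q / 2) + ennreal (B * (side Q * (1/2) ^ m) * w)"
    by (rule order_trans[OF osc], rule order_trans[OF telescope_medians[of u Q m]])
       (measurable, intro add_mono ennreal_leI s1 s2)
  also have "\<dots> = ennreal (c * side Q / 2 + B * (side Q * (1/2) ^ m) * w)"
    using c B0 w by (intro ennreal_plus[symmetric]) auto
  finally have "c * side Q \<le> c * side Q / 2 + B * (side Q * (1/2) ^ m) * w"
    using c B0 w by (subst (asm) ennreal_le_iff) auto
  moreover have "B * (side Q * (1/2) ^ m) * w = B * side Q * w * (1/2) ^ m" by (simp only: mult_ac)
  ultimately show False using m by linarith
qed

text \<open>With \<open>\<tau> = 2 powr - n\<beta>\<close> the number \<open>\<tau>\<^sup>j\<close> is \<open>|Q| powr \<beta>\<close> for a cube of side \<open>2\<^sup>-\<^sup>j\<close>, so that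
  the family consists of cubes in the level set \<open>|a\<^sub>Q| > lam\<close> of the normalized coefficients.
  The two ranges of \<open>\<beta>\<close> correspond to \<open>2\<^sup>n\<^sup>-\<^sup>1\<tau> > 1\<close> and \<open>2\<^sup>n\<tau> < 1\<close>.\<close>

definition core_bound :: "'n::finite itself \<Rightarrow> real \<Rightarrow> real \<Rightarrow> bool" where
  "core_bound _ \<tau> C \<longleftrightarrow> (\<forall>(u :: real^'n \<Rightarrow> real) F (lam::real) S. upper_gradient u F \<longrightarrow> lam > 0 \<longrightarrow> finite S \<longrightarrow>
    (\<forall>Q\<in>S. ennreal (lam * \<tau> ^ fst Q * side Q) \<le> (\<integral>\<^sup>+x\<in>dy Q. ennreal \<bar>u x - med u (dy Q)\<bar> \<partial>lborel)) \<longrightarrow>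
    ennreal (\<Sum>Q\<in>S. lam * \<tau> ^ fst Q) \<le> ennreal C * (\<integral>\<^sup>+x\<in>(\<Union>Q\<in>S. dy Q). F x \<partial>lborel))"

text \<open>Sort the cubes by the generation k in which \<open>oscillation_level\<close> finds
  enough jumps. With V = (1/6)(3/2)^k the bound of \<open>level_bound\<close> is a multiple of
  (k+1)(2/3)^k, which is summable over k.\<close>

lemma core_bound_low:
  fixes \<tau> :: real
  assumes \<tau>: "\<tau> > 0" "\<tau> * 2 ^ (CARD('n::finite) - 1) > 1"
  shows "\<exists>C>0. core_bound TYPE('n) \<tau> C"
proof -
  obtain C where C: "C > 0" and W: "\<forall>(u :: real^'n \<Rightarrow> real) F (lam::real) T. upper_gradient u F \<longrightarrow> lam > 0 \<longrightarrow> finite T \<longrightarrow>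
    (\<forall>P\<in>T. 1 \<le> fst P \<and> lam * \<tau> ^ fst P \<le> mdiff u P * side P ^ (CARD('n) - 1)) \<longrightarrow>
    ennreal (\<Sum>P\<in>T. lam * \<tau> ^ fst P) \<le> ennreal C * (\<integral>\<^sup>+x\<in>(\<Union>P\<in>T. dy (ancestor 1 P)). F x \<partial>lborel)"
    using median_family_bound[OF \<tau>] by (elim exE conjE) (rule that)
  \<comment> \<open>The 24 is the 4 of \<open>level_bound\<close> divided by the 1/6 of
    \<open>oscillation_level\<close>.\<close>
  define b where "b k = 24 * real CARD('n) * (real (Suc k) * (2/3) ^ k)" for k
  have sb: "summable b" unfolding b_def
    using geometric_deriv_sums[of "2/3::real"] by (intro summable_mult) (auto simp: sums_iff)
  have b0: "b k \<ge> 0" for k unfolding b_def by simp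
  define C' where "C' = (suminf b + 1) * C"
  have C': "C' > 0" unfolding C'_def using C suminf_nonneg[OF sb b0] by simp
  have "core_bound TYPE('n) \<tau> C'"
    unfolding core_bound_def
  proof (intro allI impI)
    fix u :: "real^'n \<Rightarrow> real" and F and lam :: real and S
    assume ug: "upper_gradient u F" and lam: "lam > 0" and S: "finite S"
      and osc: "\<forall>Q\<in>S. ennreal (lam * \<tau> ^ fst Q * side Q) \<le> (\<integral>\<^sup>+x\<in>dy Q. ennreal \<bar>u x - med u (dy Q)\<bar> \<partial>lborel)"
    have [measurable]: "F \<in> borel_measurable borel" using ug unfolding upper_gradient_def by auto
    define w where "w X = (\<integral>\<^sup>+x\<in>(\<Union>Q\<in>X. dy Q). F x \<partial>lborel)" for X
    have wmono: "w X \<le> w Y" if "X \<subseteq> Y" for X Y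
      unfolding w_def using that by (intro nn_integral_mono mult_left_mono) (auto simp: indicator_def)
    show "ennreal (\<Sum>Q\<in>S. lam * \<tau> ^ fst Q) \<le> ennreal C' * (\<integral>\<^sup>+x\<in>(\<Union>Q\<in>S. dy Q). F x \<partial>lborel)"
    \<comment> \<open>\<open>oscillation_level\<close> requires a finite integral of the gradient
      over each cube.\<close>
    proof (cases "w S = \<infinity>")
      case True thus ?thesis using C' unfolding w_def by (simp add: ennreal_mult_top)
    next
      case False
      have "\<forall>Q\<in>S. \<exists>k\<ge>1. (1/6) * (3/2) ^ k * (lam * \<tau> ^ fst Q) \<le> (\<Sum>P\<in>descendants k Q. mdiff u P * side P ^ (CARD('n) - 1))"
      proof
        fix Q assume Q: "Q \<in> S"
        have "w {Q} \<le> w S" using Q by (intro wmono) auto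
        hence "(\<integral>\<^sup>+x\<in>dy Q. F x \<partial>lborel) < \<infinity>" using False unfolding w_def by (auto simp: top.not_eq_extremum intro: le_less_trans)
        thus "\<exists>k\<ge>1. (1/6) * (3/2) ^ k * (lam * \<tau> ^ fst Q) \<le> (\<Sum>P\<in>descendants k Q. mdiff u P * side P ^ (CARD('n) - 1))"
          using osc Q lam \<tau> by (intro oscillation_level[OF ug]) auto
      qed
      from bchoice[OF this] obtain \<kappa> where "\<forall>Q\<in>S. 1 \<le> \<kappa> Q \<and>
          (1/6) * (3/2) ^ \<kappa> Q * (lam * \<tau> ^ fst Q) \<le> (\<Sum>P\<in>descendants (\<kappa> Q) Q. mdiff u P * side P ^ (CARD('n) - 1))"
        by blast
      note \<kappa>0 = this
      have \<kappa>: "\<And>Q. Q \<in> S \<Longrightarrow> \<kappa> Q \<ge> 1"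
        "\<And>Q. Q \<in> S \<Longrightarrow> (1/6) * (3/2) ^ \<kappa> Q * (lam * \<tau> ^ fst Q) \<le> (\<Sum>P\<in>descendants (\<kappa> Q) Q. mdiff u P * side P ^ (CARD('n) - 1))"
        using bspec[OF \<kappa>0] by (simp_all only:)
      have lev: "ennreal (\<Sum>Q\<in>{Q\<in>S. \<kappa> Q = k}. lam * \<tau> ^ fst Q) \<le> ennreal (b k * C) * w S" if k: "k \<in> \<kappa> ` S" for k
      proof -
        have "ennreal (\<Sum>Q\<in>{Q\<in>S. \<kappa> Q = k}. lam * \<tau> ^ fst Q)
          \<le> ennreal (4 * (real (k * CARD('n)) + 1) / ((1/6) * (3/2) ^ k) * C) * w {Q\<in>S. \<kappa> Q = k}"
          unfolding w_def
        proof (rule level_bound[OF \<tau>(1) C W[rule_format, OF ug]])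
          show "1 \<le> k" using k \<kappa>(1) by blast
          show "(1/6) * (3/2) ^ k * (lam * \<tau> ^ fst Q) \<le> (\<Sum>P\<in>descendants k Q. mdiff u P * side P ^ (CARD('n) - 1))"
            if "Q \<in> {Q\<in>S. \<kappa> Q = k}" for Q
            using \<kappa>(2)[of Q] that by blast
        qed (use lam S in simp_all)
        also have "\<dots> \<le> ennreal (b k * C) * w S"
        proof (intro mult_mono ennreal_leI wmono mult_right_mono)
          have "real (k * CARD('n)) + 1 \<le> real CARD('n) * real (Suc k)"
          proof -
            have "1 \<le> real CARD('n)" using zero_less_card_finite[where 'a='n] by linarith
            thus ?thesis by (simp add: algebra_simps)
          qed
          hence "24 * (real (k * CARD('n)) + 1) * (2/3) ^ k \<le> 24 * (real CARD('n) * real (Suc k)) * (2/3) ^ k"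
            by (intro mult_right_mono mult_left_mono) auto
          thus "4 * (real (k * CARD('n)) + 1) / ((1/6) * (3/2) ^ k) \<le> b k"
            unfolding b_def by (simp add: power_divide field_simps)
        qed (use C b0 in auto)
        finally show ?thesis .
      qed
      have "(\<Sum>Q\<in>S. lam * \<tau> ^ fst Q) = (\<Sum>k\<in>\<kappa> ` S. \<Sum>Q\<in>{Q\<in>S. \<kappa> Q = k}. lam * \<tau> ^ fst Q)"
        using S by (rule sum.image_gen)
      hence "ennreal (\<Sum>Q\<in>S. lam * \<tau> ^ fst Q) = (\<Sum>k\<in>\<kappa> ` S. ennreal (\<Sum>Q\<in>{Q\<in>S. \<kappa> Q = k}. lam * \<tau> ^ fst Q))"
        using lam \<tau> by (subst sum_ennreal) (auto intro!: sum_nonneg)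
      also have "\<dots> \<le> (\<Sum>k\<in>\<kappa> ` S. ennreal (b k * C) * w S)" by (intro sum_mono lev)
      also have "\<dots> = ennreal (\<Sum>k\<in>\<kappa> ` S. b k * C) * w S"
      proof -
        have "(\<Sum>k\<in>\<kappa> ` S. ennreal (b k * C)) = ennreal (\<Sum>k\<in>\<kappa> ` S. b k * C)"
          using b0 C by (intro sum_ennreal) simp
        thus ?thesis by (simp only: sum_distrib_right[symmetric])
      qed
      also have "\<dots> \<le> ennreal C' * w S"
      proof (intro mult_right_mono ennreal_leI)
        have "(\<Sum>k\<in>\<kappa> ` S. b k) \<le> suminf b" using S b0 by (intro sum_le_suminf sb) auto
        thus "(\<Sum>k\<in>\<kappa> ` S. b k * C) \<le> C'" unfolding C'_def sum_distrib_right[symmetric]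
          using C by (intro mult_right_mono) auto
      qed simp
      finally show ?thesis unfolding w_def .
    qed
  qed
  thus ?thesis using C' by blast
qed

text \<open>At most 2^(in) cubes lie i generations below a given one, each with cost smaller by
  \<open>\<tau> ^ i\<close>. Since \<open>2^n * \<tau> < 1\<close>, the costs inside a maximal cube
  sum to a multiple of its own. The maximal cubes are disjoint, and each is paid for by
  Poincare.\<close>

lemma core_bound_high:
  fixes \<tau> :: real
  assumes \<tau>: "\<tau> > 0" "\<tau> * 2 ^ CARD('n::finite) < 1"
  shows "\<exists>C>0. core_bound TYPE('n) \<tau> C"
proof -
  define r where "r = \<tau> * 2 ^ CARD('n)"
  have r: "0 \<le> r" "r < 1" unfolding r_def using \<tau> by auto
  define B where "B = 2 ^ (CARD('n) + 1) * real CARD('n)"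
  have B0: "B > 0" unfolding B_def by simp
  define C where "C = 1 / (1 - r) * B"
  have C: "C > 0" unfolding C_def using r B0 by simp
  have "core_bound TYPE('n) \<tau> C"
    unfolding core_bound_def
  proof (intro allI impI)
    fix u :: "real^'n \<Rightarrow> real" and F and lam :: real and S
    assume ug: "upper_gradient u F" and lam: "lam > 0" and S: "finite S"
      and osc: "\<forall>Q\<in>S. ennreal (lam * \<tau> ^ fst Q * side Q) \<le> (\<integral>\<^sup>+x\<in>dy Q. ennreal \<bar>u x - med u (dy Q)\<bar> \<partial>lborel)"
    have [measurable]: "F \<in> borel_measurable borel" using ug unfolding upper_gradient_def by auto
    define M where "M = {Q \<in> S. \<forall>Q'\<in>S. dy Q \<subseteq> dy Q' \<longrightarrow> fst Q \<le> fst Q'}"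
    have M: "finite M" "M \<subseteq> S" unfolding M_def using S by auto
    have cost: "ennreal (lam * \<tau> ^ fst Q) \<le> ennreal B * (\<integral>\<^sup>+x\<in>dy Q. F x \<partial>lborel)" if Q: "Q \<in> S" for Q
    proof -
      have "ennreal (side Q) * ennreal (lam * \<tau> ^ fst Q) = ennreal (lam * \<tau> ^ fst Q * side Q)"
        using lam \<tau> by (simp add: ennreal_mult mult_ac)
      also have "\<dots> \<le> ennreal (B * side Q) * (\<integral>\<^sup>+x\<in>dy Q. F x \<partial>lborel)"
        using order_trans[OF bspec[OF osc Q] poincare_dy[OF ug]] unfolding B_def .
      also have "\<dots> = ennreal (side Q) * (ennreal B * (\<integral>\<^sup>+x\<in>dy Q. F x \<partial>lborel))"
        using B0 by (simp add: ennreal_mult mult_ac)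
      finally show ?thesis by (subst (asm) ennreal_mult_le_mult_iff) auto
    qed
    have top: "\<exists>Q\<in>M. P \<in> {P\<in>S. dy P \<subseteq> dy Q}" if P: "P \<in> S" for P
    proof -
      from ex_has_least_nat[of "\<lambda>Q. Q \<in> S \<and> dy P \<subseteq> dy Q" P fst] P
      obtain Q where "Q \<in> S" "dy P \<subseteq> dy Q" "\<And>Q'. Q' \<in> S \<Longrightarrow> dy P \<subseteq> dy Q' \<Longrightarrow> fst Q \<le> fst Q'" by blast
      thus ?thesis using P unfolding M_def by blast
    qed
    have dis: "disjoint_family_on dy M"
      unfolding disjoint_family_on_def
    proof (intro ballI impI)
      fix Q Q' assume Q: "Q \<in> M" "Q' \<in> M" "Q \<noteq> Q'"
      show "dy Q \<inter> dy Q' = {}"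
      proof (rule ccontr)
        assume "dy Q \<inter> dy Q' \<noteq> {}"
        then obtain x where x: "x \<in> dy Q" "x \<in> dy Q'" by blast
        have "fst Q = fst Q'"
        proof (cases "fst Q \<le> fst Q'")
          case True
          from dy_meet(2)[OF x(2,1) True] have "fst Q' \<le> fst Q" using Q unfolding M_def by blast
          thus ?thesis using True by simp
        next
          case False
          from dy_meet(2)[OF x] False have "fst Q \<le> fst Q'" using Q unfolding M_def by auto
          thus ?thesis using False by simp
        qed
        thus False using dy_unique[OF x] Q(3) by blast
      qed
    qed
    have sub: "(\<Sum>P\<in>{P\<in>S. dy P \<subseteq> dy Q}. lam * \<tau> ^ fst P) \<le> 1 / (1 - r) * (lam * \<tau> ^ fst Q)" if Q: "Q \<in> M" for Q
    proof -
      define m where "m = Max (insert 0 (fst ` S))"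
      have mle: "fst P \<le> m" if "P \<in> S" for P unfolding m_def using S that by (intro Max_ge) auto
      have lev: "fst Q \<le> fst P" if "P \<in> S" "dy P \<subseteq> dy Q" for P
      proof (rule ccontr)
        assume "\<not> fst Q \<le> fst P"
        hence lt: "fst P < fst Q" by simp
        obtain x where "x \<in> dy P" using dy_nonempty by blast
        hence "dy Q \<subseteq> dy P" using dy_meet(2)[of x Q P] that lt by auto
        hence "fst Q \<le> fst P" using Q that unfolding M_def by blast
        thus False using lt by simp
      qed
      have "{P\<in>S. dy P \<subseteq> dy Q} \<subseteq> (\<Union>i\<le>m. descendants i Q)"
      proof
        fix P assume P: "P \<in> {P\<in>S. dy P \<subseteq> dy Q}"
        hence "P \<in> descendants (fst P - fst Q) Q"
          using lev[of P] dy_subset_imp[of P Q] by (auto simp: descendants_def)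
        moreover have "fst P - fst Q \<le> m" using mle[of P] P by auto
        ultimately show "P \<in> (\<Union>i\<le>m. descendants i Q)" by blast
      qed
      hence "(\<Sum>P\<in>{P\<in>S. dy P \<subseteq> dy Q}. lam * \<tau> ^ fst P) \<le> (\<Sum>P\<in>(\<Union>i\<le>m. descendants i Q). lam * \<tau> ^ fst P)"
        using lam \<tau> by (intro sum_mono2) auto
      also have "\<dots> = (\<Sum>i\<le>m. \<Sum>P\<in>descendants i Q. lam * \<tau> ^ fst P)"
      proof (rule sum.UNION_disjoint)
        show "\<forall>i\<in>{..m}. \<forall>j\<in>{..m}. i \<noteq> j \<longrightarrow> descendants i Q \<inter> descendants j Q = {}"
          by (auto simp: descendants_def)
      qed auto
      also have "\<dots> \<le> (\<Sum>i\<le>m. lam * \<tau> ^ fst Q * r ^ i)"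
      proof (intro sum_mono)
        fix i
        have "(\<Sum>P\<in>descendants i Q. lam * \<tau> ^ fst P) = real (card (descendants i Q)) * (lam * \<tau> ^ (fst Q + i))"
          by (simp add: descendants_def)
        also have "\<dots> \<le> real (2 ^ (i * CARD('n))) * (lam * \<tau> ^ (fst Q + i))"
          using card_descendants[of i Q] lam \<tau> by (intro mult_right_mono of_nat_mono) auto
        also have "\<dots> = lam * \<tau> ^ fst Q * r ^ i"
          unfolding r_def by (simp add: power_add power_mult_distrib power_mult[symmetric] mult_ac)
        finally show "(\<Sum>P\<in>descendants i Q. lam * \<tau> ^ fst P) \<le> lam * \<tau> ^ fst Q * r ^ i" .
      qed
      also have "\<dots> = lam * \<tau> ^ fst Q * (\<Sum>i\<le>m. r ^ i)" by (simp add: sum_distrib_left)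
      also have "\<dots> \<le> lam * \<tau> ^ fst Q * (1 / (1 - r))"
      proof (rule mult_left_mono)
        have "(\<Sum>i\<le>m. r ^ i) \<le> suminf (\<lambda>i. r ^ i)"
          using r by (intro sum_le_suminf summable_geometric) auto
        thus "(\<Sum>i\<le>m. r ^ i) \<le> 1 / (1 - r)" using r by (simp add: suminf_geometric)
      qed (use lam \<tau> in simp)
      finally show ?thesis by (simp add: mult.commute)
    qed
    have "(\<Sum>P\<in>S. lam * \<tau> ^ fst P) \<le> (\<Sum>P\<in>S. \<Sum>Q\<in>{Q\<in>M. dy P \<subseteq> dy Q}. lam * \<tau> ^ fst P)"
    proof (intro sum_mono)
      fix P assume "P \<in> S"
      with top obtain Q where "Q \<in> {Q\<in>M. dy P \<subseteq> dy Q}" by blast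
      thus "lam * \<tau> ^ fst P \<le> (\<Sum>Q\<in>{Q\<in>M. dy P \<subseteq> dy Q}. lam * \<tau> ^ fst P)"
        by (rule member_le_sum[where f="\<lambda>_. lam * \<tau> ^ fst P"]) (use M lam \<tau> in auto)
    qed
    also have "\<dots> = (\<Sum>Q\<in>M. \<Sum>P\<in>{P\<in>S. dy P \<subseteq> dy Q}. lam * \<tau> ^ fst P)"
      by (rule sum.swap_restrict[OF S M(1)])
    also have "\<dots> \<le> (\<Sum>Q\<in>M. 1 / (1 - r) * (lam * \<tau> ^ fst Q))" by (intro sum_mono sub)
    finally have "ennreal (\<Sum>P\<in>S. lam * \<tau> ^ fst P) \<le> ennreal (\<Sum>Q\<in>M. 1 / (1 - r) * (lam * \<tau> ^ fst Q))" by (rule ennreal_leI)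
    also have "\<dots> = (\<Sum>Q\<in>M. ennreal (1 / (1 - r)) * ennreal (lam * \<tau> ^ fst Q))"
      using r lam \<tau> by (subst sum_ennreal[symmetric]) (auto simp: ennreal_mult[symmetric])
    also have "\<dots> \<le> (\<Sum>Q\<in>M. ennreal (1 / (1 - r)) * (ennreal B * (\<integral>\<^sup>+x\<in>dy Q. F x \<partial>lborel)))"
      using M cost by (intro sum_mono mult_left_mono) auto
    also have "\<dots> = ennreal C * (\<Sum>Q\<in>M. \<integral>\<^sup>+x\<in>dy Q. F x \<partial>lborel)"
      unfolding C_def using r B0 by (subst ennreal_mult) (auto simp: sum_distrib_left mult.assoc)
    also have "(\<Sum>Q\<in>M. \<integral>\<^sup>+x\<in>dy Q. F x \<partial>lborel) = (\<integral>\<^sup>+x. (\<Sum>Q\<in>M. F x * indicator (dy Q) x) \<partial>lborel)"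
      by (rule nn_integral_sum[symmetric]) auto
    also have "\<dots> \<le> (\<integral>\<^sup>+x\<in>(\<Union>Q\<in>S. dy Q). F x \<partial>lborel)"
    proof (intro nn_integral_mono)
      fix x
      have "(\<Sum>Q\<in>M. F x * indicator (dy Q) x) = F x * indicator (\<Union>Q\<in>M. dy Q) x"
      proof -
        have "(indicator (\<Union>Q\<in>M. dy Q) x :: ennreal) = (\<Sum>Q\<in>M. indicator (dy Q) x)"
          by (rule indicator_UN_disjoint[OF M(1) dis])
        thus ?thesis by (simp only: sum_distrib_left)
      qed
      also have "\<dots> \<le> F x * indicator (\<Union>Q\<in>S. dy Q) x"
        using M by (intro mult_left_mono) (auto simp: indicator_def)
      finally show "(\<Sum>Q\<in>M. F x * indicator (dy Q) x) \<le> F x * indicator (\<Union>Q\<in>S. dy Q) x" .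
    qed
    finally show "ennreal (\<Sum>Q\<in>S. lam * \<tau> ^ fst Q) \<le> ennreal C * (\<integral>\<^sup>+x\<in>(\<Union>Q\<in>S. dy Q). F x \<partial>lborel)"
      by (simp add: mult_left_mono)
  qed
  thus ?thesis using C by blast
qed

text \<open>Write \<open>m Q\<close> as the integral over t of the indicator of t <
  \<open>m Q\<close> and apply \<open>core_bound\<close> to the subfamily alive at level t. Its
  union consists of points where w exceeds t almost everywhere, so exchanging the integrals turns
  the levels into w. Uniformity of \<open>core_bound\<close> in the family is essential
  here.\<close>

lemma core_bound_weighted:
  fixes u :: "real^'n::finite \<Rightarrow> real" and m :: "nat \<times> (int^'n) \<Rightarrow> real"
  assumes cb: "core_bound TYPE('n) \<tau> C" and \<tau>: "\<tau> > 0" and ug: "upper_gradient u F" and lam: "lam > 0" and S: "finite S"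
    and osc: "\<And>Q. Q \<in> S \<Longrightarrow> ennreal (lam * \<tau> ^ fst Q * side Q) \<le> (\<integral>\<^sup>+x\<in>dy Q. ennreal \<bar>u x - med u (dy Q)\<bar> \<partial>lborel)"
    and w [measurable]: "w \<in> borel_measurable borel"
    and m0: "\<And>Q. Q \<in> S \<Longrightarrow> 0 \<le> m Q" and mw: "\<And>Q. Q \<in> S \<Longrightarrow> AE x in lborel. x \<in> dy Q \<longrightarrow> ennreal (m Q) \<le> w x"
  shows "(\<Sum>Q\<in>S. ennreal (lam * \<tau> ^ fst Q * m Q)) \<le> ennreal C * (\<integral>\<^sup>+x. F x * w x \<partial>lborel)"
proof -
  have [measurable]: "F \<in> borel_measurable borel" using ug unfolding upper_gradient_def by auto
  \<comment> \<open>The region below the maximum of \<open>m Q\<close> over the cubes containing x.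
    For almost every x its section has length at most \<open>w x\<close>.\<close>
  define H where "H = (\<Union>Q\<in>S. {0..<m Q} \<times> dy Q)"
  have H [measurable]: "H \<in> sets (lborel \<Otimes>\<^sub>M lborel)"
    unfolding H_def using S by (intro sets.finite_UN) auto
  have "(\<Sum>Q\<in>S. ennreal (lam * \<tau> ^ fst Q * m Q)) = (\<Sum>Q\<in>S. \<integral>\<^sup>+t. ennreal (lam * \<tau> ^ fst Q) * indicator {0..<m Q} t \<partial>lborel)"
    using lam \<tau> m0 by (intro sum.cong) (auto simp: nn_integral_cmult_indicator ennreal_mult)
  also have "\<dots> = (\<integral>\<^sup>+t. (\<Sum>Q\<in>S. ennreal (lam * \<tau> ^ fst Q) * indicator {0..<m Q} t) \<partial>lborel)"
    by (rule nn_integral_sum[symmetric]) auto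
  also have "\<dots> \<le> (\<integral>\<^sup>+t. ennreal C * (\<integral>\<^sup>+x. F x * indicator H (t, x) \<partial>lborel) \<partial>lborel)"
  proof (intro nn_integral_mono)
    fix t :: real
    let ?S = "{Q\<in>S. t \<in> {0..<m Q}}"
    have "(\<Sum>Q\<in>S. ennreal (lam * \<tau> ^ fst Q) * indicator {0..<m Q} t) = (\<Sum>Q\<in>?S. ennreal (lam * \<tau> ^ fst Q))"
      using S by (simp add: indicator_def sum.If_cases Int_def if_distrib cong: if_cong)
    also have "\<dots> = ennreal (\<Sum>Q\<in>?S. lam * \<tau> ^ fst Q)" using lam \<tau> by (intro sum_ennreal) auto
    also have "\<dots> \<le> ennreal C * (\<integral>\<^sup>+x\<in>(\<Union>Q\<in>?S. dy Q). F x \<partial>lborel)"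
      using cb[unfolded core_bound_def, rule_format, OF ug lam, of ?S] S osc by auto
    also have "(\<integral>\<^sup>+x\<in>(\<Union>Q\<in>?S. dy Q). F x \<partial>lborel) = (\<integral>\<^sup>+x. F x * indicator H (t, x) \<partial>lborel)"
      by (intro nn_integral_cong) (auto simp: H_def indicator_def)
    finally show "(\<Sum>Q\<in>S. ennreal (lam * \<tau> ^ fst Q) * indicator {0..<m Q} t) \<le> ennreal C * (\<integral>\<^sup>+x. F x * indicator H (t, x) \<partial>lborel)" .
  qed
  also have "\<dots> = ennreal C * (\<integral>\<^sup>+t. \<integral>\<^sup>+x. F x * indicator H (t, x) \<partial>lborel \<partial>lborel)"
    by (rule nn_integral_cmult) measurable
  also have "(\<integral>\<^sup>+t. \<integral>\<^sup>+x. F x * indicator H (t, x) \<partial>lborel \<partial>lborel) = (\<integral>\<^sup>+x. \<integral>\<^sup>+t. F x * indicator H (t, x) \<partial>lborel \<partial>lborel)"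
    by (rule lborel_pair.Fubini'[symmetric]) measurable
  also have "\<dots> \<le> (\<integral>\<^sup>+x. F x * w x \<partial>lborel)"
  proof (intro nn_integral_mono_AE)
    have "AE x in lborel. \<forall>Q\<in>S. x \<in> dy Q \<longrightarrow> ennreal (m Q) \<le> w x"
      using S mw by (intro AE_finite_allI) auto
    thus "AE x in lborel. (\<integral>\<^sup>+t. F x * indicator H (t, x) \<partial>lborel) \<le> F x * w x"
    proof eventually_elim
      case (elim x)
      define \<mu> where "\<mu> = Max (insert 0 (m ` {Q\<in>S. x \<in> dy Q}))"
      have fin: "finite (insert 0 (m ` {Q\<in>S. x \<in> dy Q}))" using S by auto
      have \<mu>w: "ennreal \<mu> \<le> w x"
        using Max_in[OF fin] elim unfolding \<mu>_def[symmetric] by auto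
      have \<mu>0: "\<mu> \<ge> 0" unfolding \<mu>_def by (rule Max_ge[OF fin]) simp
      have "(\<integral>\<^sup>+t. F x * indicator H (t, x) \<partial>lborel) \<le> (\<integral>\<^sup>+t. F x * indicator {0..<\<mu>} t \<partial>lborel)"
      proof (intro nn_integral_mono mult_left_mono)
        fix t :: real
        show "indicator H (t, x) \<le> (indicator {0..<\<mu>} t :: ennreal)"
        proof (cases "(t, x) \<in> H")
          case True
          then obtain Q where Q: "Q \<in> S" "0 \<le> t" "t < m Q" "x \<in> dy Q" unfolding H_def by auto
          have "m Q \<le> \<mu>" unfolding \<mu>_def by (rule Max_ge[OF fin]) (use Q in auto)
          thus ?thesis using Q True by simp
        qed simp
      qed simp
      also have "\<dots> = F x * ennreal \<mu>" using \<mu>0 by (subst nn_integral_cmult_indicator) auto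
      also have "\<dots> \<le> F x * w x" using \<mu>w by (rule mult_left_mono) simp
      finally show ?case .
    qed
  qed
  finally show ?thesis by (simp add: mult_left_mono)
qed

section \<open>Coefficients against dilates of a function of mean zero\<close>

lemma nn_integral_lborel_affine:
  fixes F :: "real^'n::finite \<Rightarrow> ennreal"
  assumes [measurable]: "F \<in> borel_measurable borel" and c: "c > 0"
  shows "(\<integral>\<^sup>+x. F x \<partial>lborel) = ennreal (c ^ CARD('n)) * (\<integral>\<^sup>+y. F (t + c *\<^sub>R y) \<partial>lborel)"
  using c by (subst lborel_affine[of c t])
     (auto simp: nn_integral_density nn_integral_distr nn_integral_cmult)

lemma AE_lborel_affine:
  fixes t :: "real^'n::finite"
  assumes c: "c > 0" and P: "AE x in lborel. P x"
  shows "AE y in lborel. P (t + c *\<^sub>R y)"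
proof -
  from P obtain N where N: "{x \<in> space lborel. \<not> P x} \<subseteq> N" "emeasure lborel N = 0" "N \<in> sets lborel"
    by (rule AE_E)
  have [measurable]: "N \<in> sets borel" using N(3) by simp
  have "ennreal (c ^ CARD('n)) * (\<integral>\<^sup>+y. indicator N (t + c *\<^sub>R y) \<partial>lborel) = 0"
    using nn_integral_lborel_affine[of "indicator N" c t] c N(2,3) by simp
  hence "(\<integral>\<^sup>+y. indicator N (t + c *\<^sub>R y) \<partial>lborel) = 0" using zero_less_power[OF c, of "CARD('n)"] by (auto simp: ennreal_eq_0_iff not_le[symmetric])
  hence "AE y in lborel. indicator N (t + c *\<^sub>R y) = (0::ennreal)"
    by (subst (asm) nn_integral_0_iff_AE) auto
  thus ?thesis by (rule eventually_mono) (use N(1) in \<open>auto simp: indicator_def split: if_splits\<close>)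
qed

lemma upper_gradient_affine:
  fixes u :: "real^'n::finite \<Rightarrow> 'b::{real_normed_vector,second_countable_topology}"
  assumes ug: "upper_gradient u F" and c: "c > 0"
  shows "upper_gradient (\<lambda>y. u (t + c *\<^sub>R y)) (\<lambda>y. ennreal c * F (t + c *\<^sub>R y))"
proof -
  have [measurable]: "u \<in> borel_measurable borel" "F \<in> borel_measurable borel"
    using ug unfolding upper_gradient_def by auto
  show ?thesis unfolding upper_gradient_def
  proof (intro conjI allI)
    fix i r
    from ug have "AE x in lborel. ennreal (norm (u (x + (c * r) *\<^sub>R axis i 1) - u x))
        \<le> (\<integral>\<^sup>+s. indicator (closed_segment 0 (c * r)) s * F (x + s *\<^sub>R axis i 1) \<partial>lborel)"
      unfolding upper_gradient_def by blast
    from AE_lborel_affine[OF c this, of t]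
    show "AE y in lborel. ennreal (norm (u (t + c *\<^sub>R (y + r *\<^sub>R axis i 1)) - u (t + c *\<^sub>R y)))
        \<le> (\<integral>\<^sup>+s. indicator (closed_segment 0 r) s * (ennreal c * F (t + c *\<^sub>R (y + s *\<^sub>R axis i 1))) \<partial>lborel)"
    proof (rule eventually_mono)
      fix y
      assume *: "ennreal (norm (u (t + c *\<^sub>R y + (c * r) *\<^sub>R axis i 1) - u (t + c *\<^sub>R y)))
        \<le> (\<integral>\<^sup>+s. indicator (closed_segment 0 (c * r)) s * F (t + c *\<^sub>R y + s *\<^sub>R axis i 1) \<partial>lborel)"
      have seg: "indicator (closed_segment 0 (c * r)) (c * s) = (indicator (closed_segment 0 r) s :: ennreal)" for s
        using c by (auto simp: indicator_def closed_segment_eq_real_ivl zero_le_mult_iff mult_le_0_iff)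
      have "(\<integral>\<^sup>+s. indicator (closed_segment 0 (c * r)) s * F (t + c *\<^sub>R y + s *\<^sub>R axis i 1) \<partial>lborel)
        = ennreal c * (\<integral>\<^sup>+s. indicator (closed_segment 0 (c * r)) (0 + c * s) * F (t + c *\<^sub>R y + (0 + c * s) *\<^sub>R axis i 1) \<partial>lborel)"
        by (subst nn_integral_real_affine[where c=c and t=0]) (use c in auto)
      also have "(\<integral>\<^sup>+s. indicator (closed_segment 0 (c * r)) (0 + c * s) * F (t + c *\<^sub>R y + (0 + c * s) *\<^sub>R axis i 1) \<partial>lborel)
        = (\<integral>\<^sup>+s. indicator (closed_segment 0 r) s * F (t + c *\<^sub>R (y + s *\<^sub>R axis i 1)) \<partial>lborel)"
        by (intro nn_integral_cong) (simp add: seg scaleR_add_right add.assoc)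
      also have "ennreal c * \<dots> = (\<integral>\<^sup>+s. ennreal c * (indicator (closed_segment 0 r) s * F (t + c *\<^sub>R (y + s *\<^sub>R axis i 1))) \<partial>lborel)"
        by (rule nn_integral_cmult[symmetric]) measurable
      finally show "ennreal (norm (u (t + c *\<^sub>R (y + r *\<^sub>R axis i 1)) - u (t + c *\<^sub>R y)))
        \<le> (\<integral>\<^sup>+s. indicator (closed_segment 0 r) s * (ennreal c * F (t + c *\<^sub>R (y + s *\<^sub>R axis i 1))) \<partial>lborel)"
        using * by (simp add: scaleR_add_right add.assoc mult_ac)
    qed
  qed measurable
qed

lemma integrable_mult_compact_support:
  fixes f h :: "'a::euclidean_space \<Rightarrow> 'b::{banach, second_countable_topology, real_normed_algebra}"
  assumes [measurable]: "f \<in> borel_measurable borel" "h \<in> borel_measurable borel"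
    and K: "compact K" "\<And>x. x \<notin> K \<Longrightarrow> h x = 0" and B: "\<And>x. norm (h x) \<le> B"
    and fin: "(\<integral>\<^sup>+x. indicator K x * ennreal (norm (f x)) \<partial>lborel) < \<infinity>"
  shows "integrable lborel (\<lambda>x. f x * h x)"
  unfolding integrable_iff_bounded
proof
  have [measurable]: "K \<in> sets borel" using K(1) by (simp add: borel_compact)
  have B0: "0 \<le> B" using B[of undefined] norm_ge_zero order_trans by blast
  have "(\<integral>\<^sup>+x. ennreal (norm (f x * h x)) \<partial>lborel) \<le> (\<integral>\<^sup>+x. ennreal B * (indicator K x * ennreal (norm (f x))) \<partial>lborel)"
  proof (intro nn_integral_mono)
    fix x
    show "ennreal (norm (f x * h x)) \<le> ennreal B * (indicator K x * ennreal (norm (f x)))"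
    proof (cases "x \<in> K")
      case True
      have "norm (f x * h x) \<le> norm (f x) * norm (h x)" by (rule norm_mult_ineq)
      also have "\<dots> \<le> norm (f x) * B" by (intro mult_left_mono B) simp
      finally show ?thesis using True B0 by (simp add: ennreal_mult[symmetric] ennreal_leI mult.commute)
    qed (simp add: K(2))
  qed
  also have "\<dots> = ennreal B * (\<integral>\<^sup>+x. indicator K x * ennreal (norm (f x)) \<partial>lborel)"
    by (rule nn_integral_cmult) measurable
  also have "\<dots> < \<infinity>" using fin by (simp add: ennreal_mult_less_top)
  finally show "(\<integral>\<^sup>+x. ennreal (norm (f x * h x)) \<partial>lborel) < \<infinity>" .
qed measurable

abbreviation real_vec :: "int^'n \<Rightarrow> real^'n::finite" where
  "real_vec k \<equiv> \<chi> i. real_of_int (k $ i)"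

text \<open>It contains both the dyadic cube and the support of the dilate of any function supported
  in [-R, R)^n. Its side is the odd multiple 2R + 1 of 2^(-j).\<close>

definition dilated_cube :: "nat \<Rightarrow> nat \<times> (int^'n) \<Rightarrow> (real^'n::finite) set" where
  "dilated_cube R P = cbox (\<chi> i. (real_of_int (snd P $ i) - real R) / 2 ^ fst P)
     (\<chi> i. (real_of_int (snd P $ i) + real R + 1) / 2 ^ fst P)"

text \<open>Since \<open>M = 2R + 1\<close> is odd, \<open>2\<^sup>j\<close> is invertible modulo \<open>M\<close>, so that each cube
  \<open>2\<^sup>-\<^sup>j(k - R + [0, M))\<close> is a dyadic cube of one of finitely many translates of the dyadic grid
  magnified by \<open>M\<close>.\<close>

lemma shifted_grid:
  fixes a :: int and R j :: nat
  defines "M \<equiv> 2 * int R + 1"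
  shows "\<exists>r q. 0 \<le> r \<and> r < M \<and> a = 2 ^ j * r + M * q"
proof -
  \<comment> \<open>Since 2(R + 1) = M + 1, the number R + 1 is the inverse of 2 modulo M.\<close>
  define r where "r = ((int R + 1) ^ j * a) mod M"
  have "(2 ^ j * r) mod M = (2 ^ j * ((int R + 1) ^ j * a)) mod M"
    unfolding r_def by (rule mod_mult_right_eq)
  also have "2 ^ j * ((int R + 1) ^ j * a) = (2 * (int R + 1)) ^ j * a" by (simp only: power_mult_distrib mult.assoc)
  also have "((2 * (int R + 1)) ^ j * a) mod M = (((2 * (int R + 1)) ^ j mod M) * a) mod M"
    by (simp only: mod_mult_left_eq)
  also have "(2 * (int R + 1)) ^ j mod M = ((2 * (int R + 1)) mod M) ^ j mod M"
    by (simp only: power_mod)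
  also have "(2 * (int R + 1)) mod M = 1 mod M"
  proof -
    have "2 * (int R + 1) = 1 + M" by (simp add: M_def)
    thus ?thesis by (simp only: mod_add_self2)
  qed
  also have "(1 mod M) ^ j mod M = 1 mod M" by (simp only: power_mod power_one)
  also have "(1 mod M * a) mod M = a mod M" by (simp only: mod_mult_left_eq mult_1)
  finally have "M dvd a - 2 ^ j * r" by (metis mod_eq_dvd_iff)
  then obtain q where "a - 2 ^ j * r = M * q" by blast
  hence "a = 2 ^ j * r + M * q" by simp
  moreover have "M > 0" unfolding M_def by simp
  hence "0 \<le> r" "r < M" unfolding r_def by (rule pos_mod_sign, rule pos_mod_bound)
  ultimately show ?thesis by blast
qed

lemma finite_int_vecs: "finite {r :: int^'n::finite. \<forall>i. 0 \<le> r $ i \<and> r $ i < M}"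
proof -
  have "{r :: int^'n. \<forall>i. 0 \<le> r $ i \<and> r $ i < M} \<subseteq> vec_lambda ` (PiE UNIV (\<lambda>_. {0..<M}))"
  proof
    fix r :: "int^'n" assume "r \<in> {r. \<forall>i. 0 \<le> r $ i \<and> r $ i < M}"
    hence "vec_nth r \<in> PiE UNIV (\<lambda>_. {0..<M})" by auto
    moreover have "r = vec_lambda (vec_nth r)" by simp
    ultimately show "r \<in> vec_lambda ` (PiE UNIV (\<lambda>_. {0..<M}))" by blast
  qed
  thus ?thesis by (rule finite_subset) (intro finite_imageI finite_PiE, auto)
qed

abbreviation finite_on_compacts :: "('a::euclidean_space \<Rightarrow> 'b::real_normed_vector) \<Rightarrow> bool" where
  "finite_on_compacts u \<equiv> \<forall>K. compact K \<longrightarrow> (\<integral>\<^sup>+x. indicator K x * ennreal (norm (u x)) \<partial>lborel) < \<infinity>"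

text \<open>As g has mean zero, a median of u may be subtracted, so a coefficient is at most a
  constant times the normalized oscillation on the dilated cube. After the affine change of
  variables of its class that cube is dyadic and \<open>core_bound_weighted\<close> applies. The
  number of classes depends only on R and n.\<close>

lemma coefficient_family_bound:
  fixes g :: "real^'n::finite \<Rightarrow> real" and R :: nat
  assumes g [measurable]: "g \<in> borel_measurable borel" and gB: "\<And>x. \<bar>g x\<bar> \<le> B" and B: "B > 0"
    and supp: "\<And>x i. g x \<noteq> 0 \<Longrightarrow> - real R \<le> x $ i \<and> x $ i < real R"
    and mean0: "(LINT x|lborel. g x) = 0"
    and cb: "core_bound TYPE('n) \<tau> C" and C: "C > 0" and \<tau>: "\<tau> > 0"
  shows "\<exists>C'>0. \<forall>(u :: real^'n \<Rightarrow> real) F w (lam::real) S q. upper_gradient u F \<longrightarrow>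
     finite_on_compacts u \<longrightarrow>
     w \<in> borel_measurable borel \<longrightarrow> lam > 0 \<longrightarrow> finite S \<longrightarrow>
     (\<forall>P\<in>S. lam * \<tau> ^ fst P \<le> \<bar>LINT x|lborel. u x * (2 ^ fst P * g (2 ^ fst P *\<^sub>R x - real_vec (snd P)))\<bar>) \<longrightarrow>
     (\<forall>P\<in>S. 0 \<le> q P \<and> (AE x in lborel. x \<in> dilated_cube R P \<longrightarrow> ennreal (q P) \<le> w x)) \<longrightarrow>
     (\<Sum>P\<in>S. ennreal (lam * \<tau> ^ fst P * q P)) \<le> ennreal C' * (\<integral>\<^sup>+x. F x * w x \<partial>lborel)"
proof -
  define M where "M = 2 * int R + 1"
  define Mr where "Mr = real_of_int M"
  have Mr: "Mr > 0" "Mr \<ge> 1" "Mr = 2 * real R + 1" unfolding Mr_def M_def by auto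
  have "\<exists>r q. 0 \<le> r \<and> r < M \<and> a - int R = 2 ^ j * r + M * q" for a :: int and j :: nat
    unfolding M_def by (rule shifted_grid)
  then obtain rr qq where rq: "\<And>a j. 0 \<le> rr a j \<and> rr a j < M \<and> a - int R = 2 ^ j * rr a j + M * qq a j"
    by metis
  \<comment> \<open>\<open>\<rho>\<close> is the class of a cube, that is, the offset of its grid,
    and \<open>\<kappa>\<close> its index within the grid. The map \<open>bk\<close> recovers the
    cube from them.\<close>
  define \<rho> :: "nat \<times> (int^'n) \<Rightarrow> int^'n" where "\<rho> P = (\<chi> i. rr (snd P $ i) (fst P))" for P
  define \<kappa> :: "nat \<times> (int^'n) \<Rightarrow> int^'n" where "\<kappa> P = (\<chi> i. qq (snd P $ i) (fst P))" for P
  define bk :: "int^'n \<Rightarrow> nat \<times> (int^'n) \<Rightarrow> nat \<times> (int^'n)" where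
    "bk r Q = (fst Q, \<chi> i. int R + 2 ^ fst Q * r $ i + M * snd Q $ i)" for r Q
  have bk: "bk (\<rho> P) (fst P, \<kappa> P) = P" for P
  proof -
    have "snd P $ i - int R = 2 ^ fst P * rr (snd P $ i) (fst P) + M * qq (snd P $ i) (fst P)" for i
      using rq by blast
    hence "int R + 2 ^ fst P * rr (snd P $ i) (fst P) + M * qq (snd P $ i) (fst P) = snd P $ i" for i
      by (metis add.assoc add.commute diff_add_cancel)
    thus ?thesis unfolding bk_def \<rho>_def \<kappa>_def by (simp add: prod_eq_iff vec_eq_iff)
  qed
  define G where "G = {r :: int^'n. \<forall>i. 0 \<le> r $ i \<and> r $ i < M}"
  have G: "finite G" unfolding G_def by (rule finite_int_vecs)
  have \<rho>G: "\<rho> P \<in> G" for P unfolding G_def \<rho>_def using rq by auto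
  define C1 where "C1 = B * Mr ^ CARD('n) * C * Mr"
  have C1: "C1 > 0" unfolding C1_def using B Mr C by simp
  define C' where "C' = real (card G + 1) * C1"
  have "(\<Sum>P\<in>S. ennreal (lam * \<tau> ^ fst P * q P)) \<le> ennreal C' * (\<integral>\<^sup>+x. F x * w x \<partial>lborel)"
    if ug: "upper_gradient u F" and loc: "\<And>K. compact K \<Longrightarrow> (\<integral>\<^sup>+x. indicator K x * ennreal (norm (u x)) \<partial>lborel) < \<infinity>"
      and w [measurable]: "w \<in> borel_measurable borel" and lam: "lam > 0" and S: "finite S"
      and big: "\<And>P. P\<in>S \<Longrightarrow> lam * \<tau> ^ fst P \<le> \<bar>LINT x|lborel. u x * (2 ^ fst P * g (2 ^ fst P *\<^sub>R x - real_vec (snd P)))\<bar>"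
      and q0: "\<And>P. P\<in>S \<Longrightarrow> 0 \<le> q P" and qw: "\<And>P. P\<in>S \<Longrightarrow> AE x in lborel. x \<in> dilated_cube R P \<longrightarrow> ennreal (q P) \<le> w x"
    for u :: "real^'n \<Rightarrow> real" and F w lam S q
  proof -
    have [measurable]: "u \<in> borel_measurable borel" "F \<in> borel_measurable borel"
      using ug unfolding upper_gradient_def by auto
    define I where "I = (\<integral>\<^sup>+x. F x * w x \<partial>lborel)"
    have cls: "(\<Sum>P\<in>{P\<in>S. \<rho> P = r}. ennreal (lam * \<tau> ^ fst P * q P)) \<le> ennreal C1 * I" for r
    proof -
      define Sr where "Sr = {P\<in>S. \<rho> P = r}"
      define t where "t = real_vec r"
      define v where "v y = u (t + Mr *\<^sub>R y)" for y
      define h where "h P = (fst P, \<kappa> P)" for P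
      define T where "T = h ` Sr"
      have bh: "bk r (h P) = P" if "P \<in> Sr" for P using that bk[of P] unfolding Sr_def h_def by auto
      hence inj: "inj_on h Sr" by (metis inj_on_inverseI)
      have T: "finite T" unfolding T_def Sr_def using S by simp
      \<comment> \<open>Divides out the sup bound of g and the Jacobian of x = t + Mr y. The factor
        2^j of the dilate is matched by \<open>side Q\<close> in \<open>core_bound\<close>.\<close>
      define lam' where "lam' = lam / (B * Mr ^ CARD('n))"
      have lam': "lam' > 0" unfolding lam'_def using lam B Mr by simp
      have ugv: "upper_gradient v (\<lambda>y. ennreal Mr * F (t + Mr *\<^sub>R y))"
        unfolding v_def by (rule upper_gradient_affine[OF ug Mr(1)])
      have [measurable]: "v \<in> borel_measurable borel" unfolding v_def by measurable
      \<comment> \<open>The change of variables maps the dyadic cube with index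
        \<open>\<kappa> P\<close> onto the half-open box with the same corners as the dilated cube
        of P.\<close>
      have coord: "2 ^ fst P * (t + Mr *\<^sub>R y) $ i - real_of_int (snd P $ i) + real R = Mr * (2 ^ fst P * y $ i - real_of_int (\<kappa> P $ i))"
        if "P \<in> Sr" for P y i
      proof -
        have "snd P $ i = int R + 2 ^ fst P * r $ i + M * \<kappa> P $ i"
          using arg_cong[OF bh[OF that], of "\<lambda>P. snd P $ i"] by (simp add: bk_def h_def)
        hence "real_of_int (snd P $ i) = real R + 2 ^ fst P * real_of_int (r $ i) + Mr * real_of_int (\<kappa> P $ i)"
          by (simp add: Mr_def)
        thus ?thesis by (simp add: t_def algebra_simps)
      qed
      have osc: "ennreal (lam' * \<tau> ^ fst Q * side Q) \<le> (\<integral>\<^sup>+y\<in>dy Q. ennreal \<bar>v y - med v (dy Q)\<bar> \<partial>lborel)" if QT: "Q \<in> T" for Q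
      proof -
        from QT obtain P where P: "P \<in> Sr" "Q = h P" unfolding T_def by blast
        have PS: "P \<in> S" using P unfolding Sr_def by simp
        have fQ: "fst Q = fst P" using P(2) by (simp add: h_def)
        define j where "j = fst P"
        define m where "m = med v (dy Q)"
        define \<gamma> where "\<gamma> x = 2 ^ j * g (2 ^ j *\<^sub>R x - real_vec (snd P))" for x
        have [measurable]: "\<gamma> \<in> borel_measurable borel" unfolding \<gamma>_def by measurable
        define K where "K = dilated_cube R P"
        have K: "compact K" unfolding K_def dilated_cube_def by (rule compact_cbox)
        have \<gamma>K: "\<gamma> x = 0" if "x \<notin> K" for x
        proof (rule ccontr)
          assume "\<gamma> x \<noteq> 0"
          hence "g (2 ^ j *\<^sub>R x - real_vec (snd P)) \<noteq> 0" unfolding \<gamma>_def by auto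
          from supp[OF this] have "x \<in> K" unfolding K_def dilated_cube_def j_def
            by (auto simp: mem_box_cart field_simps) (smt (verit))+
          thus False using that by simp
        qed
        have \<gamma>B: "\<bar>\<gamma> x\<bar> \<le> 2 ^ j * B" for x unfolding \<gamma>_def by (simp add: abs_mult gB)
        have int_u: "integrable lborel (\<lambda>x. u x * \<gamma> x)"
          by (rule integrable_mult_compact_support[OF _ _ K \<gamma>K, where B="2 ^ j * B"]) (use \<gamma>B loc[OF K] in auto)
        have "(\<integral>\<^sup>+x. indicator K x * ennreal (norm (1::real)) \<partial>lborel) < \<infinity>"
          using K emeasure_compact_finite[OF K] by (simp add: borel_compact)
        hence int_1: "integrable lborel (\<lambda>x. 1 * \<gamma> x)"
          by (intro integrable_mult_compact_support[OF _ _ K \<gamma>K, where B="2 ^ j * B"]) (use \<gamma>B in auto)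
        have zero: "(LINT x|lborel. \<gamma> x) = 0"
        proof -
          have "(LINT x|lborel. g x) = (LINT x|density (distr lborel borel (\<lambda>x. - real_vec (snd P) + (2::real) ^ j *\<^sub>R x)) (\<lambda>_. ennreal (\<bar>2 ^ j\<bar> ^ DIM(real^'n))). g x)"
            using lborel_affine[of "2 ^ j :: real" "- real_vec (snd P)"] by simp
          also have "\<dots> = (LINT x|distr lborel borel (\<lambda>x. - real_vec (snd P) + (2::real) ^ j *\<^sub>R x). (\<bar>2 ^ j\<bar> ^ DIM(real^'n)) *\<^sub>R g x)"
            by (subst integral_density) auto
          also have "\<dots> = (LINT x|lborel. (\<bar>2 ^ j\<bar> ^ DIM(real^'n)) *\<^sub>R g (- real_vec (snd P) + (2::real) ^ j *\<^sub>R x))"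
            by (subst integral_distr) auto
          finally have "(2 ^ j) ^ DIM(real^'n) * (LINT x|lborel. g (2 ^ j *\<^sub>R x - real_vec (snd P))) = 0"
            using mean0 by simp
          thus ?thesis unfolding \<gamma>_def by simp
        qed
        \<comment> \<open>Mean zero allows the median to be subtracted from u.\<close>
        have "(LINT x|lborel. u x * \<gamma> x) = (LINT x|lborel. u x * \<gamma> x - m * (1 * \<gamma> x))"
          using int_u int_1 zero by (subst Bochner_Integration.integral_diff) auto
        also have "\<dots> = (LINT x|lborel. (u x - m) * \<gamma> x)" by (simp add: algebra_simps)
        finally have eq: "(LINT x|lborel. u x * \<gamma> x) = (LINT x|lborel. (u x - m) * \<gamma> x)" .
        have int_um: "integrable lborel (\<lambda>x. (u x - m) * \<gamma> x)"
          using Bochner_Integration.integrable_diff[OF int_u integrable_mult_right[OF int_1, of m]] by (simp add: algebra_simps)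
        have "ennreal (lam * \<tau> ^ j) \<le> ennreal (norm (LINT x|lborel. (u x - m) * \<gamma> x))"
        proof -
          have "lam * \<tau> ^ j \<le> \<bar>LINT x|lborel. u x * \<gamma> x\<bar>"
            using big[OF PS] unfolding \<gamma>_def j_def .
          thus ?thesis unfolding eq real_norm_def by (rule ennreal_leI)
        qed
        also have "\<dots> \<le> (\<integral>\<^sup>+x. ennreal (norm ((u x - m) * \<gamma> x)) \<partial>lborel)"
          by (rule integral_norm_bound_ennreal[OF int_um])
        also have "\<dots> = ennreal (Mr ^ CARD('n)) * (\<integral>\<^sup>+y. ennreal (norm ((u (t + Mr *\<^sub>R y) - m) * \<gamma> (t + Mr *\<^sub>R y))) \<partial>lborel)"
          by (rule nn_integral_lborel_affine[OF _ Mr(1)]) measurable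
        also have "(\<integral>\<^sup>+y. ennreal (norm ((u (t + Mr *\<^sub>R y) - m) * \<gamma> (t + Mr *\<^sub>R y))) \<partial>lborel)
          \<le> (\<integral>\<^sup>+y. ennreal (2 ^ j * B) * (ennreal \<bar>v y - m\<bar> * indicator (dy Q) y) \<partial>lborel)"
        proof (intro nn_integral_mono)
          fix y
          show "ennreal (norm ((u (t + Mr *\<^sub>R y) - m) * \<gamma> (t + Mr *\<^sub>R y))) \<le> ennreal (2 ^ j * B) * (ennreal \<bar>v y - m\<bar> * indicator (dy Q) y)"
          proof (cases "\<gamma> (t + Mr *\<^sub>R y) = 0")
            case False
            hence ne: "g (2 ^ j *\<^sub>R (t + Mr *\<^sub>R y) - real_vec (snd P)) \<noteq> 0" unfolding \<gamma>_def by auto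
            have "y \<in> dy Q"
            proof -
              have "\<lfloor>2 ^ j * y $ i\<rfloor> = \<kappa> P $ i" for i
              proof -
                have "0 \<le> Mr * (2 ^ j * y $ i - real_of_int (\<kappa> P $ i))" "Mr * (2 ^ j * y $ i - real_of_int (\<kappa> P $ i)) < Mr * 1"
                proof -
                  have "- real R \<le> 2 ^ j * (t + Mr *\<^sub>R y) $ i - real_of_int (snd P $ i)"
                    "2 ^ j * (t + Mr *\<^sub>R y) $ i - real_of_int (snd P $ i) < real R"
                    using supp[OF ne, of i]
                    by (simp_all only: vector_minus_component vector_scaleR_component vec_lambda_beta real_scaleR_def)
                  thus "0 \<le> Mr * (2 ^ j * y $ i - real_of_int (\<kappa> P $ i))" "Mr * (2 ^ j * y $ i - real_of_int (\<kappa> P $ i)) < Mr * 1"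
                    using coord[OF P(1), of y i] Mr(3) unfolding j_def by linarith+
                qed
                hence "0 \<le> 2 ^ j * y $ i - real_of_int (\<kappa> P $ i)" "2 ^ j * y $ i - real_of_int (\<kappa> P $ i) < 1"
                  using Mr(1) by (auto simp: zero_le_mult_iff)
                thus ?thesis by (simp add: floor_eq_iff)
              qed
              thus ?thesis unfolding dy_def P(2) h_def j_def by simp
            qed
            moreover have "norm ((u (t + Mr *\<^sub>R y) - m) * \<gamma> (t + Mr *\<^sub>R y)) \<le> \<bar>v y - m\<bar> * (2 ^ j * B)"
              by (simp add: v_def abs_mult mult_left_mono \<gamma>B)
            ultimately show ?thesis using B by (simp add: ennreal_mult[symmetric] ennreal_leI mult_ac)
          qed simp
        qed
        also have "\<dots> = ennreal (2 ^ j * B) * (\<integral>\<^sup>+y\<in>dy Q. ennreal \<bar>v y - m\<bar> \<partial>lborel)"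
          by (rule nn_integral_cmult) measurable
        finally have "ennreal (lam * \<tau> ^ j) \<le> ennreal (Mr ^ CARD('n)) * (ennreal (2 ^ j * B) * (\<integral>\<^sup>+y\<in>dy Q. ennreal \<bar>v y - m\<bar> \<partial>lborel))"
          by (simp add: mult_left_mono)
        also have "\<dots> = ennreal (B * Mr ^ CARD('n) * 2 ^ j) * (\<integral>\<^sup>+y\<in>dy Q. ennreal \<bar>v y - m\<bar> \<partial>lborel)"
          using B Mr by (subst mult.assoc[symmetric], subst ennreal_mult[symmetric]) (auto simp: mult_ac)
        finally have X: "ennreal (lam * \<tau> ^ j) \<le> ennreal (B * Mr ^ CARD('n) * 2 ^ j) * (\<integral>\<^sup>+y\<in>dy Q. ennreal \<bar>v y - m\<bar> \<partial>lborel)" .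
        have "lam * \<tau> ^ j = (B * Mr ^ CARD('n) * 2 ^ j) * (lam' * \<tau> ^ fst Q * side Q)"
          unfolding lam'_def fQ j_def[symmetric] using B Mr by (simp add: power_one_over field_simps)
        hence "ennreal (B * Mr ^ CARD('n) * 2 ^ j) * ennreal (lam' * \<tau> ^ fst Q * side Q) = ennreal (lam * \<tau> ^ j)"
          using B Mr lam' \<tau> by (subst ennreal_mult[symmetric]) auto
        hence "ennreal (B * Mr ^ CARD('n) * 2 ^ j) * ennreal (lam' * \<tau> ^ fst Q * side Q)
           \<le> ennreal (B * Mr ^ CARD('n) * 2 ^ j) * (\<integral>\<^sup>+y\<in>dy Q. ennreal \<bar>v y - m\<bar> \<partial>lborel)"
          using X by simp
        thus ?thesis unfolding m_def
          by (subst (asm) ennreal_mult_le_mult_iff) (use B Mr in \<open>auto simp: not_le\<close>)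
      qed
      have "(\<Sum>Q\<in>T. ennreal (lam' * \<tau> ^ fst Q * q (bk r Q))) \<le> ennreal C * (\<integral>\<^sup>+y. (ennreal Mr * F (t + Mr *\<^sub>R y)) * w (t + Mr *\<^sub>R y) \<partial>lborel)"
      proof (rule core_bound_weighted[OF cb \<tau> ugv lam' T osc])
        fix Q assume "Q \<in> T"
        then obtain P where P: "P \<in> Sr" "Q = h P" unfolding T_def by blast
        have PS: "P \<in> S" using P unfolding Sr_def by simp
        show "0 \<le> q (bk r Q)" using P bh q0[OF PS] by simp
        from AE_lborel_affine[OF Mr(1) qw[OF PS], of t]
        show "AE y in lborel. y \<in> dy Q \<longrightarrow> ennreal (q (bk r Q)) \<le> w (t + Mr *\<^sub>R y)"
        proof (rule eventually_mono)
          fix y assume *: "t + Mr *\<^sub>R y \<in> dilated_cube R P \<longrightarrow> ennreal (q P) \<le> w (t + Mr *\<^sub>R y)"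
          have "t + Mr *\<^sub>R y \<in> dilated_cube R P" if y: "y \<in> dy Q"
          proof -
            have "real_of_int (snd P $ i) - real R \<le> 2 ^ fst P * (t + Mr *\<^sub>R y) $ i \<and>
              2 ^ fst P * (t + Mr *\<^sub>R y) $ i \<le> real_of_int (snd P $ i) + real R + 1" for i
            proof -
              have "\<lfloor>2 ^ fst P * y $ i\<rfloor> = \<kappa> P $ i" using y unfolding P(2) h_def dy_def by simp
              hence "0 \<le> 2 ^ fst P * y $ i - real_of_int (\<kappa> P $ i)" "2 ^ fst P * y $ i - real_of_int (\<kappa> P $ i) \<le> 1"
                by linarith+
              hence "0 \<le> Mr * (2 ^ fst P * y $ i - real_of_int (\<kappa> P $ i))" "Mr * (2 ^ fst P * y $ i - real_of_int (\<kappa> P $ i)) \<le> Mr * 1"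
                using Mr(1) by (auto intro!: mult_left_mono mult_nonneg_nonneg simp del: mult_1_right)
              thus ?thesis using coord[OF P(1), of y i] Mr(3) by linarith
            qed
            thus ?thesis unfolding dilated_cube_def by (simp add: mem_box_cart pos_divide_le_eq pos_le_divide_eq mult.commute)
          qed
          thus "y \<in> dy Q \<longrightarrow> ennreal (q (bk r Q)) \<le> w (t + Mr *\<^sub>R y)" using * P bh by simp
        qed
      qed measurable
      also have "(\<integral>\<^sup>+y. (ennreal Mr * F (t + Mr *\<^sub>R y)) * w (t + Mr *\<^sub>R y) \<partial>lborel) = ennreal Mr * (\<integral>\<^sup>+y. F (t + Mr *\<^sub>R y) * w (t + Mr *\<^sub>R y) \<partial>lborel)"
        unfolding mult.assoc by (rule nn_integral_cmult) measurable
      also have "\<dots> \<le> ennreal Mr * I"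
      proof (rule mult_left_mono)
        have "(\<integral>\<^sup>+y. F (t + Mr *\<^sub>R y) * w (t + Mr *\<^sub>R y) \<partial>lborel) = 1 * (\<integral>\<^sup>+y. F (t + Mr *\<^sub>R y) * w (t + Mr *\<^sub>R y) \<partial>lborel)" by simp
        also have "\<dots> \<le> ennreal (Mr ^ CARD('n)) * (\<integral>\<^sup>+y. F (t + Mr *\<^sub>R y) * w (t + Mr *\<^sub>R y) \<partial>lborel)"
          using Mr(2) by (intro mult_right_mono) (auto simp: one_le_power)
        also have "\<dots> = I" unfolding I_def by (rule nn_integral_lborel_affine[OF _ Mr(1), symmetric]) measurable
        finally show "(\<integral>\<^sup>+y. F (t + Mr *\<^sub>R y) * w (t + Mr *\<^sub>R y) \<partial>lborel) \<le> I" .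
      qed simp
      finally have main: "(\<Sum>Q\<in>T. ennreal (lam' * \<tau> ^ fst Q * q (bk r Q))) \<le> ennreal C * (ennreal Mr * I)"
        by (simp add: mult_left_mono)
      have "(\<Sum>P\<in>Sr. ennreal (lam * \<tau> ^ fst P * q P)) = (\<Sum>P\<in>Sr. ennreal (B * Mr ^ CARD('n)) * ennreal (lam' * \<tau> ^ fst (h P) * q (bk r (h P))))"
      proof (rule sum.cong[OF refl])
        fix P assume P: "P \<in> Sr"
        hence "0 \<le> q P" using q0 unfolding Sr_def by simp
        moreover have "lam = (B * Mr ^ CARD('n)) * lam'" unfolding lam'_def using B Mr by simp
        ultimately show "ennreal (lam * \<tau> ^ fst P * q P) = ennreal (B * Mr ^ CARD('n)) * ennreal (lam' * \<tau> ^ fst (h P) * q (bk r (h P)))"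
          using bh[OF P] B Mr lam' \<tau> by (subst ennreal_mult[symmetric]) (auto simp: h_def mult_ac)
      qed
      also have "\<dots> = ennreal (B * Mr ^ CARD('n)) * (\<Sum>Q\<in>T. ennreal (lam' * \<tau> ^ fst Q * q (bk r Q)))"
        unfolding T_def by (simp add: sum.reindex[OF inj] sum_distrib_left)
      also have "\<dots> \<le> ennreal (B * Mr ^ CARD('n)) * (ennreal C * (ennreal Mr * I))"
        by (intro mult_left_mono main) simp
      also have "\<dots> = ennreal C1 * I"
        unfolding C1_def using B C Mr by (simp add: ennreal_mult mult_ac)
      finally show ?thesis unfolding Sr_def .
    qed
    have "(\<Sum>P\<in>S. ennreal (lam * \<tau> ^ fst P * q P)) = (\<Sum>r\<in>\<rho> ` S. \<Sum>P\<in>{P\<in>S. \<rho> P = r}. ennreal (lam * \<tau> ^ fst P * q P))"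
      using S by (rule sum.image_gen)
    also have "\<dots> \<le> (\<Sum>r\<in>\<rho> ` S. ennreal C1 * I)" by (intro sum_mono cls)
    also have "\<dots> \<le> (\<Sum>r\<in>G. ennreal C1 * I)" using G \<rho>G by (intro sum_mono2) auto
    also have "\<dots> = ennreal (real (card G) * C1) * I"
      using C1 by (simp add: ennreal_mult ennreal_of_nat_eq_real_of_nat mult.assoc)
    also have "\<dots> \<le> ennreal C' * I"
      unfolding C'_def using C1 by (intro mult_right_mono ennreal_leI) auto
    finally show ?thesis unfolding I_def .
  qed
  thus ?thesis using C1 unfolding C'_def by (intro exI[of _ C']) (auto simp: C'_def)
qed

section \<open>Schwartz functions\<close>

lemma schwartz_decay:
  fixes g :: "real^'n::finite \<Rightarrow> complex"
  assumes "g \<in> schwartz"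
  shows "\<exists>C\<ge>0. \<forall>x. norm (iter_partial js g x) \<le> C / (1 + norm x) ^ m"
proof -
  have "bounded (range (\<lambda>x. (1 + norm x) ^ m *\<^sub>R iter_partial js g x))"
    using assms unfolding schwartz_def by blast
  then obtain C where C: "\<And>x. norm ((1 + norm x) ^ m *\<^sub>R iter_partial js g x) \<le> C"
    unfolding bounded_iff by blast
  show ?thesis
  proof (intro exI[of _ "max C 0"] conjI allI)
    fix x :: "real^'n"
    have p: "(1 + norm x) ^ m > 0" by (intro zero_less_power) (simp add: add_pos_nonneg)
    have "(1 + norm x) ^ m * norm (iter_partial js g x) \<le> max C 0"
      using C[of x] p by (simp add: abs_of_pos)
    thus "norm (iter_partial js g x) \<le> max C 0 / (1 + norm x) ^ m"
      using p by (simp add: pos_le_divide_eq mult.commute)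
  qed simp
qed

lemma schwartz_differentiable: "g \<in> schwartz \<Longrightarrow> g differentiable (at x)"
  unfolding schwartz_def smooth_def by (metis (mono_tags, lifting) iter_partial.simps(1) mem_Collect_eq)

lemma schwartz_continuous: "g \<in> schwartz \<Longrightarrow> continuous_on UNIV g"
  by (auto intro!: continuous_at_imp_continuous_on differentiable_imp_continuous_within schwartz_differentiable)

lemma derivative_as_partials:
  fixes g :: "real^'n::finite \<Rightarrow> complex"
  assumes "g differentiable (at z)"
  shows "frechet_derivative g (at z) h = (\<Sum>i\<in>UNIV. (h $ i) *\<^sub>R partial_deriv i g z)"
proof -
  have lin: "linear (frechet_derivative g (at z))" using assms by (rule linear_frechet_derivative)
  have "h = (\<Sum>i\<in>UNIV. (h $ i) *\<^sub>R axis i 1)"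
    by (simp add: vec_eq_iff axis_def if_distrib cong: if_cong)
  hence "frechet_derivative g (at z) h = frechet_derivative g (at z) (\<Sum>i\<in>UNIV. (h $ i) *\<^sub>R axis i 1)" by simp
  also have "\<dots> = (\<Sum>i\<in>UNIV. frechet_derivative g (at z) ((h $ i) *\<^sub>R axis i 1))" by (rule linear_sum[OF lin])
  finally show ?thesis unfolding partial_deriv_def by (simp add: linear_cmul[OF lin])
qed

text \<open>The mean value inequality with decay at the base point: for z within r of x the weights
  compare through 1 + |x| <= (1 + r)(1 + |z|).\<close>

lemma schwartz_lipschitz:
  fixes g :: "real^'n::finite \<Rightarrow> complex"
  assumes g: "g \<in> schwartz" and r: "r \<ge> 0"
  shows "\<exists>C\<ge>0. \<forall>x y. norm (y - x) \<le> r \<longrightarrow> norm (g y - g x) \<le> C * norm (y - x) / (1 + norm x) ^ m"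
proof -
  have "\<forall>i. \<exists>C\<ge>0. \<forall>x. norm (iter_partial [i] g x) \<le> C / (1 + norm x) ^ m"
    using schwartz_decay[OF g] by blast
  then obtain C where C: "\<And>i. C i \<ge> 0" "\<And>i x. norm (partial_deriv i g x) \<le> C i / (1 + norm x) ^ m"
    by (simp add: choice_iff) blast
  define L where "L = (\<Sum>i\<in>UNIV. C i) * (1 + r) ^ m"
  have L0: "L \<ge> 0" unfolding L_def using C(1) r by (intro mult_nonneg_nonneg sum_nonneg) auto
  show ?thesis
  proof (intro exI[of _ L] conjI allI impI)
    fix x y :: "real^'n" assume xy: "norm (y - x) \<le> r"
    have px: "(1 + norm x) ^ m > 0" by (intro zero_less_power) (simp add: add_pos_nonneg)
    have "norm (g y - g x) \<le> (L / (1 + norm x) ^ m) * norm (y - x)"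
    proof (rule differentiable_bound[where S="cball x r" and f'="\<lambda>z. frechet_derivative g (at z)"])
      show "convex (cball x r)" by simp
      show "x \<in> cball x r" "y \<in> cball x r" using xy r by (auto simp: dist_norm norm_minus_commute)
      fix z assume z: "z \<in> cball x r"
      show "(g has_derivative frechet_derivative g (at z)) (at z within cball x r)"
        using schwartz_differentiable[OF g] frechet_derivative_works has_derivative_at_withinI by blast
      have "norm x \<le> norm z + r"
        using z norm_triangle_ineq2[of x z] by (simp add: dist_norm norm_minus_commute)
      moreover have "(1 + r) * (1 + norm z) = 1 + norm z + r + r * norm z" by (simp add: algebra_simps)
      moreover have "0 \<le> r * norm z" using r by simp
      ultimately have "1 + norm x \<le> (1 + r) * (1 + norm z)" by linarith
      hence "(1 + norm x) ^ m \<le> ((1 + r) * (1 + norm z)) ^ m" by (intro power_mono) auto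
      hence pw: "(1 + norm x) ^ m \<le> (1 + r) ^ m * (1 + norm z) ^ m" by (simp add: power_mult_distrib)
      have pz: "(1 + norm z) ^ m > 0" by (intro zero_less_power) (simp add: add_pos_nonneg)
      show "onorm (frechet_derivative g (at z)) \<le> L / (1 + norm x) ^ m"
      proof (rule onorm_bound)
        fix h :: "real^'n"
        have "norm (frechet_derivative g (at z) h) \<le> (\<Sum>i\<in>UNIV. norm ((h $ i) *\<^sub>R partial_deriv i g z))"
          unfolding derivative_as_partials[OF schwartz_differentiable[OF g]] by (rule norm_sum)
        also have "\<dots> \<le> (\<Sum>i\<in>UNIV. norm h * (C i / (1 + norm z) ^ m))"
          unfolding norm_scaleR using C by (intro sum_mono mult_mono) (auto simp: component_le_norm_cart)
        also have "\<dots> = (\<Sum>i\<in>UNIV. C i) * (1 / (1 + norm z) ^ m) * norm h"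
          by (simp add: sum_distrib_left sum_distrib_right mult_ac sum_divide_distrib)
        also have "\<dots> \<le> (\<Sum>i\<in>UNIV. C i) * ((1 + r) ^ m / (1 + norm x) ^ m) * norm h"
        proof (intro mult_right_mono mult_left_mono)
          show "1 / (1 + norm z) ^ m \<le> (1 + r) ^ m / (1 + norm x) ^ m"
            using pw px pz by (simp add: divide_simps mult.commute)
        qed (use C(1) in \<open>auto intro: sum_nonneg\<close>)
        finally show "norm (frechet_derivative g (at z) h) \<le> L / (1 + norm x) ^ m * norm h"
          unfolding L_def by simp
      qed (use L0 px in simp)
    qed
    thus "norm (g y - g x) \<le> L * norm (y - x) / (1 + norm x) ^ m" by simp
  qed (rule L0)
qed

text \<open>Sum over the cubes of half side 2^j. The least j with |x| < 2^j makes 2^j comparable to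
  1 + |x|, so that the j-th cube contributes volume 2^(jn) times 2^(-j(n+1)) up to constants, a
  geometric series.\<close>

lemma nn_integral_polynomial_decay_finite:
  "(\<integral>\<^sup>+x. ennreal (1 / (1 + norm (x :: real^'n::finite)) ^ (CARD('n) + 1)) \<partial>lborel) < \<infinity>"
proof -
  let ?n = "CARD('n)"
  define Q where "Q j = (cbox (\<chi> i. - (2 ^ j)) (\<chi> i. 2 ^ j) :: (real^'n) set)" for j :: nat
  have [measurable]: "Q j \<in> sets borel" for j unfolding Q_def by simp
  have eQ: "emeasure lborel (Q j) = ennreal ((2 * 2 ^ j) ^ ?n)" for j
  proof -
    have "Q j \<noteq> {}" unfolding Q_def by (auto simp: interval_ne_empty_cart intro: order_trans[of _ 0])
    hence "measure lborel (Q j) = (2 * 2 ^ j) ^ ?n" unfolding Q_def by (subst content_cbox_cart) auto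
    thus ?thesis using emeasure_eq_ennreal_measure[of lborel "Q j"]
      emeasure_lborel_cbox_finite[of "\<chi> i. - (2 ^ j)" "(\<chi> i. 2 ^ j) :: real^'n"] by (simp add: Q_def)
  qed
  define a where "a j = (2::real) ^ ?n * 2 ^ (?n + 1) * (1/2) ^ j" for j :: nat
  have pw: "ennreal (1 / (1 + norm x) ^ (?n + 1)) \<le> (\<Sum>j. ennreal (2 ^ (?n + 1) / 2 ^ (j * (?n + 1))) * indicator (Q j) x)" for x :: "real^'n"
  proof -
    obtain N where N: "norm x < 2 ^ N" using real_arch_pow[of 2 "norm x"] by auto
    define j where "j = (LEAST j. norm x < 2 ^ j)"
    have j1: "norm x < 2 ^ j" unfolding j_def by (rule LeastI[of _ N]) (rule N)
    have j2: "2 ^ j \<le> 2 * (1 + norm x)"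
    proof (cases j)
      case (Suc i)
      have "\<not> norm x < 2 ^ i" using not_less_Least[of i "\<lambda>j. norm x < 2 ^ j"] Suc unfolding j_def by auto
      thus ?thesis using Suc by simp
    qed simp
    have xQ: "x \<in> Q j" unfolding Q_def mem_box_cart
      using component_le_norm_cart[of x] j1 by (simp add: abs_le_iff) (smt (verit))
    have "(2 ^ j) ^ (?n + 1) \<le> (2 * (1 + norm x)) ^ (?n + 1)" using j2 by (rule power_mono) simp
    hence "(2 ^ j) ^ (?n + 1) \<le> 2 ^ (?n + 1) * (1 + norm x) ^ (?n + 1)" by (simp only: power_mult_distrib)
    hence le: "1 / (1 + norm x) ^ (?n + 1) \<le> 2 ^ (?n + 1) / 2 ^ (j * (?n + 1))"
      unfolding power_mult by (simp add: divide_simps add_pos_nonneg mult.commute)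
    define f where "f i = ennreal (2 ^ (?n + 1) / 2 ^ (i * (?n + 1))) * indicator (Q i) x" for i
    have "ennreal (1 / (1 + norm x) ^ (?n + 1)) \<le> ennreal (2 ^ (?n + 1) / 2 ^ (j * (?n + 1)))"
      by (rule ennreal_leI[OF le])
    also have "\<dots> = f j" unfolding f_def using xQ by simp
    also have "\<dots> = (\<Sum>i\<in>{j}. f i)" by simp
    also have "\<dots> \<le> suminf f" by (rule sum_le_suminf) auto
    also have "suminf f = (\<Sum>j. ennreal (2 ^ (?n + 1) / 2 ^ (j * (?n + 1))) * indicator (Q j) x)" unfolding f_def ..
    finally show ?thesis .
  qed
  have "(\<integral>\<^sup>+x. ennreal (1 / (1 + norm (x :: real^'n)) ^ (?n + 1)) \<partial>lborel)
     \<le> (\<integral>\<^sup>+x. (\<Sum>j. ennreal (2 ^ (?n + 1) / 2 ^ (j * (?n + 1))) * indicator (Q j) x) \<partial>lborel)"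
    by (intro nn_integral_mono pw)
  also have "\<dots> = (\<Sum>j. \<integral>\<^sup>+x. ennreal (2 ^ (?n + 1) / 2 ^ (j * (?n + 1))) * indicator (Q j) x \<partial>lborel)"
    by (rule nn_integral_suminf) measurable
  also have "\<dots> = (\<Sum>j. ennreal (a j))"
  proof (rule suminf_cong)
    fix j
    have "2 ^ (?n + 1) / 2 ^ (j * (?n + 1)) * (2 * 2 ^ j) ^ ?n = a j"
      unfolding a_def by (simp add: power_mult_distrib power_add power_mult[symmetric] field_simps power_one_over)
    thus "(\<integral>\<^sup>+x. ennreal (2 ^ (?n + 1) / 2 ^ (j * (?n + 1))) * indicator (Q j) x \<partial>lborel) = ennreal (a j)"
      by (subst nn_integral_cmult_indicator) (auto simp: eQ ennreal_mult[symmetric] simp del: ennreal_power)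
  qed
  also have "\<dots> < \<infinity>"
  proof -
    have "summable a" unfolding a_def by (intro summable_mult summable_geometric) auto
    moreover have "0 \<le> a j" for j unfolding a_def by simp
    ultimately show ?thesis by (subst suminf_ennreal2) auto
  qed
  finally show ?thesis .
qed

text \<open>The level is an integer in the definitions. All members of \<open>Omega\<close> have
  nonnegative level, so nothing is lost there by passing to naturals.\<close>

abbreviation lev :: "'n windex \<Rightarrow> nat" where "lev \<omega> \<equiv> nat (fst (snd \<omega>))"
abbreviation pos :: "'n windex \<Rightarrow> real^'n::finite \<Rightarrow> real^'n" where
  "pos \<omega> x \<equiv> 2 ^ lev \<omega> *\<^sub>R x - real_vec (snd (snd \<omega>))"

text \<open>Bounded overlap: at one level only boundedly many translates see a given point.
  Subtracting floors moves the lattice points into a box independent of y.\<close>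

lemma finite_int_near: 
  fixes y :: "real^'n::finite" and R :: nat
  shows "finite {k :: int^'n. \<forall>i. - real R \<le> y $ i - real_of_int (k $ i) \<and> y $ i - real_of_int (k $ i) < real R}"
    "card {k :: int^'n. \<forall>i. - real R \<le> y $ i - real_of_int (k $ i) \<and> y $ i - real_of_int (k $ i) < real R}
      \<le> card {k :: int^'n. \<forall>i. 0 \<le> k $ i \<and> k $ i < 2 * int R + 2}"
proof -
  let ?A = "{k :: int^'n. \<forall>i. - real R \<le> y $ i - real_of_int (k $ i) \<and> y $ i - real_of_int (k $ i) < real R}"
  let ?G = "{k :: int^'n. \<forall>i. 0 \<le> k $ i \<and> k $ i < 2 * int R + 2}"
  let ?s = "\<lambda>k::int^'n. \<chi> i. k $ i - \<lfloor>y $ i\<rfloor> + int R"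
  have inj: "inj_on ?s ?A" by (rule inj_onI) (auto simp: vec_eq_iff)
  have sub: "?s ` ?A \<subseteq> ?G"
  proof (rule image_subsetI)
    fix k assume k: "k \<in> ?A"
    have "0 \<le> k $ i - \<lfloor>y $ i\<rfloor> + int R \<and> k $ i - \<lfloor>y $ i\<rfloor> + int R < 2 * int R + 2" for i
    proof -
      have "- real R \<le> y $ i - real_of_int (k $ i)" "y $ i - real_of_int (k $ i) < real R" using k by auto
      moreover have "real_of_int \<lfloor>y $ i\<rfloor> \<le> y $ i" "y $ i < real_of_int \<lfloor>y $ i\<rfloor> + 1" by linarith+
      ultimately have "real_of_int (\<lfloor>y $ i\<rfloor> - k $ i) < real_of_int (int R)"
        "real_of_int (k $ i - \<lfloor>y $ i\<rfloor>) < real_of_int (int R + 1)" by (simp_all, linarith+)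
      thus ?thesis unfolding of_int_less_iff by linarith
    qed
    thus "?s k \<in> ?G" by simp
  qed
  show "finite ?A" using finite_subset[OF sub finite_int_vecs] inj by (simp add: finite_image_iff)
  show "card ?A \<le> card ?G" by (rule card_inj_on_le[OF inj sub finite_int_vecs])
qed

lemma countable_Omega: "countable (Omega :: 'n::finite windex set)"
  by (rule countableI_type)

section \<open>Expansion of Schwartz functions\<close>

lemma euclidean_bound_by_coordinates:
  fixes z :: "real^'n::finite"
  assumes "\<And>i. \<bar>z $ i\<bar> \<le> c" shows "norm z \<le> real CARD('n) * c"
proof -
  have "norm z \<le> (\<Sum>i\<in>UNIV. \<bar>z $ i\<bar>)" by (rule norm_le_l1_cart)
  also have "\<dots> \<le> (\<Sum>i\<in>(UNIV::'n set). c)" by (intro sum_mono assms)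
  finally show ?thesis by simp
qed

lemma integral_affine_eq:
  fixes f :: "real^'n::finite \<Rightarrow> 'b::euclidean_space"
  assumes [measurable]: "f \<in> borel_measurable borel" and c: "c > 0"
  shows "(LINT x|lborel. f x) = (c ^ CARD('n)) *\<^sub>R (LINT x|lborel. f (c *\<^sub>R x - a))"
proof -
  have "(LINT x|lborel. f x) = (LINT x|density (distr lborel borel (\<lambda>x. - a + c *\<^sub>R x)) (\<lambda>_. ennreal (\<bar>c\<bar> ^ DIM(real^'n))). f x)"
    using lborel_affine[of c "- a"] c by simp
  also have "\<dots> = (LINT x|distr lborel borel (\<lambda>x. - a + c *\<^sub>R x). (\<bar>c\<bar> ^ DIM(real^'n)) *\<^sub>R f x)"
    by (subst integral_density) auto
  also have "\<dots> = (LINT x|lborel. (\<bar>c\<bar> ^ DIM(real^'n)) *\<^sub>R f (- a + c *\<^sub>R x))"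
    by (subst integral_distr) auto
  finally show ?thesis using c by simp
qed

text \<open>What the estimates use of the tensor wavelets: a common bound, a common support box, and
  vanishing mean for every type except the pure scaling type.\<close>

locale wavelet_family =
  fixes T :: "bool^'n \<Rightarrow> real^'n::finite \<Rightarrow> real" and R :: nat and B :: real
  assumes B: "B > 0" and T_bound: "\<And>e x. \<bar>T e x\<bar> \<le> B"
    and T_supp: "\<And>e x i. T e x \<noteq> 0 \<Longrightarrow> - real R \<le> x $ i \<and> x $ i < real R"
    and T_meas [measurable]: "\<And>e. T e \<in> borel_measurable borel"
    and T_mean: "\<And>e. e \<noteq> zero_type \<Longrightarrow> (LINT x|lborel. T e x) = 0"
begin

text \<open>The wavelet in its sup normalization, from which the L^2, n and conjugate normalizations
  differ by powers of 2^j.\<close>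

definition atom :: "'n windex \<Rightarrow> real^'n \<Rightarrow> real" where
  "atom \<omega> x = T (fst \<omega>) (pos \<omega> x)"

lemma atom_meas [measurable]: "atom \<omega> \<in> borel_measurable borel"
  unfolding atom_def by measurable

lemma atom_bound: "\<bar>atom \<omega> x\<bar> \<le> B"
  unfolding atom_def by (rule T_bound)

abbreviation cube :: "'n windex \<Rightarrow> (real^'n) set" where
  "cube \<omega> \<equiv> dilated_cube R (lev \<omega>, snd (snd \<omega>))"

lemma atom_supp:
  assumes "atom \<omega> x \<noteq> 0" shows "x \<in> cube \<omega>"
proof -
  have "- real R \<le> pos \<omega> x $ i \<and> pos \<omega> x $ i < real R" for i
    using T_supp assms unfolding atom_def by blast
  hence "real_of_int (snd (snd \<omega>) $ i) - real R \<le> 2 ^ lev \<omega> * x $ i \<and> 2 ^ lev \<omega> * x $ i \<le> real_of_int (snd (snd \<omega>) $ i) + real R + 1" for i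
    by (simp, smt (verit))
  thus ?thesis unfolding dilated_cube_def by (simp add: mem_box_cart pos_divide_le_eq pos_le_divide_eq mult.commute)
qed

lemma atom_zero: "x \<notin> cube \<omega> \<Longrightarrow> atom \<omega> x = 0"
  using atom_supp by blast

lemma sets_cube [measurable, simp]: "cube \<omega> \<in> sets borel"
  unfolding dilated_cube_def by simp

lemma compact_cube: "compact (cube \<omega>)"
  unfolding dilated_cube_def by (rule compact_cbox)

lemma emeasure_cube: "emeasure lborel (cube \<omega>) = ennreal (((2 * real R + 1) / 2 ^ lev \<omega>) ^ CARD('n))"
proof -
  let ?a = "(\<chi> i. (real_of_int (snd (snd \<omega>) $ i) - real R) / 2 ^ lev \<omega>) :: real^'n"
  let ?b = "(\<chi> i. (real_of_int (snd (snd \<omega>) $ i) + real R + 1) / 2 ^ lev \<omega>) :: real^'n"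
  have "cbox ?a ?b \<noteq> {}" by (auto simp: interval_ne_empty_cart divide_right_mono)
  hence "measure lborel (cbox ?a ?b) = (\<Prod>i\<in>UNIV. ?b $ i - ?a $ i)" by (rule content_cbox_cart)
  also have "\<dots> = ((2 * real R + 1) / 2 ^ lev \<omega>) ^ CARD('n)"
    by (simp add: diff_divide_distrib[symmetric] algebra_simps)
  finally show ?thesis using emeasure_eq_ennreal_measure[of lborel "cbox ?a ?b"]
    emeasure_lborel_cbox_finite[of ?a ?b] unfolding dilated_cube_def by simp
qed

lemma cube_diameter:
  assumes "x \<in> cube \<omega>" "y \<in> cube \<omega>"
  shows "norm (y - x) \<le> real CARD('n) * ((2 * real R + 1) / 2 ^ lev \<omega>)"
proof (rule euclidean_bound_by_coordinates)
  fix i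
  have "(real_of_int (snd (snd \<omega>) $ i) - real R) / 2 ^ lev \<omega> \<le> x $ i" "x $ i \<le> (real_of_int (snd (snd \<omega>) $ i) + real R + 1) / 2 ^ lev \<omega>"
    "(real_of_int (snd (snd \<omega>) $ i) - real R) / 2 ^ lev \<omega> \<le> y $ i" "y $ i \<le> (real_of_int (snd (snd \<omega>) $ i) + real R + 1) / 2 ^ lev \<omega>"
    using assms unfolding dilated_cube_def mem_box_cart by auto
  moreover have "(real_of_int (snd (snd \<omega>) $ i) + real R + 1) / 2 ^ lev \<omega> - (real_of_int (snd (snd \<omega>) $ i) - real R) / 2 ^ lev \<omega> = (2 * real R + 1) / 2 ^ lev \<omega>"
    by (simp add: diff_divide_distrib[symmetric])
  ultimately show "\<bar>(y - x) $ i\<bar> \<le> (2 * real R + 1) / 2 ^ lev \<omega>"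
    unfolding vector_minus_component abs_le_iff by linarith
qed

lemma integrable_atom_mult:
  fixes f :: "real^'n \<Rightarrow> complex"
  assumes "f \<in> borel_measurable borel" "\<And>K. compact K \<Longrightarrow> (\<integral>\<^sup>+x. indicator K x * ennreal (norm (f x)) \<partial>lborel) < \<infinity>"
  shows "integrable lborel (\<lambda>x. f x * of_real (atom \<omega> x))"
  by (rule integrable_mult_compact_support[OF assms(1) _ compact_cube[of \<omega>] _ _ assms(2)[OF compact_cube], where B=B])
     (simp_all add: atom_zero atom_bound)

lemma continuous_locally_finite:
  fixes f :: "real^'n \<Rightarrow> complex"
  assumes f: "continuous_on UNIV f" and K: "compact K"
  shows "(\<integral>\<^sup>+x. indicator K x * ennreal (norm (f x)) \<partial>lborel) < \<infinity>"
proof -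
  have "compact (f ` K)" using f K by (intro compact_continuous_image) (auto intro: continuous_on_subset)
  then obtain b where b: "b > 0" "\<And>x. x \<in> K \<Longrightarrow> norm (f x) \<le> b"
    using compact_imp_bounded bounded_pos by (metis imageI)
  have "(\<integral>\<^sup>+x. indicator K x * ennreal (norm (f x)) \<partial>lborel) \<le> (\<integral>\<^sup>+x. ennreal b * indicator K x \<partial>lborel)"
    by (intro nn_integral_mono) (use b in \<open>auto simp: indicator_def ennreal_leI\<close>)
  also have "\<dots> = ennreal b * emeasure lborel K"
    using K by (subst nn_integral_cmult_indicator) (auto simp: borel_compact)
  also have "\<dots> < \<infinity>" using emeasure_compact_finite[OF K] by (simp add: ennreal_mult_less_top)
  finally show ?thesis .
qed

lemma integral_atom:
  assumes "fst \<omega> \<noteq> zero_type" shows "(LINT x|lborel. atom \<omega> x) = 0"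
  using integral_affine_eq[of "T (fst \<omega>)" "2 ^ lev \<omega>" "real_vec (snd (snd \<omega>))"] T_mean[OF assms]
  unfolding atom_def by simp

definition coef :: "(real^'n \<Rightarrow> complex) \<Rightarrow> 'n windex \<Rightarrow> complex" where
  "coef g \<omega> = (LINT x|lborel. g x * of_real (atom \<omega> x))"

text \<open>The L^2 term of the expansion: both the coefficient and the wavelet carry a factor
  2^(jn/2).\<close>

definition wterm :: "(real^'n \<Rightarrow> complex) \<Rightarrow> 'n windex \<Rightarrow> real^'n \<Rightarrow> complex" where
  "wterm g \<omega> x = of_real (2 ^ (lev \<omega> * CARD('n)) * atom \<omega> x) * coef g \<omega>"

lemma wterm_meas [measurable]: "wterm g \<omega> \<in> borel_measurable borel"
  unfolding wterm_def by measurable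

text \<open>The powers of 2^(jn) cancel against the volume of the support, so any gain has to come
  from cancellation. Subtracting g(x) and using the Lipschitz bound gives 2^(-j). Taking the
  evaluation point x as base point yields the decay at x.\<close>

lemma wterm_bound:
  assumes g: "g \<in> schwartz"
  shows "\<exists>C\<ge>0. \<forall>\<omega>\<in>Omega. \<forall>x. norm (wterm g \<omega> x) \<le> C * (1/2) ^ lev \<omega> / (1 + norm x) ^ m * indicator {x. atom \<omega> x \<noteq> 0} x"
proof -
  define M where "M = 2 * real R + 1"
  have M: "M \<ge> 1" unfolding M_def by simp
  define r where "r = real CARD('n) * M"
  have r: "r \<ge> 0" unfolding r_def using M by simp
  obtain C1 where C1: "C1 \<ge> 0" "\<And>x. norm (iter_partial [] g x) \<le> C1 / (1 + norm x) ^ m"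
    using schwartz_decay[OF g] by blast
  obtain C2 where C2: "C2 \<ge> 0" "\<And>x y. norm (y - x) \<le> r \<Longrightarrow> norm (g y - g x) \<le> C2 * norm (y - x) / (1 + norm x) ^ m"
    using schwartz_lipschitz[OF g r] by blast
  define L where "L = C1 + C2 * r"
  have L0: "L \<ge> 0" unfolding L_def using C1 C2 r by simp
  have gm [measurable]: "g \<in> borel_measurable borel"
    using schwartz_continuous[OF g] by (rule borel_measurable_continuous_onI)
  have gint: "integrable lborel (\<lambda>x. g x * of_real (atom \<omega> x))" for \<omega>
    by (rule integrable_atom_mult[OF gm continuous_locally_finite[OF schwartz_continuous[OF g]]])
  have cint: "integrable lborel (\<lambda>x. c * of_real (atom \<omega> x))" for \<omega> and c :: complex
    by (rule integrable_atom_mult[OF _ continuous_locally_finite]) auto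
  define C where "C = B * (B * L * M ^ CARD('n))"
  have main: "norm (wterm g \<omega> x) \<le> C * (1/2) ^ lev \<omega> / (1 + norm x) ^ m" if \<omega>: "\<omega> \<in> Omega" and x: "atom \<omega> x \<noteq> 0" for \<omega> x
  proof -
    define j where "j = lev \<omega>"
    have px: "(1 + norm x) ^ m > 0" by (intro zero_less_power) (simp add: add_pos_nonneg)
    have xc: "x \<in> cube \<omega>" by (rule atom_supp[OF x])
    \<comment> \<open>A scaling function has no cancellation, but in \<open>Omega\<close> it occurs
      only at level 0, where the size of g suffices.\<close>
    define c where "c = (if fst \<omega> = zero_type then 0 else g x)"
    have diff: "norm (g y - c) \<le> L * (1/2) ^ j / (1 + norm x) ^ m" if y: "y \<in> cube \<omega>" for y
    proof -
      have d: "norm (y - x) \<le> r * (1/2) ^ j"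
        using cube_diameter[OF xc y] unfolding r_def M_def j_def by (simp add: power_one_over divide_simps)
      moreover have "r * (1/2) ^ j \<le> r * 1" using r by (intro mult_left_mono) (auto intro: power_le_one)
      ultimately have "norm (g y - g x) \<le> C2 * norm (y - x) / (1 + norm x) ^ m" by (intro C2(2)) simp
      also have "\<dots> \<le> C2 * (r * (1/2) ^ j) / (1 + norm x) ^ m"
        using px C2(1) d by (intro divide_right_mono mult_left_mono) auto
      finally have gg: "norm (g y - g x) \<le> C2 * (r * (1/2) ^ j) / (1 + norm x) ^ m" .
      show ?thesis
      proof (cases "fst \<omega> = zero_type")
        case True
        hence j0: "j = 0" using \<omega> unfolding Omega_def dyadic_zero_def j_def by auto
        have "norm (g y) \<le> norm (g x) + norm (g y - g x)" by (metis norm_triangle_sub add.commute)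
        also have "\<dots> \<le> C1 / (1 + norm x) ^ m + C2 * (r * (1/2) ^ j) / (1 + norm x) ^ m"
          using C1(2)[of x] gg by (intro add_mono) auto
        also have "\<dots> = L * (1/2) ^ j / (1 + norm x) ^ m" unfolding L_def j0 by (simp add: add_divide_distrib)
        finally show ?thesis using True unfolding c_def by simp
      next
        case False
        have "C2 * (r * (1/2) ^ j) / (1 + norm x) ^ m \<le> L * (1/2) ^ j / (1 + norm x) ^ m"
          unfolding L_def using C1(1) px by (intro divide_right_mono) (auto simp: distrib_right)
        thus ?thesis using gg False unfolding c_def by simp
      qed
    qed
    have "coef g \<omega> = (LINT y|lborel. (g y - c) * of_real (atom \<omega> y))"
    proof -
      have "(LINT y|lborel. (g y - c) * of_real (atom \<omega> y)) = coef g \<omega> - c * (LINT y|lborel. complex_of_real (atom \<omega> y))"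
        unfolding coef_def left_diff_distrib
        by (subst Bochner_Integration.integral_diff[OF gint cint]) simp
      moreover have "c * (LINT y|lborel. complex_of_real (atom \<omega> y)) = 0"
        using integral_atom[of \<omega>] unfolding c_def by simp
      ultimately show ?thesis by simp
    qed
    hence "ennreal (norm (coef g \<omega>)) \<le> (\<integral>\<^sup>+y. ennreal (norm ((g y - c) * of_real (atom \<omega> y))) \<partial>lborel)"
      using integral_norm_bound_ennreal[OF Bochner_Integration.integrable_diff[OF gint[of \<omega>] cint[of c \<omega>]]]
      by (simp add: left_diff_distrib)
    also have "\<dots> \<le> (\<integral>\<^sup>+y. ennreal (B * (L * (1/2) ^ j / (1 + norm x) ^ m)) * indicator (cube \<omega>) y \<partial>lborel)"
    proof (intro nn_integral_mono)
      fix y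
      show "ennreal (norm ((g y - c) * of_real (atom \<omega> y))) \<le> ennreal (B * (L * (1/2) ^ j / (1 + norm x) ^ m)) * indicator (cube \<omega>) y"
      proof (cases "y \<in> cube \<omega>")
        case True
        have "norm ((g y - c) * of_real (atom \<omega> y)) \<le> (L * (1/2) ^ j / (1 + norm x) ^ m) * B"
          unfolding norm_mult norm_of_real by (rule mult_mono[OF diff[OF True] _ order_trans[OF norm_ge_zero diff[OF True]]]) (auto simp: atom_bound)
        thus ?thesis using True by (simp add: ennreal_leI mult.commute)
      next
        case False
        thus ?thesis using atom_supp[of \<omega> y] by auto
      qed
    qed
    also have "\<dots> = ennreal (B * (L * (1/2) ^ j / (1 + norm x) ^ m)) * ennreal ((M / 2 ^ j) ^ CARD('n))"
      by (subst nn_integral_cmult_indicator) (simp_all add: emeasure_cube M_def j_def)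
    also have "\<dots> = ennreal (B * (L * (1/2) ^ j / (1 + norm x) ^ m) * (M / 2 ^ j) ^ CARD('n))"
      using B L0 px M by (intro ennreal_mult[symmetric]) auto
    finally have cb: "norm (coef g \<omega>) \<le> B * (L * (1/2) ^ j / (1 + norm x) ^ m) * (M / 2 ^ j) ^ CARD('n)"
      using B L0 px M by (subst (asm) ennreal_le_iff) auto
    have "norm (wterm g \<omega> x) = (2 ^ (j * CARD('n)) * \<bar>atom \<omega> x\<bar>) * norm (coef g \<omega>)"
      unfolding wterm_def j_def norm_mult norm_of_real abs_mult by simp
    also have "\<dots> \<le> (2 ^ (j * CARD('n)) * B) * (B * (L * (1/2) ^ j / (1 + norm x) ^ m) * (M / 2 ^ j) ^ CARD('n))"
      using B atom_bound cb by (intro mult_mono) auto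
    also have "\<dots> = C * (1/2) ^ j / (1 + norm x) ^ m"
    proof -
      have "2 ^ (j * CARD('n)) * (M / 2 ^ j) ^ CARD('n) = M ^ CARD('n)"
        by (simp add: power_divide power_mult)
      thus ?thesis unfolding C_def by (metis (no_types, lifting) mult.assoc mult.commute mult.left_commute times_divide_eq_right)
    qed
    finally show ?thesis unfolding j_def .
  qed
  have "C \<ge> 0" unfolding C_def using B L0 M by simp
  moreover have "norm (wterm g \<omega> x) \<le> C * (1/2) ^ lev \<omega> / (1 + norm x) ^ m * indicator {x. atom \<omega> x \<noteq> 0} x" if "\<omega> \<in> Omega" for \<omega> x
  proof (cases "atom \<omega> x = 0")
    case True thus ?thesis by (simp add: wterm_def)
  qed (use main[OF that] in simp)
  ultimately show ?thesis by blast
qed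

text \<open>At each level boundedly many terms are nonzero at x, and the levels sum geometrically.
  The bound is uniform over finite sets of indices, as dominated convergence requires.\<close>

lemma wterm_sum_bound:
  assumes g: "g \<in> schwartz"
  shows "\<exists>C\<ge>0. \<forall>S x. finite S \<longrightarrow> S \<subseteq> Omega \<longrightarrow> (\<Sum>\<omega>\<in>S. norm (wterm g \<omega> x)) \<le> C / (1 + norm x) ^ m"
proof -
  obtain C where C: "C \<ge> 0" "\<And>\<omega> x. \<omega> \<in> Omega \<Longrightarrow> norm (wterm g \<omega> x) \<le> C * (1/2) ^ lev \<omega> / (1 + norm x) ^ m * indicator {x. atom \<omega> x \<noteq> 0} x"
    using wterm_bound[OF g] by blast
  define N where "N = card {k :: int^'n. \<forall>i. 0 \<le> k $ i \<and> k $ i < 2 * int R + 2}"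
  define E where "E = card (UNIV :: (bool^'n) set)"
  have "(\<Sum>\<omega>\<in>S. norm (wterm g \<omega> x)) \<le> (real E * (2 * (real N * C))) / (1 + norm x) ^ m"
    if S: "finite S" "S \<subseteq> Omega" for S x
  proof -
    define D where "D = 1 / (1 + norm x) ^ m"
    have D: "D \<ge> 0" unfolding D_def by simp
    define K where "K j = {k :: int^'n. \<forall>i. - real R \<le> (2 ^ j *\<^sub>R x) $ i - real_of_int (k $ i) \<and> (2 ^ j *\<^sub>R x) $ i - real_of_int (k $ i) < real R}" for j :: nat
    have K: "finite (K j)" "card (K j) \<le> N" for j
      unfolding K_def N_def by (rule finite_int_near)+
    \<comment> \<open>Re-indexes by natural levels, so that the sum can be enlarged to a product of
      types, levels and nearby lattice points.\<close>
    define h where "h \<omega> = (fst \<omega>, lev \<omega>, snd (snd \<omega>))" for \<omega> :: "'n windex"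
    define S' where "S' = {\<omega>\<in>S. atom \<omega> x \<noteq> 0}"
    have S': "finite S'" "S' \<subseteq> Omega" unfolding S'_def using S by auto
    define J where "J = Max (insert 0 (lev ` S'))"
    have J: "lev \<omega> \<le> J" if "\<omega> \<in> S'" for \<omega> unfolding J_def using S' that by (intro Max_ge) auto
    have inj: "inj_on h S'"
    proof (rule inj_onI)
      fix a b assume ab: "a \<in> S'" "b \<in> S'" "h a = h b"
      have "0 \<le> fst (snd a)" "0 \<le> fst (snd b)"
        using ab(1,2) S'(2) unfolding Omega_def dyadic_zero_def dyadic_plus_def by auto
      thus "a = b" using ab(3) unfolding h_def by (auto simp: prod_eq_iff)
    qed
    have sub: "h ` S' \<subseteq> (UNIV :: (bool^'n) set) \<times> (SIGMA j:{..J}. K j)"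
    proof (rule image_subsetI)
      fix \<omega> assume w: "\<omega> \<in> S'"
      hence "atom \<omega> x \<noteq> 0" unfolding S'_def by simp
      hence "snd (snd \<omega>) \<in> K (lev \<omega>)" using T_supp unfolding atom_def K_def by fastforce
      thus "h \<omega> \<in> (UNIV :: (bool^'n) set) \<times> (SIGMA j:{..J}. K j)" using J[OF w] unfolding h_def by simp
    qed
    have "(\<Sum>\<omega>\<in>S. norm (wterm g \<omega> x)) = (\<Sum>\<omega>\<in>S'. norm (wterm g \<omega> x))"
      using S unfolding S'_def by (intro sum.mono_neutral_right) (auto simp: wterm_def)
    also have "\<dots> \<le> (\<Sum>\<omega>\<in>S'. C * (1/2) ^ lev \<omega> * D)"
    proof (intro sum_mono)
      fix \<omega> assume w: "\<omega> \<in> S'"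
      thus "norm (wterm g \<omega> x) \<le> C * (1/2) ^ lev \<omega> * D"
        using C(2)[of \<omega> x] S' unfolding S'_def D_def by auto
    qed
    also have "\<dots> = (\<Sum>z\<in>h ` S'. C * (1/2) ^ fst (snd z) * D)"
      by (subst sum.reindex[OF inj]) (simp add: h_def)
    also have "\<dots> \<le> (\<Sum>z\<in>(UNIV :: (bool^'n) set) \<times> (SIGMA j:{..J}. K j). C * (1/2) ^ fst (snd z) * D)"
      using sub K C(1) D by (intro sum_mono2 finite_cartesian_product finite_SigmaI) auto
    also have "\<dots> = (\<Sum>e\<in>(UNIV::(bool^'n) set). \<Sum>z\<in>(SIGMA j:{..J}. K j). C * (1/2) ^ fst z * D)"
      by (subst sum.cartesian_product) (simp only: case_prod_unfold)
    also have "\<dots> = real E * (\<Sum>z\<in>(SIGMA j:{..J}. K j). C * (1/2) ^ fst z * D)"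
      unfolding E_def by simp
    also have "(\<Sum>z\<in>(SIGMA j:{..J}. K j). C * (1/2) ^ fst z * D) = (\<Sum>j\<le>J. \<Sum>k\<in>K j. C * (1/2) ^ j * D)"
      using K by (subst sum.Sigma) (auto simp: split_beta)
    also have "\<dots> \<le> (\<Sum>j\<le>J. real N * (C * (1/2) ^ j * D))"
      using K C(1) D by (intro sum_mono) (simp add: mult_right_mono)
    also have "\<dots> = real N * C * D * (\<Sum>j\<le>J. (1/2) ^ j)" by (simp add: sum_distrib_left mult_ac)
    also have "\<dots> \<le> real N * C * D * 2"
    proof (rule mult_left_mono)
      have "(\<Sum>j\<le>J. (1/2::real) ^ j) \<le> suminf (\<lambda>j. (1/2) ^ j)" by (intro sum_le_suminf summable_geometric) auto
      thus "(\<Sum>j\<le>J. (1/2::real) ^ j) \<le> 2" by (simp add: suminf_geometric)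
    qed (use C(1) D in simp)
    finally have "(\<Sum>\<omega>\<in>S. norm (wterm g \<omega> x)) \<le> real E * (real N * C * D * 2)" by (simp add: mult_left_mono)
    thus ?thesis unfolding D_def by (simp add: mult_ac)
  qed
  thus ?thesis using C(1) by (intro exI[of _ "real E * (2 * (real N * C))"]) auto
qed

text \<open>Dominated convergence along an enumeration. The integrals converge absolutely, so the
  sum does not depend on the enumeration.\<close>

lemma integral_term_has_sum:
  assumes g: "g \<in> schwartz" and f [measurable]: "f \<in> borel_measurable borel"
    and fin: "(\<integral>\<^sup>+x. ennreal (norm (f x) / (1 + norm x) ^ m) \<partial>lborel) < \<infinity>"
    and bij: "bij_betw enum (UNIV::nat set) (Omega :: 'n windex set)"
  shows "((\<lambda>\<omega>. LINT x|lborel. f x * wterm g \<omega> x) has_sum (LINT x|lborel. f x * (\<Sum>k. wterm g (enum k) x))) Omega"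
proof -
  obtain C where C: "C \<ge> 0" "\<And>S x. finite S \<Longrightarrow> S \<subseteq> Omega \<Longrightarrow> (\<Sum>\<omega>\<in>S. norm (wterm g \<omega> x)) \<le> C / (1 + norm x) ^ m"
    using wterm_sum_bound[OF g] by blast
  have enum: "inj_on enum A" "enum ` A \<subseteq> Omega" for A
    using bij by (auto simp: bij_betw_def intro: inj_on_subset)
  have part: "(\<Sum>k<K. norm (wterm g (enum k) x)) \<le> C / (1 + norm x) ^ m" for K x
    using C(2)[of "enum ` {..<K}" x] enum[of "{..<K}"] by (simp add: sum.reindex)
  have sm: "summable (\<lambda>k. norm (wterm g (enum k) x))" for x
    using part by (intro summableI_nonneg_bounded) auto
  define W where "W = (\<integral>\<^sup>+x. ennreal (norm (f x) / (1 + norm x) ^ m) \<partial>lborel)"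
  have tot: "(\<Sum>k<K. \<integral>\<^sup>+x. ennreal (norm (f x * wterm g (enum k) x)) \<partial>lborel) \<le> ennreal C * W" for K
  proof -
    have "(\<Sum>k<K. \<integral>\<^sup>+x. ennreal (norm (f x * wterm g (enum k) x)) \<partial>lborel)
      = (\<integral>\<^sup>+x. (\<Sum>k<K. ennreal (norm (f x * wterm g (enum k) x))) \<partial>lborel)"
      by (rule nn_integral_sum[symmetric]) measurable
    also have "\<dots> \<le> (\<integral>\<^sup>+x. ennreal C * ennreal (norm (f x) / (1 + norm x) ^ m) \<partial>lborel)"
    proof (intro nn_integral_mono)
      fix x
      have "(\<Sum>k<K. ennreal (norm (f x * wterm g (enum k) x))) = ennreal (norm (f x) * (\<Sum>k<K. norm (wterm g (enum k) x)))"
        by (simp add: norm_mult sum_distrib_left)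
      also have "\<dots> \<le> ennreal (norm (f x) * (C / (1 + norm x) ^ m))"
        by (intro ennreal_leI mult_left_mono part) simp
      also have "\<dots> = ennreal C * ennreal (norm (f x) / (1 + norm x) ^ m)"
        using C(1) by (subst ennreal_mult[symmetric]) (auto simp: mult_ac)
      finally show "(\<Sum>k<K. ennreal (norm (f x * wterm g (enum k) x))) \<le> ennreal C * ennreal (norm (f x) / (1 + norm x) ^ m)" .
    qed
    also have "\<dots> = ennreal C * W" unfolding W_def by (rule nn_integral_cmult) measurable
    finally show ?thesis .
  qed
  have CW: "ennreal C * W < \<infinity>" using fin unfolding W_def by (simp add: ennreal_mult_less_top)
  have int: "integrable lborel (\<lambda>x. f x * wterm g (enum k) x)" for k
    unfolding integrable_iff_bounded
  proof
    have "(\<integral>\<^sup>+x. ennreal (norm (f x * wterm g (enum k) x)) \<partial>lborel) \<le> (\<Sum>k<Suc k. \<integral>\<^sup>+x. ennreal (norm (f x * wterm g (enum k) x)) \<partial>lborel)"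
      by simp
    thus "(\<integral>\<^sup>+x. ennreal (norm (f x * wterm g (enum k) x)) \<partial>lborel) < \<infinity>" using tot[of "Suc k"] CW by (meson le_less_trans)
  qed measurable
  have nn: "ennreal (LINT x|lborel. norm (f x * wterm g (enum k) x)) = (\<integral>\<^sup>+x. ennreal (norm (f x * wterm g (enum k) x)) \<partial>lborel)" for k
    using int by (subst nn_integral_eq_integral) auto
  have sumn: "summable (\<lambda>k. LINT x|lborel. norm (f x * wterm g (enum k) x))"
  proof (rule summableI_nonneg_bounded)
    fix K
    have "ennreal (\<Sum>k<K. LINT x|lborel. norm (f x * wterm g (enum k) x)) = (\<Sum>k<K. \<integral>\<^sup>+x. ennreal (norm (f x * wterm g (enum k) x)) \<partial>lborel)"
      unfolding nn[symmetric] by (intro sum_ennreal[symmetric]) simp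
    also have "\<dots> \<le> ennreal (enn2real (ennreal C * W))" using tot CW by (simp add: less_top)
    finally show "(\<Sum>k<K. LINT x|lborel. norm (f x * wterm g (enum k) x)) \<le> enn2real (ennreal C * W)"
      by (subst (asm) ennreal_le_iff) auto
  qed simp
  have AEs: "AE x in lborel. summable (\<lambda>k. norm (f x * wterm g (enum k) x))"
    using sm by (intro AE_I2) (auto simp: norm_mult intro: summable_mult)
  have S: "(\<lambda>k. LINT x|lborel. f x * wterm g (enum k) x) sums (LINT x|lborel. (\<Sum>k. f x * wterm g (enum k) x))"
    by (rule sums_integral[OF int AEs sumn])
  have abs: "summable (\<lambda>k. norm (LINT x|lborel. f x * wterm g (enum k) x))"
    by (rule summable_comparison_test'[OF sumn]) (simp add: integral_norm_bound)
  have eq: "(LINT x|lborel. (\<Sum>k. f x * wterm g (enum k) x)) = (LINT x|lborel. f x * (\<Sum>k. wterm g (enum k) x))"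
  proof (rule Bochner_Integration.integral_cong[OF refl])
    fix x show "(\<Sum>k. f x * wterm g (enum k) x) = f x * (\<Sum>k. wterm g (enum k) x)"
      by (rule suminf_mult[OF summable_norm_cancel[OF sm[of x]]])
  qed
  have "((\<lambda>k. LINT x|lborel. f x * wterm g (enum k) x) has_sum (LINT x|lborel. f x * (\<Sum>k. wterm g (enum k) x))) UNIV"
    using norm_summable_imp_has_sum[OF abs] S eq by (simp add: sums_iff)
  thus ?thesis
    by (rule iffD1[OF has_sum_reindex_bij_betw[OF bij, of "\<lambda>\<omega>. LINT x|lborel. f x * wterm g \<omega> x"]])
qed

end

locale wavelet_basis = wavelet_family T R B
  for T :: "bool^'n \<Rightarrow> real^'n::finite \<Rightarrow> real" and R :: nat and B :: real +
  assumes onb: "L2_orthonormal_basis (Omega :: 'n windex set)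
    (\<lambda>\<omega> x. 2 powr (real (lev \<omega>) * real CARD('n) / 2) * atom \<omega> x)"
begin

abbreviation scale :: "'n windex \<Rightarrow> real" where
  "scale \<omega> \<equiv> 2 powr (real (lev \<omega>) * real CARD('n) / 2)"

lemma scale_sq: "scale \<omega> * scale \<omega> = 2 ^ (lev \<omega> * CARD('n))"
  by (simp add: powr_add[symmetric] powr_realpow[symmetric] mult.commute)

lemma atom_orthogonal:
  assumes "\<omega> \<in> Omega" "\<omega>' \<in> Omega"
  shows "2 ^ (lev \<omega> * CARD('n)) * (LINT x|lborel. atom \<omega>' x * atom \<omega> x) = (if \<omega>' = \<omega> then 1 else 0)"
proof -
  have "(LINT x|lebesgue. (scale \<omega>' * atom \<omega>' x) * (scale \<omega> * atom \<omega> x)) = (if \<omega>' = \<omega> then 1 else 0)"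
    using onb assms unfolding L2_orthonormal_basis_def L2_orthonormal_def by blast
  hence "(LINT x|lborel. (scale \<omega>' * scale \<omega>) * (atom \<omega>' x * atom \<omega> x)) = (if \<omega>' = \<omega> then 1 else 0)"
    by (subst (asm) integral_completion) (auto simp: mult_ac)
  hence 1: "scale \<omega>' * scale \<omega> * (LINT x|lborel. atom \<omega>' x * atom \<omega> x) = (if \<omega>' = \<omega> then 1 else 0)" by simp
  show ?thesis
  proof (cases "\<omega>' = \<omega>")
    case True thus ?thesis using 1 scale_sq[of \<omega>] by simp
  next
    case False
    have "scale \<omega>' * scale \<omega> \<noteq> 0" by simp
    hence "(LINT x|lborel. atom \<omega>' x * atom \<omega> x) = 0" using 1 False by simp
    thus ?thesis using False by simp
  qed
qed

lemma one_le_decay: "1 \<le> (1 + norm (x :: real^'n)) ^ m"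
  by (rule one_le_power) simp

lemma decay_pos [simp]: "0 < (1 + norm (x :: real^'n)) ^ m"
  using one_le_decay[of x m] by linarith

text \<open>The pointwise sum h decays like g, hence r = g - h is square integrable. Termwise
  integration and orthonormality show that r is orthogonal to every wavelet, and completeness forces
  r = 0 almost everywhere.\<close>

lemma expansion_AE:
  assumes g: "g \<in> schwartz" and bij: "bij_betw enum (UNIV::nat set) (Omega :: 'n windex set)"
  shows "AE x in lborel. (\<Sum>k. wterm g (enum k) x) = g x"
proof -
  define m where "m = CARD('n) + 1"
  define h where "h x = (\<Sum>k. wterm g (enum k) x)" for x
  have [measurable]: "h \<in> borel_measurable borel" unfolding h_def by measurable
  have gm [measurable]: "g \<in> borel_measurable borel"
    using schwartz_continuous[OF g] by (rule borel_measurable_continuous_onI)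
  obtain C where C: "C \<ge> 0" "\<And>S x. finite S \<Longrightarrow> S \<subseteq> Omega \<Longrightarrow> (\<Sum>\<omega>\<in>S. norm (wterm g \<omega> x)) \<le> C / (1 + norm x) ^ m"
    using wterm_sum_bound[OF g] by blast
  obtain C1 where C1: "C1 \<ge> 0" "\<And>x. norm (iter_partial [] g x) \<le> C1 / (1 + norm x) ^ m"
    using schwartz_decay[OF g] by blast
  have hb: "norm (h x) \<le> C / (1 + norm x) ^ m" for x
  proof -
    have part: "(\<Sum>k<K. norm (wterm g (enum k) x)) \<le> C / (1 + norm x) ^ m" for K
    proof -
      have "inj_on enum {..<K}" "enum ` {..<K} \<subseteq> Omega" using bij by (auto simp: bij_betw_def intro: inj_on_subset)
      thus ?thesis using C(2)[of "enum ` {..<K}" x] by (simp add: sum.reindex)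
    qed
    have sm: "summable (\<lambda>k. norm (wterm g (enum k) x))" using part by (intro summableI_nonneg_bounded) auto
    have "norm (h x) \<le> (\<Sum>k. norm (wterm g (enum k) x))" unfolding h_def by (rule summable_norm[OF sm])
    also have "\<dots> \<le> C / (1 + norm x) ^ m" by (rule suminf_le_const[OF sm part])
    finally show ?thesis .
  qed
  define r where "r x = g x - h x" for x
  have [measurable]: "r \<in> borel_measurable borel" unfolding r_def by measurable
  define D where "D = C1 + C"
  have D0: "D \<ge> 0" unfolding D_def using C C1 by simp
  have rb: "norm (r x) \<le> D / (1 + norm x) ^ m" for x
    using norm_triangle_ineq4[of "g x" "h x"] C1(2)[of x] hb[of x] unfolding r_def D_def by (simp add: add_divide_distrib)
  have rD: "norm (r x) \<le> D" for x
  proof -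
    have "D / (1 + norm x) ^ m \<le> D / 1" using D0 one_le_decay[of x m] by (intro divide_left_mono) auto
    thus ?thesis using rb[of x] by simp
  qed
  have loc: "(\<integral>\<^sup>+x. indicator K x * ennreal (norm (u x)) \<partial>lborel) < \<infinity>"
    if "compact K" "\<And>x. norm (u x) \<le> b" for K :: "(real^'n) set" and u :: "real^'n \<Rightarrow> complex" and b
  proof -
    have "(\<integral>\<^sup>+x. indicator K x * ennreal (norm (u x)) \<partial>lborel) \<le> (\<integral>\<^sup>+x. indicator K x * ennreal (norm (complex_of_real b)) \<partial>lborel)"
      using that(2) by (intro nn_integral_mono mult_left_mono ennreal_leI) (auto intro: order_trans[OF _ abs_ge_self])
    also have "\<dots> < \<infinity>" by (rule continuous_locally_finite[OF _ that(1)]) auto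
    finally show ?thesis .
  qed
  have int_r: "integrable lborel (\<lambda>x. r x * of_real (atom \<omega> x))" for \<omega>
    by (rule integrable_atom_mult) (use loc[OF _ rD] in auto)
  have int_g: "integrable lborel (\<lambda>x. g x * of_real (atom \<omega> x))" for \<omega>
    by (rule integrable_atom_mult[OF gm continuous_locally_finite[OF schwartz_continuous[OF g]]])
  \<comment> \<open>Integrating the series for h against one atom leaves a single coefficient, which
    is that of g.\<close>
  have orth: "(LINT x|lborel. r x * of_real (atom \<omega>' x)) = 0" if w: "\<omega>' \<in> Omega" for \<omega>'
  proof -
    let ?f = "\<lambda>x. complex_of_real (atom \<omega>' x)"
    have "(\<integral>\<^sup>+x. ennreal (norm (?f x) / (1 + norm x) ^ m) \<partial>lborel) \<le> (\<integral>\<^sup>+x. indicator (cube \<omega>') x * ennreal (norm (?f x)) \<partial>lborel)"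
    proof (intro nn_integral_mono)
      fix x
      show "ennreal (norm (?f x) / (1 + norm x) ^ m) \<le> indicator (cube \<omega>') x * ennreal (norm (?f x))"
      proof (cases "atom \<omega>' x = 0")
        case False
        have "norm (?f x) / (1 + norm x) ^ m \<le> norm (?f x) / 1"
          using one_le_decay[of x m] by (intro divide_left_mono) auto
        thus ?thesis using atom_supp[OF False] by (simp add: ennreal_leI)
      qed simp
    qed
    also have "\<dots> < \<infinity>" by (rule loc[OF compact_cube, of _ B]) (simp add: atom_bound)
    finally have "((\<lambda>\<omega>. LINT x|lborel. ?f x * wterm g \<omega> x) has_sum (LINT x|lborel. ?f x * h x)) Omega"
      unfolding h_def by (intro integral_term_has_sum[OF g _ _ bij]) auto
    moreover have "(LINT x|lborel. ?f x * wterm g \<omega> x) = (if \<omega> = \<omega>' then coef g \<omega>' else 0)" if "\<omega> \<in> Omega" for \<omega>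
    proof -
      have "(LINT x|lborel. ?f x * wterm g \<omega> x) = (LINT x|lborel. (complex_of_real (2 ^ (lev \<omega> * CARD('n))) * coef g \<omega>) * complex_of_real (atom \<omega>' x * atom \<omega> x))"
        by (intro Bochner_Integration.integral_cong) (auto simp: wterm_def mult_ac)
      also have "\<dots> = (complex_of_real (2 ^ (lev \<omega> * CARD('n))) * coef g \<omega>) * complex_of_real (LINT x|lborel. atom \<omega>' x * atom \<omega> x)"
        by (simp only: integral_mult_right_zero integral_complex_of_real)
      also have "\<dots> = coef g \<omega> * complex_of_real (2 ^ (lev \<omega> * CARD('n)) * (LINT x|lborel. atom \<omega>' x * atom \<omega> x))"
        by simp
      finally show ?thesis unfolding atom_orthogonal[OF that w] by auto
    qed
    hence "((\<lambda>\<omega>. LINT x|lborel. ?f x * wterm g \<omega> x) has_sum S) Omega \<longleftrightarrow> ((\<lambda>\<omega>. coef g \<omega>') has_sum S) {\<omega>'}" for S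
      using w by (intro has_sum_cong_neutral) auto
    moreover have "((\<lambda>\<omega>. coef g \<omega>') has_sum coef g \<omega>') {\<omega>'}" using has_sum_finite[of "{\<omega>'}" "\<lambda>\<omega>. coef g \<omega>'"] by simp
    ultimately have eq: "(LINT x|lborel. ?f x * h x) = coef g \<omega>'" using has_sum_unique by blast
    have "h x * ?f x = g x * ?f x - r x * ?f x" for x unfolding r_def by (simp add: algebra_simps)
    hence "(LINT x|lborel. h x * ?f x) = coef g \<omega>' - (LINT x|lborel. r x * ?f x)"
      unfolding coef_def using Bochner_Integration.integral_diff[OF int_g int_r] by simp
    thus ?thesis using eq by (simp add: mult.commute)
  qed
  \<comment> \<open>One factor of the square is bounded by a constant, the other by an integrable
    power.\<close>
  have L2fin: "(\<integral>\<^sup>+x. ennreal ((norm (r x))\<^sup>2) \<partial>lborel) < \<infinity>"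
  proof -
    have "(\<integral>\<^sup>+x. ennreal ((norm (r x))\<^sup>2) \<partial>lborel) \<le> (\<integral>\<^sup>+x. ennreal (D * D) * ennreal (1 / (1 + norm (x :: real^'n)) ^ m) \<partial>lborel)"
    proof (intro nn_integral_mono)
      fix x
      have "(norm (r x))\<^sup>2 \<le> D * (D / (1 + norm x) ^ m)"
        unfolding power2_eq_square using rD rb D0 by (intro mult_mono) auto
      thus "ennreal ((norm (r x))\<^sup>2) \<le> ennreal (D * D) * ennreal (1 / (1 + norm x) ^ m)"
        using D0 by (subst ennreal_mult[symmetric]) (auto intro!: ennreal_leI)
    qed
    also have "\<dots> = ennreal (D * D) * (\<integral>\<^sup>+x. ennreal (1 / (1 + norm (x :: real^'n)) ^ m) \<partial>lborel)"
      by (rule nn_integral_cmult) measurable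
    also have "\<dots> < \<infinity>" using nn_integral_polynomial_decay_finite[where 'n='n] unfolding m_def
      by (simp add: ennreal_mult_less_top)
    finally show ?thesis .
  qed
  have int_r2: "integrable lborel (\<lambda>x. (norm (r x))\<^sup>2)"
    unfolding integrable_iff_bounded using L2fin by simp
  have "r \<in> L2_space" unfolding L2_space_def using L2fin
    by (auto simp: nn_integral_completion intro: measurable_completion)
  hence "r \<in> L2_closed_span (Omega :: 'n windex set) (\<lambda>\<omega> x. scale \<omega> * atom \<omega> x)"
    using onb unfolding L2_orthonormal_basis_def by simp
  hence span: "\<exists>S c. finite S \<and> S \<subseteq> Omega \<and> L2_approx r \<epsilon> (\<lambda>x. \<Sum>\<omega>\<in>S. c \<omega> * of_real (scale \<omega> * atom \<omega> x))" if "\<epsilon> > 0" for \<epsilon>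
    unfolding L2_closed_span_def using that by blast
  have small: "(LINT x|lborel. (norm (r x))\<^sup>2) \<le> \<epsilon>\<^sup>2" if \<epsilon>: "\<epsilon> > 0" for \<epsilon>
  proof -
    from span[OF \<epsilon>] obtain S c where S: "finite S" "S \<subseteq> Omega"
      "L2_approx r \<epsilon> (\<lambda>x. \<Sum>\<omega>\<in>S. c \<omega> * of_real (scale \<omega> * atom \<omega> x))" by blast
    define p where "p x = (\<Sum>\<omega>\<in>S. c \<omega> * of_real (scale \<omega> * atom \<omega> x))" for x
    have [measurable]: "p \<in> borel_measurable borel" unfolding p_def by measurable
    have ap: "(\<integral>\<^sup>+x. ennreal ((norm (r x - p x))\<^sup>2) \<partial>lborel) < ennreal (\<epsilon>\<^sup>2)"
      using S(3) unfolding L2_approx_def p_def[symmetric] by (simp add: nn_integral_completion)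
    have int_rp: "integrable lborel (\<lambda>x. (norm (r x - p x))\<^sup>2)"
      unfolding integrable_iff_bounded using ap by (auto simp: top.not_eq_extremum intro: less_trans)
    have expand: "r x * cnj (p x) = (\<Sum>\<omega>\<in>S. (cnj (c \<omega>) * of_real (scale \<omega>)) * (r x * of_real (atom \<omega> x)))" for x
      unfolding p_def by (simp add: sum_distrib_left mult_ac)
    have int_c: "integrable lborel (\<lambda>x. r x * cnj (p x))"
      unfolding expand by (intro Bochner_Integration.integrable_sum integrable_mult_right int_r)
    have "(LINT x|lborel. r x * cnj (p x)) = (\<Sum>\<omega>\<in>S. (cnj (c \<omega>) * of_real (scale \<omega>)) * (LINT x|lborel. r x * of_real (atom \<omega> x)))"
      unfolding expand by (subst Bochner_Integration.integral_sum) (auto intro!: integrable_mult_right int_r)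
    also have "\<dots> = 0" using S(2) orth by (intro sum.neutral) auto
    finally have z0: "(LINT x|lborel. r x * cnj (p x)) = 0" .
    define q where "q x = Re (r x * cnj (p x))" for x
    have int_q: "integrable lborel q" unfolding q_def using int_c by (rule integrable_Re)
    have z: "(LINT x|lborel. q x) = 0" unfolding q_def using integral_Re[OF int_c] z0 by simp
    \<comment> \<open>As r is orthogonal to the approximant p, the norm of r is at most the distance
      of r from p.\<close>
    have "(LINT x|lborel. (norm (r x))\<^sup>2) = (LINT x|lborel. (norm (r x))\<^sup>2 - 2 * q x)"
      using Bochner_Integration.integral_diff[OF int_r2 integrable_mult_right[OF int_q, of 2]] z by simp
    also have "\<dots> \<le> (LINT x|lborel. (norm (r x - p x))\<^sup>2)"
    proof (rule integral_mono[OF Bochner_Integration.integrable_diff[OF int_r2 integrable_mult_right[OF int_q, of 2]] int_rp])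
      fix x
      have "(norm (r x - p x))\<^sup>2 = (norm (r x))\<^sup>2 - 2 * q x + (norm (p x))\<^sup>2"
        unfolding cmod_power2 q_def by (simp add: power2_eq_square algebra_simps)
      thus "(norm (r x))\<^sup>2 - 2 * q x \<le> (norm (r x - p x))\<^sup>2" by simp
    qed
    also have "\<dots> \<le> \<epsilon>\<^sup>2"
    proof -
      have "ennreal (LINT x|lborel. (norm (r x - p x))\<^sup>2) = (\<integral>\<^sup>+x. ennreal ((norm (r x - p x))\<^sup>2) \<partial>lborel)"
        by (rule nn_integral_eq_integral[OF int_rp, symmetric]) simp
      hence "ennreal (LINT x|lborel. (norm (r x - p x))\<^sup>2) \<le> ennreal (\<epsilon>\<^sup>2)" using ap by (simp add: less_imp_le)
      thus ?thesis by (subst (asm) ennreal_le_iff) auto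
    qed
    finally show ?thesis .
  qed
  have "(LINT x|lborel. (norm (r x))\<^sup>2) \<le> 0"
  proof (rule field_le_epsilon)
    fix e :: real assume e: "e > 0"
    have "(LINT x|lborel. (norm (r x))\<^sup>2) \<le> (sqrt e)\<^sup>2" by (rule small) (use e in simp)
    thus "(LINT x|lborel. (norm (r x))\<^sup>2) \<le> 0 + e" using e by simp
  qed
  hence "(LINT x|lborel. (norm (r x))\<^sup>2) = 0" by (intro antisym) (auto intro!: integral_nonneg_AE)
  hence "AE x in lborel. (norm (r x))\<^sup>2 = 0"
    by (subst (asm) integral_nonneg_eq_0_iff_AE[OF int_r2]) auto
  thus ?thesis by eventually_elim (simp add: r_def h_def)
qed

lemma ex_enum_Omega: "\<exists>enum. bij_betw enum (UNIV::nat set) (Omega :: 'n windex set)"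
proof -
  have "infinite (Omega :: 'n windex set)"
  proof -
    have "(\<lambda>k::int. (zero_type :: bool^'n, (0::int, (\<chi> i. k) :: int^'n))) ` UNIV \<subseteq> Omega"
      by (auto simp: Omega_def dyadic_zero_def)
    moreover have "infinite ((\<lambda>k::int. (zero_type :: bool^'n, (0::int, (\<chi> i. k) :: int^'n))) ` UNIV)"
      by (subst finite_image_iff) (auto simp: inj_on_def vec_eq_iff infinite_UNIV_int)
    ultimately show ?thesis using finite_subset by blast
  qed
  thus ?thesis using bij_betw_from_nat_into[OF countable_Omega] by blast
qed

text \<open>The series for g decays faster than any power, so f only has to be integrable against
  some power of 1/(1 + |x|).\<close>

lemma expansion_has_sum:
  assumes g: "g \<in> schwartz" and f [measurable]: "f \<in> borel_measurable borel"
    and fin: "(\<integral>\<^sup>+x. ennreal (norm (f x) / (1 + norm x) ^ m) \<partial>lborel) < \<infinity>"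
  shows "((\<lambda>\<omega>. LINT x|lborel. f x * wterm g \<omega> x) has_sum (LINT x|lborel. f x * g x)) Omega"
proof -
  obtain enum where bij: "bij_betw enum (UNIV::nat set) (Omega :: 'n windex set)" using ex_enum_Omega by blast
  have [measurable]: "g \<in> borel_measurable borel"
    using schwartz_continuous[OF g] by (rule borel_measurable_continuous_onI)
  have "(LINT x|lborel. f x * (\<Sum>k. wterm g (enum k) x)) = (LINT x|lborel. f x * g x)"
    using expansion_AE[OF g bij] by (intro integral_cong_AE) (auto elim!: eventually_mono)
  thus ?thesis using integral_term_has_sum[OF g f fin bij] by simp
qed

end

section \<open>Weights of class \<open>A\<^sub>1\<close>\<close>

lemma A1_weight_measurable:
  assumes "A1_weight \<upsilon>" shows "\<upsilon> \<in> borel_measurable lebesgue"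
proof -
  have l: "locally_integrable \<upsilon>" using assms unfolding A1_weight_def by blast
  have 1: "(\<lambda>x. indicator (cball 0 (real k)) x *\<^sub>R \<upsilon> x) \<in> borel_measurable lebesgue" for k :: nat
    using l unfolding locally_integrable_def set_integrable_def by (metis borel_measurable_integrable compact_cball)
  have 2: "(\<lambda>k. indicator (cball 0 (real k)) x *\<^sub>R \<upsilon> x) \<longlonglongrightarrow> \<upsilon> x" for x
  proof (rule tendsto_eventually)
    obtain N :: nat where N: "norm x \<le> real N" using real_arch_simple by blast
    show "\<forall>\<^sub>F k in sequentially. indicator (cball 0 (real k)) x *\<^sub>R \<upsilon> x = \<upsilon> x"
      using eventually_ge_at_top[of N] by eventually_elim (use N in auto)
  qed
  show ?thesis by (rule borel_measurable_LIMSEQ_real[OF 2 1])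
qed

lemma weight_measure_finite:
  fixes \<upsilon> :: "real^'n::finite \<Rightarrow> real"
  assumes "A1_weight \<upsilon>" "compact K" shows "weight_measure \<upsilon> K < \<infinity>"
proof -
  have "integrable lebesgue (\<lambda>x. indicator K x *\<^sub>R \<upsilon> x)"
    using assms unfolding A1_weight_def locally_integrable_def set_integrable_def by blast
  hence "(\<integral>\<^sup>+x. ennreal (norm (indicator K x *\<^sub>R \<upsilon> x)) \<partial>lebesgue) < \<infinity>"
    by (simp add: integrable_iff_bounded)
  also have "(\<integral>\<^sup>+x. ennreal (norm (indicator K x *\<^sub>R \<upsilon> x)) \<partial>lebesgue) = weight_measure \<upsilon> K"
    unfolding weight_measure_def using assms(1) unfolding A1_weight_def
    by (intro nn_integral_cong) (auto simp: indicator_def)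
  finally show ?thesis .
qed

text \<open>The pointwise form of the A1 condition, linear in its constant.\<close>

lemma A1_AE:
  fixes \<upsilon> :: "real^'n::finite \<Rightarrow> real"
  assumes A1: "A1_weight \<upsilon>" and r: "r > 0" and Q: "Q = cbox a (a + r *\<^sub>R (\<chi> i. 1))"
  shows "AE x in lebesgue. x \<in> Q \<longrightarrow> weight_measure \<upsilon> Q \<le> A1_const \<upsilon> * ennreal (r ^ CARD('n)) * ennreal (\<upsilon> x)"
proof -
  define E where "E = esssup (restrict_space lebesgue Q) (\<lambda>x. inverse (ennreal (\<upsilon> x)))"
  have eQ: "emeasure lebesgue Q = ennreal (r ^ CARD('n))"
  proof -
    have ne: "Q \<noteq> {}" unfolding Q using r by (auto simp: interval_ne_empty_cart)
    have "measure lborel Q = r ^ CARD('n)" using ne unfolding Q by (subst content_cbox_cart) auto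
    hence "emeasure lborel Q = ennreal (r ^ CARD('n))" using emeasure_eq_ennreal_measure[of lborel Q]
      emeasure_lborel_cbox_finite[of a "a + r *\<^sub>R (\<chi> i. 1)"] unfolding Q by simp
    thus ?thesis unfolding Q by simp
  qed
  have "weight_measure \<upsilon> Q / emeasure lebesgue Q * E \<le> A1_const \<upsilon>"
    unfolding A1_const_def E_def by (rule SUP_upper) (use Q r in \<open>auto simp: cubes_def\<close>)
  hence le: "weight_measure \<upsilon> Q / ennreal (r ^ CARD('n)) * E \<le> A1_const \<upsilon>" unfolding eQ .
  have rn: "r ^ CARD('n) > 0" using r by simp
  have fin: "A1_const \<upsilon> < \<infinity>" using A1 unfolding A1_weight_def by blast
  have "AE x in restrict_space lebesgue Q. inverse (ennreal (\<upsilon> x)) \<le> E" unfolding E_def by (rule esssup_AE)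
  hence "AE x in lebesgue. x \<in> Q \<longrightarrow> inverse (ennreal (\<upsilon> x)) \<le> E"
    by (subst (asm) AE_restrict_space_iff) (auto simp: Q)
  thus ?thesis
  proof eventually_elim
    case (elim x)
    show ?case
    proof
      assume "x \<in> Q"
      hence inv: "inverse (ennreal (\<upsilon> x)) \<le> E" using elim by blast
      have "weight_measure \<upsilon> Q / ennreal (r ^ CARD('n)) * inverse (ennreal (\<upsilon> x)) \<le> A1_const \<upsilon>"
        using le inv by (meson mult_left_mono order_trans zero_le)
      hence X: "weight_measure \<upsilon> Q / ennreal (r ^ CARD('n)) * inverse (ennreal (\<upsilon> x)) \<le> A1_const \<upsilon>" .
      have WQ: "weight_measure \<upsilon> Q < \<infinity>" by (rule weight_measure_finite[OF A1]) (simp add: Q compact_cbox)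
      show "weight_measure \<upsilon> Q \<le> A1_const \<upsilon> * ennreal (r ^ CARD('n)) * ennreal (\<upsilon> x)"
      proof (cases "\<upsilon> x > 0")
        case False
        \<comment> \<open>Where the weight vanishes, its inverse is infinite, so a finite A1
          constant forces the mass of the cube to be 0.\<close>
        hence "inverse (ennreal (\<upsilon> x)) = top" by (simp add: ennreal_neg)
        hence "weight_measure \<upsilon> Q / ennreal (r ^ CARD('n)) * top < top" using X fin by (simp add: le_less_trans)
        hence "weight_measure \<upsilon> Q / ennreal (r ^ CARD('n)) = 0"
          by (auto simp: ennreal_mult_top split: if_splits)
        hence "weight_measure \<upsilon> Q = 0" by (auto simp: ennreal_divide_eq_0_iff)
        thus ?thesis by simp
      next
        case True
        obtain W where W: "W \<ge> 0" "weight_measure \<upsilon> Q = ennreal W" using WQ by (cases "weight_measure \<upsilon> Q") auto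
        obtain A where A: "A \<ge> 0" "A1_const \<upsilon> = ennreal A" using fin by (cases "A1_const \<upsilon>") auto
        have "inverse (ennreal (\<upsilon> x)) = ennreal (inverse (\<upsilon> x))" using True by (simp add: inverse_ennreal)
        hence "ennreal (W / r ^ CARD('n) * inverse (\<upsilon> x)) \<le> ennreal A"
          using X unfolding W(2) A(2) using W(1) rn True by (simp add: divide_ennreal ennreal_mult[symmetric] del: ennreal_power)
        hence "W / r ^ CARD('n) * inverse (\<upsilon> x) \<le> A" using A(1) by (subst (asm) ennreal_le_iff) auto
        hence "W \<le> A * r ^ CARD('n) * \<upsilon> x" using rn True by (simp add: field_simps)
        thus ?thesis unfolding W(2) A(2) using A(1) rn True by (simp add: ennreal_mult[symmetric] ennreal_leI del: ennreal_power)
      qed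
    qed
  qed
qed

definition A1_real :: "(real^'n::finite \<Rightarrow> real) \<Rightarrow> real" where
  "A1_real \<upsilon> = enn2real (A1_const \<upsilon>)"

lemma A1_real: "A1_weight \<upsilon> \<Longrightarrow> A1_const \<upsilon> = ennreal (A1_real \<upsilon>)"
  unfolding A1_weight_def A1_real_def by simp

definition wgt :: "(real^'n::finite \<Rightarrow> real) \<Rightarrow> (real^'n) set \<Rightarrow> real" where
  "wgt \<upsilon> Q = enn2real (weight_measure \<upsilon> Q)"

lemma wgt: "A1_weight \<upsilon> \<Longrightarrow> compact Q \<Longrightarrow> weight_measure \<upsilon> Q = ennreal (wgt \<upsilon> Q)"
  unfolding wgt_def using weight_measure_finite by (metis ennreal_enn2real infinity_ennreal_def)

lemma wgt_nonneg: "0 \<le> wgt \<upsilon> Q"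
  unfolding wgt_def by simp

lemma A1_AE_real:
  fixes \<upsilon> :: "real^'n::finite \<Rightarrow> real"
  assumes A1: "A1_weight \<upsilon>" and r: "r > 0" and Q: "Q = cbox a (a + r *\<^sub>R (\<chi> i. 1))"
  shows "AE x in lebesgue. x \<in> Q \<longrightarrow> wgt \<upsilon> Q \<le> A1_real \<upsilon> * r ^ CARD('n) * \<upsilon> x"
  using A1_AE[OF A1 r Q]
proof eventually_elim
  case (elim x)
  have v: "\<upsilon> x \<ge> 0" "A1_real \<upsilon> \<ge> 0" using A1 unfolding A1_weight_def A1_real_def by auto
  show ?case
  proof
    assume "x \<in> Q"
    hence "ennreal (wgt \<upsilon> Q) \<le> ennreal (A1_real \<upsilon>) * ennreal (r ^ CARD('n)) * ennreal (\<upsilon> x)"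
      using elim wgt[OF A1, of Q] A1_real[OF A1] Q by simp
    also have "\<dots> = ennreal (A1_real \<upsilon> * r ^ CARD('n) * \<upsilon> x)"
      using v r by (simp add: ennreal_mult[symmetric] del: ennreal_power)
    finally show "wgt \<upsilon> Q \<le> A1_real \<upsilon> * r ^ CARD('n) * \<upsilon> x"
      using v r by (subst (asm) ennreal_le_iff) auto
  qed
qed

lemma A1_positive_mass:
  fixes \<upsilon> :: "real^'n::finite \<Rightarrow> real"
  assumes A1: "A1_weight \<upsilon>"
  shows "\<exists>N::nat. N > 0 \<and> wgt \<upsilon> (cbox (\<chi> i. - real N) (\<chi> i. real N)) > 0"
proof (rule ccontr)
  assume neg: "\<not> ?thesis"
  define Q where "Q N = (cbox (\<chi> i. - real N) (\<chi> i. real N) :: (real^'n) set)" for N :: nat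
  have m [measurable]: "\<upsilon> \<in> borel_measurable lebesgue" by (rule A1_weight_measurable[OF A1])
  have "AE x in lebesgue. x \<in> Q (Suc N) \<longrightarrow> \<upsilon> x = 0" for N
  proof -
    have [measurable]: "Q (Suc N) \<in> sets lebesgue" unfolding Q_def by simp
    have "wgt \<upsilon> (Q (Suc N)) = 0" using neg wgt_nonneg[of \<upsilon> "Q (Suc N)"] unfolding Q_def by (metis less_eq_real_def zero_less_Suc)
    hence "weight_measure \<upsilon> (Q (Suc N)) = 0" using wgt[OF A1, of "Q (Suc N)"] unfolding Q_def by simp
    hence "AE x in lebesgue. ennreal (\<upsilon> x) * indicator (Q (Suc N)) x = 0"
      unfolding weight_measure_def by (subst (asm) nn_integral_0_iff_AE) auto
    thus ?thesis
    proof eventually_elim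
      case (elim x)
      have "\<upsilon> x \<ge> 0" using A1 unfolding A1_weight_def by blast
      thus ?case using elim by (auto simp: ennreal_eq_0_iff)
    qed
  qed
  hence "AE x in lebesgue. \<forall>N. x \<in> Q (Suc N) \<longrightarrow> \<upsilon> x = 0" unfolding AE_all_countable by blast
  hence "AE x in lebesgue. \<upsilon> x = 0"
  proof eventually_elim
    case (elim x)
    obtain N :: nat where N: "norm x \<le> real N" using real_arch_simple by blast
    have "x \<in> Q (Suc N)" unfolding Q_def mem_box_cart
    proof (intro allI conjI)
      fix i have "\<bar>x $ i\<bar> \<le> real N" using component_le_norm_cart[of x i] N by simp
      thus "(\<chi> i. - real (Suc N)) $ i \<le> x $ i" "x $ i \<le> (\<chi> i. real (Suc N)) $ i" by auto
    qed
    thus ?case using elim by blast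
  qed
  thus False using A1 unfolding A1_weight_def by blast
qed

text \<open>A fixed cube at the origin has positive mass. Any x shares with it a centred cube of
  side comparable to 1 + |x|, and the A1 condition on that cube bounds the weight at x from below by
  mass over volume.\<close>

lemma A1_lower_bound:
  fixes \<upsilon> :: "real^'n::finite \<Rightarrow> real"
  assumes A1: "A1_weight \<upsilon>"
  shows "A1_real \<upsilon> > 0" "\<exists>c>0. AE x in lebesgue. c / (1 + norm x) ^ CARD('n) \<le> \<upsilon> x"
proof -
  define Q where "Q N = (cbox (\<chi> i. - real N) (\<chi> i. real N) :: (real^'n) set)" for N :: nat
  have Qc: "Q N = cbox (\<chi> i. - real N) ((\<chi> i. - real N) + (2 * real N) *\<^sub>R (\<chi> i. 1))" for N
    unfolding Q_def by (rule arg_cong2[where f=cbox]) (auto simp: vec_eq_iff)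
  obtain N where N: "N > 0" "wgt \<upsilon> (Q N) > 0" using A1_positive_mass[OF A1] unfolding Q_def by blast
  have AA: "AE x in lebesgue. x \<in> Q K \<longrightarrow> wgt \<upsilon> (Q K) \<le> A1_real \<upsilon> * (2 * real K) ^ CARD('n) * \<upsilon> x" if "K > 0" for K
    by (rule A1_AE_real[OF A1 _ Qc]) (use that in simp)
  have Apos: "A1_real \<upsilon> \<ge> 0" unfolding A1_real_def by simp
  show A: "A1_real \<upsilon> > 0"
  proof (rule ccontr)
    assume "\<not> A1_real \<upsilon> > 0"
    hence "A1_real \<upsilon> = 0" using Apos by simp
    hence "AE x in lebesgue. x \<notin> Q N" using AA[OF N(1)] N(2) by auto
    hence "Q N \<in> null_sets lebesgue" by (simp add: AE_iff_null_sets Q_def)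
    hence "negligible (Q N)" by (simp add: negligible_iff_null_sets)
    moreover have "box (\<chi> i. - real N) (\<chi> i. real N) \<noteq> ({} :: (real^'n) set)" using N(1) by (auto simp: interval_ne_empty_cart)
    ultimately show False unfolding Q_def using negligible_interval by blast
  qed
  define c where "c = wgt \<upsilon> (Q N) / (A1_real \<upsilon> * (2 * (2 + real N)) ^ CARD('n))"
  have c: "c > 0" unfolding c_def using N A by simp
  have "AE x in lebesgue. \<forall>K. K > 0 \<longrightarrow> x \<in> Q K \<longrightarrow> wgt \<upsilon> (Q K) \<le> A1_real \<upsilon> * (2 * real K) ^ CARD('n) * \<upsilon> x"
    unfolding AE_all_countable using AA by auto
  hence "AE x in lebesgue. c / (1 + norm x) ^ CARD('n) \<le> \<upsilon> x"
  proof eventually_elim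
    case (elim x)
    have v: "\<upsilon> x \<ge> 0" using A1 unfolding A1_weight_def by blast
    \<comment> \<open>Large enough to contain both x and the fixed cube, yet at most a constant
      times 1 + |x|.\<close>
    define K where "K = nat \<lceil>norm x\<rceil> + N"
    have K0: "K > 0" unfolding K_def using N by simp
    have K1: "norm x \<le> real K" unfolding K_def by (simp add: real_nat_ceiling_ge add_increasing2)
    have K2: "real K \<le> (2 + real N) * (1 + norm x)"
    proof -
      have "0 \<le> \<lceil>norm x\<rceil>" using norm_ge_zero[of x] by linarith
      hence "real (nat \<lceil>norm x\<rceil>) \<le> norm x + 1" using ceiling_correct[of "norm x"] by linarith
      hence "real K \<le> norm x + 1 + real N" unfolding K_def of_nat_add by linarith
      moreover have "(2 + real N) * (1 + norm x) = 2 + real N + 2 * norm x + real N * norm x" by (simp add: algebra_simps)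
      moreover have "0 \<le> real N * norm x" by simp
      ultimately show ?thesis using norm_ge_zero[of x] by linarith
    qed
    have xQ: "x \<in> Q K" unfolding Q_def mem_box_cart
    proof (intro allI conjI)
      fix i have "\<bar>x $ i\<bar> \<le> real K" using component_le_norm_cart[of x i] K1 by simp
      thus "(\<chi> i. - real K) $ i \<le> x $ i" "x $ i \<le> (\<chi> i. real K) $ i" by auto
    qed
    have "Q N \<subseteq> Q K"
    proof
      fix y assume y: "y \<in> Q N"
      have NK: "real N \<le> real K" unfolding K_def of_nat_le_iff by (rule le_add2)
      show "y \<in> Q K" unfolding Q_def mem_box_cart
      proof (intro allI conjI)
        fix i have "- real N \<le> y $ i" "y $ i \<le> real N" using y unfolding Q_def mem_box_cart by auto
        thus "(\<chi> i. - real K) $ i \<le> y $ i" "y $ i \<le> (\<chi> i. real K) $ i" using NK by auto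
      qed
    qed
    hence "weight_measure \<upsilon> (Q N) \<le> weight_measure \<upsilon> (Q K)"
      unfolding weight_measure_def by (intro nn_integral_mono mult_left_mono indicator_leI) auto
    hence "ennreal (wgt \<upsilon> (Q N)) \<le> ennreal (wgt \<upsilon> (Q K))"
      using wgt[OF A1, of "Q N"] wgt[OF A1, of "Q K"] unfolding Q_def by simp
    hence "wgt \<upsilon> (Q N) \<le> wgt \<upsilon> (Q K)"
      by (simp add: ennreal_le_iff[OF wgt_nonneg[of \<upsilon> "Q K"]])
    also have "\<dots> \<le> A1_real \<upsilon> * (2 * real K) ^ CARD('n) * \<upsilon> x" using elim K0 xQ by blast
    also have "\<dots> \<le> A1_real \<upsilon> * (2 * ((2 + real N) * (1 + norm x))) ^ CARD('n) * \<upsilon> x"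
      by (intro mult_right_mono mult_left_mono power_mono K2 Apos v) (simp_all add: K2 Apos v)
    also have "\<dots> = (A1_real \<upsilon> * (2 * (2 + real N)) ^ CARD('n)) * ((1 + norm x) ^ CARD('n) * \<upsilon> x)"
      by (simp only: mult.assoc[symmetric] power_mult_distrib)
    finally have w: "wgt \<upsilon> (Q N) \<le> (A1_real \<upsilon> * (2 * (2 + real N)) ^ CARD('n)) * ((1 + norm x) ^ CARD('n) * \<upsilon> x)" .
    have "A1_real \<upsilon> * (2 * (2 + real N)) ^ CARD('n) > 0" using A by simp
    hence cx: "c \<le> (1 + norm x) ^ CARD('n) * \<upsilon> x" unfolding c_def using w by (simp add: pos_divide_le_eq mult.commute)
    have px: "(1 + norm x) ^ CARD('n) > 0" by (intro zero_less_power) (use norm_ge_zero[of x] in linarith)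
    show ?case unfolding pos_divide_le_eq[OF px] using cx by (simp only: mult.commute)
  qed
  thus "\<exists>c>0. AE x in lebesgue. c / (1 + norm x) ^ CARD('n) \<le> \<upsilon> x" using c by blast
qed

text \<open>The embedding through which weighted functions can be paired with Schwartz functions and
  their expansions.\<close>

lemma decay_integrable_of_weighted:
  fixes \<upsilon> :: "real^'n::finite \<Rightarrow> real" and f :: "real^'n \<Rightarrow> ennreal"
  assumes A1: "A1_weight \<upsilon>" and [measurable]: "f \<in> borel_measurable lebesgue"
    and fin: "(\<integral>\<^sup>+x. f x * ennreal (\<upsilon> x) \<partial>lebesgue) < \<infinity>"
  shows "(\<integral>\<^sup>+x. f x * ennreal (1 / (1 + norm x) ^ CARD('n)) \<partial>lebesgue) < \<infinity>"
proof -
  obtain c where c: "c > 0" "AE x in lebesgue. c / (1 + norm x) ^ CARD('n) \<le> \<upsilon> x"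
    using A1_lower_bound(2)[OF A1] by blast
  have m [measurable]: "(\<lambda>x::real^'n. ennreal (1 / (1 + norm x) ^ CARD('n))) \<in> borel_measurable lebesgue"
    by (rule measurable_completion) measurable
  have "ennreal c * (\<integral>\<^sup>+x. f x * ennreal (1 / (1 + norm x) ^ CARD('n)) \<partial>lebesgue)
    = (\<integral>\<^sup>+x. ennreal c * (f x * ennreal (1 / (1 + norm x) ^ CARD('n))) \<partial>lebesgue)"
    by (rule nn_integral_cmult[symmetric]) (rule borel_measurable_times_ennreal[OF assms(2) m])
  also have "\<dots> \<le> (\<integral>\<^sup>+x. f x * ennreal (\<upsilon> x) \<partial>lebesgue)"
  proof (rule nn_integral_mono_AE, use c(2) in eventually_elim)
    case (elim x)
    have "ennreal c * ennreal (1 / (1 + norm x) ^ CARD('n)) = ennreal (c / (1 + norm x) ^ CARD('n))"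
      using c(1) by (subst ennreal_mult[symmetric]) auto
    also have "\<dots> \<le> ennreal (\<upsilon> x)" using elim by (rule ennreal_leI)
    finally have "f x * (ennreal c * ennreal (1 / (1 + norm x) ^ CARD('n))) \<le> f x * ennreal (\<upsilon> x)"
      by (rule mult_left_mono) simp
    thus ?case by (simp only: mult.left_commute)
  qed
  finally have "ennreal c * (\<integral>\<^sup>+x. f x * ennreal (1 / (1 + norm x) ^ CARD('n)) \<partial>lebesgue) < \<infinity>"
    using fin by (rule le_less_trans)
  thus ?thesis using c(1) by (auto simp: ennreal_mult_less_top)
qed

lemma locally_finite_of_decay:
  fixes f :: "real^'n::finite \<Rightarrow> ennreal"
  assumes [measurable]: "f \<in> borel_measurable M" and M: "sets borel \<subseteq> sets M" "space M = UNIV"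
    and fin: "(\<integral>\<^sup>+x. f x * ennreal (1 / (1 + norm x) ^ m) \<partial>M) < \<infinity>" and K: "compact K"
  shows "(\<integral>\<^sup>+x. indicator K x * f x \<partial>M) < \<infinity>"
proof -
  obtain b where b: "b > 0" "\<And>x. x \<in> K \<Longrightarrow> norm x \<le> b" using compact_imp_bounded[OF K] bounded_pos by blast
  have mm: "(\<lambda>x::real^'n. ennreal (1 / (1 + norm x) ^ m)) \<in> borel_measurable M"
  proof -
    have "(\<lambda>x::real^'n. ennreal (1 / (1 + norm x) ^ m)) \<in> borel_measurable borel" by measurable
    thus ?thesis using M unfolding measurable_def by auto
  qed
  have "(\<integral>\<^sup>+x. indicator K x * f x \<partial>M) \<le> (\<integral>\<^sup>+x. ennreal ((1 + b) ^ m) * (f x * ennreal (1 / (1 + norm x) ^ m)) \<partial>M)"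
  proof (intro nn_integral_mono)
    fix x
    show "indicator K x * f x \<le> ennreal ((1 + b) ^ m) * (f x * ennreal (1 / (1 + norm x) ^ m))"
    proof (cases "x \<in> K")
      case True
      have px: "(1 + norm x) ^ m > 0" by (intro zero_less_power) (use norm_ge_zero[of x] in linarith)
      have "(1 + norm x) ^ m \<le> (1 + b) ^ m" using b(2)[OF True] by (intro power_mono) auto
      hence "1 \<le> (1 + b) ^ m * (1 / (1 + norm x) ^ m)" using px by simp
      hence "ennreal 1 \<le> ennreal ((1 + b) ^ m * (1 / (1 + norm x) ^ m))" by (rule ennreal_leI)
      also have "\<dots> = ennreal ((1 + b) ^ m) * ennreal (1 / (1 + norm x) ^ m)" using b(1) px by (intro ennreal_mult) auto
      finally have "f x * 1 \<le> f x * (ennreal ((1 + b) ^ m) * ennreal (1 / (1 + norm x) ^ m))"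
        by (intro mult_left_mono) auto
      thus ?thesis using True by (simp add: mult.left_commute)
    qed simp
  qed
  also have "\<dots> = ennreal ((1 + b) ^ m) * (\<integral>\<^sup>+x. f x * ennreal (1 / (1 + norm x) ^ m) \<partial>M)"
    by (rule nn_integral_cmult) (rule borel_measurable_times_ennreal[OF assms(1) mm])
  also have "\<dots> < \<infinity>" using fin by (simp add: ennreal_mult_less_top)
  finally show ?thesis .
qed

section \<open>Bumps as Schwartz functions, and integration by parts\<close>

lemma iter_partial_bump_zero:
  assumes c: "c > 0" and x: "x \<notin> cbox a b"
  shows "iter_partial js (\<lambda>x. complex_of_real (bump c a b x)) x = 0"
  using x
proof (induction js arbitrary: x)
  case Nil thus ?case by (simp add: bump_eq_0)
next
  case (Cons i js)
  have "open (- cbox a b)" by (simp add: closed_cbox open_Compl)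
  have "((\<lambda>x. 0::complex) has_derivative (\<lambda>_. 0)) (at x)" by simp
  hence "(iter_partial js (\<lambda>x. complex_of_real (bump c a b x)) has_derivative (\<lambda>_. 0)) (at x)"
    by (rule has_derivative_transform_within_open[of _ _ _ _ "- cbox a b"])
       (use Cons \<open>open (- cbox a b)\<close> in auto)
  from partial_deriv_eqI[OF this] show ?case by simp
qed

lemma schwartz_bump:
  assumes c: "c > 0" shows "(\<lambda>x. complex_of_real (bump c a b x)) \<in> schwartz"
  unfolding schwartz_def
proof (intro CollectI conjI allI)
  let ?\<theta> = "\<lambda>x. complex_of_real (bump c a b x)"
  show sm: "smooth ?\<theta>" using test_function_bump[OF c] unfolding test_function_def by blast
  fix js and m :: nat
  let ?h = "\<lambda>x. (1 + norm x) ^ m *\<^sub>R iter_partial js ?\<theta> x"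
  have "continuous_on UNIV (iter_partial js ?\<theta>)"
    using sm unfolding smooth_def
    by (auto intro!: continuous_at_imp_continuous_on differentiable_imp_continuous_within)
  hence "compact (?h ` cbox a b)"
    by (intro compact_continuous_image continuous_intros) (auto intro: continuous_on_subset)
  hence "bounded (insert 0 (?h ` cbox a b))" by (simp add: compact_imp_bounded)
  moreover have "range ?h \<subseteq> insert 0 (?h ` cbox a b)"
  proof
    fix y assume "y \<in> range ?h"
    then obtain x where y: "y = ?h x" by blast
    show "y \<in> insert 0 (?h ` cbox a b)"
    proof (cases "x \<in> cbox a b")
      case True thus ?thesis unfolding y by blast
    next
      case False thus ?thesis unfolding y using iter_partial_bump_zero[OF c False, of js] by simp
    qed
  qed
  ultimately show "bounded (range ?h)" by (rule bounded_subset)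
qed

lemma iter_partial_append: "iter_partial (js @ [i]) g = iter_partial js (partial_deriv i g)"
  by (induction js) auto

lemma schwartz_partial:
  assumes "g \<in> schwartz" shows "partial_deriv i g \<in> schwartz"
  using assms unfolding schwartz_def smooth_def by (auto simp flip: iter_partial_append)

text \<open>Translation invariance replaces boundary terms: the integral of H(x+e) - H(x) vanishes,
  and by Fubini it equals the integral over s in [0, 1] of the integral of D, which does not depend
  on s.\<close>

lemma integral_line_derivative_zero:
  fixes H D :: "real^'n::finite \<Rightarrow> complex" and e :: "real^'n"
  assumes D: "continuous_on UNIV D" and HD: "\<And>x s. ((\<lambda>s. H (x + s *\<^sub>R e)) has_vector_derivative D (x + s *\<^sub>R e)) (at s)"
    and H: "integrable lborel H" and int: "integrable lborel D"
  shows "(LINT x|lborel. D x) = 0"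
proof -
  have [measurable]: "D \<in> borel_measurable borel" using D by (rule borel_measurable_continuous_onI)
  define h where "h x s = indicator {0..1::real} s *\<^sub>R D (x + s *\<^sub>R e)" for x s
  have [measurable]: "case_prod h \<in> borel_measurable (lborel \<Otimes>\<^sub>M lborel)" unfolding h_def by measurable
  have h_int: "integrable (lborel \<Otimes>\<^sub>M lborel) (case_prod h)"
    unfolding integrable_iff_bounded
  proof
    have "(\<integral>\<^sup>+z. ennreal (norm (case_prod h z)) \<partial>(lborel \<Otimes>\<^sub>M lborel)) = (\<integral>\<^sup>+s. \<integral>\<^sup>+x. ennreal (norm (h x s)) \<partial>lborel \<partial>lborel)"
      by (subst lborel_pair.nn_integral_snd[symmetric]) auto
    also have "\<dots> = (\<integral>\<^sup>+s. indicator {0..1::real} s * (\<integral>\<^sup>+x. ennreal (norm (D (x::real^'n))) \<partial>lborel) \<partial>lborel)"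
    proof (rule nn_integral_cong)
      fix s :: real
      have "(\<integral>\<^sup>+x. ennreal (norm (D (x + s *\<^sub>R e))) \<partial>lborel) = (\<integral>\<^sup>+x. ennreal (norm (D (x::real^'n))) \<partial>lborel)"
        by (rule nn_integral_lborel_shift) measurable
      thus "(\<integral>\<^sup>+x. ennreal (norm (h x s)) \<partial>lborel) = indicator {0..1} s * (\<integral>\<^sup>+x. ennreal (norm (D (x::real^'n))) \<partial>lborel)"
        unfolding h_def by (cases "s \<in> {0..1}") auto
    qed
    also have "\<dots> = (\<integral>\<^sup>+x. ennreal (norm (D (x::real^'n))) \<partial>lborel)" by (subst nn_integral_multc) auto
    also have "\<dots> < \<infinity>" using int by (simp add: integrable_iff_bounded)
    finally show "(\<integral>\<^sup>+z. ennreal (norm (case_prod h z)) \<partial>(lborel \<Otimes>\<^sub>M lborel)) < \<infinity>" .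
  qed measurable
  have ftc: "(LINT s|lborel. h x s) = H (x + e) - H x" for x
  proof -
    have "(LINT s|lborel. indicator {0..1} s *\<^sub>R D (x + s *\<^sub>R e)) = H (x + 1 *\<^sub>R e) - H (x + 0 *\<^sub>R e)"
    proof (rule integral_FTC_Icc)
      show "((\<lambda>s. H (x + s *\<^sub>R e)) has_vector_derivative D (x + s *\<^sub>R e)) (at s within {0..1})" for s
        using HD by (rule has_vector_derivative_at_within)
      show "continuous_on {0..1} (\<lambda>s. D (x + s *\<^sub>R e))"
        by (intro continuous_on_compose2[OF D] continuous_intros) auto
    qed simp
    thus ?thesis unfolding h_def by simp
  qed
  have "0 = (LINT x|lborel. H (x + e) - H x)"
    using integral_lborel_shift[of H e] integrable_lborel_shift[OF H, of e] H
    by (subst Bochner_Integration.integral_diff) auto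
  also have "\<dots> = (LINT x|lborel. LINT s|lborel. h x s)" unfolding ftc ..
  also have "\<dots> = (LINT s|lborel. LINT x|lborel. h x s)" by (rule lborel_pair.Fubini_integral[OF h_int, symmetric])
  also have "\<dots> = (LINT s|lborel. indicator {0..1::real} s *\<^sub>R (LINT x|lborel. D x))"
  proof (rule Bochner_Integration.integral_cong[OF refl])
    fix s :: real
    have "(LINT x|lborel. D (x + s *\<^sub>R e)) = (LINT x|lborel. D x)" by (rule integral_lborel_shift) measurable
    thus "(LINT x|lborel. h x s) = indicator {0..1} s *\<^sub>R (LINT x|lborel. D x)" unfolding h_def by simp
  qed
  also have "\<dots> = (LINT x|lborel. D x)" by (subst integral_scaleR_left) auto
  finally show ?thesis by simp
qed

lemma infsum_ennreal_enum:
  fixes f :: "'a \<Rightarrow> ennreal"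
  assumes "bij_betw enum (UNIV::nat set) A"
  shows "infsum f A = (\<Sum>k. f (enum k))"
proof -
  have "infsum f A = infsum (\<lambda>k. f (enum k)) UNIV"
    by (rule infsum_reindex_bij_betw[OF assms, symmetric])
  also have "\<dots> = (\<Sum>k. f (enum k))"
  proof -
    have "((\<lambda>k. f (enum k)) has_sum infsum (\<lambda>k. f (enum k)) UNIV) UNIV"
      by (rule has_sum_infsum) (simp add: nonneg_summable_on_complete)
    from has_sum_imp_sums[OF this] show ?thesis by (simp add: sums_iff)
  qed
  finally show ?thesis .
qed

section \<open>Cubes of the index set and their dilates under an A1 weight\<close>

lemma cube_of_eq_dy:
  fixes \<omega> :: "'n::finite windex"
  assumes "\<omega> \<in> Omega" shows "cube_of \<omega> = dy (lev \<omega>, snd (snd \<omega>))"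
proof -
  have "0 \<le> fst (snd \<omega>)" using assms unfolding Omega_def dyadic_zero_def dyadic_plus_def by auto
  then obtain j :: nat where j: "fst (snd \<omega>) = int j" using nonneg_int_cases by blast
  have p: "(2::real) powi (- int j) = 1 / 2 ^ j" by (simp add: power_int_minus divide_inverse)
  have l: "lev \<omega> = j" using j by simp
  have "(1 / 2 ^ j * real_of_int k \<le> y \<and> y < 1 / 2 ^ j * (real_of_int k + 1)) = (\<lfloor>2 ^ j * y\<rfloor> = k)" for k y
    by (simp add: floor_eq_iff pos_divide_le_eq pos_less_divide_eq mult.commute)
  thus ?thesis unfolding cube_of_def dyadic_cube_def dy_def case_prod_beta j l p by simp
qed

lemma cube_vol_eq:
  fixes \<omega> :: "'n::finite windex"
  assumes "\<omega> \<in> Omega" shows "cube_vol \<omega> = (1 / 2 ^ lev \<omega>) ^ CARD('n)"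
proof -
  have "emeasure lborel (dy (lev \<omega>, snd (snd \<omega>))) = ennreal ((1 / 2 ^ lev \<omega>) ^ CARD('n))"
    by (simp only: emeasure_dy fst_conv power_one_over)
  hence "measure lborel (dy (lev \<omega>, snd (snd \<omega>))) = (1 / 2 ^ lev \<omega>) ^ CARD('n)"
    by (simp add: measure_def)
  thus ?thesis unfolding cube_vol_def cube_of_eq_dy[OF assms] by simp
qed

lemma dy_subset_dilated_cube: "dy P \<subseteq> dilated_cube R P"
proof
  fix x assume x: "x \<in> dy P"
  have "(real_of_int (snd P $ i) - real R) / 2 ^ fst P \<le> x $ i \<and> x $ i \<le> (real_of_int (snd P $ i) + real R + 1) / 2 ^ fst P" for i
  proof -
    have "\<lfloor>2 ^ fst P * x $ i\<rfloor> = snd P $ i" using x unfolding dy_def by simp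
    hence "real_of_int (snd P $ i) \<le> 2 ^ fst P * x $ i" "2 ^ fst P * x $ i < real_of_int (snd P $ i) + 1" by linarith+
    thus ?thesis by (simp add: pos_divide_le_eq pos_le_divide_eq mult.commute)
  qed
  thus "x \<in> dilated_cube R P" unfolding dilated_cube_def by (simp add: mem_box_cart)
qed

lemma dilated_cube_as_cube:
  fixes P :: "nat \<times> (int^'n::finite)"
  shows "dilated_cube R P = cbox (\<chi> i. (real_of_int (snd P $ i) - real R) / 2 ^ fst P)
    ((\<chi> i. (real_of_int (snd P $ i) - real R) / 2 ^ fst P) + ((2 * real R + 1) / 2 ^ fst P) *\<^sub>R (\<chi> i. 1))"
  unfolding dilated_cube_def by (rule arg_cong2[where f=cbox]) (auto simp: vec_eq_iff field_simps)

lemma compact_dilated_cube: "compact (dilated_cube R P)"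
  unfolding dilated_cube_def by (rule compact_cbox)

lemma dilated_cube_AE:
  fixes \<upsilon> :: "real^'n::finite \<Rightarrow> real"
  assumes A1: "A1_weight \<upsilon>"
  shows "AE x in lebesgue. x \<in> dilated_cube R P \<longrightarrow>
     wgt \<upsilon> (dilated_cube R P) \<le> A1_real \<upsilon> * ((2 * real R + 1) / 2 ^ fst P) ^ CARD('n) * \<upsilon> x"
  by (rule A1_AE_real[OF A1 _ dilated_cube_as_cube]) simp

text \<open>Integrate the pointwise A1 bound of the dilated cube over the small cube. The constant
  is linear in the A1 constant, and this is the factor that appears in
  \<open>strong_bound\<close>.\<close>

lemma doubling:
  fixes \<upsilon> :: "real^'n::finite \<Rightarrow> real" and P :: "nat \<times> (int^'n)"
  assumes A1: "A1_weight \<upsilon>"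
  shows "weight_measure \<upsilon> (dilated_cube R P) \<le> ennreal (A1_real \<upsilon> * (2 * real R + 1) ^ CARD('n)) * weight_measure \<upsilon> (dy P)"
proof -
  define W where "W = wgt \<upsilon> (dilated_cube R P)"
  define r where "r = (2 * real R + 1) / 2 ^ fst P"
  have v: "\<upsilon> x \<ge> 0" for x using A1 unfolding A1_weight_def by blast
  have Apos: "A1_real \<upsilon> \<ge> 0" unfolding A1_real_def by simp
  have m [measurable]: "\<upsilon> \<in> borel_measurable lebesgue" by (rule A1_weight_measurable[OF A1])
  have [measurable]: "dy P \<in> sets lebesgue" by simp
  have vE: "(\<lambda>x. ennreal (\<upsilon> x) * indicator (dy P) x) \<in> borel_measurable lebesgue"
    by (rule borel_measurable_times_ennreal[OF measurable_compose[OF m measurable_ennreal] borel_measurable_indicator]) simp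
  have W0: "W \<ge> 0" unfolding W_def by (rule wgt_nonneg)
  have "ennreal (W * side P ^ CARD('n)) = (\<integral>\<^sup>+x. ennreal W * indicator (dy P) x \<partial>lebesgue)"
    using W0 by (subst nn_integral_cmult_indicator) (auto simp: emeasure_dy ennreal_mult simp del: ennreal_power)
  also have "\<dots> \<le> (\<integral>\<^sup>+x. ennreal (A1_real \<upsilon> * r ^ CARD('n)) * (ennreal (\<upsilon> x) * indicator (dy P) x) \<partial>lebesgue)"
  proof (rule nn_integral_mono_AE, use dilated_cube_AE[OF A1, of R P] in eventually_elim)
    case (elim x)
    show ?case
    proof (cases "x \<in> dy P")
      case True
      hence "W \<le> A1_real \<upsilon> * r ^ CARD('n) * \<upsilon> x"
        using elim dy_subset_dilated_cube[of P R] unfolding W_def r_def by blast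
      hence "ennreal W \<le> ennreal (A1_real \<upsilon> * r ^ CARD('n) * \<upsilon> x)" by (rule ennreal_leI)
      also have "\<dots> = ennreal (A1_real \<upsilon> * r ^ CARD('n)) * ennreal (\<upsilon> x)"
        using Apos v unfolding r_def by (intro ennreal_mult) auto
      finally show ?thesis using True by simp
    qed simp
  qed
  also have "\<dots> = ennreal (A1_real \<upsilon> * r ^ CARD('n)) * weight_measure \<upsilon> (dy P)"
    unfolding weight_measure_def by (rule nn_integral_cmult) (simp add: vE)
  finally have X: "ennreal (W * side P ^ CARD('n)) \<le> ennreal (A1_real \<upsilon> * r ^ CARD('n)) * weight_measure \<upsilon> (dy P)" .
  have s: "side P ^ CARD('n) > 0" by simp
  have r: "A1_real \<upsilon> * r ^ CARD('n) = side P ^ CARD('n) * (A1_real \<upsilon> * (2 * real R + 1) ^ CARD('n))"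
  proof -
    have "r = side P * (2 * real R + 1)" unfolding r_def by (simp add: power_one_over)
    thus ?thesis by (simp only: power_mult_distrib mult.left_commute)
  qed
  have "ennreal (side P ^ CARD('n)) * ennreal W \<le> ennreal (side P ^ CARD('n)) * (ennreal (A1_real \<upsilon> * (2 * real R + 1) ^ CARD('n)) * weight_measure \<upsilon> (dy P))"
  proof -
    have "ennreal (W * side P ^ CARD('n)) = ennreal (side P ^ CARD('n)) * ennreal W"
      using W0 by (simp add: ennreal_mult mult.commute del: ennreal_power)
    moreover have "ennreal (A1_real \<upsilon> * r ^ CARD('n)) = ennreal (side P ^ CARD('n)) * ennreal (A1_real \<upsilon> * (2 * real R + 1) ^ CARD('n))"
      unfolding r using Apos by (intro ennreal_mult) auto
    ultimately show ?thesis using X by (simp only: mult.assoc)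
  qed
  hence "ennreal W \<le> ennreal (A1_real \<upsilon> * (2 * real R + 1) ^ CARD('n)) * weight_measure \<upsilon> (dy P)"
    using s by (subst (asm) ennreal_mult_le_mult_iff) (auto simp del: ennreal_power)
  thus ?thesis unfolding W_def using wgt[OF A1 compact_dilated_cube, of R P] by simp
qed

text \<open>The pairings with all bumps are dominated termwise, so \<open>domination\<close> gives
  |u| <= sum of \<open>d k * \<bar>\<psi> k x\<bar>\<close> almost everywhere. Integrating this
  against the weight bounds each term by the mass of its support.\<close>

lemma dominated_by_series:
  fixes \<upsilon> :: "real^'n::finite \<Rightarrow> real" and u :: "real^'n \<Rightarrow> complex" and \<psi> :: "nat \<Rightarrow> real^'n \<Rightarrow> real"
  assumes A1: "A1_weight \<upsilon>" and um [measurable]: "u \<in> borel_measurable lebesgue" and ul: "locally_integrable u"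
    and \<psi> [measurable]: "\<And>k. \<psi> k \<in> borel_measurable borel" and \<psi>B: "\<And>k x. \<bar>\<psi> k x\<bar> \<le> B" and B: "B > 0"
    and Q: "\<And>k. compact (Q k)" and supp: "\<And>k x. \<psi> k x \<noteq> 0 \<Longrightarrow> x \<in> Q k" and d: "\<And>k. d k \<ge> 0"
    and series: "\<And>a b c. c > 0 \<Longrightarrow> \<exists>t. t sums (LINT x|lebesgue. u x * of_real (bump c a b x)) \<and>
       (\<forall>k. norm (t k) \<le> d k * (LINT x|lborel. \<bar>\<psi> k x\<bar> * bump c a b x))"
  shows "L1_norm \<upsilon> u \<le> (\<Sum>k. ennreal (d k * B) * weight_measure \<upsilon> (Q k))"
proof (cases "(\<Sum>k. ennreal (d k * B) * weight_measure \<upsilon> (Q k)) = \<infinity>")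
  case False
  have v: "\<upsilon> x \<ge> 0" for x using A1 unfolding A1_weight_def by blast
  have vm [measurable]: "\<upsilon> \<in> borel_measurable lebesgue" by (rule A1_weight_measurable[OF A1])
  \<comment> \<open>G takes values in [0, infinity]. Its weighted integral is finite in the case at
    hand, and the lower bound on A1 weights turns this into local integrability, as
    \<open>domination\<close> requires.\<close>
  define G where "G x = (\<Sum>k. ennreal (d k * \<bar>\<psi> k x\<bar>))" for x
  have Gm [measurable]: "G \<in> borel_measurable borel" unfolding G_def by measurable
  have GL [measurable]: "G \<in> borel_measurable lebesgue" by (rule measurable_completion) simp
  have \<psi>L [measurable]: "\<psi> k \<in> borel_measurable lebesgue" for k by (rule measurable_completion) simp
  have [measurable]: "Q k \<in> sets lebesgue" for k using Q[of k] by (simp add: borel_compact)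
  have Gv: "(\<integral>\<^sup>+x. G x * ennreal (\<upsilon> x) \<partial>lebesgue) \<le> (\<Sum>k. ennreal (d k * B) * weight_measure \<upsilon> (Q k))"
  proof -
    have "(\<integral>\<^sup>+x. G x * ennreal (\<upsilon> x) \<partial>lebesgue) = (\<integral>\<^sup>+x. (\<Sum>k. ennreal (d k * \<bar>\<psi> k x\<bar>) * ennreal (\<upsilon> x)) \<partial>lebesgue)"
      unfolding G_def by (simp add: ennreal_suminf_multc)
    also have "\<dots> = (\<Sum>k. \<integral>\<^sup>+x. ennreal (d k * \<bar>\<psi> k x\<bar>) * ennreal (\<upsilon> x) \<partial>lebesgue)"
      by (rule nn_integral_suminf)
         (intro borel_measurable_times_ennreal measurable_compose[OF _ measurable_ennreal] vm
            borel_measurable_times borel_measurable_const borel_measurable_abs \<psi>L)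
    also have "\<dots> \<le> (\<Sum>k. ennreal (d k * B) * weight_measure \<upsilon> (Q k))"
    proof (rule suminf_le)
      fix k
      have "(\<integral>\<^sup>+x. ennreal (d k * \<bar>\<psi> k x\<bar>) * ennreal (\<upsilon> x) \<partial>lebesgue) \<le> (\<integral>\<^sup>+x. ennreal (d k * B) * (ennreal (\<upsilon> x) * indicator (Q k) x) \<partial>lebesgue)"
      proof (intro nn_integral_mono)
        fix x
        show "ennreal (d k * \<bar>\<psi> k x\<bar>) * ennreal (\<upsilon> x) \<le> ennreal (d k * B) * (ennreal (\<upsilon> x) * indicator (Q k) x)"
        proof (cases "\<psi> k x = 0")
          case False
          have "d k * \<bar>\<psi> k x\<bar> \<le> d k * B" using \<psi>B d by (intro mult_left_mono) auto
          thus ?thesis using supp[OF False] by (simp add: mult_right_mono ennreal_leI)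
        qed simp
      qed
      also have "\<dots> = ennreal (d k * B) * weight_measure \<upsilon> (Q k)"
        unfolding weight_measure_def
          by (intro nn_integral_cmult borel_measurable_times_ennreal measurable_compose[OF _ measurable_ennreal] vm
            borel_measurable_indicator) simp
      finally show "(\<integral>\<^sup>+x. ennreal (d k * \<bar>\<psi> k x\<bar>) * ennreal (\<upsilon> x) \<partial>lebesgue) \<le> ennreal (d k * B) * weight_measure \<upsilon> (Q k)" .
    qed auto
    finally show ?thesis .
  qed
  moreover have "(\<Sum>k. ennreal (d k * B) * weight_measure \<upsilon> (Q k)) < \<infinity>"
    using False unfolding infinity_ennreal_def less_top .
  ultimately have Gfin: "(\<integral>\<^sup>+x. G x * ennreal (\<upsilon> x) \<partial>lebesgue) < \<infinity>" by (rule le_less_trans)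
  have "(\<integral>\<^sup>+x. G x * ennreal (1 / (1 + norm x) ^ CARD('n)) \<partial>lebesgue) < \<infinity>"
    by (rule decay_integrable_of_weighted[OF A1 GL Gfin])
  hence dec: "(\<integral>\<^sup>+x. G x * ennreal (1 / (1 + norm x) ^ CARD('n)) \<partial>lborel) < \<infinity>"
    by (subst (asm) nn_integral_completion) auto
  have locG: "(\<integral>\<^sup>+x. indicator K x * G x \<partial>lborel) < \<infinity>" if "compact K" for K
    by (rule locally_finite_of_decay[OF _ _ _ dec that]) auto
  have G_AE: "AE x in lborel. G x < \<infinity>"
  proof -
    have [measurable]: "cball (0::real^'n) (real k) \<in> sets borel" for k by simp
    have "AE x in lborel. \<forall>k::nat. indicator (cball 0 (real k)) x * G x \<noteq> \<infinity>"
      unfolding AE_all_countable using locG by (intro allI nn_integral_noteq_infinite) (auto simp: less_top)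
    thus ?thesis
    proof (rule eventually_mono)
      fix x assume *: "\<forall>k::nat. indicator (cball 0 (real k)) x * G x \<noteq> \<infinity>"
      obtain k :: nat where "norm x \<le> real k" using real_arch_simple by blast
      thus "G x < \<infinity>" using *[rule_format, of k] by (auto simp: less_top)
    qed
  qed
  define g where "g x = enn2real (G x)" for x
  have [measurable]: "g \<in> borel_measurable borel" unfolding g_def by measurable
  have lg: "locally_integrable g"
  proof (rule locally_integrable_borelI)
    fix K :: "(real^'n) set" assume K: "compact K"
    have "(\<integral>\<^sup>+x. indicator K x * ennreal (norm (g x)) \<partial>lborel) \<le> (\<integral>\<^sup>+x. indicator K x * G x \<partial>lborel)"
      unfolding g_def by (intro nn_integral_mono mult_left_mono) (auto simp: ennreal_enn2real_if)
    thus "(\<integral>\<^sup>+x. indicator K x * ennreal (norm (g x)) \<partial>lborel) < \<infinity>" using locG[OF K] by (rule le_less_trans)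
  qed measurable
  have "AE x in lebesgue. norm (u x) \<le> g x"
  proof (rule domination[OF ul lg])
    fix a b :: "real^'n" and c :: real assume c: "c > 0"
    from series[OF c, of a b] obtain t where t: "t sums (LINT x|lebesgue. u x * of_real (bump c a b x))"
      "\<And>k. norm (t k) \<le> d k * (LINT x|lborel. \<bar>\<psi> k x\<bar> * bump c a b x)" by blast
    have "integrable lebesgue (\<lambda>x. g x * bump c a b x)"
      by (rule locally_integrable_mult_bounded[OF lg compact_cbox[of a b], where B=1])
         (auto intro!: measurable_completion simp: bump_bounds[OF c] bump_eq_0 abs_of_nonneg)
    hence gi: "integrable lborel (\<lambda>x. g x * bump c a b x)" by (subst (asm) integrable_completion) auto
    have term_k: "ennreal (norm (t k)) \<le> (\<integral>\<^sup>+x. ennreal (d k * \<bar>\<psi> k x\<bar>) * ennreal (bump c a b x) \<partial>lborel)" for k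
    proof -
      have fin: "(\<integral>\<^sup>+x. indicator (cbox a b) x * ennreal (norm (\<bar>\<psi> k x\<bar>)) \<partial>lborel) < \<infinity>"
      proof -
        have "(\<integral>\<^sup>+x. indicator (cbox a b) x * ennreal (norm (\<bar>\<psi> k x\<bar>)) \<partial>lborel) \<le> (\<integral>\<^sup>+x. ennreal B * indicator (cbox a b) x \<partial>lborel)"
          using \<psi>B by (intro nn_integral_mono) (auto simp: indicator_def ennreal_leI)
        also have "\<dots> < \<infinity>" by (subst nn_integral_cmult_indicator) (auto simp: ennreal_mult_less_top emeasure_lborel_cbox_eq)
        finally show ?thesis .
      qed
      have i: "integrable lborel (\<lambda>x. \<bar>\<psi> k x\<bar> * bump c a b x)"
        by (rule integrable_mult_compact_support[OF _ _ compact_cbox[of a b] _ _ fin, where B=1])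
           (auto simp: bump_bounds[OF c] bump_eq_0 abs_of_nonneg)
      have "ennreal (norm (t k)) \<le> ennreal (LINT x|lborel. d k * (\<bar>\<psi> k x\<bar> * bump c a b x))"
        using t(2)[of k] by (intro ennreal_leI) simp
      also have "\<dots> = (\<integral>\<^sup>+x. ennreal (d k * (\<bar>\<psi> k x\<bar> * bump c a b x)) \<partial>lborel)"
        by (rule nn_integral_eq_integral[symmetric, OF integrable_mult_right[OF i]])
           (auto simp: d bump_bounds[OF c])
      also have "\<dots> = (\<integral>\<^sup>+x. ennreal (d k * \<bar>\<psi> k x\<bar>) * ennreal (bump c a b x) \<partial>lborel)"
        by (intro nn_integral_cong) (simp add: d bump_bounds[OF c] ennreal_mult mult.assoc)
      finally show ?thesis .
    qed
    have "ennreal (norm (\<Sum>k<K. t k)) \<le> ennreal (LINT x|lborel. g x * bump c a b x)" for K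
    proof -
      have "ennreal (norm (\<Sum>k<K. t k)) \<le> (\<Sum>k<K. ennreal (norm (t k)))"
        by (subst sum_ennreal) (auto intro!: ennreal_leI norm_sum)
      also have "\<dots> \<le> (\<Sum>k<K. \<integral>\<^sup>+x. ennreal (d k * \<bar>\<psi> k x\<bar>) * ennreal (bump c a b x) \<partial>lborel)"
        by (intro sum_mono term_k)
      also have "\<dots> = (\<integral>\<^sup>+x. (\<Sum>k<K. ennreal (d k * \<bar>\<psi> k x\<bar>) * ennreal (bump c a b x)) \<partial>lborel)"
        by (rule nn_integral_sum[symmetric]) measurable
      also have "\<dots> \<le> (\<integral>\<^sup>+x. G x * ennreal (bump c a b x) \<partial>lborel)"
        unfolding G_def sum_distrib_right[symmetric] by (intro nn_integral_mono mult_right_mono sum_le_suminf) auto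
      also have "\<dots> = (\<integral>\<^sup>+x. ennreal (g x * bump c a b x) \<partial>lborel)"
        by (rule nn_integral_cong_AE, use G_AE in eventually_elim)
           (simp add: g_def ennreal_mult bump_bounds[OF c])
      also have "\<dots> = ennreal (LINT x|lborel. g x * bump c a b x)"
        by (rule nn_integral_eq_integral[OF gi]) (simp add: g_def bump_bounds[OF c])
      finally show ?thesis .
    qed
    moreover have "0 \<le> (LINT x|lborel. g x * bump c a b x)"
      by (intro integral_nonneg_AE) (simp add: g_def bump_bounds[OF c])
    ultimately have part: "norm (\<Sum>k<K. t k) \<le> (LINT x|lborel. g x * bump c a b x)" for K
      by (subst (asm) ennreal_le_iff) auto
    have "(\<lambda>K. norm (\<Sum>k<K. t k)) \<longlonglongrightarrow> norm (LINT x|lebesgue. u x * of_real (bump c a b x))"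
      using t(1) unfolding sums_def by (rule tendsto_norm)
    hence "norm (LINT x|lebesgue. u x * of_real (bump c a b x)) \<le> (LINT x|lborel. g x * bump c a b x)"
      by (rule LIMSEQ_le_const2) (use part in blast)
    thus "norm (LINT x|lebesgue. u x * of_real (bump c a b x)) \<le> (LINT x|lebesgue. g x * bump c a b x)"
      by (simp add: integral_completion)
  qed
  moreover have "AE x in lebesgue. G x < \<infinity>" using G_AE by (simp add: AE_completion)
  ultimately have "AE x in lebesgue. ennreal (norm (u x) * \<upsilon> x) \<le> G x * ennreal (\<upsilon> x)"
  proof eventually_elim
    case (elim x)
    have "ennreal (norm (u x)) \<le> ennreal (g x)" using elim(1) by (rule ennreal_leI)
    also have "\<dots> = G x" unfolding g_def using elim(2) by simp
    finally show ?case using v by (simp add: ennreal_mult mult_right_mono)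
  qed
  hence "L1_norm \<upsilon> u \<le> (\<integral>\<^sup>+x. G x * ennreal (\<upsilon> x) \<partial>lebesgue)"
    unfolding L1_norm_def by (rule nn_integral_mono_AE)
  thus ?thesis using Gv by (rule order_trans)
qed simp

section \<open>Bounding the Sobolev norm by the coefficients\<close>

text \<open>Weighted functions are only Lebesgue measurable, whereas Fubini and translations are
  used for \<open>lborel\<close>. The passage to Borel representatives is made once, here.\<close>

lemma ex_borel_representative:
  fixes f :: "'a::euclidean_space \<Rightarrow> complex"
  assumes "f \<in> borel_measurable lebesgue"
  shows "\<exists>f0\<in>borel_measurable borel. AE x in lebesgue. f x = f0 x"
proof -
  have re: "(\<lambda>x. Re (f x)) \<in> borel_measurable (completion lborel)" and im: "(\<lambda>x. Im (f x)) \<in> borel_measurable (completion lborel)"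
    using assms by measurable
  obtain p where p: "p \<in> borel_measurable lborel" "AE x in lborel. Re (f x) = p x"
    using completion_ex_borel_measurable_real[OF re] by blast
  obtain q where q: "q \<in> borel_measurable lborel" "AE x in lborel. Im (f x) = q x"
    using completion_ex_borel_measurable_real[OF im] by blast
  have [measurable]: "p \<in> borel_measurable borel" "q \<in> borel_measurable borel" using p(1) q(1) by auto
  have C: "(\<lambda>x. Complex (p x) (q x)) \<in> borel_measurable borel" proof -
    have "(\<lambda>x. complex_of_real (p x) + \<i> * complex_of_real (q x)) \<in> borel_measurable borel" by measurable
    moreover have "(\<lambda>x. Complex (p x) (q x)) = (\<lambda>x. complex_of_real (p x) + \<i> * complex_of_real (q x))"
      by (auto simp: complex_eq_iff)
    ultimately show ?thesis by simp
  qed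
  have "AE x in lborel. f x = Complex (p x) (q x)"
    using p(2) q(2) by eventually_elim (simp add: complex_eq_iff)
  hence "AE x in lebesgue. f x = Complex (p x) (q x)" by (rule AE_completion)
  thus ?thesis by (intro bexI[of _ "\<lambda>x. Complex (p x) (q x)"] C)
qed

lemma LINT_lebesgue_representative:
  fixes f :: "'a::euclidean_space \<Rightarrow> complex"
  assumes f: "f \<in> borel_measurable lebesgue" and f0: "f0 \<in> borel_measurable borel"
    and AE: "AE x in lebesgue. f x = f0 x" and g: "g \<in> borel_measurable borel"
  shows "(LINT x|lebesgue. f x * g x) = (LINT x|lborel. f0 x * g x)"
proof -
  have g': "g \<in> borel_measurable lebesgue" and f0': "f0 \<in> borel_measurable lebesgue"
    using f0 g by (auto intro: measurable_completion)
  have "(LINT x|lebesgue. f x * g x) = (LINT x|lebesgue. f0 x * g x)"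
    by (rule Bochner_Integration.integral_cong_AE)
       (use AE in \<open>auto intro!: borel_measurable_times f f0' g'\<close>)
  also have "\<dots> = (LINT x|lborel. f0 x * g x)"
    by (rule integral_completion) (use f0 g in \<open>auto intro!: borel_measurable_times\<close>)
  finally show ?thesis .
qed

lemma decay_of_representative:
  fixes \<upsilon> :: "real^'n::finite \<Rightarrow> real" and f :: "real^'n \<Rightarrow> complex"
  assumes A1: "A1_weight \<upsilon>" and f: "f \<in> L1_space \<upsilon>" and f0 [measurable]: "f0 \<in> borel_measurable borel"
    and AE: "AE x in lebesgue. f x = f0 x"
  shows "(\<integral>\<^sup>+x. ennreal (norm (f0 x) / (1 + norm x) ^ CARD('n)) \<partial>lborel) < \<infinity>"
proof -
  have v: "\<upsilon> x \<ge> 0" for x using A1 unfolding A1_weight_def by blast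
  have m: "(\<lambda>x. ennreal (norm (f0 x))) \<in> borel_measurable lebesgue" by (rule measurable_completion) simp
  have "(\<integral>\<^sup>+x. ennreal (norm (f0 x)) * ennreal (\<upsilon> x) \<partial>lebesgue) = L1_norm \<upsilon> f"
    unfolding L1_norm_def
    by (rule nn_integral_cong_AE, use AE in eventually_elim) (simp add: ennreal_mult v)
  hence "(\<integral>\<^sup>+x. ennreal (norm (f0 x)) * ennreal (\<upsilon> x) \<partial>lebesgue) < \<infinity>"
    using f unfolding L1_space_def by simp
  from decay_integrable_of_weighted[OF A1 m this]
  have "(\<integral>\<^sup>+x. ennreal (norm (f0 x)) * ennreal (1 / (1 + norm x) ^ CARD('n)) \<partial>lborel) < \<infinity>"
    by (subst (asm) nn_integral_completion) auto
  also have "(\<integral>\<^sup>+x. ennreal (norm (f0 x)) * ennreal (1 / (1 + norm x) ^ CARD('n)) \<partial>lborel)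
    = (\<integral>\<^sup>+x. ennreal (norm (f0 x) / (1 + norm x) ^ CARD('n)) \<partial>lborel)"
    by (intro nn_integral_cong) (simp add: ennreal_mult[symmetric])
  finally show ?thesis .
qed

lemma weak_gradient_properties:
  assumes "f \<in> W11_space \<upsilon>"
  shows "has_weak_gradient f (weak_gradient f)" "weak_gradient f \<in> L1_space \<upsilon>" "f \<in> L1_space \<upsilon>"
    "f \<in> borel_measurable lebesgue" "weak_gradient f \<in> borel_measurable lebesgue"
proof -
  obtain G where "has_weak_gradient f G" using assms unfolding W11_space_def by blast
  thus "has_weak_gradient f (weak_gradient f)" unfolding weak_gradient_def by (rule someI[of "has_weak_gradient f"])
qed (use assms in \<open>auto simp: W11_space_def L1_space_def\<close>)

lemma locally_integrable_component:
  fixes G :: "real^'n::finite \<Rightarrow> complex^'n"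
  assumes "locally_integrable G" shows "locally_integrable (\<lambda>x. G x $ i)"
  unfolding locally_integrable_def
proof (intro allI impI)
  fix K :: "(real^'n) set" assume "compact K"
  hence "integrable lebesgue (\<lambda>x. indicator K x *\<^sub>R G x)"
    using assms unfolding locally_integrable_def set_integrable_def by blast
  hence "integrable lebesgue (\<lambda>x. (indicator K x *\<^sub>R G x) $ i)"
    by (rule integrable_bounded_linear[OF bounded_linear_vec_nth])
  thus "set_integrable lebesgue K (\<lambda>x. G x $ i)" unfolding set_integrable_def by simp
qed

text \<open>\<open>DT e i\<close> is the i-th partial derivative of \<open>T e\<close>, given
  through restrictions to coordinate lines and sharing the bound and support box of
  \<open>T\<close>.\<close>

locale wavelet_c1 = wavelet_basis T R B
  for T :: "bool^'n \<Rightarrow> real^'n::finite \<Rightarrow> real" and R :: nat and B :: real +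
  fixes DT :: "bool^'n \<Rightarrow> 'n \<Rightarrow> real^'n \<Rightarrow> real"
  assumes T_cont: "\<And>e. continuous_on UNIV (T e)" and DT_cont: "\<And>e i. continuous_on UNIV (DT e i)"
    and DT_bound: "\<And>e i x. \<bar>DT e i x\<bar> \<le> B"
    and DT_supp: "\<And>e i x l. DT e i x \<noteq> 0 \<Longrightarrow> - real R \<le> x $ l \<and> x $ l < real R"
    and T_line: "\<And>e i x s. ((\<lambda>s. T e (x + s *\<^sub>R axis i 1)) has_real_derivative DT e i (x + s *\<^sub>R axis i 1)) (at s)"
begin

definition datom :: "'n windex \<Rightarrow> 'n \<Rightarrow> real^'n \<Rightarrow> real" where
  "datom \<omega> i x = DT (fst \<omega>) i (pos \<omega> x)"

lemma atom_cont: "continuous_on UNIV (atom \<omega>)"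
  unfolding atom_def by (intro continuous_on_compose2[OF T_cont] continuous_intros) auto

lemma datom_cont: "continuous_on UNIV (datom \<omega> i)"
  unfolding datom_def by (intro continuous_on_compose2[OF DT_cont] continuous_intros) auto

lemma datom_meas [measurable]: "datom \<omega> i \<in> borel_measurable borel"
  by (rule borel_measurable_continuous_onI[OF datom_cont])

lemma datom_bound: "\<bar>datom \<omega> i x\<bar> \<le> B"
  unfolding datom_def by (rule DT_bound)

lemma datom_supp:
  assumes "datom \<omega> i x \<noteq> 0" shows "x \<in> cube \<omega>"
proof -
  have "real_of_int (snd (snd \<omega>) $ l) - real R \<le> 2 ^ lev \<omega> * x $ l \<and> 2 ^ lev \<omega> * x $ l \<le> real_of_int (snd (snd \<omega>) $ l) + real R + 1" for l
    using DT_supp[OF assms[unfolded datom_def], of l] by simp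
  thus ?thesis unfolding dilated_cube_def by (simp add: mem_box_cart pos_divide_le_eq pos_le_divide_eq mult.commute)
qed

lemma atom_line:
  "((\<lambda>s. atom \<omega> (x + s *\<^sub>R axis i 1)) has_real_derivative 2 ^ lev \<omega> * datom \<omega> i (x + s *\<^sub>R axis i 1)) (at s)"
proof -
  have e: "pos \<omega> (x + s *\<^sub>R axis i 1) = pos \<omega> x + (2 ^ lev \<omega> * s) *\<^sub>R axis i 1" for s
    by (simp add: algebra_simps)
  have "((\<lambda>s. T (fst \<omega>) (pos \<omega> x + (2 ^ lev \<omega> * s) *\<^sub>R axis i 1)) has_real_derivative
     DT (fst \<omega>) i (pos \<omega> x + (2 ^ lev \<omega> * s) *\<^sub>R axis i 1) * 2 ^ lev \<omega>) (at s)"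
    by (rule DERIV_chain2[OF T_line]) (auto intro!: derivative_eq_intros)
  thus ?thesis unfolding atom_def datom_def e by (simp add: mult.commute)
qed

lemma integrable_schwartz_datom:
  assumes "g \<in> schwartz" shows "integrable lborel (\<lambda>x. g x * complex_of_real (datom \<omega> i x))"
proof (rule integrable_mult_compact_support[OF _ _ compact_cube[of \<omega>], where B=B])
  show "g \<in> borel_measurable borel" by (rule borel_measurable_continuous_onI[OF schwartz_continuous[OF assms]])
  show "(\<integral>\<^sup>+x. indicator (cube \<omega>) x * ennreal (norm (g x)) \<partial>lborel) < \<infinity>"
    by (rule continuous_locally_finite[OF schwartz_continuous[OF assms] compact_cube])
  show "complex_of_real (datom \<omega> i x) = 0" if "x \<notin> cube \<omega>" for x using that datom_supp[of \<omega> i x] by auto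
  show "norm (complex_of_real (datom \<omega> i x)) \<le> B" for x using datom_bound[of \<omega> i x] by simp
qed simp

lemma integrable_schwartz_atom:
  assumes "g \<in> schwartz" shows "integrable lborel (\<lambda>x. g x * complex_of_real (atom \<omega> x))"
  by (rule integrable_atom_mult[OF borel_measurable_continuous_onI[OF schwartz_continuous[OF assms]]])
     (rule continuous_locally_finite[OF schwartz_continuous[OF assms]])

text \<open>Integration by parts: the integral of the partial derivative of g times the atom
  vanishes. Differentiating the atom brings out 2^j.\<close>

lemma coef_partial:
  assumes g: "g \<in> schwartz"
  shows "coef (partial_deriv i g) \<omega> = - (of_real (2 ^ lev \<omega>) * (LINT x|lborel. g x * of_real (datom \<omega> i x)))"
proof -
  define H where "H x = g x * complex_of_real (atom \<omega> x)" for x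
  define D where "D x = partial_deriv i g x * complex_of_real (atom \<omega> x)
    + of_real (2 ^ lev \<omega>) * (g x * complex_of_real (datom \<omega> i x))" for x
  have p: "partial_deriv i g \<in> schwartz" by (rule schwartz_partial[OF g])
  have i1: "integrable lborel (\<lambda>x. partial_deriv i g x * complex_of_real (atom \<omega> x))"
    by (rule integrable_schwartz_atom[OF p])
  have i2: "integrable lborel (\<lambda>x. complex_of_real (2 ^ lev \<omega>) * (g x * complex_of_real (datom \<omega> i x)))"
    by (rule integrable_mult_right[OF integrable_schwartz_datom[OF g]])
  have "(LINT x|lborel. D x) = 0"
  proof (rule integral_line_derivative_zero[where H=H and e="axis i 1"])
    show "continuous_on UNIV D" unfolding D_def
      by (intro continuous_intros schwartz_continuous g p atom_cont datom_cont)
    show "integrable lborel H" unfolding H_def by (rule integrable_schwartz_atom[OF g])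
    show "integrable lborel D" unfolding D_def by (rule Bochner_Integration.integrable_add[OF i1 i2])
    fix x s
    have 1: "((\<lambda>s. g (x + s *\<^sub>R axis i 1)) has_vector_derivative partial_deriv i g (x + s *\<^sub>R axis i 1)) (at s)"
      by (rule partial_deriv_line[OF schwartz_differentiable[OF g]])
    have 2: "((\<lambda>s. complex_of_real (atom \<omega> (x + s *\<^sub>R axis i 1))) has_vector_derivative
        complex_of_real (2 ^ lev \<omega> * datom \<omega> i (x + s *\<^sub>R axis i 1))) (at s)"
      by (rule has_vector_derivative_of_real[OF atom_line])
    show "((\<lambda>s. H (x + s *\<^sub>R axis i 1)) has_vector_derivative D (x + s *\<^sub>R axis i 1)) (at s)"
      using has_vector_derivative_mult[OF 1 2] unfolding H_def D_def by (simp add: algebra_simps)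
  qed
  hence "(LINT x|lborel. partial_deriv i g x * complex_of_real (atom \<omega> x))
    + (LINT x|lborel. complex_of_real (2 ^ lev \<omega>) * (g x * complex_of_real (datom \<omega> i x))) = 0"
    unfolding D_def by (simp only: Bochner_Integration.integral_add[OF i1 i2])
  thus ?thesis unfolding coef_def by (simp add: add_eq_0_iff)
qed

lemma LINT_wterm:
  "(LINT x|lborel. f x * wterm g \<omega> x) = of_real (2 ^ (lev \<omega> * CARD('n))) * coef f \<omega> * coef g \<omega>"
proof -
  have "(LINT x|lborel. f x * wterm g \<omega> x) = (LINT x|lborel. (of_real (2 ^ (lev \<omega> * CARD('n))) * coef g \<omega>) * (f x * of_real (atom \<omega> x)))"
    unfolding wterm_def by (intro Bochner_Integration.integral_cong) (simp_all add: mult_ac)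
  also have "\<dots> = (of_real (2 ^ (lev \<omega> * CARD('n))) * coef g \<omega>) * coef f \<omega>"
    unfolding coef_def by (rule integral_mult_right_zero)
  finally show ?thesis by (simp add: mult_ac)
qed

text \<open>The coefficient of the theorem: in dimension n the n-normalization has the factor
  2^(jn/n) = 2^j.\<close>

definition wc :: "(real^'n \<Rightarrow> complex) \<Rightarrow> 'n windex \<Rightarrow> complex" where
  "wc f \<omega> = of_real (2 ^ lev \<omega>) * coef f \<omega>"

lemma synthesis:
  assumes A1: "A1_weight \<upsilon>" and f: "f \<in> W11_space \<upsilon>" and f0 [measurable]: "f0 \<in> borel_measurable borel"
    and AE: "AE x in lebesgue. f x = f0 x" and g: "g \<in> schwartz"
  shows "((\<lambda>\<omega>. of_real (2 ^ (lev \<omega> * CARD('n))) * coef f0 \<omega> * coef g \<omega>) has_sum pairing f g) Omega"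
proof -
  have gm: "g \<in> borel_measurable borel" by (rule borel_measurable_continuous_onI[OF schwartz_continuous[OF g]])
  have "pairing f g = (LINT x|lborel. f0 x * g x)"
    unfolding pairing_def by (rule LINT_lebesgue_representative[OF weak_gradient_properties(4)[OF f] f0 AE gm])
  thus ?thesis
    using expansion_has_sum[OF g f0 decay_of_representative[OF A1 weak_gradient_properties(3)[OF f] f0 AE]]
    unfolding LINT_wterm by simp
qed

text \<open>The exponents n and n/(n-1) are conjugate, so the two normalizations multiply to 2^j
  times 2^(j(n-1)) = 2^(jn), the same factor as in the L^2 expansion.\<close>

lemma pairing_synthesis_term:
  assumes g: "g \<in> schwartz"
  shows "pairing (\<lambda>x. wc f0 \<omega> * of_real (2 ^ (lev \<omega> * (CARD('n) - 1)) * atom \<omega> x)) g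
    = of_real (2 ^ (lev \<omega> * CARD('n))) * coef f0 \<omega> * coef g \<omega>"
proof -
  have gm [measurable]: "g \<in> borel_measurable borel" by (rule borel_measurable_continuous_onI[OF schwartz_continuous[OF g]])
  have "CARD('n) \<ge> 1" by (simp add: Suc_leI)
  hence "lev \<omega> + lev \<omega> * (CARD('n) - 1) = lev \<omega> * CARD('n)"
    by (simp add: diff_mult_distrib2)
  hence p: "(2::real) ^ lev \<omega> * 2 ^ (lev \<omega> * (CARD('n) - 1)) = 2 ^ (lev \<omega> * CARD('n))"
    by (metis power_add)
  have "pairing (\<lambda>x. wc f0 \<omega> * of_real (2 ^ (lev \<omega> * (CARD('n) - 1)) * atom \<omega> x)) g
    = (LINT x|lebesgue. (of_real (2 ^ lev \<omega> * 2 ^ (lev \<omega> * (CARD('n) - 1))) * coef f0 \<omega>) * (g x * of_real (atom \<omega> x)))"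
    unfolding pairing_def wc_def by (intro Bochner_Integration.integral_cong) (simp_all add: mult_ac)
  also have "\<dots> = (of_real (2 ^ (lev \<omega> * CARD('n))) * coef f0 \<omega>) * (LINT x|lebesgue. g x * of_real (atom \<omega> x))"
    unfolding p by (rule integral_mult_right_zero)
  also have "(LINT x|lebesgue. g x * of_real (atom \<omega> x)) = coef g \<omega>"
    unfolding coef_def by (rule integral_completion) measurable
  finally show ?thesis .
qed

text \<open>The summand of the strong sequence norm once the powers of |I| have been combined. It no
  longer contains \<beta>.\<close>

definition strong_term :: "(real^'n \<Rightarrow> real) \<Rightarrow> (real^'n \<Rightarrow> complex) \<Rightarrow> 'n windex \<Rightarrow> ennreal" where
  "strong_term \<upsilon> f \<omega> = ennreal (2 ^ (lev \<omega> * CARD('n)) * norm (wc f \<omega>)) * weight_measure \<upsilon> (cube_of \<omega>)"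

text \<open>\<open>dominated_by_series\<close> bounds the norm by masses of dilated cubes, and
  \<open>doubling\<close> returns to the dyadic cubes. It is used for f with the atoms and for each
  gradient component with their derivatives.\<close>

lemma strong_component:
  fixes \<upsilon> :: "real^'n \<Rightarrow> real" and u :: "real^'n \<Rightarrow> complex"
  assumes A1: "A1_weight \<upsilon>" and um: "u \<in> borel_measurable lebesgue" and ul: "locally_integrable u"
    and \<psi>m: "\<And>\<omega>. \<psi> \<omega> \<in> borel_measurable borel" and \<psi>B: "\<And>\<omega> x. \<bar>\<psi> \<omega> x\<bar> \<le> B"
    and supp: "\<And>\<omega> x. \<psi> \<omega> x \<noteq> 0 \<Longrightarrow> x \<in> cube \<omega>"
    and series: "\<And>a b c. c > 0 \<Longrightarrow> \<exists>t. (t has_sum (LINT x|lebesgue. u x * of_real (bump c a b x))) Omega \<and>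
       (\<forall>\<omega>\<in>Omega. norm (t \<omega>) \<le> 2 ^ (lev \<omega> * CARD('n)) * norm (wc f \<omega>) * (LINT x|lborel. \<bar>\<psi> \<omega> x\<bar> * bump c a b x))"
  shows "L1_norm \<upsilon> u \<le> ennreal (B * (2 * real R + 1) ^ CARD('n)) * (A1_const \<upsilon> * infsum (strong_term \<upsilon> f) Omega)"
proof -
  obtain enum where bij: "bij_betw enum (UNIV::nat set) (Omega :: 'n windex set)" using ex_enum_Omega by blast
  have eO: "enum k \<in> Omega" for k using bij by (auto simp: bij_betw_def)
  define d where "d k = 2 ^ (lev (enum k) * CARD('n)) * norm (wc f (enum k))" for k
  have "L1_norm \<upsilon> u \<le> (\<Sum>k. ennreal (d k * B) * weight_measure \<upsilon> (cube (enum k)))"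
  proof (rule dominated_by_series[OF A1 um ul, where \<psi>="\<lambda>k. \<psi> (enum k)"])
    fix a b :: "real^'n" and c :: real assume "c > 0"
    from series[OF this, of a b] obtain t where t: "(t has_sum (LINT x|lebesgue. u x * of_real (bump c a b x))) Omega"
       "\<And>\<omega>. \<omega> \<in> Omega \<Longrightarrow> norm (t \<omega>) \<le> 2 ^ (lev \<omega> * CARD('n)) * norm (wc f \<omega>) * (LINT x|lborel. \<bar>\<psi> \<omega> x\<bar> * bump c a b x)" by blast
    have "((\<lambda>k. t (enum k)) has_sum (LINT x|lebesgue. u x * of_real (bump c a b x))) UNIV"
      using t(1) has_sum_reindex_bij_betw[OF bij, of t] by blast
    hence "(\<lambda>k. t (enum k)) sums (LINT x|lebesgue. u x * of_real (bump c a b x))" by (rule has_sum_imp_sums)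
    thus "\<exists>t. t sums (LINT x|lebesgue. u x * of_real (bump c a b x)) \<and>
       (\<forall>k. norm (t k) \<le> d k * (LINT x|lborel. \<bar>\<psi> (enum k) x\<bar> * bump c a b x))"
      using t(2)[OF eO] unfolding d_def by blast
  qed (use \<psi>m \<psi>B supp B compact_cube in \<open>auto simp: d_def\<close>)
  also have "\<dots> \<le> (\<Sum>k. ennreal (B * (2 * real R + 1) ^ CARD('n)) * A1_const \<upsilon> * strong_term \<upsilon> f (enum k))"
  proof (rule suminf_le)
    fix k
    have Ap: "A1_real \<upsilon> > 0" by (rule A1_lower_bound(1)[OF A1])
    have "weight_measure \<upsilon> (cube (enum k)) \<le> ennreal (A1_real \<upsilon> * (2 * real R + 1) ^ CARD('n)) * weight_measure \<upsilon> (cube_of (enum k))"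
      unfolding cube_of_eq_dy[OF eO] by (rule doubling[OF A1])
    hence "ennreal (d k * B) * weight_measure \<upsilon> (cube (enum k)) \<le> ennreal (d k * B) * (ennreal (A1_real \<upsilon> * (2 * real R + 1) ^ CARD('n)) * weight_measure \<upsilon> (cube_of (enum k)))"
      by (rule mult_left_mono) simp
    also have "\<dots> = ennreal (d k * B * (A1_real \<upsilon> * (2 * real R + 1) ^ CARD('n))) * weight_measure \<upsilon> (cube_of (enum k))"
      using B Ap by (subst mult.assoc[symmetric], subst ennreal_mult[symmetric]) (auto simp: d_def)
    also have "d k * B * (A1_real \<upsilon> * (2 * real R + 1) ^ CARD('n)) = B * (2 * real R + 1) ^ CARD('n) * A1_real \<upsilon> * d k"
      by (simp only: mult_ac)
    also have "ennreal \<dots> = ennreal (B * (2 * real R + 1) ^ CARD('n)) * A1_const \<upsilon> * ennreal (d k)"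
      unfolding A1_real[OF A1] using B Ap by (simp add: ennreal_mult d_def del: ennreal_power)
    finally show "ennreal (d k * B) * weight_measure \<upsilon> (cube (enum k)) \<le> ennreal (B * (2 * real R + 1) ^ CARD('n)) * A1_const \<upsilon> * strong_term \<upsilon> f (enum k)"
      unfolding strong_term_def d_def by (simp only: mult.assoc)
  qed auto
  also have "\<dots> = ennreal (B * (2 * real R + 1) ^ CARD('n)) * A1_const \<upsilon> * (\<Sum>k. strong_term \<upsilon> f (enum k))"
    by (rule ennreal_suminf_cmult)
  also have "(\<Sum>k. strong_term \<upsilon> f (enum k)) = infsum (strong_term \<upsilon> f) Omega"
    by (rule infsum_ennreal_enum[OF bij, symmetric])
  finally show ?thesis by (simp only: mult.assoc)
qed

lemma norm_bump_pairing:
  assumes c: "c > 0"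
  shows "norm (LINT x|lborel. complex_of_real (bump c a b x) * complex_of_real (p x)) \<le> (LINT x|lborel. \<bar>p x\<bar> * bump c a b x)"
proof -
  have "norm (LINT x|lborel. complex_of_real (bump c a b x) * complex_of_real (p x))
     \<le> (LINT x|lborel. norm (complex_of_real (bump c a b x) * complex_of_real (p x)))"
    by (rule integral_norm_bound)
  also have "\<dots> = (LINT x|lborel. \<bar>p x\<bar> * bump c a b x)"
    by (intro Bochner_Integration.integral_cong) (simp_all add: norm_mult bump_bounds[OF c] abs_of_nonneg mult.commute)
  finally show ?thesis .
qed

text \<open>For f itself the factor 2^j in \<open>wc\<close> is surplus. For a gradient component
  the derivative is moved from the bump to the atom, where it produces exactly this 2^j.\<close>

lemma strong_bound:
  fixes \<upsilon> :: "real^'n \<Rightarrow> real"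
  assumes A1: "A1_weight \<upsilon>" and f: "f \<in> W11_space \<upsilon>" and f0: "f0 \<in> borel_measurable borel"
    and AE: "AE x in lebesgue. f x = f0 x"
  shows "W11_norm \<upsilon> f \<le> ennreal ((1 + real CARD('n)) * (B * (2 * real R + 1) ^ CARD('n))) *
     (A1_const \<upsilon> * infsum (strong_term \<upsilon> f0) Omega)"
proof -
  define G where "G = weak_gradient f"
  note wg = weak_gradient_properties[OF f, folded G_def]
  have wgr: "locally_integrable f" "locally_integrable G"
    "\<And>i g. test_function g \<Longrightarrow> (LINT x|lebesgue. f x * partial_deriv i g x) = - (LINT x|lebesgue. G x $ i * g x)"
    using wg(1) unfolding has_weak_gradient_def by auto
  define Y where "Y = ennreal (B * (2 * real R + 1) ^ CARD('n)) * (A1_const \<upsilon> * infsum (strong_term \<upsilon> f0) Omega)"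
  \<comment> \<open>Levels are nonnegative, so 2^j >= 1.\<close>
  have coef_le: "norm (coef f0 \<omega>) \<le> norm (wc f0 \<omega>)" for \<omega>
    unfolding wc_def norm_mult by (simp add: mult_le_cancel_right1 norm_power)
  have 1: "L1_norm \<upsilon> f \<le> Y"
    unfolding Y_def
  proof (rule strong_component[OF A1 wg(4) wgr(1) atom_meas atom_bound atom_supp])
    fix a b :: "real^'n" and c :: real assume c: "c > 0"
    let ?g = "\<lambda>x. complex_of_real (bump c a b x)"
    have "norm (of_real (2 ^ (lev \<omega> * CARD('n))) * coef f0 \<omega> * coef ?g \<omega>)
      \<le> 2 ^ (lev \<omega> * CARD('n)) * norm (wc f0 \<omega>) * (LINT x|lborel. \<bar>atom \<omega> x\<bar> * bump c a b x)" for \<omega>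
      unfolding norm_mult coef_def[of ?g] norm_of_real
      by (intro mult_mono norm_bump_pairing[OF c] coef_le) auto
    thus "\<exists>t. (t has_sum (LINT x|lebesgue. f x * ?g x)) Omega \<and>
       (\<forall>\<omega>\<in>Omega. norm (t \<omega>) \<le> 2 ^ (lev \<omega> * CARD('n)) * norm (wc f0 \<omega>) * (LINT x|lborel. \<bar>atom \<omega> x\<bar> * bump c a b x))"
      using synthesis[OF A1 f f0 AE schwartz_bump[OF c, of a b]] unfolding pairing_def by blast
  qed
  have 2: "L1_norm \<upsilon> (\<lambda>x. G x $ i) \<le> Y" for i
    unfolding Y_def
  proof (rule strong_component[OF A1 _ locally_integrable_component[OF wgr(2)] datom_meas datom_bound datom_supp])
    show "(\<lambda>x. G x $ i) \<in> borel_measurable lebesgue"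
      by (rule borel_measurable_continuous_on[OF _ wg(5)]) (intro continuous_intros)
    fix a b :: "real^'n" and c :: real assume c: "c > 0"
    let ?g = "\<lambda>x. complex_of_real (bump c a b x)"
    have g: "?g \<in> schwartz" by (rule schwartz_bump[OF c])
    \<comment> \<open>Expand f against the derivative of the bump. By the weak gradient this is, up
      to sign, the pairing of the gradient component with the bump.\<close>
    have "((\<lambda>\<omega>. - (of_real (2 ^ (lev \<omega> * CARD('n))) * coef f0 \<omega> * coef (partial_deriv i ?g) \<omega>)) has_sum
       - (LINT x|lebesgue. f x * partial_deriv i ?g x)) Omega"
      using synthesis[OF A1 f f0 AE schwartz_partial[OF g, of i]] unfolding pairing_def by (simp only: has_sum_uminus minus_minus)
    moreover have "- (LINT x|lebesgue. f x * partial_deriv i ?g x) = (LINT x|lebesgue. G x $ i * ?g x)"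
      using wgr(3)[OF test_function_bump[OF c], of i a b] by simp
    moreover have "norm (- (of_real (2 ^ (lev \<omega> * CARD('n))) * coef f0 \<omega> * coef (partial_deriv i ?g) \<omega>))
      \<le> 2 ^ (lev \<omega> * CARD('n)) * norm (wc f0 \<omega>) * (LINT x|lborel. \<bar>datom \<omega> i x\<bar> * bump c a b x)" for \<omega>
    proof -
      have "norm (- (of_real (2 ^ (lev \<omega> * CARD('n))) * coef f0 \<omega> * coef (partial_deriv i ?g) \<omega>))
        = 2 ^ (lev \<omega> * CARD('n)) * norm (wc f0 \<omega>) * norm (LINT x|lborel. ?g x * of_real (datom \<omega> i x))"
        unfolding coef_partial[OF g] wc_def by (simp add: norm_mult norm_power)
      also have "\<dots> \<le> 2 ^ (lev \<omega> * CARD('n)) * norm (wc f0 \<omega>) * (LINT x|lborel. \<bar>datom \<omega> i x\<bar> * bump c a b x)"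
        by (intro mult_left_mono norm_bump_pairing[OF c]) auto
      finally show ?thesis .
    qed
    ultimately show "\<exists>t. (t has_sum (LINT x|lebesgue. G x $ i * ?g x)) Omega \<and>
       (\<forall>\<omega>\<in>Omega. norm (t \<omega>) \<le> 2 ^ (lev \<omega> * CARD('n)) * norm (wc f0 \<omega>) * (LINT x|lborel. \<bar>datom \<omega> i x\<bar> * bump c a b x))"
      by (intro exI[of _ "\<lambda>\<omega>. - (of_real (2 ^ (lev \<omega> * CARD('n))) * coef f0 \<omega> * coef (partial_deriv i ?g) \<omega>)"]) simp
  qed
  have v: "\<upsilon> x \<ge> 0" for x using A1 unfolding A1_weight_def by blast
  have "L1_norm \<upsilon> G \<le> (\<integral>\<^sup>+x. (\<Sum>i\<in>UNIV. ennreal (norm (G x $ i) * \<upsilon> x)) \<partial>lebesgue)"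
    unfolding L1_norm_def
  proof (rule nn_integral_mono)
    fix x
    have "norm (G x) * \<upsilon> x \<le> (\<Sum>i\<in>UNIV. norm (G x $ i)) * \<upsilon> x"
      unfolding norm_vec_def by (intro mult_right_mono L2_set_le_sum v) auto
    thus "ennreal (norm (G x) * \<upsilon> x) \<le> (\<Sum>i\<in>UNIV. ennreal (norm (G x $ i) * \<upsilon> x))"
      using v by (subst sum_ennreal) (auto simp: sum_distrib_right intro!: ennreal_leI)
  qed
  also have "\<dots> = (\<Sum>i\<in>UNIV. L1_norm \<upsilon> (\<lambda>x. G x $ i))"
    unfolding L1_norm_def
  proof (rule nn_integral_sum)
    fix i
    have "(\<lambda>x. G x $ i) \<in> borel_measurable lebesgue"
      by (rule borel_measurable_continuous_on[OF _ wg(5)]) (intro continuous_intros)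
    hence "(\<lambda>x. norm (G x $ i)) \<in> borel_measurable lebesgue"
      by (intro borel_measurable_continuous_on[where f=norm and g="\<lambda>x. G x $ i"] continuous_intros)
    thus "(\<lambda>x. ennreal (norm (G x $ i) * \<upsilon> x)) \<in> borel_measurable lebesgue"
      by (intro measurable_compose[OF _ measurable_ennreal] borel_measurable_times A1_weight_measurable[OF A1])
  qed
  also have "\<dots> \<le> (\<Sum>i\<in>(UNIV::'n set). Y)" by (intro sum_mono 2)
  also have "\<dots> = ennreal (real CARD('n)) * Y" by (simp add: ennreal_of_nat_eq_real_of_nat)
  finally have 3: "L1_norm \<upsilon> G \<le> ennreal (real CARD('n)) * Y" .
  have "W11_norm \<upsilon> f \<le> Y + ennreal (real CARD('n)) * Y"
    unfolding W11_norm_def G_def[symmetric] by (intro add_mono 1 3)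
  also have "\<dots> = (1 + ennreal (real CARD('n))) * Y" by (simp only: distrib_right mult_1)
  also have "1 + ennreal (real CARD('n)) = ennreal (1 + real CARD('n))"
    by (subst ennreal_plus) auto
  also have "ennreal (1 + real CARD('n)) * Y = ennreal ((1 + real CARD('n)) * (B * (2 * real R + 1) ^ CARD('n))) *
     (A1_const \<upsilon> * infsum (strong_term \<upsilon> f0) Omega)"
    unfolding Y_def 
    by (subst ennreal_mult[of "1 + real CARD('n)" "B * (2 * real R + 1) ^ CARD('n)"]) (use B in \<open>simp_all only: mult.assoc, auto\<close>)
  finally show ?thesis .
qed

end

section \<open>Weak-type bounds for the coefficients\<close>

lemma upper_gradient_Re_Im:
  fixes f :: "real^'n::finite \<Rightarrow> complex"
  assumes "upper_gradient f F"
  shows "upper_gradient (\<lambda>x. Re (f x)) F" "upper_gradient (\<lambda>x. Im (f x)) F"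
proof -
  have m [measurable]: "f \<in> borel_measurable borel" "F \<in> borel_measurable borel" using assms unfolding upper_gradient_def by blast+
  have P: "upper_gradient (\<lambda>x. p (f x)) F" if p: "\<And>z w. \<bar>p z - p w\<bar> \<le> norm (z - w)" and pm: "(\<lambda>x. p (f x)) \<in> borel_measurable borel" for p :: "complex \<Rightarrow> real"
    unfolding upper_gradient_def
  proof (intro conjI allI pm m)
    fix i t
    have "AE x in lborel. ennreal (norm (f (x + t *\<^sub>R axis i 1) - f x))
        \<le> (\<integral>\<^sup>+s. indicator (closed_segment 0 t) s * F (x + s *\<^sub>R axis i 1) \<partial>lborel)"
      using assms unfolding upper_gradient_def by blast
    thus "AE x in lborel. ennreal (norm (p (f (x + t *\<^sub>R axis i 1)) - p (f x)))
        \<le> (\<integral>\<^sup>+s. indicator (closed_segment 0 t) s * F (x + s *\<^sub>R axis i 1) \<partial>lborel)"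
    proof eventually_elim
      case (elim x)
      have "ennreal (norm (p (f (x + t *\<^sub>R axis i 1)) - p (f x))) \<le> ennreal (norm (f (x + t *\<^sub>R axis i 1) - f x))"
        by (rule ennreal_leI) (use p in simp)
      thus ?case using elim by (rule order_trans)
    qed
  qed
  show "upper_gradient (\<lambda>x. Re (f x)) F"
  proof (rule P)
    show "\<bar>Re z - Re w\<bar> \<le> norm (z - w)" for z w using abs_Re_le_cmod[of "z - w"] by simp
  qed measurable
  show "upper_gradient (\<lambda>x. Im (f x)) F"
  proof (rule P)
    show "\<bar>Im z - Im w\<bar> \<le> norm (z - w)" for z w using abs_Im_le_cmod[of "z - w"] by simp
  qed measurable
qed

text \<open>A Borel version of |G| dominates every component, which is all that
  \<open>upper_gradient_of_weak\<close> asks. The same function serves all directions.\<close>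

lemma weak_gradient_upper_gradient:
  fixes f :: "real^'n::finite \<Rightarrow> complex" and G :: "real^'n \<Rightarrow> complex^'n"
  assumes wg: "has_weak_gradient f G" and fm: "f \<in> borel_measurable lebesgue" and Gm: "G \<in> borel_measurable lebesgue"
    and f0 [measurable]: "f0 \<in> borel_measurable borel" and AE: "AE x in lebesgue. f x = f0 x"
  shows "\<exists>F0\<in>borel_measurable borel. (AE x in lebesgue. norm (G x) = F0 x) \<and> upper_gradient f0 (\<lambda>x. ennreal (F0 x))"
proof -
  have lf: "locally_integrable f" and lG: "locally_integrable G" and
    w: "\<And>i g. test_function g \<Longrightarrow> (LINT x|lebesgue. f x * partial_deriv i g x) = - (LINT x|lebesgue. G x $ i * g x)"
    using wg unfolding has_weak_gradient_def by auto
  have nG: "(\<lambda>x. norm (G x)) \<in> borel_measurable (completion lborel)"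
    using Gm by (intro borel_measurable_continuous_on[where f=norm and g=G] continuous_intros)
  obtain p where p: "p \<in> borel_measurable lborel" "AE x in lborel. norm (G x) = p x"
    using completion_ex_borel_measurable_real[OF nG] by blast
  define F0 where "F0 x = \<bar>p x\<bar>" for x
  have F0 [measurable]: "F0 \<in> borel_measurable borel" unfolding F0_def using p(1) by simp
  have "AE x in lborel. norm (G x) = F0 x" using p(2)
  proof eventually_elim
    case (elim x) thus ?case unfolding F0_def using norm_ge_zero[of "G x"] by linarith
  qed
  hence GF: "AE x in lebesgue. norm (G x) = F0 x" by (rule AE_completion)
  have lnG: "locally_integrable (\<lambda>x. norm (G x))"
    unfolding locally_integrable_def
  proof (intro allI impI)
    fix K :: "(real^'n) set" assume "compact K"
    hence "integrable lebesgue (\<lambda>x. indicator K x *\<^sub>R G x)"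
      using lG unfolding locally_integrable_def set_integrable_def by blast
    hence "integrable lebesgue (\<lambda>x. norm (indicator K x *\<^sub>R G x))" by (rule integrable_norm)
    thus "set_integrable lebesgue K (\<lambda>x. norm (G x))" unfolding set_integrable_def by (simp add: indicator_def)
  qed
  have "upper_gradient f0 (\<lambda>x. ennreal (F0 x))"
  proof (rule upper_gradient_of_weak[OF f0 F0])
    show "0 \<le> F0 x" for x unfolding F0_def by simp
    fix K :: "(real^'n) set" assume K: "compact K"
    show "(\<integral>\<^sup>+x. indicator K x * ennreal (norm (f0 x)) \<partial>lborel) < \<infinity>"
      by (rule locally_integrable_nn_integral_finite[OF lf f0 AE K])
    show "(\<integral>\<^sup>+x. indicator K x * ennreal (F0 x) \<partial>lborel) < \<infinity>"
      using locally_integrable_nn_integral_finite[OF lnG F0 GF K] unfolding F0_def by simp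
  next
    fix i :: 'n and a b :: "real^'n" and c :: real assume c: "c > 0"
    let ?g = "\<lambda>x. complex_of_real (bump c a b x)"
    have pm: "partial_deriv i ?g \<in> borel_measurable borel"
      by (rule borel_measurable_continuous_onI[OF continuous_on_partial_bump[OF c]])
    have bm: "?g \<in> borel_measurable lebesgue" by (rule measurable_completion) simp
    have int: "integrable lebesgue (\<lambda>x. G x $ i * ?g x)"
      by (rule locally_integrable_mult_bounded[OF locally_integrable_component[OF lG] compact_cbox[of a b] _ bm, where B=1])
         (auto simp: bump_eq_0 bump_bounds[OF c] abs_of_nonneg)
    have "(LINT x|lborel. f0 x * partial_deriv i ?g x) = (LINT x|lebesgue. f x * partial_deriv i ?g x)"
      by (rule LINT_lebesgue_representative[OF fm f0 AE pm, symmetric])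
    also have "\<dots> = - (LINT x|lebesgue. G x $ i * ?g x)" by (rule w[OF test_function_bump[OF c]])
    finally have "ennreal (norm (LINT x|lborel. f0 x * partial_deriv i ?g x)) = ennreal (norm (LINT x|lebesgue. G x $ i * ?g x))" by simp
    also have "\<dots> \<le> (\<integral>\<^sup>+x. ennreal (norm (G x $ i * ?g x)) \<partial>lebesgue)" by (rule integral_norm_bound_ennreal[OF int])
    also have "\<dots> \<le> (\<integral>\<^sup>+x. ennreal (F0 x * bump c a b x) \<partial>lebesgue)"
    proof (rule nn_integral_mono_AE, use GF in eventually_elim)
      case (elim x)
      have "norm (G x $ i) \<le> norm (G x)" unfolding norm_vec_def by (rule member_le_L2_set) auto
      hence "norm (G x $ i) * bump c a b x \<le> F0 x * bump c a b x"
        unfolding elim[symmetric] by (rule mult_right_mono) (rule bump_bounds[OF c])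
      thus ?case by (intro ennreal_leI) (simp add: norm_mult bump_bounds[OF c] abs_of_nonneg)
    qed
    also have "\<dots> = (\<integral>\<^sup>+x. ennreal (F0 x * bump c a b x) \<partial>lborel)"
      by (rule nn_integral_completion)
    finally show "ennreal (norm (LINT x|lborel. f0 x * partial_deriv i ?g x)) \<le> (\<integral>\<^sup>+x. ennreal (F0 x * bump c a b x) \<partial>lborel)" .
  qed
  thus ?thesis using GF by (intro bexI[OF _ F0] conjI)
qed

lemma cube_vol_powr:
  fixes \<omega> :: "'n::finite windex"
  assumes "\<omega> \<in> Omega"
  shows "cube_vol \<omega> powr \<beta> = (2 powr (- (real CARD('n) * \<beta>))) ^ lev \<omega>"
    "cube_vol \<omega> powr (\<beta> - 1) = (2 powr (- (real CARD('n) * \<beta>))) ^ lev \<omega> * 2 ^ (lev \<omega> * CARD('n))"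
proof -
  have v: "cube_vol \<omega> = 2 powr (- real (lev \<omega> * CARD('n)))"
    unfolding cube_vol_eq[OF assms] by (simp add: powr_minus powr_realpow power_one_over power_mult divide_inverse power_inverse del: of_nat_mult)
  show 1: "cube_vol \<omega> powr \<beta> = (2 powr (- (real CARD('n) * \<beta>))) ^ lev \<omega>" for \<beta>
    unfolding v powr_powr by (simp add: powr_power mult_ac)
  have "(2::real) powr (- (real CARD('n) * (\<beta> - 1))) = 2 powr (- (real CARD('n) * \<beta>)) * 2 ^ CARD('n)"
    by (simp add: powr_add[symmetric] powr_realpow[symmetric] algebra_simps)
  thus "cube_vol \<omega> powr (\<beta> - 1) = (2 powr (- (real CARD('n) * \<beta>))) ^ lev \<omega> * 2 ^ (lev \<omega> * CARD('n))"
    unfolding 1 by (simp only: power_mult_distrib power_mult[symmetric] mult.commute[of "CARD('n)"])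
qed

lemma wm_mono: "A \<subseteq> D \<Longrightarrow> weight_measure \<upsilon> A \<le> weight_measure \<upsilon> D"
  unfolding weight_measure_def by (intro nn_integral_mono mult_left_mono indicator_leI) auto

context wavelet_family
begin

text \<open>The seq weight times t is rewritten as the A1 constant times
  \<open>t * \<tau> ^ j * q\<close>, where q is a lower bound for the weight on the dilated cube.
  \<open>coefficient_family_bound\<close> is free of the weight, so the A1 constant enters exactly
  once.\<close>

lemma detail_bound:
  assumes e: "e \<noteq> zero_type" and cb: "core_bound TYPE('n) \<tau> C0" and C0: "C0 > 0" and \<tau>: "\<tau> = 2 powr (- (real CARD('n) * \<beta>))"
  shows "\<exists>C>0. \<forall>\<upsilon> (u::real^'n \<Rightarrow> real) F w t \<Phi>. A1_weight \<upsilon> \<longrightarrow> upper_gradient u F \<longrightarrow>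
     finite_on_compacts u \<longrightarrow>
     w \<in> borel_measurable borel \<longrightarrow> (AE x in lborel. ennreal (\<upsilon> x) = w x) \<longrightarrow> t > 0 \<longrightarrow> finite \<Phi> \<longrightarrow>
     \<Phi> \<subseteq> {\<omega>\<in>Omega. fst \<omega> = e} \<longrightarrow>
     (\<forall>\<omega>\<in>\<Phi>. t * \<tau> ^ lev \<omega> \<le> \<bar>LINT x|lborel. u x * (2 ^ lev \<omega> * atom \<omega> x)\<bar>) \<longrightarrow>
     (\<Sum>\<omega>\<in>\<Phi>. ennreal t * seq_weight \<beta> \<upsilon> \<omega>) \<le> ennreal C * (A1_const \<upsilon> * (\<integral>\<^sup>+x. F x * w x \<partial>lborel))"
proof -
  have \<tau>0: "\<tau> > 0" unfolding \<tau> by simp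
  obtain C' where C': "C' > 0" and main: "\<forall>(u :: real^'n \<Rightarrow> real) F w (lam::real) S q. upper_gradient u F \<longrightarrow>
     finite_on_compacts u \<longrightarrow>
     w \<in> borel_measurable borel \<longrightarrow> lam > 0 \<longrightarrow> finite S \<longrightarrow>
     (\<forall>P\<in>S. lam * \<tau> ^ fst P \<le> \<bar>LINT x|lborel. u x * (2 ^ fst P * T e (2 ^ fst P *\<^sub>R x - real_vec (snd P)))\<bar>) \<longrightarrow>
     (\<forall>P\<in>S. 0 \<le> q P \<and> (AE x in lborel. x \<in> dilated_cube R P \<longrightarrow> ennreal (q P) \<le> w x)) \<longrightarrow>
     (\<Sum>P\<in>S. ennreal (lam * \<tau> ^ fst P * q P)) \<le> ennreal C' * (\<integral>\<^sup>+x. F x * w x \<partial>lborel)"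
    using coefficient_family_bound[OF T_meas T_bound B _ T_mean[OF e] cb C0 \<tau>0, of R] T_supp[of e]
    by (elim meta_impE exE conjE) (assumption, rule that)
  define M where "M = (2 * real R + 1) ^ CARD('n)"
  have M: "M > 0" unfolding M_def by simp
  show ?thesis
  proof (intro exI[of _ "M * C'"] conjI allI impI)
    show "M * C' > 0" using M C' by simp
    fix \<upsilon> :: "real^'n \<Rightarrow> real" and u :: "real^'n \<Rightarrow> real" and F w t and \<Phi> :: "'n windex set"
    assume A1: "A1_weight \<upsilon>" and ug: "upper_gradient u F"
      and lf: "finite_on_compacts u"
      and wm: "w \<in> borel_measurable borel" and wAE: "AE x in lborel. ennreal (\<upsilon> x) = w x" and t: "t > 0" and fin: "finite \<Phi>"
      and \<Phi>: "\<Phi> \<subseteq> {\<omega>\<in>Omega. fst \<omega> = e}"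
      and big: "\<forall>\<omega>\<in>\<Phi>. t * \<tau> ^ lev \<omega> \<le> \<bar>LINT x|lborel. u x * (2 ^ lev \<omega> * atom \<omega> x)\<bar>"
    define par where "par \<omega> = (lev \<omega>, snd (snd \<omega>))" for \<omega> :: "'n windex"
    have inj: "inj_on par \<Phi>"
    proof (rule inj_onI)
      fix \<omega> \<omega>' assume o: "\<omega> \<in> \<Phi>" "\<omega>' \<in> \<Phi>" and eq: "par \<omega> = par \<omega>'"
      have "fst \<omega> = e" "fst \<omega>' = e" "0 \<le> fst (snd \<omega>)" "0 \<le> fst (snd \<omega>')"
        using o \<Phi> unfolding Omega_def dyadic_zero_def dyadic_plus_def by auto
      thus "\<omega> = \<omega>'" using eq unfolding par_def by (auto simp: prod_eq_iff)
    qed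
    have Ap: "A1_real \<upsilon> > 0" by (rule A1_lower_bound(1)[OF A1])
    \<comment> \<open>The mean of the weight over the dilated cube divided by the A1 constant, hence
      at most the weight almost everywhere on that cube.\<close>
    define q where "q P = wgt \<upsilon> (dilated_cube R P) * 2 ^ (fst P * CARD('n)) / (A1_real \<upsilon> * M)" for P
    have q0: "q P \<ge> 0" for P unfolding q_def using Ap M by (simp add: wgt_nonneg)
    have qAE: "AE x in lborel. x \<in> dilated_cube R P \<longrightarrow> ennreal (q P) \<le> w x" for P
    proof -
      have "AE x in lborel. x \<in> dilated_cube R P \<longrightarrow> wgt \<upsilon> (dilated_cube R P) \<le> A1_real \<upsilon> * ((2 * real R + 1) / 2 ^ fst P) ^ CARD('n) * \<upsilon> x"
        using dilated_cube_AE[OF A1, of R P] by (simp only: AE_completion_iff)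
      with wAE show ?thesis
      proof eventually_elim
        case (elim x)
        show ?case
        proof
          assume "x \<in> dilated_cube R P"
          hence "wgt \<upsilon> (dilated_cube R P) \<le> A1_real \<upsilon> * ((2 * real R + 1) / 2 ^ fst P) ^ CARD('n) * \<upsilon> x" using elim by blast
          also have "((2 * real R + 1) / 2 ^ fst P) ^ CARD('n) = M / 2 ^ (fst P * CARD('n))"
            unfolding M_def by (simp only: power_divide power_mult)
          finally have "q P \<le> \<upsilon> x" unfolding q_def using Ap M by (simp add: field_simps)
          thus "ennreal (q P) \<le> w x" unfolding elim(1)[symmetric] by (rule ennreal_leI)
        qed
      qed
    qed
    have "(\<Sum>\<omega>\<in>\<Phi>. ennreal t * seq_weight \<beta> \<upsilon> \<omega>) \<le> (\<Sum>\<omega>\<in>\<Phi>. ennreal (A1_real \<upsilon> * M) * ennreal (t * \<tau> ^ fst (par \<omega>) * q (par \<omega>)))"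
    proof (rule sum_mono)
      fix \<omega> assume "\<omega> \<in> \<Phi>"
      hence o: "\<omega> \<in> Omega" using \<Phi> by blast
      have "weight_measure \<upsilon> (cube_of \<omega>) \<le> weight_measure \<upsilon> (dilated_cube R (par \<omega>))"
        unfolding cube_of_eq_dy[OF o] par_def by (rule wm_mono[OF dy_subset_dilated_cube])
      also have "\<dots> = ennreal (wgt \<upsilon> (dilated_cube R (par \<omega>)))" by (rule wgt[OF A1 compact_dilated_cube])
      finally have "ennreal t * seq_weight \<beta> \<upsilon> \<omega> \<le> ennreal t * (ennreal (\<tau> ^ lev \<omega> * 2 ^ (lev \<omega> * CARD('n))) * ennreal (wgt \<upsilon> (dilated_cube R (par \<omega>))))"
        unfolding seq_weight_def cube_vol_powr(2)[OF o] \<tau> by (intro mult_left_mono) auto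
      also have "\<dots> = ennreal (t * (\<tau> ^ lev \<omega> * 2 ^ (lev \<omega> * CARD('n)) * wgt \<upsilon> (dilated_cube R (par \<omega>))))"
        using t \<tau>0 by (simp add: ennreal_mult wgt_nonneg del: ennreal_power)
      also have "t * (\<tau> ^ lev \<omega> * 2 ^ (lev \<omega> * CARD('n)) * wgt \<upsilon> (dilated_cube R (par \<omega>))) = (A1_real \<upsilon> * M) * (t * \<tau> ^ fst (par \<omega>) * q (par \<omega>))"
        unfolding q_def par_def using Ap M by simp
      also have "ennreal \<dots> = ennreal (A1_real \<upsilon> * M) * ennreal (t * \<tau> ^ fst (par \<omega>) * q (par \<omega>))"
        using Ap M t \<tau>0 q0 by (intro ennreal_mult) auto
      finally show "ennreal t * seq_weight \<beta> \<upsilon> \<omega> \<le> ennreal (A1_real \<upsilon> * M) * ennreal (t * \<tau> ^ fst (par \<omega>) * q (par \<omega>))" .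
    qed
    also have "\<dots> = ennreal (A1_real \<upsilon> * M) * (\<Sum>P\<in>par ` \<Phi>. ennreal (t * \<tau> ^ fst P * q P))"
      by (simp only: sum_distrib_left sum.reindex[OF inj] o_def)
    also have "\<dots> \<le> ennreal (A1_real \<upsilon> * M) * (ennreal C' * (\<integral>\<^sup>+x. F x * w x \<partial>lborel))"
    proof (intro mult_left_mono main[rule_format, OF ug _ wm t])
      show "(\<integral>\<^sup>+x. indicator K x * ennreal (norm (u x)) \<partial>lborel) < \<infinity>" if "compact K" for K using lf that by blast
      show "finite (par ` \<Phi>)" using fin by simp
      show "t * \<tau> ^ fst P \<le> \<bar>LINT x|lborel. u x * (2 ^ fst P * T e (2 ^ fst P *\<^sub>R x - real_vec (snd P)))\<bar>" if "P \<in> par ` \<Phi>" for P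
      proof -
        from that obtain \<omega> where o: "\<omega> \<in> \<Phi>" "P = par \<omega>" by blast
        have "fst \<omega> = e" using o \<Phi> by blast
        thus ?thesis using big[rule_format, OF o(1)] unfolding o(2) par_def atom_def by simp
      qed
      show "0 \<le> q P \<and> (AE x in lborel. x \<in> dilated_cube R P \<longrightarrow> ennreal (q P) \<le> w x)" for P using q0 qAE by blast
    qed simp
    also have "\<dots> = ennreal (M * C') * (A1_const \<upsilon> * (\<integral>\<^sup>+x. F x * w x \<partial>lborel))"
      unfolding A1_real[OF A1] using Ap M C' by (simp add: ennreal_mult mult_ac)
    finally show "(\<Sum>\<omega>\<in>\<Phi>. ennreal t * seq_weight \<beta> \<upsilon> \<omega>) \<le> ennreal (M * C') * (A1_const \<upsilon> * (\<integral>\<^sup>+x. F x * w x \<partial>lborel))" .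
  qed
qed

lemma scaling_overlap:
  fixes \<Phi> :: "'n windex set"
  assumes fin: "finite \<Phi>" and \<Phi>: "\<Phi> \<subseteq> {\<omega>\<in>Omega. fst \<omega> = zero_type}"
  shows "(\<Sum>\<omega>\<in>\<Phi>. indicator (cube \<omega>) x :: ennreal) \<le> ennreal (real (card {k :: int^'n. \<forall>i. 0 \<le> k $ i \<and> k $ i < 2 * int (R + 2) + 2}))"
proof -
  define S where "S = {\<omega>\<in>\<Phi>. x \<in> cube \<omega>}"
  define N where "N = card {k :: int^'n. \<forall>i. 0 \<le> k $ i \<and> k $ i < 2 * int (R + 2) + 2}"
  \<comment> \<open>The closed cube allows x - k in [-R, R+1]. Enlarging R by 2 gives a half-open
    range containing it, as \<open>finite_int_near\<close> requires.\<close>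
  let ?K = "{k :: int^'n. \<forall>i. - real (R + 2) \<le> x $ i - real_of_int (k $ i) \<and> x $ i - real_of_int (k $ i) < real (R + 2)}"
  have o: "fst \<omega> = zero_type" "fst (snd \<omega>) = 0" if "\<omega> \<in> \<Phi>" for \<omega>
    using that \<Phi> unfolding Omega_def dyadic_zero_def by auto
  have "inj_on (\<lambda>\<omega>. snd (snd \<omega>)) S"
  proof (rule inj_onI)
    fix \<omega> \<omega>' assume "\<omega> \<in> S" "\<omega>' \<in> S" "snd (snd \<omega>) = snd (snd \<omega>')"
    thus "\<omega> = \<omega>'" unfolding S_def using o[of \<omega>] o[of \<omega>'] by (intro prod_eqI) auto
  qed
  moreover have "(\<lambda>\<omega>. snd (snd \<omega>)) ` S \<subseteq> ?K"
  proof
    fix k assume "k \<in> (\<lambda>\<omega>. snd (snd \<omega>)) ` S"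
    then obtain \<omega> where w: "\<omega> \<in> \<Phi>" "x \<in> cube \<omega>" "k = snd (snd \<omega>)" unfolding S_def by blast
    have "real_of_int (k $ i) - real R \<le> x $ i \<and> x $ i \<le> real_of_int (k $ i) + real R + 1" for i
      using w(2) o[OF w(1)] unfolding w(3) dilated_cube_def by (simp add: mem_box_cart)
    note b = this
    have "- real (R + 2) \<le> x $ i - real_of_int (k $ i) \<and> x $ i - real_of_int (k $ i) < real (R + 2)" for i
      using b[of i] by (simp; linarith?)
    thus "k \<in> ?K" by blast
  qed
  ultimately have "card S \<le> card ?K" using card_inj_on_le finite_int_near(1) by blast
  also have "\<dots> \<le> N" unfolding N_def by (rule finite_int_near(2))
  finally have "card S \<le> N" .
  have "(\<Sum>\<omega>\<in>\<Phi>. indicator (cube \<omega>) x :: ennreal) = (\<Sum>\<omega>\<in>S. 1)"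
    unfolding S_def by (rule sum.mono_neutral_cong_right) (use fin in \<open>auto simp: indicator_def\<close>)
  also have "\<dots> = ennreal (real (card S))" by (simp add: ennreal_of_nat_eq_real_of_nat)
  also have "\<dots> \<le> ennreal (real N)" using \<open>card S \<le> N\<close> by (intro ennreal_leI) simp
  finally show ?thesis unfolding N_def .
qed

text \<open>Scaling functions have no cancellation, but they occur only at level 0. There the cubes
  have volume 1, so \<beta> drops out. The coefficient is at most a constant times the integral of
  |f| over the support, the A1 bound inserts the weight, and bounded overlap sums the cubes.\<close>

lemma scaling_bound:
  "\<exists>C>0. \<forall>\<upsilon> f0 t \<Phi>. A1_weight \<upsilon> \<longrightarrow> f0 \<in> borel_measurable borel \<longrightarrow>
     finite_on_compacts f0 \<longrightarrow> t > 0 \<longrightarrow> finite \<Phi> \<longrightarrow>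
     \<Phi> \<subseteq> {\<omega>\<in>Omega. fst \<omega> = zero_type} \<longrightarrow> (\<forall>\<omega>\<in>\<Phi>. t \<le> norm (coef f0 \<omega>)) \<longrightarrow>
     (\<Sum>\<omega>\<in>\<Phi>. ennreal t * seq_weight \<beta> \<upsilon> \<omega>) \<le> ennreal C * (A1_const \<upsilon> * (\<integral>\<^sup>+x. ennreal (norm (f0 x) * \<upsilon> x) \<partial>lebesgue))"
proof -
  define M where "M = (2 * real R + 1) ^ CARD('n)"
  define N where "N = real (card {k :: int^'n. \<forall>i. 0 \<le> k $ i \<and> k $ i < 2 * int (R + 2) + 2})"
  have M: "M > 0" unfolding M_def by simp
  have N: "N \<ge> 0" unfolding N_def by simp
  show ?thesis
  proof (intro exI[of _ "B * M * (N + 1)"] conjI allI impI)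
    show "B * M * (N + 1) > 0" using B M N by (intro mult_pos_pos) auto
    fix \<upsilon> :: "real^'n \<Rightarrow> real" and f0 :: "real^'n \<Rightarrow> complex" and t and \<Phi> :: "'n windex set"
    assume A1: "A1_weight \<upsilon>" and f0 [measurable]: "f0 \<in> borel_measurable borel"
      and lf: "finite_on_compacts f0"
      and t: "t > 0" and fin: "finite \<Phi>"
      and \<Phi>: "\<Phi> \<subseteq> {\<omega>\<in>Omega. fst \<omega> = zero_type}" and big: "\<forall>\<omega>\<in>\<Phi>. t \<le> norm (coef f0 \<omega>)"
    have v: "\<upsilon> x \<ge> 0" for x using A1 unfolding A1_weight_def by blast
    have Ap: "A1_real \<upsilon> > 0" by (rule A1_lower_bound(1)[OF A1])
    have fL: "f0 \<in> borel_measurable lebesgue" by (rule measurable_completion) simp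
    have vL: "\<upsilon> \<in> borel_measurable lebesgue" by (rule A1_weight_measurable[OF A1])
    have fvL: "(\<lambda>x. ennreal (norm (f0 x) * \<upsilon> x)) \<in> borel_measurable lebesgue"
      using fL vL by (intro measurable_compose[OF _ measurable_ennreal] borel_measurable_times
        borel_measurable_continuous_on[where f=norm and g=f0] continuous_intros)
    have cL: "(\<lambda>x. indicator (cube \<omega>) x :: ennreal) \<in> borel_measurable lebesgue" for \<omega>
      by (rule borel_measurable_indicator) simp
    have "(\<Sum>\<omega>\<in>\<Phi>. ennreal t * seq_weight \<beta> \<upsilon> \<omega>) \<le> (\<Sum>\<omega>\<in>\<Phi>. \<integral>\<^sup>+x. ennreal (B * M * A1_real \<upsilon>) * (ennreal (norm (f0 x) * \<upsilon> x) * indicator (cube \<omega>) x) \<partial>lebesgue)"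
    proof (rule sum_mono)
      fix \<omega> assume oP: "\<omega> \<in> \<Phi>"
      hence o: "\<omega> \<in> Omega" "fst (snd \<omega>) = 0" using \<Phi> unfolding Omega_def dyadic_zero_def by auto
      define W where "W = wgt \<upsilon> (cube \<omega>)"
      have W0: "W \<ge> 0" unfolding W_def by (rule wgt_nonneg)
      have "seq_weight \<beta> \<upsilon> \<omega> = weight_measure \<upsilon> (cube_of \<omega>)"
        unfolding seq_weight_def cube_vol_eq[OF o(1)] using o(2) by simp
      also have "\<dots> \<le> weight_measure \<upsilon> (cube \<omega>)"
        unfolding cube_of_eq_dy[OF o(1)] by (rule wm_mono[OF dy_subset_dilated_cube])
      also have "\<dots> = ennreal W" unfolding W_def by (rule wgt[OF A1 compact_cube])
      finally have sw: "seq_weight \<beta> \<upsilon> \<omega> \<le> ennreal W" .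
      have "ennreal t \<le> ennreal (norm (coef f0 \<omega>))" using big oP by (intro ennreal_leI) blast
      also have "\<dots> \<le> (\<integral>\<^sup>+x. ennreal (norm (f0 x * of_real (atom \<omega> x))) \<partial>lborel)"
        unfolding coef_def by (rule integral_norm_bound_ennreal[OF integrable_atom_mult[OF f0]]) (use lf in blast)
      also have "\<dots> \<le> (\<integral>\<^sup>+x. ennreal (B * norm (f0 x)) * indicator (cube \<omega>) x \<partial>lborel)"
      proof (rule nn_integral_mono)
        fix x
        show "ennreal (norm (f0 x * of_real (atom \<omega> x))) \<le> ennreal (B * norm (f0 x)) * indicator (cube \<omega>) x"
        proof (cases "atom \<omega> x = 0")
          case False
          have "norm (f0 x * of_real (atom \<omega> x)) \<le> B * norm (f0 x)"
            unfolding norm_mult norm_of_real using atom_bound[of \<omega> x] by (subst mult.commute) (rule mult_right_mono, auto)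
          thus ?thesis using atom_supp[OF False] by (simp add: ennreal_leI)
        qed simp
      qed
      also have "\<dots> = (\<integral>\<^sup>+x. ennreal (B * norm (f0 x)) * indicator (cube \<omega>) x \<partial>lebesgue)"
        by (rule nn_integral_completion[symmetric]) measurable
      finally have "ennreal t * seq_weight \<beta> \<upsilon> \<omega> \<le> (\<integral>\<^sup>+x. ennreal (B * norm (f0 x)) * indicator (cube \<omega>) x \<partial>lebesgue) * ennreal W"
        using sw by (intro mult_mono) auto
      also have "\<dots> = (\<integral>\<^sup>+x. ennreal (B * norm (f0 x)) * indicator (cube \<omega>) x * ennreal W \<partial>lebesgue)"
        by (rule nn_integral_multc[symmetric], rule measurable_completion) measurable
      also have "\<dots> \<le> (\<integral>\<^sup>+x. ennreal (B * M * A1_real \<upsilon>) * (ennreal (norm (f0 x) * \<upsilon> x) * indicator (cube \<omega>) x) \<partial>lebesgue)"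
      proof (rule nn_integral_mono_AE, use dilated_cube_AE[OF A1, of R "(lev \<omega>, snd (snd \<omega>))"] in eventually_elim)
        case (elim x)
        show ?case
        proof (cases "x \<in> cube \<omega>")
          case True
          hence "W \<le> A1_real \<upsilon> * M * \<upsilon> x" using elim o(2) unfolding W_def M_def by simp
          hence "B * norm (f0 x) * W \<le> B * norm (f0 x) * (A1_real \<upsilon> * M * \<upsilon> x)" using B by (intro mult_left_mono) auto
          also have "\<dots> = B * M * A1_real \<upsilon> * (norm (f0 x) * \<upsilon> x)" by (simp only: mult_ac)
          finally have "ennreal (B * norm (f0 x) * W) \<le> ennreal (B * M * A1_real \<upsilon> * (norm (f0 x) * \<upsilon> x))" by (rule ennreal_leI)
          moreover have "ennreal (B * norm (f0 x) * W) = ennreal (B * norm (f0 x)) * ennreal W"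
            using B W0 by (intro ennreal_mult) auto
          moreover have "ennreal (B * M * A1_real \<upsilon> * (norm (f0 x) * \<upsilon> x)) = ennreal (B * M * A1_real \<upsilon>) * ennreal (norm (f0 x) * \<upsilon> x)"
            using B M Ap v by (intro ennreal_mult) auto
          ultimately show ?thesis using True by simp
        qed simp
      qed
      finally show "ennreal t * seq_weight \<beta> \<upsilon> \<omega> \<le> (\<integral>\<^sup>+x. ennreal (B * M * A1_real \<upsilon>) * (ennreal (norm (f0 x) * \<upsilon> x) * indicator (cube \<omega>) x) \<partial>lebesgue)" .
    qed
    also have "\<dots> = (\<integral>\<^sup>+x. (\<Sum>\<omega>\<in>\<Phi>. ennreal (B * M * A1_real \<upsilon>) * (ennreal (norm (f0 x) * \<upsilon> x) * indicator (cube \<omega>) x)) \<partial>lebesgue)"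
      by (rule nn_integral_sum[symmetric]) (intro borel_measurable_times_ennreal borel_measurable_const fvL cL)
    also have "\<dots> \<le> (\<integral>\<^sup>+x. ennreal (B * M * A1_real \<upsilon> * N) * ennreal (norm (f0 x) * \<upsilon> x) \<partial>lebesgue)"
    proof (rule nn_integral_mono)
      fix x
      have "(\<Sum>\<omega>\<in>\<Phi>. ennreal (B * M * A1_real \<upsilon>) * (ennreal (norm (f0 x) * \<upsilon> x) * indicator (cube \<omega>) x))
        = ennreal (B * M * A1_real \<upsilon>) * (ennreal (norm (f0 x) * \<upsilon> x) * (\<Sum>\<omega>\<in>\<Phi>. indicator (cube \<omega>) x))"
        by (simp only: sum_distrib_left)
      also have "\<dots> \<le> ennreal (B * M * A1_real \<upsilon>) * (ennreal (norm (f0 x) * \<upsilon> x) * ennreal N)"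
        unfolding N_def by (intro mult_left_mono scaling_overlap[OF fin \<Phi>]) auto
      also have "\<dots> = ennreal (B * M * A1_real \<upsilon> * N) * ennreal (norm (f0 x) * \<upsilon> x)"
      proof -
        have "ennreal (B * M * A1_real \<upsilon> * N) = ennreal (B * M * A1_real \<upsilon>) * ennreal N"
          using B M Ap N by (intro ennreal_mult) auto
        thus ?thesis by (simp only: mult_ac)
      qed
      finally show "(\<Sum>\<omega>\<in>\<Phi>. ennreal (B * M * A1_real \<upsilon>) * (ennreal (norm (f0 x) * \<upsilon> x) * indicator (cube \<omega>) x))
         \<le> ennreal (B * M * A1_real \<upsilon> * N) * ennreal (norm (f0 x) * \<upsilon> x)" .
    qed
    also have "\<dots> = ennreal (B * M * A1_real \<upsilon> * N) * (\<integral>\<^sup>+x. ennreal (norm (f0 x) * \<upsilon> x) \<partial>lebesgue)"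
      by (rule nn_integral_cmult[OF fvL])
    also have "\<dots> \<le> ennreal (B * M * (N + 1) * A1_real \<upsilon>) * (\<integral>\<^sup>+x. ennreal (norm (f0 x) * \<upsilon> x) \<partial>lebesgue)"
    proof (intro mult_right_mono ennreal_leI)
      have "B * M * A1_real \<upsilon> * N \<le> B * M * A1_real \<upsilon> * (N + 1)" using B M Ap by (intro mult_left_mono) auto
      thus "B * M * A1_real \<upsilon> * N \<le> B * M * (N + 1) * A1_real \<upsilon>" by (simp only: mult_ac)
    qed simp
    also have "ennreal (B * M * (N + 1) * A1_real \<upsilon>) = ennreal (B * M * (N + 1)) * A1_const \<upsilon>"
      unfolding A1_real[OF A1] using B M N Ap by (intro ennreal_mult) auto
    finally show "(\<Sum>\<omega>\<in>\<Phi>. ennreal t * seq_weight \<beta> \<upsilon> \<omega>) \<le> ennreal (B * M * (N + 1)) * (A1_const \<upsilon> * (\<integral>\<^sup>+x. ennreal (norm (f0 x) * \<upsilon> x) \<partial>lebesgue))"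
      by (simp only: mult.assoc)
  qed
qed

end

lemma sum_Un_le_ennreal:
  fixes h :: "'a \<Rightarrow> ennreal"
  assumes "finite A" "finite D" shows "sum h (A \<union> D) \<le> sum h A + sum h D"
  unfolding sum.union_inter[OF assms, symmetric] by simp

text \<open>Reduces the weak norm to finite families, the form in which its bounds are
  proved.\<close>

lemma infsum_ennreal_le:
  fixes h :: "'a \<Rightarrow> ennreal"
  assumes t: "t > 0" and le: "\<And>\<Phi>. finite \<Phi> \<Longrightarrow> \<Phi> \<subseteq> A \<Longrightarrow> (\<Sum>\<omega>\<in>\<Phi>. ennreal t * h \<omega>) \<le> Y"
  shows "ennreal t * infsum h A \<le> Y"
proof -
  have inv: "ennreal (1 / t) * ennreal t = 1" using t by (subst ennreal_mult[symmetric]) auto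
  have "infsum h A \<le> ennreal (1 / t) * Y"
  proof (rule infsum_le_finite_sums)
    fix \<Phi> assume "finite \<Phi>" "\<Phi> \<subseteq> A"
    hence "ennreal (1 / t) * (ennreal t * sum h \<Phi>) \<le> ennreal (1 / t) * Y"
      using le by (intro mult_left_mono) (auto simp: sum_distrib_left)
    thus "sum h \<Phi> \<le> ennreal (1 / t) * Y" by (simp only: mult.assoc[symmetric] inv mult_1)
  qed (simp add: nonneg_summable_on_complete)
  hence "ennreal t * infsum h A \<le> ennreal t * (ennreal (1 / t) * Y)" by (rule mult_left_mono) simp
  also have "\<dots> = (ennreal (1 / t) * ennreal t) * Y" by (simp only: mult_ac)
  finally show ?thesis unfolding inv by simp
qed

lemma core_bound_exists:
  assumes "\<beta> < 1 - 1 / real CARD('n::finite) \<or> \<beta> > 1" and \<tau>: "\<tau> = 2 powr (- (real CARD('n) * \<beta>))"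
  shows "\<exists>C>0. core_bound TYPE('n) \<tau> C"
proof -
  have \<tau>0: "\<tau> > 0" unfolding \<tau> by simp
  show ?thesis using assms(1)
  proof
    have n: "real CARD('n) > 0" by simp
    assume "\<beta> < 1 - 1 / real CARD('n)"
    hence "real CARD('n) * \<beta> < real CARD('n) * (1 - 1 / real CARD('n))" using n by (intro mult_strict_left_mono) auto
    also have "\<dots> = real CARD('n) - 1" using n by (simp add: field_simps)
    finally have "0 < - (real CARD('n) * \<beta>) + (real CARD('n) - 1)" by simp
    hence "1 < 2 powr (- (real CARD('n) * \<beta>) + (real CARD('n) - 1))" by simp
    also have "\<dots> = \<tau> * 2 powr (real CARD('n) - 1)" unfolding \<tau> by (rule powr_add)
    also have "real CARD('n) - 1 = real (CARD('n) - 1)" by (simp add: of_nat_diff Suc_leI)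
    also have "2 powr real (CARD('n) - 1) = (2::real) ^ (CARD('n) - 1)" by (rule powr_realpow) simp
    finally have "\<tau> * 2 ^ (CARD('n) - 1) > 1" .
    thus ?thesis by (rule core_bound_low[OF \<tau>0])
  next
    assume "\<beta> > 1"
    hence "real CARD('n) * 1 < real CARD('n) * \<beta>" by (intro mult_strict_left_mono) auto
    hence "- (real CARD('n) * \<beta>) + real CARD('n) < 0" by simp
    hence "2 powr (- (real CARD('n) * \<beta>) + real CARD('n)) < 2 powr (0::real)" by (intro powr_less_mono) auto
    moreover have "2 powr (- (real CARD('n) * \<beta>) + real CARD('n)) = \<tau> * 2 ^ CARD('n)"
      unfolding \<tau> powr_add by (simp add: powr_realpow)
    ultimately have "\<tau> * 2 ^ CARD('n) < 1" by simp
    thus ?thesis by (rule core_bound_high[OF \<tau>0])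
  qed
qed

context wavelet_c1
begin

text \<open>Scaling coefficients go to \<open>scaling_bound\<close>. The others are split by type
  and by whether the real or the imaginary part has at least half the required size, because medians
  need real functions.\<close>

lemma weak_sum_bound:
  assumes \<beta>: "\<beta> < 1 - 1 / real CARD('n) \<or> \<beta> > 1"
  shows "\<exists>C>0. \<forall>\<upsilon> f f0 t \<Phi>. A1_weight \<upsilon> \<longrightarrow> f \<in> W11_space \<upsilon> \<longrightarrow> f0 \<in> borel_measurable borel \<longrightarrow>
     (AE x in lebesgue. f x = f0 x) \<longrightarrow> t > 0 \<longrightarrow> finite \<Phi> \<longrightarrow>
     \<Phi> \<subseteq> {\<omega>\<in>Omega. norm (wc f0 \<omega> / of_real (cube_vol \<omega> powr \<beta>)) > t} \<longrightarrow>
     (\<Sum>\<omega>\<in>\<Phi>. ennreal t * seq_weight \<beta> \<upsilon> \<omega>) \<le> ennreal C * (A1_const \<upsilon> * W11_norm \<upsilon> f)"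
proof -
  define \<tau> where "\<tau> = (2::real) powr (- (real CARD('n) * \<beta>))"
  have \<tau>0: "\<tau> > 0" unfolding \<tau>_def by simp
  obtain C0 where C0: "C0 > 0" "core_bound TYPE('n) \<tau> C0" using core_bound_exists[OF \<beta> \<tau>_def] by blast
  let ?det = "\<lambda>e C. \<forall>\<upsilon> (u::real^'n \<Rightarrow> real) F w t \<Phi>. A1_weight \<upsilon> \<longrightarrow> upper_gradient u F \<longrightarrow>
     finite_on_compacts u \<longrightarrow>
     w \<in> borel_measurable borel \<longrightarrow> (AE x in lborel. ennreal (\<upsilon> x) = w x) \<longrightarrow> t > 0 \<longrightarrow> finite \<Phi> \<longrightarrow>
     \<Phi> \<subseteq> {\<omega>\<in>Omega. fst \<omega> = e} \<longrightarrow>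
     (\<forall>\<omega>\<in>\<Phi>. t * \<tau> ^ lev \<omega> \<le> \<bar>LINT x|lborel. u x * (2 ^ lev \<omega> * atom \<omega> x)\<bar>) \<longrightarrow>
     (\<Sum>\<omega>\<in>\<Phi>. ennreal t * seq_weight \<beta> \<upsilon> \<omega>) \<le> ennreal C * (A1_const \<upsilon> * (\<integral>\<^sup>+x. F x * w x \<partial>lborel))"
  have "\<forall>e. \<exists>C>0. e \<noteq> zero_type \<longrightarrow> ?det e C"
  proof
    fix e :: "bool^'n"
    show "\<exists>C>0. e \<noteq> zero_type \<longrightarrow> ?det e C"
    proof (cases "e = zero_type")
      case True thus ?thesis by (intro exI[of _ 1]) simp
    next
      case False
      from detail_bound[OF False C0(2,1) \<tau>_def] show ?thesis by (elim exE conjE) (intro exI conjI impI, assumption+)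
    qed
  qed
  then obtain Cd where Cd: "\<forall>e. Cd e > 0 \<and> (e \<noteq> zero_type \<longrightarrow> ?det e (Cd e))"
    by (elim choice[THEN exE]) (rule that)
  have Cd0: "Cd e > 0" for e using Cd[rule_format, of e] by (rule conjunct1)
  obtain Cs where Cs: "Cs > 0" and sc: "\<forall>\<upsilon> f0 t \<Phi>. A1_weight \<upsilon> \<longrightarrow> f0 \<in> borel_measurable borel \<longrightarrow>
     finite_on_compacts f0 \<longrightarrow> t > 0 \<longrightarrow> finite \<Phi> \<longrightarrow>
     \<Phi> \<subseteq> {\<omega>\<in>Omega. fst \<omega> = zero_type} \<longrightarrow> (\<forall>\<omega>\<in>\<Phi>. t \<le> norm (coef f0 \<omega>)) \<longrightarrow>
     (\<Sum>\<omega>\<in>\<Phi>. ennreal t * seq_weight \<beta> \<upsilon> \<omega>) \<le> ennreal Cs * (A1_const \<upsilon> * (\<integral>\<^sup>+x. ennreal (norm (f0 x) * \<upsilon> x) \<partial>lebesgue))"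
    using scaling_bound[where \<beta>=\<beta>] by (elim exE conjE) (rule that)
  \<comment> \<open>The 4 combines the halved threshold with the two parts, real and
    imaginary.\<close>
  define C where "C = Cs + (\<Sum>e\<in>UNIV. 4 * Cd e)"
  have C: "C > 0" unfolding C_def using Cs Cd0 by (intro add_pos_nonneg sum_nonneg) (auto intro: less_imp_le)
  show ?thesis
  proof (intro exI[of _ C] conjI allI impI C)
    fix \<upsilon> :: "real^'n \<Rightarrow> real" and f f0 :: "real^'n \<Rightarrow> complex" and t :: real and \<Phi> :: "'n windex set"
    assume A1: "A1_weight \<upsilon>" and f: "f \<in> W11_space \<upsilon>" and f0: "f0 \<in> borel_measurable borel"
      and AE: "AE x in lebesgue. f x = f0 x" and t: "t > 0" and fin: "finite \<Phi>"
      and \<Phi>: "\<Phi> \<subseteq> {\<omega>\<in>Omega. norm (wc f0 \<omega> / of_real (cube_vol \<omega> powr \<beta>)) > t}"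
    have v: "\<upsilon> x \<ge> 0" for x using A1 unfolding A1_weight_def by blast
    define G where "G = weak_gradient f"
    note wg = weak_gradient_properties[OF f, folded G_def]
    obtain F0 where F0: "F0 \<in> borel_measurable borel" and GF: "AE x in lebesgue. norm (G x) = F0 x"
      and ug: "upper_gradient f0 (\<lambda>x. ennreal (F0 x))"
      using weak_gradient_upper_gradient[OF wg(1,4,5) f0 AE] by blast
    have lf: "(\<integral>\<^sup>+x. indicator K x * ennreal (norm (f0 x)) \<partial>lborel) < \<infinity>" if "compact K" for K
      by (rule locally_integrable_nn_integral_finite[OF _ f0 AE that]) (use wg(1) in \<open>simp add: has_weak_gradient_def\<close>)
    obtain w0 where w0: "w0 \<in> borel_measurable lborel" "AE x in lborel. \<upsilon> x = w0 x"
      using completion_ex_borel_measurable_real[OF A1_weight_measurable[OF A1]] by blast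
    define w where "w x = ennreal (w0 x)" for x
    have wm: "w \<in> borel_measurable borel" unfolding w_def using w0(1) by simp
    have wAE: "AE x in lborel. ennreal (\<upsilon> x) = w x" using w0(2) unfolding w_def by eventually_elim simp
    have Fw: "(\<integral>\<^sup>+x. ennreal (F0 x) * w x \<partial>lborel) = L1_norm \<upsilon> G"
    proof -
      have "(\<integral>\<^sup>+x. ennreal (F0 x) * w x \<partial>lborel) = (\<integral>\<^sup>+x. ennreal (F0 x) * w x \<partial>lebesgue)"
        by (rule nn_integral_completion[symmetric])
      also have "\<dots> = L1_norm \<upsilon> G" unfolding L1_norm_def
      proof (rule nn_integral_cong_AE, use GF AE_completion[OF wAE] in eventually_elim)
        case (elim x)
        show ?case unfolding elim[symmetric] by (simp add: ennreal_mult v)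
      qed
      finally show ?thesis .
    qed
    have fL: "(\<integral>\<^sup>+x. ennreal (norm (f0 x) * \<upsilon> x) \<partial>lebesgue) = L1_norm \<upsilon> f" unfolding L1_norm_def
      by (rule nn_integral_cong_AE, use AE in eventually_elim) simp
    have large: "t * \<tau> ^ lev \<omega> < norm (wc f0 \<omega>)" if "\<omega> \<in> \<Phi>" for \<omega>
    proof -
      have o: "\<omega> \<in> Omega" and n: "norm (wc f0 \<omega> / of_real (cube_vol \<omega> powr \<beta>)) > t" using that \<Phi> by auto
      have "t < norm (wc f0 \<omega>) / \<tau> ^ lev \<omega>"
        using n unfolding cube_vol_powr(1)[OF o] \<tau>_def[symmetric] using \<tau>0 by (simp add: norm_divide norm_power)
      thus ?thesis using \<tau>0 by (simp add: pos_less_divide_eq)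
    qed
    define h where "h \<omega> = ennreal t * seq_weight \<beta> \<upsilon> \<omega>" for \<omega>
    define \<Phi>0 where "\<Phi>0 = {\<omega>\<in>\<Phi>. fst \<omega> = zero_type}"
    define \<Phi>1 where "\<Phi>1 e = {\<omega>\<in>\<Phi>. fst \<omega> = e \<and> t / 2 * \<tau> ^ lev \<omega> \<le> \<bar>Re (wc f0 \<omega>)\<bar>}" for e
    define \<Phi>2 where "\<Phi>2 e = {\<omega>\<in>\<Phi>. fst \<omega> = e \<and> t / 2 * \<tau> ^ lev \<omega> \<le> \<bar>Im (wc f0 \<omega>)\<bar>}" for e
    define Z where "Z = (UNIV :: (bool^'n) set) - {zero_type}"
    have finN: "finite \<Phi>0" "finite (\<Phi>1 e)" "finite (\<Phi>2 e)" for e unfolding \<Phi>0_def \<Phi>1_def \<Phi>2_def using fin by auto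
    have cover: "\<Phi> \<subseteq> \<Phi>0 \<union> (\<Union>e\<in>Z. \<Phi>1 e \<union> \<Phi>2 e)"
    proof
      fix \<omega> assume o: "\<omega> \<in> \<Phi>"
      show "\<omega> \<in> \<Phi>0 \<union> (\<Union>e\<in>Z. \<Phi>1 e \<union> \<Phi>2 e)"
      proof (cases "fst \<omega> = zero_type")
        case False
        have "t * \<tau> ^ lev \<omega> < \<bar>Re (wc f0 \<omega>)\<bar> + \<bar>Im (wc f0 \<omega>)\<bar>"
          using large[OF o] cmod_le[of "wc f0 \<omega>"] by linarith
        hence "t / 2 * \<tau> ^ lev \<omega> \<le> \<bar>Re (wc f0 \<omega>)\<bar> \<or> t / 2 * \<tau> ^ lev \<omega> \<le> \<bar>Im (wc f0 \<omega>)\<bar>" by linarith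
        hence "\<omega> \<in> \<Phi>1 (fst \<omega>) \<union> \<Phi>2 (fst \<omega>)" unfolding \<Phi>1_def \<Phi>2_def using o by blast
        thus ?thesis unfolding Z_def using False by blast
      qed (use o in \<open>simp add: \<Phi>0_def\<close>)
    qed
    have "(\<Sum>\<omega>\<in>\<Phi>. h \<omega>) \<le> (\<Sum>\<omega>\<in>\<Phi>0 \<union> (\<Union>e\<in>Z. \<Phi>1 e \<union> \<Phi>2 e). h \<omega>)"
      by (rule sum_mono2) (use cover finN in \<open>auto simp: Z_def\<close>)
    also have "\<dots> \<le> (\<Sum>\<omega>\<in>\<Phi>0. h \<omega>) + (\<Sum>\<omega>\<in>(\<Union>e\<in>Z. \<Phi>1 e \<union> \<Phi>2 e). h \<omega>)"
      by (rule sum_Un_le_ennreal) (use finN in \<open>auto simp: Z_def\<close>)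
    also have "(\<Sum>\<omega>\<in>(\<Union>e\<in>Z. \<Phi>1 e \<union> \<Phi>2 e). h \<omega>) = (\<Sum>e\<in>Z. \<Sum>\<omega>\<in>\<Phi>1 e \<union> \<Phi>2 e. h \<omega>)"
      by (rule sum.UNION_disjoint) (use finN in \<open>auto simp: Z_def \<Phi>1_def \<Phi>2_def\<close>)
    also have "\<dots> \<le> (\<Sum>e\<in>Z. (\<Sum>\<omega>\<in>\<Phi>1 e. h \<omega>) + (\<Sum>\<omega>\<in>\<Phi>2 e. h \<omega>))"
      by (intro sum_mono sum_Un_le_ennreal finN)
    finally have split: "(\<Sum>\<omega>\<in>\<Phi>. h \<omega>) \<le> (\<Sum>\<omega>\<in>\<Phi>0. h \<omega>) + (\<Sum>e\<in>Z. (\<Sum>\<omega>\<in>\<Phi>1 e. h \<omega>) + (\<Sum>\<omega>\<in>\<Phi>2 e. h \<omega>))"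
      by (simp add: add_left_mono)
    define X where "X = A1_const \<upsilon> * W11_norm \<upsilon> f"
    have zero: "(\<Sum>\<omega>\<in>\<Phi>0. h \<omega>) \<le> ennreal Cs * X"
    proof -
      have "(\<Sum>\<omega>\<in>\<Phi>0. h \<omega>) \<le> ennreal Cs * (A1_const \<upsilon> * L1_norm \<upsilon> f)"
        unfolding h_def fL[symmetric]
      proof (rule sc[rule_format, OF A1 f0 _ t finN(1)])
        show "\<Phi>0 \<subseteq> {\<omega>\<in>Omega. fst \<omega> = zero_type}" unfolding \<Phi>0_def using \<Phi> by blast
        show "t \<le> norm (coef f0 \<omega>)" if "\<omega> \<in> \<Phi>0" for \<omega>
        proof -
          have "\<omega> \<in> \<Phi>" "\<omega> \<in> Omega" "fst \<omega> = zero_type" using that \<Phi> unfolding \<Phi>0_def by auto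
          hence "fst (snd \<omega>) = 0" unfolding Omega_def dyadic_zero_def by auto
          thus ?thesis using large[OF \<open>\<omega> \<in> \<Phi>\<close>] unfolding wc_def by simp
        qed
      qed (rule lf)
      also have "\<dots> \<le> ennreal Cs * X" unfolding X_def W11_norm_def by (intro mult_left_mono) auto
      finally show ?thesis .
    qed
    have uc: "integrable lborel (\<lambda>x. f0 x * complex_of_real (atom \<omega> x))" for \<omega>
      by (rule integrable_atom_mult[OF f0 lf])
    have reim: "(LINT x|lborel. Re (f0 x) * (2 ^ lev \<omega> * atom \<omega> x)) = Re (wc f0 \<omega>)"
       "(LINT x|lborel. Im (f0 x) * (2 ^ lev \<omega> * atom \<omega> x)) = Im (wc f0 \<omega>)" for \<omega>
    proof -
      have i: "integrable lborel (\<lambda>x. complex_of_real (2 ^ lev \<omega>) * (f0 x * complex_of_real (atom \<omega> x)))"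
        by (rule integrable_mult_right[OF uc])
      have wc: "wc f0 \<omega> = (LINT x|lborel. complex_of_real (2 ^ lev \<omega>) * (f0 x * complex_of_real (atom \<omega> x)))"
        unfolding wc_def coef_def by (rule integral_mult_right_zero[symmetric])
      show "(LINT x|lborel. Re (f0 x) * (2 ^ lev \<omega> * atom \<omega> x)) = Re (wc f0 \<omega>)"
        unfolding wc integral_Re[OF i, symmetric] by (intro Bochner_Integration.integral_cong) (simp_all add: mult_ac)
      show "(LINT x|lborel. Im (f0 x) * (2 ^ lev \<omega> * atom \<omega> x)) = Im (wc f0 \<omega>)"
        unfolding wc integral_Im[OF i, symmetric] by (intro Bochner_Integration.integral_cong) (simp_all add: mult_ac)
    qed
    have lfp: "(\<integral>\<^sup>+x. indicator K x * ennreal (norm (p (f0 x) :: real)) \<partial>lborel) < \<infinity>"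
      if "compact K" "\<And>z. norm (p z) \<le> norm z" for K p
    proof -
      have "(\<integral>\<^sup>+x. indicator K x * ennreal (norm (p (f0 x) :: real)) \<partial>lborel) \<le> (\<integral>\<^sup>+x. indicator K x * ennreal (norm (f0 x)) \<partial>lborel)"
        by (intro nn_integral_mono mult_left_mono ennreal_leI that(2)) simp
      thus ?thesis using lf[OF that(1)] by (rule le_less_trans)
    qed
    have half: "(\<Sum>\<omega>\<in>S. h \<omega>) \<le> ennreal (2 * Cd e) * X"
      if le: "(\<Sum>\<omega>\<in>S. ennreal (t / 2) * seq_weight \<beta> \<upsilon> \<omega>) \<le> ennreal (Cd e) * (A1_const \<upsilon> * (\<integral>\<^sup>+x. ennreal (F0 x) * w x \<partial>lborel))" for S e
    proof -
      have "ennreal t = ennreal 2 * ennreal (t / 2)" using t by (subst ennreal_mult[symmetric]) auto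
      hence "(\<Sum>\<omega>\<in>S. h \<omega>) = ennreal 2 * (\<Sum>\<omega>\<in>S. ennreal (t / 2) * seq_weight \<beta> \<upsilon> \<omega>)"
        unfolding h_def sum_distrib_left by (simp only: mult.assoc)
      also have "\<dots> \<le> ennreal 2 * (ennreal (Cd e) * X)"
        unfolding X_def W11_norm_def G_def[symmetric]
        using le unfolding Fw by (intro mult_left_mono order_trans[OF le[unfolded Fw]]) auto
      also have "\<dots> = ennreal (2 * Cd e) * X"
        using Cd0[of e] by (simp only: mult.assoc[symmetric], subst ennreal_mult) (auto intro: less_imp_le)
      finally show ?thesis .
    qed
    have one: "(\<Sum>\<omega>\<in>\<Phi>1 e. h \<omega>) \<le> ennreal (2 * Cd e) * X" if "e \<in> Z" for e
    proof (rule half, rule Cd[rule_format, THEN conjunct2, rule_format, OF _ A1 upper_gradient_Re_Im(1)[OF ug] _ wm wAE _ finN(2)])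
      show "e \<noteq> zero_type" using that unfolding Z_def by blast
      show "\<Phi>1 e \<subseteq> {\<omega>\<in>Omega. fst \<omega> = e}" unfolding \<Phi>1_def using \<Phi> by blast
      show "t / 2 * \<tau> ^ lev \<omega> \<le> \<bar>LINT x|lborel. Re (f0 x) * (2 ^ lev \<omega> * atom \<omega> x)\<bar>" if "\<omega> \<in> \<Phi>1 e" for \<omega>
        unfolding reim using that unfolding \<Phi>1_def by blast
      show "(\<integral>\<^sup>+x. indicator K x * ennreal (norm (Re (f0 x))) \<partial>lborel) < \<infinity>" if "compact K" for K
        by (rule lfp[OF that]) (simp add: abs_Re_le_cmod)
    qed (use t in simp)
    have two: "(\<Sum>\<omega>\<in>\<Phi>2 e. h \<omega>) \<le> ennreal (2 * Cd e) * X" if "e \<in> Z" for e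
    proof (rule half, rule Cd[rule_format, THEN conjunct2, rule_format, OF _ A1 upper_gradient_Re_Im(2)[OF ug] _ wm wAE _ finN(3)])
      show "e \<noteq> zero_type" using that unfolding Z_def by blast
      show "\<Phi>2 e \<subseteq> {\<omega>\<in>Omega. fst \<omega> = e}" unfolding \<Phi>2_def using \<Phi> by blast
      show "t / 2 * \<tau> ^ lev \<omega> \<le> \<bar>LINT x|lborel. Im (f0 x) * (2 ^ lev \<omega> * atom \<omega> x)\<bar>" if "\<omega> \<in> \<Phi>2 e" for \<omega>
        unfolding reim using that unfolding \<Phi>2_def by blast
      show "(\<integral>\<^sup>+x. indicator K x * ennreal (norm (Im (f0 x))) \<partial>lborel) < \<infinity>" if "compact K" for K
        by (rule lfp[OF that]) (simp add: abs_Im_le_cmod)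
    qed (use t in simp)
    have "(\<Sum>e\<in>Z. (\<Sum>\<omega>\<in>\<Phi>1 e. h \<omega>) + (\<Sum>\<omega>\<in>\<Phi>2 e. h \<omega>)) \<le> (\<Sum>e\<in>Z. ennreal (4 * Cd e) * X)"
    proof (rule sum_mono)
      fix e assume e: "e \<in> Z"
      have "(\<Sum>\<omega>\<in>\<Phi>1 e. h \<omega>) + (\<Sum>\<omega>\<in>\<Phi>2 e. h \<omega>) \<le> ennreal (2 * Cd e) * X + ennreal (2 * Cd e) * X"
        by (intro add_mono one two e)
      also have "\<dots> = (ennreal (2 * Cd e) + ennreal (2 * Cd e)) * X" by (simp only: distrib_right)
      also have "ennreal (2 * Cd e) + ennreal (2 * Cd e) = ennreal (4 * Cd e)"
        using Cd0[of e] by (subst ennreal_plus[symmetric]) auto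
      finally show "(\<Sum>\<omega>\<in>\<Phi>1 e. h \<omega>) + (\<Sum>\<omega>\<in>\<Phi>2 e. h \<omega>) \<le> ennreal (4 * Cd e) * X" .
    qed
    also have "\<dots> \<le> (\<Sum>e\<in>UNIV. ennreal (4 * Cd e) * X)" by (rule sum_mono2) auto
    also have "\<dots> = ennreal (\<Sum>e\<in>UNIV. 4 * Cd e) * X"
      unfolding sum_distrib_right[symmetric] using Cd0 by (subst sum_ennreal) (auto intro: less_imp_le)
    finally have "(\<Sum>\<omega>\<in>\<Phi>. h \<omega>) \<le> ennreal Cs * X + ennreal (\<Sum>e\<in>UNIV. 4 * Cd e) * X"
      using split zero by (meson add_mono order_trans)
    also have "\<dots> = (ennreal Cs + ennreal (\<Sum>e\<in>UNIV. 4 * Cd e)) * X" by (simp only: distrib_right)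
    also have "ennreal Cs + ennreal (\<Sum>e\<in>UNIV. 4 * Cd e) = ennreal C"
      unfolding C_def using Cs Cd0 by (intro ennreal_plus[symmetric] sum_nonneg) (auto intro: less_imp_le)
    finally show "(\<Sum>\<omega>\<in>\<Phi>. ennreal t * seq_weight \<beta> \<upsilon> \<omega>) \<le> ennreal C * (A1_const \<upsilon> * W11_norm \<upsilon> f)"
      unfolding h_def X_def .
  qed
qed

end

section \<open>Tensor product wavelets\<close>

lemma CcN_bounds:
  assumes g: "g \<in> CcN N" and N: "N \<ge> 2"
  shows "\<exists>(R::nat) B. 0 \<le> B \<and> (\<forall>x. (g has_real_derivative deriv g x) (at x)) \<and> continuous_on UNIV g \<and> continuous_on UNIV (deriv g) \<and>
     (\<forall>x. \<bar>g x\<bar> \<le> B \<and> \<bar>deriv g x\<bar> \<le> B \<and> (g x \<noteq> 0 \<or> deriv g x \<noteq> 0 \<longrightarrow> - real R \<le> x \<and> x < real R))"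
proof -
  have fd: "(deriv ^^ k) g field_differentiable (at x)" if "k < N" for k x using g that unfolding CcN_def by blast
  have d0: "(g has_real_derivative deriv g x) (at x)" for x
    using fd[of 0 x] N by (simp add: DERIV_deriv_iff_field_differentiable)
  have d1: "deriv g field_differentiable (at x)" for x using fd[of 1 x] N by simp
  have c0: "continuous_on UNIV g" using d0 DERIV_isCont continuous_at_imp_continuous_on by blast
  have c1: "continuous_on UNIV (deriv g)"
    by (intro continuous_at_imp_continuous_on ballI field_differentiable_imp_continuous_at d1)
  define S where "S = closure {x. g x \<noteq> 0}"
  have S: "compact S" using g unfolding CcN_def S_def by blast
  have g0: "g x = 0" if "x \<notin> S" for x
  proof (rule ccontr)
    assume "g x \<noteq> 0"
    hence "x \<in> {x. g x \<noteq> 0}" by simp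
    hence "x \<in> S" unfolding S_def by (rule subsetD[OF closure_subset])
    thus False using that by blast
  qed
  have dg0: "deriv g x = 0" if "x \<notin> S" for x
  proof -
    have "open (- S)" unfolding S_def by (rule open_Compl[OF closed_closure])
    have "((\<lambda>_. 0::real) has_field_derivative 0) (at x)" by simp
    hence "(g has_field_derivative 0) (at x)"
      by (rule has_field_derivative_transform_within_open[OF _ \<open>open (- S)\<close>]) (use that g0 in auto)
    thus ?thesis by (rule DERIV_imp_deriv)
  qed
  obtain r where r: "r > 0" "\<And>x. x \<in> S \<Longrightarrow> \<bar>x\<bar> \<le> r"
    using compact_imp_bounded[OF S] unfolding bounded_pos by auto
  \<comment> \<open>Strictly larger than the radius, because the support condition excludes the
    right endpoint.\<close>
  obtain R :: nat where R: "r < real R" using reals_Archimedean2 by blast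
  have "bounded (g ` S)" "bounded (deriv g ` S)"
    by (intro compact_imp_bounded compact_continuous_image S continuous_on_subset[OF c0] continuous_on_subset[OF c1] subset_UNIV)+
  then obtain b1 b2 where b: "b1 > 0" "\<And>x. x \<in> S \<Longrightarrow> \<bar>g x\<bar> \<le> b1" "\<And>x. x \<in> S \<Longrightarrow> \<bar>deriv g x\<bar> \<le> b2"
    unfolding bounded_pos by (metis imageI real_norm_def)
  show ?thesis
  proof (intro exI[of _ R] exI[of _ "max b1 b2"] conjI allI d0 c0 c1 impI)
    show "0 \<le> max b1 b2" using b(1) by simp
    fix x
    show "\<bar>g x\<bar> \<le> max b1 b2" "\<bar>deriv g x\<bar> \<le> max b1 b2"
      using b g0[of x] dg0[of x] by (cases "x \<in> S"; force simp: le_max_iff_disj)+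
    assume "g x \<noteq> 0 \<or> deriv g x \<noteq> 0"
    hence "x \<in> S" using g0 dg0 by blast
    from r(2)[OF this] R show "- real R \<le> x" "x < real R" by linarith+
  qed
qed

lemma tensor_properties:
  fixes p :: "'n::finite \<Rightarrow> real \<Rightarrow> real"
  assumes c: "\<And>i. continuous_on UNIV (p i)" and b: "\<And>i x. \<bar>p i x\<bar> \<le> b"
    and s: "\<And>i x. p i x \<noteq> 0 \<Longrightarrow> - real R \<le> x \<and> x < real R"
  shows "continuous_on UNIV (\<lambda>x::real^'n. \<Prod>i\<in>UNIV. p i (x $ i))"
    "\<bar>\<Prod>i\<in>UNIV. p i (x $ i)\<bar> \<le> b ^ CARD('n)"
    "(\<Prod>i\<in>UNIV. p i (x $ i)) \<noteq> 0 \<Longrightarrow> - real R \<le> x $ l \<and> x $ l < real R"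
proof -
  show "continuous_on UNIV (\<lambda>x::real^'n. \<Prod>i\<in>UNIV. p i (x $ i))"
    by (intro continuous_on_prod continuous_on_compose2[OF c] continuous_intros) auto
  have "\<bar>\<Prod>i\<in>UNIV. p i (x $ i)\<bar> \<le> (\<Prod>i\<in>(UNIV::'n set). b)"
    unfolding abs_prod by (rule prod_mono) (use b in auto)
  thus "\<bar>\<Prod>i\<in>UNIV. p i (x $ i)\<bar> \<le> b ^ CARD('n)" by simp
  assume "(\<Prod>i\<in>UNIV. p i (x $ i)) \<noteq> 0"
  hence "p l (x $ l) \<noteq> 0" by auto
  thus "- real R \<le> x $ l \<and> x $ l < real R" by (rule s)
qed

lemma tensor_line:
  fixes p q :: "'n::finite \<Rightarrow> real \<Rightarrow> real"
  assumes d: "\<And>i x. (p i has_real_derivative q i x) (at x)"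
  shows "((\<lambda>s. \<Prod>j\<in>UNIV. p j ((x + s *\<^sub>R axis i 1) $ j)) has_real_derivative
     (\<Prod>j\<in>UNIV. (if j = i then q j else p j) ((x + s *\<^sub>R axis i 1) $ j))) (at s)"
proof -
  let ?P = "\<Prod>j\<in>UNIV - {i}. p j (x $ j)"
  have e: "(\<Prod>j\<in>UNIV. p j ((x + s *\<^sub>R axis i 1) $ j)) = p i (x $ i + s) * ?P" for s
    by (subst prod.remove[of UNIV i]) (auto simp: axis_def intro!: prod.cong)
  have e': "(\<Prod>j\<in>UNIV. (if j = i then q j else p j) ((x + s *\<^sub>R axis i 1) $ j)) = q i (x $ i + s) * ?P"
    by (subst prod.remove[of UNIV i]) (auto simp: axis_def intro!: prod.cong)
  have "((\<lambda>s. p i (x $ i + s) * ?P) has_real_derivative q i (x $ i + s) * ?P) (at s)"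
  proof (rule DERIV_cmult_right)
    have "((\<lambda>s. p i (x $ i + s)) has_real_derivative q i (x $ i + s) * 1) (at s)"
      by (rule DERIV_chain2[OF d]) (auto intro!: derivative_eq_intros)
    thus "((\<lambda>s. p i (x $ i + s)) has_real_derivative q i (x $ i + s)) (at s)" by simp
  qed
  thus ?thesis unfolding e e' .
qed

lemma L2_orthonormal_basis_cong:
  assumes "L2_orthonormal_basis A g" "\<And>i. i \<in> A \<Longrightarrow> g i = h i"
  shows "L2_orthonormal_basis A h"
proof -
  have "L2_orthonormal A h" using assms unfolding L2_orthonormal_basis_def L2_orthonormal_def by simp
  moreover have eq: "(\<lambda>x. \<Sum>i\<in>F. c i * complex_of_real (g i x)) = (\<lambda>x. \<Sum>i\<in>F. c i * complex_of_real (h i x))" if "F \<subseteq> A" for F c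
    using assms(2) that by (intro ext sum.cong) auto
  have "(\<exists>F c. finite F \<and> F \<subseteq> A \<and> L2_approx f \<epsilon> (\<lambda>x. \<Sum>i\<in>F. c i * complex_of_real (g i x))) =
    (\<exists>F c. finite F \<and> F \<subseteq> A \<and> L2_approx f \<epsilon> (\<lambda>x. \<Sum>i\<in>F. c i * complex_of_real (h i x)))" for f \<epsilon>
    by (intro ex_cong1 conj_cong refl) (simp only: eq)
  hence "L2_closed_span A g = L2_closed_span A h"
    unfolding L2_closed_span_def by (simp only:)
  ultimately show ?thesis using assms(1) unfolding L2_orthonormal_basis_def by simp
qed

lemma wavelet_eq:
  fixes \<omega> :: "'n::finite windex"
  assumes "\<omega> \<in> Omega"
  shows "wavelet \<phi> \<psi> p \<omega> x = 2 powr (real (lev \<omega>) * real CARD('n) * real_of_ereal (inverse p)) * tensor_wavelet \<phi> \<psi> (fst \<omega>) (pos \<omega> x)"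
proof -
  have "0 \<le> fst (snd \<omega>)" using assms unfolding Omega_def dyadic_zero_def dyadic_plus_def by auto
  then obtain j :: nat where j: "fst (snd \<omega>) = int j" using nonneg_int_cases by blast
  thus ?thesis unfolding wavelet_def rescale_def case_prod_beta by simp
qed

text \<open>Powers of one common bound for the factors and their first derivatives bound the tensor
  products, and a derivative in direction i changes only the i-th factor.\<close>

lemma wavelet_locale:
  assumes sys: "wavelet_system TYPE('n::finite) N \<phi> \<psi>" and N: "N \<ge> 2"
  shows "\<exists>R B DT. wavelet_c1 (tensor_wavelet \<phi> \<psi> :: bool^'n \<Rightarrow> real^'n \<Rightarrow> real) R B DT"
proof -
  have c: "\<phi> \<in> CcN N" "\<psi> \<in> CcN N" using sys unfolding wavelet_system_def by auto
  from CcN_bounds[OF c(1) N] obtain R1 :: nat and B1 where 1: "0 \<le> B1" "\<And>x. (\<phi> has_real_derivative deriv \<phi> x) (at x)" "continuous_on UNIV \<phi>" "continuous_on UNIV (deriv \<phi>)"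
     "\<And>x. \<bar>\<phi> x\<bar> \<le> B1" "\<And>x. \<bar>deriv \<phi> x\<bar> \<le> B1" "\<And>x. \<phi> x \<noteq> 0 \<or> deriv \<phi> x \<noteq> 0 \<Longrightarrow> - real R1 \<le> x \<and> x < real R1" by blast
  from CcN_bounds[OF c(2) N] obtain R2 :: nat and B2 where 2: "0 \<le> B2" "\<And>x. (\<psi> has_real_derivative deriv \<psi> x) (at x)" "continuous_on UNIV \<psi>" "continuous_on UNIV (deriv \<psi>)"
     "\<And>x. \<bar>\<psi> x\<bar> \<le> B2" "\<And>x. \<bar>deriv \<psi> x\<bar> \<le> B2" "\<And>x. \<psi> x \<noteq> 0 \<or> deriv \<psi> x \<noteq> 0 \<Longrightarrow> - real R2 \<le> x \<and> x < real R2" by blast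
  define R where "R = max R1 R2"
  define b where "b = 1 + B1 + B2"
  define p where "p e i = (if e $ i then \<psi> else \<phi>)" for e :: "bool^'n" and i
  define q where "q e i = (if e $ i then deriv \<psi> else deriv \<phi>)" for e :: "bool^'n" and i
  have T: "tensor_wavelet \<phi> \<psi> e x = (\<Prod>i\<in>UNIV. p e i (x $ i))" for e :: "bool^'n" and x :: "real^'n"
    unfolding tensor_wavelet_def p_def ..
  define DT where "DT e i x = (\<Prod>j\<in>UNIV. (if j = i then q e j else p e j) (x $ j))" for e :: "bool^'n" and i :: 'n and x :: "real^'n"
  have R12: "real R1 \<le> real R" "real R2 \<le> real R" unfolding R_def by auto
  have P: "continuous_on UNIV (p e i)" "continuous_on UNIV (q e i)" "\<bar>p e i x\<bar> \<le> b" "\<bar>q e i x\<bar> \<le> b"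
    "p e i x \<noteq> 0 \<Longrightarrow> - real R \<le> x \<and> x < real R" "q e i x \<noteq> 0 \<Longrightarrow> - real R \<le> x \<and> x < real R"
    "(p e i has_real_derivative q e i x) (at x)" for e :: "bool^'n" and i x
  proof -
    show "continuous_on UNIV (p e i)" "continuous_on UNIV (q e i)" "(p e i has_real_derivative q e i x) (at x)"
      unfolding p_def q_def using 1(2-4) 2(2-4) by auto
    show "\<bar>p e i x\<bar> \<le> b" "\<bar>q e i x\<bar> \<le> b"
      unfolding p_def q_def b_def using 1(1) 2(1) 1(5,6)[of x] 2(5,6)[of x] by auto
    show "p e i x \<noteq> 0 \<Longrightarrow> - real R \<le> x \<and> x < real R" "q e i x \<noteq> 0 \<Longrightarrow> - real R \<le> x \<and> x < real R"
      unfolding p_def q_def using 1(7)[of x] 2(7)[of x] R12 by (auto split: if_splits)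
  qed
  have b: "b > 0" unfolding b_def using 1(1) 2(1) by simp
  have D: "continuous_on UNIV ((if j = i then q e j else p e j))" "\<bar>(if j = i then q e j else p e j) x\<bar> \<le> b"
    "(if j = i then q e j else p e j) x \<noteq> 0 \<Longrightarrow> - real R \<le> x \<and> x < real R" for e :: "bool^'n" and i j x
    using P(3-6)[of e j x] P(1,2)[of e j] by (auto split: if_splits)
  have Tc: "continuous_on UNIV (tensor_wavelet \<phi> \<psi> e)" for e :: "bool^'n"
    unfolding T by (rule tensor_properties(1)[of "p e" b R, OF P(1,3,5)])
  let ?T = "tensor_wavelet \<phi> \<psi> :: bool^'n \<Rightarrow> real^'n \<Rightarrow> real"
  have Tm: "?T e \<in> borel_measurable borel" for e by (rule borel_measurable_continuous_onI[OF Tc])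
  have mom: "\<forall>(e :: bool^'n) (\<alpha> :: nat^'n). e \<noteq> zero_type \<longrightarrow> (\<Sum>i\<in>UNIV. \<alpha> $ i) \<le> N \<longrightarrow>
      (LINT x|lebesgue. (\<Prod>i\<in>UNIV. (x $ i) ^ (\<alpha> $ i)) * ?T e x) = 0"
    using sys unfolding wavelet_system_def by (elim conjE)
  have fam: "wavelet_family ?T R (b ^ CARD('n))"
  proof
    show "0 < b ^ CARD('n)" using b by simp
    show "?T e \<in> borel_measurable borel" for e by (rule Tm)
    show "\<bar>?T e x\<bar> \<le> b ^ CARD('n)" for e x unfolding T by (rule tensor_properties(2)[of "p e" b R, OF P(1,3,5)])
    show "?T e x \<noteq> 0 \<Longrightarrow> - real R \<le> x $ i \<and> x $ i < real R" for e x i unfolding T by (rule tensor_properties(3)[of "p e" b R, OF P(1,3,5)])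
    show "(LINT x|lborel. ?T e x) = 0" if e: "e \<noteq> zero_type" for e
    proof -
      \<comment> \<open>The moment of order zero is the mean.\<close>
      have "(LINT x|lebesgue. (\<Prod>i\<in>UNIV. (x $ i) ^ ((\<chi> i. (0::nat)) $ i)) * ?T e x) = 0"
        by (rule mom[rule_format, OF e]) simp
      hence "(LINT x|lebesgue. ?T e x) = 0" by simp
      thus ?thesis using Tm by (simp add: integral_completion)
    qed
  qed
  have bas: "wavelet_basis ?T R (b ^ CARD('n))"
  proof (intro wavelet_basis.intro fam wavelet_basis_axioms.intro)
    show "L2_orthonormal_basis (Omega :: 'n windex set) (\<lambda>\<omega> x. 2 powr (real (lev \<omega>) * real CARD('n) / 2) * wavelet_family.atom ?T \<omega> x)"
    proof (rule L2_orthonormal_basis_cong)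
      show "L2_orthonormal_basis (Omega :: 'n windex set) (wavelet \<phi> \<psi> 2)" using sys unfolding wavelet_system_def by blast
      fix \<omega> :: "'n windex" assume o: "\<omega> \<in> Omega"
      have "(2::ereal) = ereal 2" by simp
      hence i2: "real_of_ereal (inverse 2) = 1 / 2" by (simp only: inverse_ereal.simps) simp
      show "wavelet \<phi> \<psi> 2 \<omega> = (\<lambda>x. 2 powr (real (lev \<omega>) * real CARD('n) / 2) * wavelet_family.atom ?T \<omega> x)"
        unfolding wavelet_family.atom_def[OF fam] by (intro ext) (simp add: wavelet_eq[OF o] i2)
    qed
  qed
  have "wavelet_c1 ?T R (b ^ CARD('n)) DT"
  proof (intro wavelet_c1.intro bas wavelet_c1_axioms.intro)
    show "continuous_on UNIV (?T e)" for e by (rule Tc)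
    show "continuous_on UNIV (DT e i)" for e i unfolding DT_def by (rule tensor_properties(1)[of "\<lambda>j. if j = i then q e j else p e j" b R, OF D])
    show "\<bar>DT e i x\<bar> \<le> b ^ CARD('n)" for e i x unfolding DT_def by (rule tensor_properties(2)[of "\<lambda>j. if j = i then q e j else p e j" b R, OF D])
    show "DT e i x \<noteq> 0 \<Longrightarrow> - real R \<le> x $ l \<and> x $ l < real R" for e i x l unfolding DT_def by (rule tensor_properties(3)[of "\<lambda>j. if j = i then q e j else p e j" b R, OF D])
    show "((\<lambda>s. ?T e (x + s *\<^sub>R axis i 1)) has_real_derivative DT e i (x + s *\<^sub>R axis i 1)) (at s)" for e i x s
      unfolding T DT_def by (rule tensor_line[OF P(7)])
  qed
  thus ?thesis by blast
qed

theorem theorem3p1: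
  fixes \<phi> \<psi> :: "real \<Rightarrow> real" and N :: nat and \<beta> :: real
  assumes "wavelet_system TYPE('n::finite) N \<phi> \<psi>"
    and "N > CARD('n) + 1"
    and "\<beta> < 1 - 1 / real CARD('n) \<or> \<beta> > 1"
  shows "\<exists>C1>0. \<exists>C2>0. \<forall>(\<upsilon> :: real ^ 'n \<Rightarrow> real) (f :: real ^ 'n \<Rightarrow> complex).
    A1_weight \<upsilon> \<longrightarrow> f \<in> W11_space \<upsilon> \<longrightarrow>
      sums_in_tempered Omega
        (\<lambda>\<omega> x. wcoeff \<phi> \<psi> f \<omega> * of_real (wavelet \<phi> \<psi> (sobolev_exp TYPE('n)) \<omega> x)) f \<and>
      wl1_norm \<beta> \<upsilon> (\<lambda>\<omega>. wcoeff \<phi> \<psi> f \<omega> / of_real (cube_vol \<omega> powr \<beta>))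
        \<le> ennreal C1 * (A1_const \<upsilon> * W11_norm \<upsilon> f) \<and>
      A1_const \<upsilon> * W11_norm \<upsilon> f
        \<le> ennreal C2 * ((A1_const \<upsilon>)\<^sup>2 *
             l1_norm \<beta> \<upsilon> (\<lambda>\<omega>. wcoeff \<phi> \<psi> f \<omega> / of_real (cube_vol \<omega> powr \<beta>)))"
proof -
  have "N \<ge> 2" using assms(2) by simp
  from wavelet_locale[OF assms(1) this] obtain R B DT where
    "wavelet_c1 (tensor_wavelet \<phi> \<psi> :: bool^'n \<Rightarrow> real^'n \<Rightarrow> real) R B DT" by (elim exE) (rule that)
  then interpret wavelet_c1 "tensor_wavelet \<phi> \<psi> :: bool^'n \<Rightarrow> real^'n \<Rightarrow> real" R B DT .
  obtain C1 where C1: "C1 > 0" and weak: "\<forall>\<upsilon> f f0 t \<Phi>. A1_weight \<upsilon> \<longrightarrow> f \<in> W11_space \<upsilon> \<longrightarrow> f0 \<in> borel_measurable borel \<longrightarrow>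
     (AE x in lebesgue. f x = f0 x) \<longrightarrow> t > 0 \<longrightarrow> finite \<Phi> \<longrightarrow>
     \<Phi> \<subseteq> {\<omega>\<in>Omega. norm (wc f0 \<omega> / of_real (cube_vol \<omega> powr \<beta>)) > t} \<longrightarrow>
     (\<Sum>\<omega>\<in>\<Phi>. ennreal t * seq_weight \<beta> \<upsilon> \<omega>) \<le> ennreal C1 * (A1_const \<upsilon> * W11_norm \<upsilon> f)"
    using weak_sum_bound[OF assms(3)] by (elim exE conjE) (rule that)
  define C2 where "C2 = (1 + real CARD('n)) * (B * (2 * real R + 1) ^ CARD('n))"
  have C2: "C2 > 0" unfolding C2_def using B by (intro mult_pos_pos) auto
  define \<tau> where "\<tau> = (2::real) powr (- (real CARD('n) * \<beta>))"
  have \<tau>0: "\<tau> > 0" unfolding \<tau>_def by simp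
  have n0: "real CARD('n) \<noteq> 0" by simp
  have W_n: "wavelet \<phi> \<psi> (ereal (real CARD('n))) \<omega> x = 2 ^ lev \<omega> * atom \<omega> x" if "\<omega> \<in> Omega" for \<omega> :: "'n windex" and x
  proof -
    have "real (lev \<omega>) * real CARD('n) * real_of_ereal (inverse (ereal (real CARD('n)))) = real (lev \<omega>)"
      using n0 by simp
    thus ?thesis unfolding wavelet_eq[OF that] atom_def by (simp only: powr_realpow zero_less_numeral)
  qed
  have W_s: "wavelet \<phi> \<psi> (sobolev_exp TYPE('n)) \<omega> x = 2 ^ (lev \<omega> * (CARD('n) - 1)) * atom \<omega> x" if "\<omega> \<in> Omega" for \<omega> :: "'n windex" and x
  proof -
    \<comment> \<open>n divided by the conjugate exponent n/(n-1) is n - 1. In dimension 1 the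
      exponent is infinite and both sides are 0.\<close>
    have "real CARD('n) * real_of_ereal (inverse (sobolev_exp TYPE('n))) = real (CARD('n) - 1)"
    proof (cases "CARD('n) = 1")
      case True thus ?thesis unfolding sobolev_exp_def by simp
    next
      case False
      have "CARD('n) > 1" using False zero_less_card_finite[where 'a='n] by linarith
      hence "real CARD('n) - 1 \<noteq> 0" by simp
      thus ?thesis unfolding sobolev_exp_def using False n0 by (simp add: of_nat_diff Suc_leI)
    qed
    hence "2 powr (real (lev \<omega>) * real CARD('n) * real_of_ereal (inverse (sobolev_exp TYPE('n)))) = (2::real) powr real (lev \<omega> * (CARD('n) - 1))"
      by (simp only: mult.assoc of_nat_mult)
    also have "\<dots> = 2 ^ (lev \<omega> * (CARD('n) - 1))" by (rule powr_realpow) simp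
    finally show ?thesis unfolding wavelet_eq[OF that] atom_def by simp
  qed
  show ?thesis
  proof (rule exI[of _ C1], rule conjI[OF C1], rule exI[of _ C2], rule conjI[OF C2], intro allI impI conjI)
    fix \<upsilon> :: "real^'n \<Rightarrow> real" and f :: "real^'n \<Rightarrow> complex"
    assume A1: "A1_weight \<upsilon>" and f: "f \<in> W11_space \<upsilon>"
    note fm = weak_gradient_properties(4)[OF f]
    obtain f0 where f0 [measurable]: "f0 \<in> borel_measurable borel" and AE: "AE x in lebesgue. f x = f0 x"
      using ex_borel_representative[OF fm] by blast
    have wce: "wcoeff \<phi> \<psi> f \<omega> = wc f0 \<omega>" if "\<omega> \<in> Omega" for \<omega> :: "'n windex"
    proof -
      have "wcoeff \<phi> \<psi> f \<omega> = (LINT x|lebesgue. f x * of_real (2 ^ lev \<omega> * atom \<omega> x))"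
        unfolding wcoeff_def W_n[OF that] ..
      also have "\<dots> = (LINT x|lborel. f0 x * of_real (2 ^ lev \<omega> * atom \<omega> x))"
        by (rule LINT_lebesgue_representative[OF fm f0 AE]) measurable
      also have "\<dots> = (LINT x|lborel. of_real (2 ^ lev \<omega>) * (f0 x * of_real (atom \<omega> x)))"
        by (intro Bochner_Integration.integral_cong) (simp_all add: mult_ac)
      also have "\<dots> = wc f0 \<omega>" unfolding wc_def coef_def by (rule integral_mult_right_zero)
      finally show ?thesis .
    qed
    show "sums_in_tempered Omega (\<lambda>\<omega> x. wcoeff \<phi> \<psi> f \<omega> * of_real (wavelet \<phi> \<psi> (sobolev_exp TYPE('n)) \<omega> x)) f"
      unfolding sums_in_tempered_def
    proof
      fix g :: "real^'n \<Rightarrow> complex" assume g: "g \<in> schwartz"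
      show "((\<lambda>\<omega>. pairing (\<lambda>x. wcoeff \<phi> \<psi> f \<omega> * of_real (wavelet \<phi> \<psi> (sobolev_exp TYPE('n)) \<omega> x)) g) has_sum pairing f g) Omega"
        by (rule has_sum_cong[THEN iffD1, OF _ synthesis[OF A1 f f0 AE g]])
           (simp only: wce W_s pairing_synthesis_term[OF g])
    qed
    show "wl1_norm \<beta> \<upsilon> (\<lambda>\<omega>. wcoeff \<phi> \<psi> f \<omega> / of_real (cube_vol \<omega> powr \<beta>)) \<le> ennreal C1 * (A1_const \<upsilon> * W11_norm \<upsilon> f)"
      unfolding wl1_norm_def
    proof (rule SUP_least)
      fix t :: real assume "t \<in> {0<..}"
      hence t: "t > 0" by simp
      have e: "{\<omega>\<in>Omega. norm (wcoeff \<phi> \<psi> f \<omega> / of_real (cube_vol \<omega> powr \<beta>)) > t} = {\<omega>\<in>Omega. norm (wc f0 \<omega> / of_real (cube_vol \<omega> powr \<beta>)) > t}"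
        using wce by auto
      show "ennreal t * (\<Sum>\<^sub>\<infinity>\<omega>\<in>{\<omega>\<in>Omega. norm (wcoeff \<phi> \<psi> f \<omega> / of_real (cube_vol \<omega> powr \<beta>)) > t}. seq_weight \<beta> \<upsilon> \<omega>) \<le> ennreal C1 * (A1_const \<upsilon> * W11_norm \<upsilon> f)"
        unfolding e by (rule infsum_ennreal_le[OF t]) (rule weak[rule_format, OF A1 f f0 AE t])
    qed
    \<comment> \<open>|I| to the power \<beta> - 1 times |I| to the power -\<beta> is
      2^(jn).\<close>
    have l1: "l1_norm \<beta> \<upsilon> (\<lambda>\<omega>. wcoeff \<phi> \<psi> f \<omega> / of_real (cube_vol \<omega> powr \<beta>)) = infsum (strong_term \<upsilon> f0) Omega"
      unfolding l1_norm_def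
    proof (rule infsum_cong)
      fix \<omega> :: "'n windex" assume o: "\<omega> \<in> Omega"
      have "ennreal (norm (wc f0 \<omega> / of_real (\<tau> ^ lev \<omega>))) * ennreal (\<tau> ^ lev \<omega> * 2 ^ (lev \<omega> * CARD('n)))
        = ennreal (norm (wc f0 \<omega> / of_real (\<tau> ^ lev \<omega>)) * (\<tau> ^ lev \<omega> * 2 ^ (lev \<omega> * CARD('n))))"
        using \<tau>0 by (intro ennreal_mult[symmetric]) auto
      also have "norm (wc f0 \<omega> / of_real (\<tau> ^ lev \<omega>)) * (\<tau> ^ lev \<omega> * 2 ^ (lev \<omega> * CARD('n))) = 2 ^ (lev \<omega> * CARD('n)) * norm (wc f0 \<omega>)"
        using \<tau>0 by (simp add: norm_divide norm_power)
      finally have X: "ennreal (2 ^ (lev \<omega> * CARD('n)) * norm (wc f0 \<omega>)) =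
        ennreal (norm (wc f0 \<omega> / of_real (\<tau> ^ lev \<omega>))) * ennreal (\<tau> ^ lev \<omega> * 2 ^ (lev \<omega> * CARD('n)))" by (rule sym)
      show "seq_weight \<beta> \<upsilon> \<omega> * ennreal (norm (wcoeff \<phi> \<psi> f \<omega> / of_real (cube_vol \<omega> powr \<beta>))) = strong_term \<upsilon> f0 \<omega>"
        unfolding seq_weight_def strong_term_def wce[OF o] cube_vol_powr(2)[OF o] cube_vol_powr(1)[OF o, of \<beta>] \<tau>_def[symmetric] X
        by (simp only: mult_ac)
    qed
    \<comment> \<open>One factor of the A1 constant comes from \<open>strong_bound\<close>, the
      second from the middle term of the chain.\<close>
    have "A1_const \<upsilon> * W11_norm \<upsilon> f \<le> A1_const \<upsilon> * (ennreal C2 * (A1_const \<upsilon> * infsum (strong_term \<upsilon> f0) Omega))"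
      unfolding C2_def by (intro mult_left_mono strong_bound[OF A1 f f0 AE]) simp
    also have "\<dots> = ennreal C2 * ((A1_const \<upsilon>)\<^sup>2 * infsum (strong_term \<upsilon> f0) Omega)"
      by (simp only: power2_eq_square mult_ac)
    finally show "A1_const \<upsilon> * W11_norm \<upsilon> f \<le> ennreal C2 * ((A1_const \<upsilon>)\<^sup>2 * l1_norm \<beta> \<upsilon> (\<lambda>\<omega>. wcoeff \<phi> \<psi> f \<omega> / of_real (cube_vol \<omega> powr \<beta>)))"
      unfolding l1 .
  qed
qed

end
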